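(* Let $P=\mathbb{N}^k\times\mathbb{Z}_2^a$ and $Q=\mathbb{N}^l\times\mathbb{Z}_2^b$. Let $\Lambda$ be a row-finite $P$-graph with no sources and $\Gamma$ a row-finite $Q$-graph with no sources. Then there is an isomorphism of graded $C^*$-algebras $$C^*(\Lambda\times\Gamma,c_{\Lambda\times\Gamma})\cong C^*(\Lambda,c_\Lambda)\widehat\otimes C^*(\Gamma,c_\Gamma)$$ with respect to the gradings $\alpha_{\delta_{\Lambda\times\Gamma}}$ and $\alpha_{\delta_\Lambda}\widehat\otimes\alpha_{\delta_\Gamma}$.
   Context: For a monoid $P$ of the form $\mathbb{N}^k\times\mathbb{Z}_2^a$ (or a product of such), a $P$-graph is a countable small category $\Lambda$ with a functor $d:\Lambda\to P$ satisfying the factorisation property: if $d(\lambda)=p+q$ then there are unique $\mu,\nu$ with $d(\mu)=p$, $d(\nu)=q$, $\lambda=\mu\nu$. $r,s$ are the codomain and domain maps, $\Lambda^p=d^{-1}(p)$, $\Lambda^0$ is identified with the objects, $v\Lambda^p=\{\lambda\in\Lambda^p:r(\lambda)=v\}$. $\Lambda$ is row-finite (has no sources) if every $v\Lambda^p$ is finite (nonempty). The product category $\Lambda\times\Gamma$ with degree map $(\lambda,\mu)\mapsto(d(\lambda),d(\mu))$ is a $(P\times Q)$-graph. A $2$-cocycle $c\in Z^2(\Lambda,\mathbb{T})$ is a function from composable pairs to $\mathbb{T}$ with $c(\lambda,\mu)c(\lambda\mu,\nu)=c(\mu,\nu)c(\lambda,\mu\nu)$ and $c(r(\lambda),\lambda)=1=c(\lambda,s(\lambda))$.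 $C^*(\Lambda,c)$ is the universal $C^*$-algebra generated by $s_\lambda$ ($\lambda\in\Lambda$) such that: $\{s_v:v\in\Lambda^0\}$ are mutually orthogonal projections; $s_\mu s_\nu=c(\mu,\nu)s_{\mu\nu}$ when $s(\mu)=r(\nu)$; $s_\lambda^*s_\lambda=s_{s(\lambda)}$; $s_v=\sum_{\lambda\in v\Lambda^p}s_\lambda s_\lambda^*$ for $v\in\Lambda^0$, $p\in P$. For a $P$-graph $\Lambda$ with $P=\mathbb{N}^k\times\mathbb{Z}_2^a$, $c_\Lambda(\lambda,\mu):=(-1)^{\kappa(\rho(d(\lambda)),\rho(d(\mu)))}$, where $\rho:P\to\mathbb{Z}_2^{k+a}$ is coordinatewise reduction mod $2$ and $\kappa(m,n)=\sum_{j<i}m_i\cdot n_j$; $\delta_\Lambda(\lambda):=\pi(d(\lambda))$ where $\pi:P\to\mathbb{Z}_2$ is the homomorphism sending each standard generator to $1$; and $\alpha_{\delta_\Lambda}$ is the grading automorphism of $C^*(\Lambda,c_\Lambda)$ with $\alpha_{\delta_\Lambda}(s_\lambda)=(-1)^{\delta_\Lambda(\lambda)}s_\lambda$. The same formulas define $c_\Gamma,\delta_\Gamma$, and $c_{\Lambda\times\Gamma},\delta_{\Lambda\times\Gamma}$, for the latter using the coordinatewise reduction map $P\times Q\to\mathbb{Z}_2^{(k+a)+(l+b)}$ (coordinates of $P$ followed by those of $Q$). A grading of a $C^*$-algebra is an automorphism $\alpha$ with $\alpha^2=1$, and $a$ has degree $\partial a=j\in\mathbb{Z}_2$ if $\alpha(a)=(-1)^ja$.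 $A\widehat\otimes B$ is the completion in the minimal norm of the algebraic tensor product with, for homogeneous elements, $(a\widehat\otimes b)(a'\widehat\otimes b')=(-1)^{\partial b\cdot\partial a'}aa'\widehat\otimes bb'$ and $(a\widehat\otimes b)^*=(-1)^{\partial a\cdot\partial b}a^*\widehat\otimes b^*$. *)

theory Defs
  imports
    Complex_Main
    "HOL-Library.FuncSet"
    "HOL-Library.Countable_Set"
    "HOL-Library.Z2"
    "HOL-Library.Poly_Mapping"
    "HOL-Algebra.Group"
begin

section \<open>Complex *-algebras and C*-algebras\<close>

text \<open>Algebras are complex, not necessarily unital, and live on a carrier set.\<close>

record 'a star_alg = "'a partial_object" +
  vzero :: 'a
  vplus :: "'a \<Rightarrow> 'a \<Rightarrow> 'a"
  vscale :: "complex \<Rightarrow> 'a \<Rightarrow> 'a"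
  vtimes :: "'a \<Rightarrow> 'a \<Rightarrow> 'a"
  adj :: "'a \<Rightarrow> 'a"

record 'a normed_star_alg = "'a star_alg" +
  vnorm :: "'a \<Rightarrow> real"

definition vminus :: "('a, 'm) star_alg_scheme \<Rightarrow> 'a \<Rightarrow> 'a \<Rightarrow> 'a" where
  "vminus A x y = vplus A x (vscale A (-1) y)"

locale star_algebra =
  fixes A :: "('a, 'm) star_alg_scheme"
  assumes zero_closed: "vzero A \<in> carrier A"
    and plus_closed: "\<lbrakk>x \<in> carrier A; y \<in> carrier A\<rbrakk> \<Longrightarrow> vplus A x y \<in> carrier A"
    and scale_closed: "x \<in> carrier A \<Longrightarrow> vscale A z x \<in> carrier A"
    and times_closed: "\<lbrakk>x \<in> carrier A; y \<in> carrier A\<rbrakk> \<Longrightarrow> vtimes A x y \<in> carrier A"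
    and adj_closed: "x \<in> carrier A \<Longrightarrow> adj A x \<in> carrier A"
    and plus_assoc: "\<lbrakk>x \<in> carrier A; y \<in> carrier A; u \<in> carrier A\<rbrakk>
          \<Longrightarrow> vplus A (vplus A x y) u = vplus A x (vplus A y u)"
    and plus_commute: "\<lbrakk>x \<in> carrier A; y \<in> carrier A\<rbrakk> \<Longrightarrow> vplus A x y = vplus A y x"
    and plus_zero: "x \<in> carrier A \<Longrightarrow> vplus A x (vzero A) = x"
    and minus_self: "x \<in> carrier A \<Longrightarrow> vminus A x x = vzero A"
    and scale_one: "x \<in> carrier A \<Longrightarrow> vscale A 1 x = x"
    and scale_scale: "x \<in> carrier A \<Longrightarrow> vscale A z (vscale A w x) = vscale A (z * w) x"
    and scale_add_left: "x \<in> carrier A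
          \<Longrightarrow> vscale A (z + w) x = vplus A (vscale A z x) (vscale A w x)"
    and scale_add_right: "\<lbrakk>x \<in> carrier A; y \<in> carrier A\<rbrakk>
          \<Longrightarrow> vscale A z (vplus A x y) = vplus A (vscale A z x) (vscale A z y)"
    and times_assoc: "\<lbrakk>x \<in> carrier A; y \<in> carrier A; u \<in> carrier A\<rbrakk>
          \<Longrightarrow> vtimes A (vtimes A x y) u = vtimes A x (vtimes A y u)"
    and times_add_left: "\<lbrakk>x \<in> carrier A; y \<in> carrier A; u \<in> carrier A\<rbrakk>
          \<Longrightarrow> vtimes A (vplus A x y) u = vplus A (vtimes A x u) (vtimes A y u)"
    and times_add_right: "\<lbrakk>x \<in> carrier A; y \<in> carrier A; u \<in> carrier A\<rbrakk>
          \<Longrightarrow> vtimes A x (vplus A y u) = vplus A (vtimes A x y) (vtimes A x u)"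
    and times_scale_left: "\<lbrakk>x \<in> carrier A; y \<in> carrier A\<rbrakk>
          \<Longrightarrow> vtimes A (vscale A z x) y = vscale A z (vtimes A x y)"
    and times_scale_right: "\<lbrakk>x \<in> carrier A; y \<in> carrier A\<rbrakk>
          \<Longrightarrow> vtimes A x (vscale A z y) = vscale A z (vtimes A x y)"
    and adj_adj: "x \<in> carrier A \<Longrightarrow> adj A (adj A x) = x"
    and adj_plus: "\<lbrakk>x \<in> carrier A; y \<in> carrier A\<rbrakk>
          \<Longrightarrow> adj A (vplus A x y) = vplus A (adj A x) (adj A y)"
    and adj_scale: "x \<in> carrier A \<Longrightarrow> adj A (vscale A z x) = vscale A (cnj z) (adj A x)"
    and adj_times: "\<lbrakk>x \<in> carrier A; y \<in> carrier A\<rbrakk>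
          \<Longrightarrow> adj A (vtimes A x y) = vtimes A (adj A y) (adj A x)"

definition cstar_seminorm :: "('a, 'm) star_alg_scheme \<Rightarrow> ('a \<Rightarrow> real) \<Rightarrow> bool" where
  "cstar_seminorm X p \<longleftrightarrow>
     (\<forall>x\<in>carrier X. \<forall>y\<in>carrier X. p (vplus X x y) \<le> p x + p y) \<and>
     (\<forall>z. \<forall>x\<in>carrier X. p (vscale X z x) = cmod z * p x) \<and>
     (\<forall>x\<in>carrier X. \<forall>y\<in>carrier X. p (vtimes X x y) \<le> p x * p y) \<and>
     (\<forall>x\<in>carrier X. p (vtimes X (adj X x) x) = (p x)\<^sup>2)"

definition cauchy_seqs :: "('a, 'm) star_alg_scheme \<Rightarrow> ('a \<Rightarrow> real) \<Rightarrow> (nat \<Rightarrow> 'a) set" where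
  "cauchy_seqs X p = {\<sigma>. (\<forall>n. \<sigma> n \<in> carrier X) \<and>
     (\<forall>e>0. \<exists>N. \<forall>m\<ge>N. \<forall>n\<ge>N. p (vminus X (\<sigma> m) (\<sigma> n)) < e)}"

locale cstar_algebra = star_algebra A for A :: "('a, 'm) normed_star_alg_scheme" +
  assumes norm_cstar_seminorm: "cstar_seminorm A (vnorm A)"
    and norm_definite: "\<lbrakk>x \<in> carrier A; vnorm A x = 0\<rbrakk> \<Longrightarrow> x = vzero A"
    and norm_complete: "\<sigma> \<in> cauchy_seqs A (vnorm A)
          \<Longrightarrow> \<exists>x\<in>carrier A. (\<lambda>n. vnorm A (vminus A (\<sigma> n) x)) \<longlonglongrightarrow> 0"

definition star_hom ::
    "('a, 'm) star_alg_scheme \<Rightarrow> ('b, 'n) star_alg_scheme \<Rightarrow> ('a \<Rightarrow> 'b) set" where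
  "star_hom A B = {\<Phi>.
     (\<forall>x\<in>carrier A. \<Phi> x \<in> carrier B) \<and>
     (\<forall>x\<in>carrier A. \<forall>y\<in>carrier A. \<Phi> (vplus A x y) = vplus B (\<Phi> x) (\<Phi> y)) \<and>
     (\<forall>z. \<forall>x\<in>carrier A. \<Phi> (vscale A z x) = vscale B z (\<Phi> x)) \<and>
     (\<forall>x\<in>carrier A. \<forall>y\<in>carrier A. \<Phi> (vtimes A x y) = vtimes B (\<Phi> x) (\<Phi> y)) \<and>
     (\<forall>x\<in>carrier A. \<Phi> (adj A x) = adj B (\<Phi> x))}"

definition star_iso ::
    "('a, 'm) star_alg_scheme \<Rightarrow> ('b, 'n) star_alg_scheme \<Rightarrow> ('a \<Rightarrow> 'b) set" where
  "star_iso A B = {\<Phi> \<in> star_hom A B. bij_betw \<Phi> (carrier A) (carrier B)}"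

definition grading :: "('a, 'm) star_alg_scheme \<Rightarrow> ('a \<Rightarrow> 'a) \<Rightarrow> bool" where
  "grading A \<alpha> \<longleftrightarrow> \<alpha> \<in> star_iso A A \<and> (\<forall>x\<in>carrier A. \<alpha> (\<alpha> x) = x)"

text \<open>The well-formedness conditions on both sides are part of the notion: in particular the
  norms constructed below as suprema must really be C*-norms, and the gradings introduced by
  definite description must exist.\<close>

definition graded_cstar_isomorphic ::
    "('a, 'm) normed_star_alg_scheme \<Rightarrow> ('a \<Rightarrow> 'a) \<Rightarrow>
     ('b, 'n) normed_star_alg_scheme \<Rightarrow> ('b \<Rightarrow> 'b) \<Rightarrow> bool" where
  "graded_cstar_isomorphic A \<alpha> B \<beta> \<longleftrightarrow>
     cstar_algebra A \<and> grading A \<alpha> \<and> cstar_algebra B \<and> grading B \<beta> \<and>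
     (\<exists>\<Phi>\<in>star_iso A B. \<forall>x\<in>carrier A. \<Phi> (\<alpha> x) = \<beta> (\<Phi> x))"


section \<open>Separated completion of a *-algebra in a C*-seminorm\<close>

definition null_rel ::
    "('a, 'm) star_alg_scheme \<Rightarrow> ('a \<Rightarrow> real) \<Rightarrow> ((nat \<Rightarrow> 'a) \<times> (nat \<Rightarrow> 'a)) set" where
  "null_rel X p = {(\<sigma>, \<tau>). \<sigma> \<in> cauchy_seqs X p \<and> \<tau> \<in> cauchy_seqs X p \<and>
     (\<lambda>n. p (vminus X (\<sigma> n) (\<tau> n))) \<longlonglongrightarrow> 0}"

definition cstar_completion ::
    "('a, 'm) star_alg_scheme \<Rightarrow> ('a \<Rightarrow> real) \<Rightarrow> (nat \<Rightarrow> 'a) set normed_star_alg" where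
  "cstar_completion X p =
    \<lparr>carrier = cauchy_seqs X p // null_rel X p,
     vzero = null_rel X p `` {\<lambda>_. vzero X},
     vplus = (\<lambda>S T. \<Union>\<sigma>\<in>S. \<Union>\<tau>\<in>T. null_rel X p `` {\<lambda>n. vplus X (\<sigma> n) (\<tau> n)}),
     vscale = (\<lambda>z S. \<Union>\<sigma>\<in>S. null_rel X p `` {\<lambda>n. vscale X z (\<sigma> n)}),
     vtimes = (\<lambda>S T. \<Union>\<sigma>\<in>S. \<Union>\<tau>\<in>T. null_rel X p `` {\<lambda>n. vtimes X (\<sigma> n) (\<tau> n)}),
     adj = (\<lambda>S. \<Union>\<sigma>\<in>S. null_rel X p `` {\<lambda>n. adj X (\<sigma> n)}),
     vnorm = (\<lambda>S. THE r. \<forall>\<sigma>\<in>S. (\<lambda>n. p (\<sigma> n)) \<longlonglongrightarrow> r)\<rparr>"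

definition to_completion ::
    "('a, 'm) star_alg_scheme \<Rightarrow> ('a \<Rightarrow> real) \<Rightarrow> 'a \<Rightarrow> (nat \<Rightarrow> 'a) set" where
  "to_completion X p x = null_rel X p `` {\<lambda>_. x}"


section \<open>Universal C*-algebras given by generators and relations\<close>

text \<open>With lists as the monoid of words, the type \<open>'b list \<Rightarrow>\<^sub>0 complex\<close> carries the
  multiplication of the free algebra.\<close>

instantiation list :: (type) monoid_add
begin

definition zero_list :: "'a list" where "0 = []"

definition plus_list :: "'a list \<Rightarrow> 'a list \<Rightarrow> 'a list" where "xs + ys = xs @ ys"

instance
  by standard (simp_all add: zero_list_def plus_list_def)

end

text \<open>The letter \<open>(x, False)\<close> stands for the generator \<open>x\<close> and \<open>(x, True)\<close> for its adjoint.
  Excluding the empty word gives the nonunital free *-algebra.\<close>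

definition free_star_alg :: "'g set \<Rightarrow> (('g \<times> bool) list \<Rightarrow>\<^sub>0 complex) star_alg" where
  "free_star_alg S =
    \<lparr>carrier = {f. \<forall>w\<in>Poly_Mapping.keys f. w \<noteq> [] \<and> fst ` set w \<subseteq> S},
     vzero = 0,
     vplus = (+),
     vscale = (\<lambda>z. Poly_Mapping.map (\<lambda>c. z * c)),
     vtimes = (*),
     adj = (\<lambda>f. \<Sum>w\<in>Poly_Mapping.keys f.
              Poly_Mapping.single (rev (map (apsnd Not) w)) (cnj (Poly_Mapping.lookup f w)))\<rparr>"

definition free_gen :: "'g \<Rightarrow> (('g \<times> bool) list \<Rightarrow>\<^sub>0 complex)" where
  "free_gen x = Poly_Mapping.single [(x, False)] 1"

text \<open>A *-homomorphism from the free *-algebra on \<open>S\<close> to a C*-algebra that kills the relators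
  \<open>R\<close> induces a C*-seminorm vanishing on \<open>R\<close>, and every such seminorm arises in this way (from its
  separated completion).  So the supremum below is the usual supremum over all representations of
  the relations.  As usual, it is meaningful only if the relations bound the norms of the
  generators.\<close>

definition universal_seminorm ::
    "'g set \<Rightarrow> (('g \<times> bool) list \<Rightarrow>\<^sub>0 complex) set \<Rightarrow> (('g \<times> bool) list \<Rightarrow>\<^sub>0 complex) \<Rightarrow> real" where
  "universal_seminorm S R x =
     Sup {p x |p. cstar_seminorm (free_star_alg S) p \<and> (\<forall>r\<in>R. p r = 0)}"

definition universal_cstar ::
    "'g set \<Rightarrow> (('g \<times> bool) list \<Rightarrow>\<^sub>0 complex) set \<Rightarrow>
     (nat \<Rightarrow> (('g \<times> bool) list \<Rightarrow>\<^sub>0 complex)) set normed_star_alg" where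
  "universal_cstar S R = cstar_completion (free_star_alg S) (universal_seminorm S R)"

definition universal_gen ::
    "'g set \<Rightarrow> (('g \<times> bool) list \<Rightarrow>\<^sub>0 complex) set \<Rightarrow> 'g \<Rightarrow>
     (nat \<Rightarrow> (('g \<times> bool) list \<Rightarrow>\<^sub>0 complex)) set" where
  "universal_gen S R x = to_completion (free_star_alg S) (universal_seminorm S R) (free_gen x)"


section \<open>P-graphs\<close>

text \<open>The degree monoids (written multiplicatively, as in \<open>HOL-Algebra\<close>) come with their number of
  coordinates and the coordinatewise reduction modulo 2.\<close>

record 'p degree_monoid = "'p monoid" +
  coords :: nat
  red :: "'p \<Rightarrow> nat \<Rightarrow> bit"

text \<open>\<open>NZ k a\<close> is the monoid \<open>\<nat>\<^sup>k \<times> \<int>\<^sub>2\<^sup>a\<close>; tuples are functions vanishing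
  beyond their length, so that \<open>k = 0\<close> and \<open>a = 0\<close> are allowed.\<close>

definition NZ :: "nat \<Rightarrow> nat \<Rightarrow> ((nat \<Rightarrow> nat) \<times> (nat \<Rightarrow> bit)) degree_monoid" where
  "NZ k a =
    \<lparr>carrier = {(m, x). (\<forall>i\<ge>k. m i = 0) \<and> (\<forall>i\<ge>a. x i = 0)},
     mult = (\<lambda>(m, x) (m', x'). (\<lambda>i. m i + m' i, \<lambda>i. x i + x' i)),
     one = (\<lambda>_. 0, \<lambda>_. 0),
     coords = k + a,
     red = (\<lambda>(m, x) i. if i < k then of_nat (m i) else x (i - k))\<rparr>"

definition prod_degree ::
    "('p, 'm) degree_monoid_scheme \<Rightarrow> ('q, 'n) degree_monoid_scheme \<Rightarrow> ('p \<times> 'q) degree_monoid" where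
  "prod_degree P Q =
    \<lparr>carrier = carrier (P \<times>\<times> Q),
     mult = mult (P \<times>\<times> Q),
     one = one (P \<times>\<times> Q),
     coords = coords P + coords Q,
     red = (\<lambda>(p, q) i. if i < coords P then red P p i else red Q q (i - coords P))\<rparr>"

text \<open>A small category is given by its set of morphisms, objects being identified with identity
  morphisms; \<open>cmp \<Lambda> x y\<close> is the composite \<open>xy\<close>, defined when \<open>src \<Lambda> x = rng \<Lambda> y\<close>.\<close>

record ('a, 'p) deg_category =
  arr :: "'a set"
  src :: "'a \<Rightarrow> 'a"
  rng :: "'a \<Rightarrow> 'a"
  cmp :: "'a \<Rightarrow> 'a \<Rightarrow> 'a"
  degr :: "'a \<Rightarrow> 'p"

locale P_graph =
  fixes P :: "('p, 'm) monoid_scheme" and \<Lambda> :: "('a, 'p) deg_category"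
  assumes countable_arr: "countable (arr \<Lambda>)"
    and src_closed: "x \<in> arr \<Lambda> \<Longrightarrow> src \<Lambda> x \<in> arr \<Lambda>"
    and rng_closed: "x \<in> arr \<Lambda> \<Longrightarrow> rng \<Lambda> x \<in> arr \<Lambda>"
    and src_ident: "x \<in> arr \<Lambda> \<Longrightarrow> src \<Lambda> (src \<Lambda> x) = src \<Lambda> x \<and> rng \<Lambda> (src \<Lambda> x) = src \<Lambda> x"
    and rng_ident: "x \<in> arr \<Lambda> \<Longrightarrow> src \<Lambda> (rng \<Lambda> x) = rng \<Lambda> x \<and> rng \<Lambda> (rng \<Lambda> x) = rng \<Lambda> x"
    and comp_closed: "\<lbrakk>x \<in> arr \<Lambda>; y \<in> arr \<Lambda>; src \<Lambda> x = rng \<Lambda> y\<rbrakk> \<Longrightarrow> cmp \<Lambda> x y \<in> arr \<Lambda>"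
    and src_comp: "\<lbrakk>x \<in> arr \<Lambda>; y \<in> arr \<Lambda>; src \<Lambda> x = rng \<Lambda> y\<rbrakk> \<Longrightarrow> src \<Lambda> (cmp \<Lambda> x y) = src \<Lambda> y"
    and rng_comp: "\<lbrakk>x \<in> arr \<Lambda>; y \<in> arr \<Lambda>; src \<Lambda> x = rng \<Lambda> y\<rbrakk> \<Longrightarrow> rng \<Lambda> (cmp \<Lambda> x y) = rng \<Lambda> x"
    and comp_src: "x \<in> arr \<Lambda> \<Longrightarrow> cmp \<Lambda> x (src \<Lambda> x) = x"
    and comp_rng: "x \<in> arr \<Lambda> \<Longrightarrow> cmp \<Lambda> (rng \<Lambda> x) x = x"
    and comp_assoc: "\<lbrakk>x \<in> arr \<Lambda>; y \<in> arr \<Lambda>; u \<in> arr \<Lambda>; src \<Lambda> x = rng \<Lambda> y; src \<Lambda> y = rng \<Lambda> u\<rbrakk>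
          \<Longrightarrow> cmp \<Lambda> (cmp \<Lambda> x y) u = cmp \<Lambda> x (cmp \<Lambda> y u)"
    and deg_closed: "x \<in> arr \<Lambda> \<Longrightarrow> degr \<Lambda> x \<in> carrier P"
    and deg_ident: "x \<in> arr \<Lambda> \<Longrightarrow> degr \<Lambda> (src \<Lambda> x) = \<one>\<^bsub>P\<^esub> \<and> degr \<Lambda> (rng \<Lambda> x) = \<one>\<^bsub>P\<^esub>"
    and deg_comp: "\<lbrakk>x \<in> arr \<Lambda>; y \<in> arr \<Lambda>; src \<Lambda> x = rng \<Lambda> y\<rbrakk>
          \<Longrightarrow> degr \<Lambda> (cmp \<Lambda> x y) = degr \<Lambda> x \<otimes>\<^bsub>P\<^esub> degr \<Lambda> y"
    and factorisation: "\<lbrakk>x \<in> arr \<Lambda>; p \<in> carrier P; q \<in> carrier P; degr \<Lambda> x = p \<otimes>\<^bsub>P\<^esub> q\<rbrakk>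
          \<Longrightarrow> \<exists>!(y, u). y \<in> arr \<Lambda> \<and> u \<in> arr \<Lambda> \<and> src \<Lambda> y = rng \<Lambda> u \<and>
                degr \<Lambda> y = p \<and> degr \<Lambda> u = q \<and> x = cmp \<Lambda> y u"

definition level :: "('a, 'p) deg_category \<Rightarrow> 'p \<Rightarrow> 'a set" where
  "level \<Lambda> p = {x \<in> arr \<Lambda>. degr \<Lambda> x = p}"

definition vertices :: "('p, 'm) monoid_scheme \<Rightarrow> ('a, 'p) deg_category \<Rightarrow> 'a set" where
  "vertices P \<Lambda> = level \<Lambda> \<one>\<^bsub>P\<^esub>"

definition level_at :: "('a, 'p) deg_category \<Rightarrow> 'a \<Rightarrow> 'p \<Rightarrow> 'a set" where
  "level_at \<Lambda> v p = {x \<in> level \<Lambda> p. rng \<Lambda> x = v}"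

definition row_finite :: "('p, 'm) monoid_scheme \<Rightarrow> ('a, 'p) deg_category \<Rightarrow> bool" where
  "row_finite P \<Lambda> \<longleftrightarrow> (\<forall>v\<in>vertices P \<Lambda>. \<forall>p\<in>carrier P. finite (level_at \<Lambda> v p))"

definition no_sources :: "('p, 'm) monoid_scheme \<Rightarrow> ('a, 'p) deg_category \<Rightarrow> bool" where
  "no_sources P \<Lambda> \<longleftrightarrow> (\<forall>v\<in>vertices P \<Lambda>. \<forall>p\<in>carrier P. level_at \<Lambda> v p \<noteq> {})"

definition prod_graph ::
    "('a, 'p) deg_category \<Rightarrow> ('b, 'q) deg_category \<Rightarrow> ('a \<times> 'b, 'p \<times> 'q) deg_category" where
  "prod_graph \<Lambda> \<Gamma> =
    \<lparr>arr = arr \<Lambda> \<times> arr \<Gamma>,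
     src = map_prod (src \<Lambda>) (src \<Gamma>),
     rng = map_prod (rng \<Lambda>) (rng \<Gamma>),
     cmp = (\<lambda>(x, y) (x', y'). (cmp \<Lambda> x x', cmp \<Gamma> y y')),
     degr = map_prod (degr \<Lambda>) (degr \<Gamma>)\<rparr>"


section \<open>Twisted C*-algebras of P-graphs\<close>

text \<open>A relation \<open>x = y\<close> is encoded by the relator \<open>x - y\<close>.\<close>

definition twisted_relators ::
    "('p, 'm) monoid_scheme \<Rightarrow> ('a, 'p) deg_category \<Rightarrow> ('a \<Rightarrow> 'a \<Rightarrow> complex) \<Rightarrow>
     (('a \<times> bool) list \<Rightarrow>\<^sub>0 complex) set" where
  "twisted_relators P \<Lambda> c =
    (let F = free_star_alg (arr \<Lambda>); s = free_gen in
      {adj F (s v) - s v |v. v \<in> vertices P \<Lambda>} \<union>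
      {s v * s v - s v |v. v \<in> vertices P \<Lambda>} \<union>
      {s v * s w |v w. v \<in> vertices P \<Lambda> \<and> w \<in> vertices P \<Lambda> \<and> v \<noteq> w} \<union>
      {s x * s y - vscale F (c x y) (s (cmp \<Lambda> x y)) |x y.
         x \<in> arr \<Lambda> \<and> y \<in> arr \<Lambda> \<and> src \<Lambda> x = rng \<Lambda> y} \<union>
      {adj F (s x) * s x - s (src \<Lambda> x) |x. x \<in> arr \<Lambda>} \<union>
      {s v - (\<Sum>x\<in>level_at \<Lambda> v p. s x * adj F (s x)) |v p. v \<in> vertices P \<Lambda> \<and> p \<in> carrier P})"

definition twisted_cstar ::
    "('p, 'm) monoid_scheme \<Rightarrow> ('a, 'p) deg_category \<Rightarrow> ('a \<Rightarrow> 'a \<Rightarrow> complex) \<Rightarrow>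
     (nat \<Rightarrow> (('a \<times> bool) list \<Rightarrow>\<^sub>0 complex)) set normed_star_alg" where
  "twisted_cstar P \<Lambda> c = universal_cstar (arr \<Lambda>) (twisted_relators P \<Lambda> c)"

definition twisted_gen ::
    "('p, 'm) monoid_scheme \<Rightarrow> ('a, 'p) deg_category \<Rightarrow> ('a \<Rightarrow> 'a \<Rightarrow> complex) \<Rightarrow> 'a \<Rightarrow>
     (nat \<Rightarrow> (('a \<times> bool) list \<Rightarrow>\<^sub>0 complex)) set" where
  "twisted_gen P \<Lambda> c = universal_gen (arr \<Lambda>) (twisted_relators P \<Lambda> c)"

definition bit_sign :: "bit \<Rightarrow> complex" where
  "bit_sign j = (if j = 0 then 1 else -1)"

definition kappa :: "nat \<Rightarrow> (nat \<Rightarrow> bit) \<Rightarrow> (nat \<Rightarrow> bit) \<Rightarrow> bit" where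
  "kappa N m n = (\<Sum>i<N. \<Sum>j<i. m i * n j)"

definition sign_cocycle ::
    "('p, 'm) degree_monoid_scheme \<Rightarrow> ('a, 'p) deg_category \<Rightarrow> 'a \<Rightarrow> 'a \<Rightarrow> complex" where
  "sign_cocycle P \<Lambda> x y = bit_sign (kappa (coords P) (red P (degr \<Lambda> x)) (red P (degr \<Lambda> y)))"

text \<open>The homomorphism \<open>P \<rightarrow> \<int>\<^sub>2\<close> taking each standard generator to \<open>1\<close> is the sum of the
  coordinates modulo 2.\<close>

definition deg_parity ::
    "('p, 'm) degree_monoid_scheme \<Rightarrow> ('a, 'p) deg_category \<Rightarrow> 'a \<Rightarrow> bit" where
  "deg_parity P \<Lambda> x = (\<Sum>i<coords P. red P (degr \<Lambda> x) i)"

text \<open>Restricting to \<open>extensional\<close> functions makes the automorphism unique as a HOL function.\<close>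

definition gen_grading ::
    "('p, 'm) monoid_scheme \<Rightarrow> ('a, 'p) deg_category \<Rightarrow> ('a \<Rightarrow> 'a \<Rightarrow> complex) \<Rightarrow> ('a \<Rightarrow> bit) \<Rightarrow>
     (nat \<Rightarrow> (('a \<times> bool) list \<Rightarrow>\<^sub>0 complex)) set \<Rightarrow>
     (nat \<Rightarrow> (('a \<times> bool) list \<Rightarrow>\<^sub>0 complex)) set" where
  "gen_grading P \<Lambda> c \<delta> =
    (let A = twisted_cstar P \<Lambda> c; s = twisted_gen P \<Lambda> c in
      THE \<alpha>. \<alpha> \<in> extensional (carrier A) \<and> grading A \<alpha> \<and>
        (\<forall>x\<in>arr \<Lambda>. \<alpha> (s x) = vscale A (bit_sign (\<delta> x)) (s x)))"


abbreviation sign_cstar ::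
    "('p, 'm) degree_monoid_scheme \<Rightarrow> ('a, 'p) deg_category \<Rightarrow>
     (nat \<Rightarrow> (('a \<times> bool) list \<Rightarrow>\<^sub>0 complex)) set normed_star_alg" where
  "sign_cstar P \<Lambda> \<equiv> twisted_cstar P \<Lambda> (sign_cocycle P \<Lambda>)"

abbreviation parity_grading ::
    "('p, 'm) degree_monoid_scheme \<Rightarrow> ('a, 'p) deg_category \<Rightarrow>
     (nat \<Rightarrow> (('a \<times> bool) list \<Rightarrow>\<^sub>0 complex)) set \<Rightarrow>
     (nat \<Rightarrow> (('a \<times> bool) list \<Rightarrow>\<^sub>0 complex)) set" where
  "parity_grading P \<Lambda> \<equiv> gen_grading P \<Lambda> (sign_cocycle P \<Lambda>) (deg_parity P \<Lambda>)"


section \<open>The minimal graded tensor product\<close>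

definition bilinear_forms ::
    "('a, 'm) star_alg_scheme \<Rightarrow> ('b, 'n) star_alg_scheme \<Rightarrow> ('a \<Rightarrow> 'b \<Rightarrow> complex) set" where
  "bilinear_forms A B = {f.
     (\<forall>x\<in>carrier A. \<forall>y\<in>carrier A. \<forall>b\<in>carrier B. f (vplus A x y) b = f x b + f y b) \<and>
     (\<forall>z. \<forall>x\<in>carrier A. \<forall>b\<in>carrier B. f (vscale A z x) b = z * f x b) \<and>
     (\<forall>a\<in>carrier A. \<forall>x\<in>carrier B. \<forall>y\<in>carrier B. f a (vplus B x y) = f a x + f a y) \<and>
     (\<forall>z. \<forall>a\<in>carrier A. \<forall>x\<in>carrier B. f a (vscale B z x) = z * f a x)}"

text \<open>The algebraic tensor product is realised as a space of functionals on bilinear forms, the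
  elementary tensor of \<open>a\<close> and \<open>b\<close> being evaluation at \<open>(a, b)\<close>.  Functionals are \<open>0\<close> on
  arguments that are not bilinear forms.\<close>

definition elem_tensor ::
    "('a, 'm) star_alg_scheme \<Rightarrow> ('b, 'n) star_alg_scheme \<Rightarrow> 'a \<Rightarrow> 'b \<Rightarrow>
     ('a \<Rightarrow> 'b \<Rightarrow> complex) \<Rightarrow> complex" where
  "elem_tensor A B a b = (\<lambda>f. if f \<in> bilinear_forms A B then f a b else 0)"

text \<open>The component \<open>(a + (-1)\<^sup>i \<alpha>(a)) / 2\<close> of degree \<open>i\<close>.\<close>

definition hom_part :: "('a, 'm) star_alg_scheme \<Rightarrow> ('a \<Rightarrow> 'a) \<Rightarrow> bit \<Rightarrow> 'a \<Rightarrow> 'a" where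
  "hom_part A \<alpha> i a = vscale A (1/2) (vplus A a (vscale A (bit_sign i) (\<alpha> a)))"

text \<open>In terms of elementary tensors the operations are the linear (conjugate-linear) extensions of
  \<open>(a \<otimes> b)(a' \<otimes> b') = \<Sum>\<^sub>i\<^sub>,\<^sub>j (-1)\<^sup>i\<^sup>j a a'\<^sub>i \<otimes> b\<^sub>j b'\<close> and
  \<open>(a \<otimes> b)* = \<Sum>\<^sub>i\<^sub>,\<^sub>j (-1)\<^sup>i\<^sup>j a\<^sub>i* \<otimes> b\<^sub>j*\<close>, where subscripts denote homogeneous components.\<close>

definition alg_gtensor ::
    "('a, 'm) star_alg_scheme \<Rightarrow> ('a \<Rightarrow> 'a) \<Rightarrow> ('b, 'n) star_alg_scheme \<Rightarrow> ('b \<Rightarrow> 'b) \<Rightarrow>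
     (('a \<Rightarrow> 'b \<Rightarrow> complex) \<Rightarrow> complex) star_alg" where
  "alg_gtensor A \<alpha> B \<beta> =
    \<lparr>carrier = {(\<lambda>f. \<Sum>(a, b)\<in>F. z (a, b) * elem_tensor A B a b f) |F z.
                  finite F \<and> F \<subseteq> carrier A \<times> carrier B},
     vzero = (\<lambda>f. 0),
     vplus = (\<lambda>T U f. T f + U f),
     vscale = (\<lambda>z T f. z * T f),
     vtimes = (\<lambda>T U f. if f \<in> bilinear_forms A B then
        T (\<lambda>a b. U (\<lambda>a' b'. \<Sum>i\<in>{0, 1}. \<Sum>j\<in>{0, 1}.
             bit_sign (i * j) * f (vtimes A a (hom_part A \<alpha> i a')) (vtimes B (hom_part B \<beta> j b) b')))
        else 0),
     adj = (\<lambda>T f. if f \<in> bilinear_forms A B then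
        cnj (T (\<lambda>a b. cnj (\<Sum>i\<in>{0, 1}. \<Sum>j\<in>{0, 1}.
             bit_sign (i * j) * f (adj A (hom_part A \<alpha> i a)) (adj B (hom_part B \<beta> j b)))))
        else 0)\<rparr>"

definition even_positive_functional ::
    "('a, 'm) star_alg_scheme \<Rightarrow> ('a \<Rightarrow> 'a) \<Rightarrow> ('a \<Rightarrow> complex) \<Rightarrow> bool" where
  "even_positive_functional A \<alpha> \<phi> \<longleftrightarrow>
     (\<forall>x\<in>carrier A. \<forall>y\<in>carrier A. \<phi> (vplus A x y) = \<phi> x + \<phi> y) \<and>
     (\<forall>z. \<forall>x\<in>carrier A. \<phi> (vscale A z x) = z * \<phi> x) \<and>
     (\<forall>x\<in>carrier A. \<phi> (vtimes A (adj A x) x) \<in> \<real> \<and> 0 \<le> Re (\<phi> (vtimes A (adj A x) x))) \<and>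
     (\<forall>x\<in>carrier A. \<phi> (\<alpha> x) = \<phi> x)"

text \<open>The minimal (spatial) norm.  For even positive functionals \<open>\<phi>\<close>, \<open>\<psi>\<close> the functional
  \<open>\<phi> \<otimes> \<psi>\<close> on the graded tensor product is positive, and its GNS representation is the spatial
  representation \<open>(a \<otimes> b)(h \<otimes> k) = (-1)\<^bsup>\<partial>b\<cdot>\<partial>h\<^esup> ah \<otimes> bk\<close> on the tensor product of the (graded) GNS
  spaces of \<open>\<phi>\<close> and \<open>\<psi>\<close>; for fixed \<open>\<phi>\<close>, \<open>\<psi>\<close> the supremum over \<open>y\<close> is the operator norm of
  \<open>x\<close> in it.  The direct sum of the GNS representations of all even positive functionals is
  faithful.  Normalising the functionals to states would leave the supremum unchanged.\<close>

definition min_norm ::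
    "('a, 'm) star_alg_scheme \<Rightarrow> ('a \<Rightarrow> 'a) \<Rightarrow> ('b, 'n) star_alg_scheme \<Rightarrow> ('b \<Rightarrow> 'b) \<Rightarrow>
     (('a \<Rightarrow> 'b \<Rightarrow> complex) \<Rightarrow> complex) \<Rightarrow> real" where
  "min_norm A \<alpha> B \<beta> x =
    (let X = alg_gtensor A \<alpha> B \<beta> in
      Sup {sqrt (Re (vtimes X (adj X (vtimes X x y)) (vtimes X x y) (\<lambda>a b. \<phi> a * \<psi> b))) |\<phi> \<psi> y.
        even_positive_functional A \<alpha> \<phi> \<and> even_positive_functional B \<beta> \<psi> \<and> y \<in> carrier X \<and>
        Re (vtimes X (adj X y) y (\<lambda>a b. \<phi> a * \<psi> b)) \<le> 1})"

definition gtensor ::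
    "('a, 'm) star_alg_scheme \<Rightarrow> ('a \<Rightarrow> 'a) \<Rightarrow> ('b, 'n) star_alg_scheme \<Rightarrow> ('b \<Rightarrow> 'b) \<Rightarrow>
     (nat \<Rightarrow> ('a \<Rightarrow> 'b \<Rightarrow> complex) \<Rightarrow> complex) set normed_star_alg" where
  "gtensor A \<alpha> B \<beta> = cstar_completion (alg_gtensor A \<alpha> B \<beta>) (min_norm A \<alpha> B \<beta>)"

definition gtensor_elem ::
    "('a, 'm) star_alg_scheme \<Rightarrow> ('a \<Rightarrow> 'a) \<Rightarrow> ('b, 'n) star_alg_scheme \<Rightarrow> ('b \<Rightarrow> 'b) \<Rightarrow>
     'a \<Rightarrow> 'b \<Rightarrow> (nat \<Rightarrow> ('a \<Rightarrow> 'b \<Rightarrow> complex) \<Rightarrow> complex) set" where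
  "gtensor_elem A \<alpha> B \<beta> a b =
     to_completion (alg_gtensor A \<alpha> B \<beta>) (min_norm A \<alpha> B \<beta>) (elem_tensor A B a b)"

definition gtensor_grading ::
    "('a, 'm) star_alg_scheme \<Rightarrow> ('a \<Rightarrow> 'a) \<Rightarrow> ('b, 'n) star_alg_scheme \<Rightarrow> ('b \<Rightarrow> 'b) \<Rightarrow>
     (nat \<Rightarrow> ('a \<Rightarrow> 'b \<Rightarrow> complex) \<Rightarrow> complex) set \<Rightarrow>
     (nat \<Rightarrow> ('a \<Rightarrow> 'b \<Rightarrow> complex) \<Rightarrow> complex) set" where
  "gtensor_grading A \<alpha> B \<beta> =
    (let D = gtensor A \<alpha> B \<beta>; t = gtensor_elem A \<alpha> B \<beta> in
      THE \<gamma>. \<gamma> \<in> extensional (carrier D) \<and> grading D \<gamma> \<and>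
        (\<forall>a\<in>carrier A. \<forall>b\<in>carrier B. \<gamma> (t a b) = t (\<alpha> a) (\<beta> b)))"

end

(* Write s, t for the generators of the two algebras.  The elements s_x (x) t_y of the graded tensor
   product satisfy the relations of the product graph, since the sign from moving t_y past s_x' is
   exactly the quotient of the product cocycle by the two given ones.  They therefore induce a
   *-homomorphism with dense range, and it remains to see that it is isometric.  This is a
   gauge-invariant uniqueness argument: the tensor products of gauge automorphisms act
   contractively on the minimal tensor product, so averaging over them reduces the comparison of
   norms to the core of elements of degree zero, which is a union of finite-dimensional algebras.
   There it suffices that no vertex projection is mapped to zero, which follows from even states
   on the two factors that are nonzero at given vertices; they are vector states of the twisted
   representation on the infinite path space.  Comparisons of C*-seminorms are obtained up to a
   factor growing slowly along powers, which the C*-identity then reduces to 1. *)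

theory Submission
  imports Defs "HOL-Number_Theory.Cong"
begin

section \<open>Calculating in *-algebras with carriers\<close>

text \<open>Both norms are suprema, one over all C*-seminorms and one over even positive
  functionals; no Hilbert space, spectrum or integral appears. A C*-seminorm on a nonunital *-ring
  takes the place of a representation, so contractivity, positivity and orthogonality must be
  extracted from the axioms of a seminorm: square roots come from a fixed-point iteration, unitaries
  are handled without a unit, and projections with a projection as sum are orthogonal because a
  projection is an extreme point of the unit ball. The average over a gauge group is a finite one
  over roots of unity. It separates the homogeneous components of an element of bounded degree, and
  their number enters as a factor; under repeated squaring this number is only proportional to the
  exponent. In the coordinates \<open>\<int>\<^sub>2\<close> degrees have no least upper bounds, so
  the product of two degrees serves as their common multiple. Evenness of the functionals removes
  all signs from the Gram matrices of product functionals, which makes these functionals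
  positive.\<close>

class star_ring = ring +
  fixes scaleC :: "complex \<Rightarrow> 'a \<Rightarrow> 'a" (infixr "*\<^sub>C" 75)
    and star :: "'a \<Rightarrow> 'a"
  assumes scaleC_add_right: "z *\<^sub>C (x + y) = z *\<^sub>C x + z *\<^sub>C y"
    and scaleC_add_left: "(z + w) *\<^sub>C x = z *\<^sub>C x + w *\<^sub>C x"
    and scaleC_scaleC [simp]: "z *\<^sub>C w *\<^sub>C x = (z * w) *\<^sub>C x"
    and scaleC_one [simp]: "1 *\<^sub>C x = x"
    and mult_scaleC_left [simp]: "(z *\<^sub>C x) * y = z *\<^sub>C (x * y)"
    and mult_scaleC_right [simp]: "x * (z *\<^sub>C y) = z *\<^sub>C (x * y)"
    and star_star [simp]: "star (star x) = x"
    and star_add: "star (x + y) = star x + star y"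
    and star_scaleC [simp]: "star (z *\<^sub>C x) = cnj z *\<^sub>C star x"
    and star_mult: "star (x * y) = star y * star x"
begin

lemma scaleC_zero_left [simp]: "0 *\<^sub>C x = 0"
  using scaleC_add_left[of 0 0 x] by simp

lemma scaleC_zero_right [simp]: "z *\<^sub>C 0 = 0"
  using scaleC_add_right[of z 0 0] by simp

lemma scaleC_minus_left [simp]: "(- z) *\<^sub>C x = - (z *\<^sub>C x)"
  using scaleC_add_left[of z "-z" x] by (simp add: eq_neg_iff_add_eq_0 add.commute)

lemma scaleC_minus_right [simp]: "z *\<^sub>C (- x) = - (z *\<^sub>C x)"
  using scaleC_add_right[of z x "-x"] by (simp add: eq_neg_iff_add_eq_0 add.commute)

lemma scaleC_diff_right: "z *\<^sub>C (x - y) = z *\<^sub>C x - z *\<^sub>C y"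
  using scaleC_add_right[of z x "-y"] by simp

lemma scaleC_diff_left: "(z - w) *\<^sub>C x = z *\<^sub>C x - w *\<^sub>C x"
  using scaleC_add_left[of z "-w" x] by simp

lemma star_zero [simp]: "star 0 = 0"
  using star_add[of 0 0] by simp

lemma star_minus [simp]: "star (- x) = - star x"
  using star_add[of x "-x"] by (simp add: eq_neg_iff_add_eq_0 add.commute)

lemma star_diff: "star (x - y) = star x - star y"
  using star_add[of x "-y"] by simp

lemmas star_ring_simps = scaleC_add_right scaleC_diff_right star_add star_diff star_mult

lemma scaleC_sum_right: "z *\<^sub>C sum f I = (\<Sum>i\<in>I. z *\<^sub>C f i)"
  by (induct I rule: infinite_finite_induct) (simp_all add: scaleC_add_right)

lemma star_sum: "star (sum f I) = (\<Sum>i\<in>I. star (f i))"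
  by (induct I rule: infinite_finite_induct) (simp_all add: star_add)

lemma scaleC_two: "2 *\<^sub>C x = x + x"
  using scaleC_add_left[of 1 1 x] by simp

end

lemma scaleC_sum_left: "(\<Sum>i\<in>I. f i) *\<^sub>C (x::'a::star_ring) = (\<Sum>i\<in>I. f i *\<^sub>C x)"
  by (induct I rule: infinite_finite_induct) (simp_all add: scaleC_add_left)


text \<open>An element of \<open>'a star_prod\<close> is a family with one element in each *-algebra on the type
  \<open>'a\<close>.  Every such *-algebra embeds into this type-level *-ring as the families supported
  at one place, so that its elements can be computed with as in a type class.\<close>

definition place :: "'a star_alg \<Rightarrow> 'a set" where
  "place A = (if star_algebra A then carrier A else {undefined})"

typedef 'a star_prod = "{f :: 'a star_alg \<Rightarrow> 'a. \<forall>A. f A \<in> place A}"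
  morphisms component Abs_star_prod
  by (rule exI[of _ "\<lambda>A. if star_algebra A then vzero A else undefined"])
    (simp add: place_def star_algebra.zero_closed)

setup_lifting type_definition_star_prod

context star_algebra
begin

lemma scale_zero_left: "x \<in> carrier A \<Longrightarrow> vscale A 0 x = vzero A"
  using scale_add_left[of x 1 "-1"] minus_self[of x] by (simp add: vminus_def scale_one)

lemma scale_zero_right: "vscale A z (vzero A) = vzero A"
  using scale_scale[of "vzero A" z 0] zero_closed by (simp add: scale_zero_left)

lemma zero_plus: "x \<in> carrier A \<Longrightarrow> vplus A (vzero A) x = x"
  using plus_commute plus_zero zero_closed by simp

lemma zero_times: "x \<in> carrier A \<Longrightarrow> vtimes A (vzero A) x = vzero A"
  using times_scale_left[of "vzero A" x 0] zero_closed
  by (simp add: scale_zero_left times_closed)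

lemma times_zero: "x \<in> carrier A \<Longrightarrow> vtimes A x (vzero A) = vzero A"
  using times_scale_right[of x "vzero A" 0] zero_closed
  by (simp add: scale_zero_left times_closed)

lemma adj_zero: "adj A (vzero A) = vzero A"
  using adj_scale[of "vzero A" 0] zero_closed adj_closed by (simp add: scale_zero_left)

lemma minus_closed: "x \<in> carrier A \<Longrightarrow> y \<in> carrier A \<Longrightarrow> vminus A x y \<in> carrier A"
  by (simp add: vminus_def plus_closed scale_closed)

lemma minus_plus_self: "x \<in> carrier A \<Longrightarrow> vplus A (vscale A (-1) x) x = vzero A"
  using minus_self[of x] plus_commute[of x "vscale A (-1) x"] scale_closed by (simp add: vminus_def)

lemmas closed = zero_closed plus_closed scale_closed times_closed adj_closed minus_closed

end

instantiation star_prod :: (type) star_ring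
begin

lift_definition zero_star_prod :: "'a star_prod" is
  "\<lambda>A. if star_algebra A then vzero A else undefined"
  by (simp add: place_def star_algebra.zero_closed)

lift_definition plus_star_prod :: "'a star_prod \<Rightarrow> 'a star_prod \<Rightarrow> 'a star_prod" is
  "\<lambda>f g A. if star_algebra A then vplus A (f A) (g A) else undefined"
  by (auto simp: place_def split: if_splits) (metis star_algebra.closed)

lift_definition minus_star_prod :: "'a star_prod \<Rightarrow> 'a star_prod \<Rightarrow> 'a star_prod" is
  "\<lambda>f g A. if star_algebra A then vminus A (f A) (g A) else undefined"
  by (auto simp: place_def split: if_splits) (metis star_algebra.closed)

lift_definition uminus_star_prod :: "'a star_prod \<Rightarrow> 'a star_prod" is
  "\<lambda>f A. if star_algebra A then vscale A (-1) (f A) else undefined"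
  by (auto simp: place_def split: if_splits) (metis star_algebra.closed)

lift_definition times_star_prod :: "'a star_prod \<Rightarrow> 'a star_prod \<Rightarrow> 'a star_prod" is
  "\<lambda>f g A. if star_algebra A then vtimes A (f A) (g A) else undefined"
  by (auto simp: place_def split: if_splits) (metis star_algebra.closed)

lift_definition scaleC_star_prod :: "complex \<Rightarrow> 'a star_prod \<Rightarrow> 'a star_prod" is
  "\<lambda>z f A. if star_algebra A then vscale A z (f A) else undefined"
  by (auto simp: place_def split: if_splits) (metis star_algebra.closed)

lift_definition star_star_prod :: "'a star_prod \<Rightarrow> 'a star_prod" is
  "\<lambda>f A. if star_algebra A then adj A (f A) else undefined"
  by (auto simp: place_def split: if_splits) (metis star_algebra.closed)

lemma component_mem: "star_algebra A \<Longrightarrow> component f A \<in> carrier A"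
  using component[of f] by (auto simp: place_def split: if_splits)

lemma component_undefined: "\<not> star_algebra A \<Longrightarrow> component f A = undefined"
  using component[of f] by (auto simp: place_def split: if_splits)

lemmas rep_eqs = zero_star_prod.rep_eq plus_star_prod.rep_eq minus_star_prod.rep_eq
  uminus_star_prod.rep_eq times_star_prod.rep_eq scaleC_star_prod.rep_eq star_star_prod.rep_eq

instance
proof
  fix a b c :: "'a star_prod" and z w :: complex
  note [intro!] = component_inject[THEN iffD1] ext
    and [simp] = rep_eqs component_mem component_undefined star_algebra.closed
  show "a + b + c = a + (b + c)"
    by (auto simp: star_algebra.plus_assoc)
  show "a + b = b + a"
    by (auto, rule star_algebra.plus_commute, auto)
  show "0 + a = a"
    by (auto simp: star_algebra.zero_plus)
  show "- a + a = 0"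
    by (auto simp: star_algebra.minus_plus_self)
  show "a - b = a + - b"
    by (auto simp: vminus_def)
  show "a * b * c = a * (b * c)"
    by (auto simp: star_algebra.times_assoc)
  show "(a + b) * c = a * c + b * c"
    by (auto simp: star_algebra.times_add_left)
  show "a * (b + c) = a * b + a * c"
    by (auto simp: star_algebra.times_add_right)
  show "z *\<^sub>C (a + b) = z *\<^sub>C a + z *\<^sub>C b"
    by (auto simp: star_algebra.scale_add_right)
  show "(z + w) *\<^sub>C a = z *\<^sub>C a + w *\<^sub>C a"
    by (auto simp: star_algebra.scale_add_left)
  show "z *\<^sub>C w *\<^sub>C a = (z * w) *\<^sub>C a"
    by (auto simp: star_algebra.scale_scale)
  show "1 *\<^sub>C a = a"
    by (auto simp: star_algebra.scale_one)
  show "(z *\<^sub>C a) * b = z *\<^sub>C (a * b)"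
    by (auto simp: star_algebra.times_scale_left)
  show "a * (z *\<^sub>C b) = z *\<^sub>C (a * b)"
    by (auto simp: star_algebra.times_scale_right)
  show "star (star a) = a"
    by (auto simp: star_algebra.adj_adj)
  show "star (a + b) = star a + star b"
    by (auto simp: star_algebra.adj_plus)
  show "star (z *\<^sub>C a) = cnj z *\<^sub>C star a"
    by (auto simp: star_algebra.adj_scale)
  show "star (a * b) = star b * star a"
    by (auto simp: star_algebra.adj_times)
qed

end

text \<open>\<open>star_prod\<close> is indexed by bare \<open>star_alg\<close> records. Truncating
  drops further fields such as the norm, so that a normed algebra finds its own place in the
  product.\<close>

definition proj :: "('a, 'm) star_alg_scheme \<Rightarrow> 'a star_prod \<Rightarrow> 'a" where
  "proj A f = component f (star_alg.truncate A)"

definition emb :: "('a, 'm) star_alg_scheme \<Rightarrow> 'a \<Rightarrow> 'a star_prod" where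
  "emb A a = Abs_star_prod (\<lambda>B. if star_algebra B
     then if B = star_alg.truncate A then a else vzero B else undefined)"

lemma truncate_simps [simp]:
  "carrier (star_alg.truncate A) = carrier A" "vzero (star_alg.truncate A) = vzero A"
  "vplus (star_alg.truncate A) = vplus A" "vscale (star_alg.truncate A) = vscale A"
  "vtimes (star_alg.truncate A) = vtimes A" "adj (star_alg.truncate A) = adj A"
  "vminus (star_alg.truncate A) = vminus A"
  by (simp_all add: star_alg.truncate_def vminus_def fun_eq_iff)

lemma star_algebra_truncate: "star_algebra (star_alg.truncate A) \<longleftrightarrow> star_algebra A"
  by (simp add: star_algebra_def)

context star_algebra
begin

lemma star_algebra_truncate' [simp]: "star_algebra (star_alg.truncate A)"
  using star_algebra_axioms by (simp add: star_algebra_truncate)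

lemma proj_closed [simp]: "proj A f \<in> carrier A"
  using component_mem[OF star_algebra_truncate', of f] by (simp add: proj_def)

lemma proj_hom [simp]:
  "proj A 0 = vzero A"
  "proj A (f + g) = vplus A (proj A f) (proj A g)"
  "proj A (f - g) = vminus A (proj A f) (proj A g)"
  "proj A (f * g) = vtimes A (proj A f) (proj A g)"
  "proj A (z *\<^sub>C f) = vscale A z (proj A f)"
  "proj A (star f) = adj A (proj A f)"
  "proj A (- f) = vscale A (-1) (proj A f)"
  by (simp_all add: proj_def zero_star_prod.rep_eq plus_star_prod.rep_eq minus_star_prod.rep_eq
      times_star_prod.rep_eq scaleC_star_prod.rep_eq star_star_prod.rep_eq uminus_star_prod.rep_eq)

lemma component_emb:
  assumes "a \<in> carrier A"
  shows "component (emb A a) = (\<lambda>B. if star_algebra B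
     then if B = star_alg.truncate A then a else vzero B else undefined)"
  unfolding emb_def using assms
  by (subst Abs_star_prod_inverse) (auto simp: place_def star_algebra.zero_closed)

lemma proj_emb [simp]: "a \<in> carrier A \<Longrightarrow> proj A (emb A a) = a"
  by (simp add: proj_def component_emb)

lemma emb_hom:
  "emb A (vzero A) = 0"
  "a \<in> carrier A \<Longrightarrow> b \<in> carrier A \<Longrightarrow> emb A (vplus A a b) = emb A a + emb A b"
  "a \<in> carrier A \<Longrightarrow> b \<in> carrier A \<Longrightarrow> emb A (vminus A a b) = emb A a - emb A b"
  "a \<in> carrier A \<Longrightarrow> b \<in> carrier A \<Longrightarrow> emb A (vtimes A a b) = emb A a * emb A b"
  "a \<in> carrier A \<Longrightarrow> emb A (vscale A z a) = z *\<^sub>C emb A a"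
  "a \<in> carrier A \<Longrightarrow> emb A (adj A a) = star (emb A a)"
  by (rule component_inject[THEN iffD1], rule ext,
      simp add: component_emb rep_eqs closed star_algebra.zero_plus star_algebra.zero_times
        star_algebra.scale_zero_right star_algebra.adj_zero star_algebra.zero_closed
        star_algebra.minus_self)+

lemma emb_eq_iff: "a \<in> carrier A \<Longrightarrow> b \<in> carrier A \<Longrightarrow> emb A a = emb A b \<longleftrightarrow> a = b"
  by (metis proj_emb)

end

section \<open>C*-seminorms\<close>

lemma null_limit:
  fixes f g :: "nat \<Rightarrow> real"
  assumes "\<And>n. f n \<le> g n" "\<And>n. 0 \<le> f n" "g \<longlonglongrightarrow> 0"
  shows "f \<longlonglongrightarrow> 0"
  using assms by (intro tendsto_sandwich[of "\<lambda>_. 0" f sequentially g]) auto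

locale cstar_seminormed =
  fixes p :: "'r::star_ring \<Rightarrow> real"
  assumes triangle: "p (x + y) \<le> p x + p y"
    and scale [simp]: "p (z *\<^sub>C x) = cmod z * p x"
    and submult: "p (x * y) \<le> p x * p y"
    and cstar: "p (star x * x) = (p x)\<^sup>2"
begin

lemma zero [simp]: "p 0 = 0"
  using scale[of 0 0] by simp

lemma minus [simp]: "p (- x) = p x"
  using scale[of "-1" x] by simp

lemma diff_commute: "p (x - y) = p (y - x)"
  using minus[of "x - y"] by simp

lemma nonneg [simp]: "0 \<le> p x"
  using triangle[of x "- x"] by simp

lemma diff_triangle: "p (x - z) \<le> p (x - y) + p (y - z)"
  using triangle[of "x - y" "y - z"] by simp

lemma diff_le: "p (x - y) \<le> p x + p y"
  using triangle[of x "- y"] by simp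

lemma abs_diff_le: "\<bar>p x - p y\<bar> \<le> p (x - y)"
  using triangle[of "x - y" y] triangle[of "y - x" x] diff_commute[of x y] by simp

lemma sum_le: "p (sum f I) \<le> (\<Sum>i\<in>I. p (f i))"
  by (induct I rule: infinite_finite_induct) (auto intro: order_trans[OF triangle])

text \<open>Isometry of the involution is not an axiom here: cancel one factor \<open>p x\<close> in
  \<open>p x ^ 2 = p (star x * x) \<le> p (star x) * p x\<close>.\<close>

lemma star_le: "p x \<le> p (star x)"
proof (cases "p x = 0")
  case False
  then have "p x * p x \<le> p (star x) * p x" "0 < p x"
    using submult[of "star x" x] cstar[of x] nonneg[of x] by (simp_all add: power2_eq_square less_le)
  then show ?thesis by simp
qed simp

lemma star_eq [simp]: "p (star x) = p x"
  using star_le[of x] star_le[of "star x"] by simp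

lemma null_mult: "p x = 0 \<Longrightarrow> p (x * y) = 0" "p y = 0 \<Longrightarrow> p (x * y) = 0"
  using submult[of x y] nonneg[of "x * y"] by auto

lemma mult_le_one: "p x \<le> 1 \<Longrightarrow> p y \<le> 1 \<Longrightarrow> p (x * y) \<le> 1"
  using submult[of x y] mult_le_one[of "p x" "p y"] nonneg[of y] by linarith

lemma projection_le_one: "star e = e \<Longrightarrow> e * e = e \<Longrightarrow> p e \<le> 1"
  using cstar[of e] nonneg[of e] by (cases "p e = 0") (auto simp: power2_eq_square)

end

primrec square_power :: "'r::star_ring \<Rightarrow> nat \<Rightarrow> 'r" where
  "square_power x 0 = star x * x"
| "square_power x (Suc n) = square_power x n * square_power x n"

lemma star_square_power [simp]: "star (square_power x n) = square_power x n"
  by (induct n) (simp_all add: star_mult)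

lemma (in cstar_seminormed) square_power_eq: "p (square_power x n) = p x ^ (2 * 2 ^ n)"
proof (induct n)
  case (Suc n)
  have "p (square_power x (Suc n)) = (p (square_power x n))\<^sup>2"
    using cstar[of "square_power x n"] by simp
  then show ?case by (simp add: Suc power_mult[symmetric] power2_eq_square power_add[symmetric])
qed (simp add: cstar power2_eq_square)

text \<open>For C*-seminorms, an estimate with a constant that grows subexponentially along powers
  improves itself to one with the constant \<open>1\<close>.\<close>

lemma power_trick:
  assumes p: "cstar_seminormed p" and q: "cstar_seminormed q"
    and le: "\<And>n. p (square_power x n) \<le> C * 2 ^ n * q (square_power x n)"
  shows "p x \<le> q x"
proof (rule ccontr)
  assume "\<not> p x \<le> q x"
  interpret p: cstar_seminormed p by fact
  interpret q: cstar_seminormed q by fact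
  have le': "p x ^ (2 * 2 ^ n) \<le> C * 2 ^ n * q x ^ (2 * 2 ^ n)" for n
    using le[of n] by (simp add: p.square_power_eq q.square_power_eq)
  have px: "p x > 0" using \<open>\<not> p x \<le> q x\<close> q.nonneg[of x] by linarith
  have "q x \<noteq> 0"
    using le'[of 0] mult_pos_pos[OF px px] by (auto simp: power2_eq_square)
  then have qx: "q x > 0" using q.nonneg[of x] by linarith
  define e where "e = p x / q x - 1"
  have e: "e > 0" using qx \<open>\<not> p x \<le> q x\<close> by (simp add: e_def)
  obtain n where n: "C / e\<^sup>2 < 2 ^ n" using real_arch_pow[of 2 "C / e\<^sup>2"] by auto
  define m :: nat where "m = 2 ^ n"
  \<comment> \<open>The seminorms carry the exponent \<open>2 * m\<close>. Bernoulli squared grows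
    like \<open>m ^ 2\<close> and so beats the constant \<open>C * m\<close>.\<close>
  have "1 + real m * e \<le> (1 + e) ^ m"
    using e by (intro Bernoulli_inequality) auto
  then have "(real m * e)\<^sup>2 \<le> ((1 + e) ^ m)\<^sup>2"
    using e by (intro power_mono) auto
  also have "\<dots> = (p x / q x) ^ (2 * 2 ^ n)"
    by (simp add: e_def m_def power_mult[symmetric] mult.commute)
  also have "\<dots> \<le> C * 2 ^ n"
    using le'[of n] qx by (simp add: power_divide divide_simps)
  finally have "real m * real m * e\<^sup>2 \<le> C * real m"
    by (simp add: m_def power_mult_distrib power2_eq_square ac_simps)
  then have "real m * (real m * e\<^sup>2) \<le> real m * C" by (simp add: ac_simps)
  then have "real m * e\<^sup>2 \<le> C" by (simp add: m_def power2_eq_square ac_simps)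
  then show False using n e by (simp add: m_def divide_simps)
qed

lemma (in star_algebra) seminormed_proj:
  assumes "cstar_seminorm A p"
  shows "cstar_seminormed (\<lambda>f. p (proj A f))"
  using assms unfolding cstar_seminorm_def by unfold_locales auto

lemma (in star_algebra) cstar_seminormI:
  assumes "\<And>x y. x \<in> carrier A \<Longrightarrow> y \<in> carrier A \<Longrightarrow> p (vplus A x y) \<le> p x + p y"
    and "\<And>z x. x \<in> carrier A \<Longrightarrow> p (vscale A z x) = cmod z * p x"
    and "\<And>x y. x \<in> carrier A \<Longrightarrow> y \<in> carrier A \<Longrightarrow> p (vtimes A x y) \<le> p x * p y"
    and "\<And>x. x \<in> carrier A \<Longrightarrow> p (vtimes A (adj A x) x) = (p x)\<^sup>2"
  shows "cstar_seminorm A p"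
  using assms unfolding cstar_seminorm_def by simp

section \<open>Square roots and automatic contractivity in C*-algebras\<close>

locale cstar_complete = cstar_seminormed p for p :: "'r::star_ring \<Rightarrow> real" +
  fixes C :: "'r set"
  assumes add_closed: "x \<in> C \<Longrightarrow> y \<in> C \<Longrightarrow> x + y \<in> C"
    and scaleC_closed: "x \<in> C \<Longrightarrow> z *\<^sub>C x \<in> C"
    and mult_closed: "x \<in> C \<Longrightarrow> y \<in> C \<Longrightarrow> x * y \<in> C"
    and star_closed: "x \<in> C \<Longrightarrow> star x \<in> C"
    and definite: "x \<in> C \<Longrightarrow> p x = 0 \<Longrightarrow> x = 0"
    and complete: "(\<And>n. \<sigma> n \<in> C) \<Longrightarrow> (\<And>e. e > 0 \<Longrightarrow> \<exists>N. \<forall>m\<ge>N. \<forall>n\<ge>N. p (\<sigma> m - \<sigma> n) < e)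
          \<Longrightarrow> \<exists>x\<in>C. (\<lambda>n. p (\<sigma> n - x)) \<longlonglongrightarrow> 0"
begin

lemma diff_closed: "x \<in> C \<Longrightarrow> y \<in> C \<Longrightarrow> x - y \<in> C"
  using add_closed[of x "(-1) *\<^sub>C y"] scaleC_closed[of y "-1"] by simp

lemmas closed = add_closed scaleC_closed mult_closed star_closed diff_closed

lemma limit_eqI:
  assumes "x \<in> C" "y \<in> C" "(\<lambda>n. p (\<sigma> n - x)) \<longlonglongrightarrow> 0" "(\<lambda>n. p (\<sigma> n - y)) \<longlonglongrightarrow> 0"
  shows "x = y"
proof -
  have "(\<lambda>n. p (\<sigma> n - x) + p (\<sigma> n - y)) \<longlonglongrightarrow> 0 + 0"
    by (intro tendsto_add assms)
  moreover have "p (x - y) \<le> p (\<sigma> n - x) + p (\<sigma> n - y)" for n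
    using diff_triangle[of x y "\<sigma> n"] by (simp add: diff_commute)
  ultimately have "p (x - y) \<le> 0"
    by (intro LIMSEQ_le_const) auto
  then have "p (x - y) = 0" using nonneg[of "x - y"] by linarith
  then show ?thesis using definite[of "x - y"] diff_closed assms by simp
qed

text \<open>Without a unit, \<open>b\<close> stands for \<open>1 - sqrt (1 - k)\<close>: the
  equation says \<open>(1 - b) ^ 2 = 1 - k\<close>. It is the limit of the iteration
  \<open>x \<mapsto> (k + x * x) / 2\<close> started at \<open>0\<close>, whose members are
  polynomials in \<open>k\<close>; hence \<open>b\<close> is selfadjoint and commutes with whatever
  commutes with \<open>k\<close>.\<close>

lemma square_root:
  assumes k: "k \<in> C" "star k = k" "p k < 1"
  obtains b where "b \<in> C" "star b = b" "b + b = k + b * b"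
    "\<And>y. y \<in> C \<Longrightarrow> y * k = k * y \<Longrightarrow> y * b = b * y"
proof -
  \<comment> \<open>The smaller root of \<open>p k + r * r = 2 * r\<close>: the iteration maps the
    ball of radius \<open>r\<close> into itself and contracts distances on it by the factor
    \<open>r < 1\<close>.\<close>
  define r where "r = 1 - sqrt (1 - p k)"
  have r: "0 \<le> r" "r < 1" "p k + r * r = 2 * r"
    using k(3) nonneg[of k] by (auto simp: r_def algebra_simps)
  define b where "b = rec_nat (0 *\<^sub>C k) (\<lambda>_ x. (1/2) *\<^sub>C (k + x * x))"
  have b0: "b 0 = 0" and bS: "b (Suc n) = (1/2) *\<^sub>C (k + b n * b n)" for n
    by (simp_all add: b_def)
  have bC: "b n \<in> C" for n
    by (induct n) (use k scaleC_closed[of k 0] in \<open>auto simp: b0 bS intro!: closed\<close>)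
  have b_star: "star (b n) = b n" for n
    by (induct n) (auto simp: b0 bS star_ring_simps k)
  have b_le: "p (b n) \<le> r" for n
  proof (induct n)
    case (Suc n)
    have "p (b n) * p (b n) \<le> r * r" using Suc r by (intro mult_mono) auto
    then have "p (k + b n * b n) \<le> p k + r * r"
      using triangle[of k "b n * b n"] submult[of "b n" "b n"] by linarith
    then show ?case using r by (simp add: bS)
  qed (simp add: b0 r)
  have comm: "y * b n = b n * y" if "y * k = k * y" for y n
  proof (induct n)
    case (Suc n)
    then have "y * (b n * b n) = b n * b n * y" by (metis mult.assoc)
    then show ?case using that by (simp add: bS algebra_simps scaleC_add_right)
  qed (simp add: b0)
  have bb: "b m * b n = b n * b m" for m n
    by (metis comm)
  have step: "p (b (Suc m) - b (Suc n)) \<le> r * p (b m - b n)" for m n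
  proof -
    have "b (Suc m) - b (Suc n) = (1/2) *\<^sub>C ((b m - b n) * (b m + b n))"
      by (simp add: bS algebra_simps bb[of m n] scaleC_add_right scaleC_diff_right)
    then have "p (b (Suc m) - b (Suc n)) = p ((b m - b n) * (b m + b n)) / 2" by simp
    also have "\<dots> \<le> p (b m - b n) * p (b m + b n) / 2"
      using submult by (simp add: divide_right_mono)
    also have "\<dots> \<le> p (b m - b n) * (2 * r) / 2"
      using triangle[of "b m" "b n"] b_le[of m] b_le[of n]
      by (intro divide_right_mono mult_left_mono) auto
    finally show ?thesis by (simp add: ac_simps)
  qed
  have tail: "p (b (n + j) - b n) \<le> r ^ n" for n j
  proof (induct n)
    case 0
    then show ?case using b_le[of j] r by (simp add: b0)
  next
    case (Suc n)
    have "p (b (Suc (n + j)) - b (Suc n)) \<le> r * p (b (n + j) - b n)" by (rule step)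
    also have "\<dots> \<le> r * r ^ n" using Suc r by (intro mult_left_mono) auto
    finally show ?case by simp
  qed
  have "\<exists>N. \<forall>m\<ge>N. \<forall>n\<ge>N. p (b m - b n) < e" if "e > 0" for e
  proof -
    obtain N where N: "r ^ N < e / 2" using real_arch_pow_inv[of "e/2" r] \<open>e > 0\<close> r by auto
    have "p (b m - b n) < e" if "m \<ge> N" "n \<ge> N" for m n
      using tail[of N "m - N"] tail[of N "n - N"] that N diff_triangle[of "b m" "b n" "b N"]
      by (simp add: diff_commute[of "b N"])
    then show ?thesis by blast
  qed
  from complete[of b, OF bC this] obtain l where l: "l \<in> C" "(\<lambda>n. p (b n - l)) \<longlonglongrightarrow> 0" by auto
  have mult_le: "p (y * b n - y * l) \<le> p y * p (b n - l)" "p (b n * y - l * y) \<le> p y * p (b n - l)" for y n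
    using submult[of y "b n - l"] submult[of "b n - l" y] by (simp_all add: algebra_simps)
  have lim_mult: "(\<lambda>n. p (y * b n - y * l)) \<longlonglongrightarrow> 0" "(\<lambda>n. p (b n * y - l * y)) \<longlonglongrightarrow> 0" for y
    by (rule null_limit[OF mult_le(1)], simp, rule tendsto_mult_right_zero[OF l(2)])
      (rule null_limit[OF mult_le(2)], simp, rule tendsto_mult_right_zero[OF l(2)])
  show ?thesis
  proof (rule that)
    show "l \<in> C" by fact
    have "p (b n - star l) = p (b n - l)" for n
      using star_eq[of "b n - l"] by (simp only: star_diff b_star)
    then have "(\<lambda>n. p (b n - star l)) \<longlonglongrightarrow> 0" using l(2) by simp
    then show "star l = l" using limit_eqI[of "star l" l b] l closed by simp
    show "y * l = l * y" if y: "y \<in> C" "y * k = k * y" for y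
      using limit_eqI[of "y * l" "l * y" "\<lambda>n. y * b n"] lim_mult[of y] y l
      by (simp add: closed comm)
    have "(\<lambda>n. p (b n * b n - l * l)) \<longlonglongrightarrow> 0"
    proof (rule null_limit)
      show "(\<lambda>n. (r + p l) * p (b n - l)) \<longlonglongrightarrow> 0" using tendsto_mult_right_zero[OF l(2)] .
      show "p (b n * b n - l * l) \<le> (r + p l) * p (b n - l)" for n
      proof -
        have "b n * b n - l * l = b n * (b n - l) + (b n - l) * l" by (simp add: algebra_simps)
        then have "p (b n * b n - l * l) \<le> p (b n) * p (b n - l) + p (b n - l) * p l"
          using triangle submult by (smt (verit))
        also have "\<dots> \<le> r * p (b n - l) + p (b n - l) * p l"
          by (intro add_mono mult_right_mono b_le) auto
        finally show ?thesis by (simp add: algebra_simps)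
      qed
    qed simp
    moreover have "p (b (Suc n) - (1/2) *\<^sub>C (k + l * l)) = p (b n * b n - l * l) / 2" for n
    proof -
      have "b (Suc n) - (1/2) *\<^sub>C (k + l * l) = (1/2) *\<^sub>C (b n * b n - l * l)"
        by (simp add: bS scaleC_add_right scaleC_diff_right)
      then show ?thesis by simp
    qed
    ultimately have "(\<lambda>n. p (b (Suc n) - (1/2) *\<^sub>C (k + l * l))) \<longlonglongrightarrow> 0"
      using tendsto_divide_zero[of "\<lambda>n. p (b n * b n - l * l)" sequentially 2] by presburger
    then have "l = (1/2) *\<^sub>C (k + l * l)"
      using limit_eqI[of l "(1/2) *\<^sub>C (k + l * l)" "\<lambda>n. b (Suc n)"] LIMSEQ_Suc[OF l(2)] l k
      by (simp add: closed)
    then have "2 *\<^sub>C l = 2 *\<^sub>C (1/2) *\<^sub>C (k + l * l)" by simp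
    then show "l + l = k + l * l" by (simp add: scaleC_two)
  qed
qed

text \<open>If \<open>h\<close> is selfadjoint of norm less than \<open>1\<close> and \<open>(1 - b)\<^sup>2 = 1 - h\<^sup>2\<close>, then
  \<open>1 - b + i h\<close> is a unitary with imaginary part \<open>h\<close>; unitaries act isometrically for every
  C*-seminorm.\<close>

lemma selfadjoint_contractive:
  assumes q: "cstar_seminormed q" and h: "h \<in> C" "star h = h" "p h < 1"
  shows "q h \<le> 1"
proof -
  interpret q: cstar_seminormed q by fact
  have "p (h * h) < 1"
    using cstar[of h] h power_less_one_iff[of "p h" 2] by simp
  then obtain b where b: "b \<in> C" "star b = b" "b + b = h * h + b * b" "h * b = b * h"
    using square_root[of "h * h"] h by (metis mult_closed star_mult mult.assoc)
  \<comment> \<open>\<open>w\<close> is \<open>u - 1\<close> for the unitary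
    \<open>u = 1 - b + i h\<close>. The two equations labelled \<open>0\<close> below say
    \<open>star u * u = 1 = u * star u\<close>, and \<open>h + w * h\<close> is
    \<open>u * h\<close>.\<close>
  define w where "w = \<i> *\<^sub>C h - b"
  have w: "star w = - b - \<i> *\<^sub>C h"
    using b h by (simp add: w_def star_ring_simps)
  have "star w * w = h * h + b * b" "w * star w = h * h + b * b"
    unfolding w by (simp_all add: w_def algebra_simps b scaleC_diff_right scaleC_add_right)
  then have 0: "w + star w + star w * w = 0" "w + star w + w * star w = 0"
    unfolding w by (simp_all add: w_def b(3)[symmetric])
  have "star (h + w * h) * (h + w * h) = star h * h + star h * (w + star w + star w * w) * h"
    "star (h + star w * h) * (h + star w * h) = star h * h + star h * (w + star w + w * star w) * h"
    by (simp_all add: algebra_simps star_ring_simps)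
  then have "(q (h + w * h))\<^sup>2 = (q h)\<^sup>2" "(q (h + star w * h))\<^sup>2 = (q h)\<^sup>2"
    unfolding 0 by (simp_all flip: q.cstar)
  then have "q (h + w * h) = q h" "q (h + star w * h) = q h"
    by (simp_all add: power2_eq_iff_nonneg)
  \<comment> \<open>The elements \<open>u * h\<close> and \<open>star u * h\<close> have the
    seminorm of \<open>h\<close>, and their difference is \<open>2 i h * h\<close>; this gives
    \<open>q (h * h) \<le> q h\<close>.\<close>
  moreover have "(h + w * h) - (h + star w * h) = (2 * \<i>) *\<^sub>C (h * h)"
    unfolding w by (simp add: w_def algebra_simps scaleC_add_left[symmetric] mult_2)
  ultimately have "2 * q (h * h) \<le> 2 * q h"
    using q.diff_le[of "h + w * h" "h + star w * h"] by (simp add: norm_mult)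
  then have "q h * q h \<le> q h" using q.cstar[of h] h by (simp add: power2_eq_square)
  then show ?thesis using q.nonneg[of h] by (cases "q h = 0") auto
qed

text \<open>The seminorm form of the fact that *-homomorphisms out of a C*-algebra are contractive.
  The selfadjoint \<open>star x * x\<close>, scaled by any \<open>t\<close> above its norm, falls
  under \<open>selfadjoint_contractive\<close>; the C*-identity returns to \<open>x\<close>.\<close>

lemma contractive:
  assumes q: "cstar_seminormed q" and x: "x \<in> C"
  shows "q x \<le> p x"
proof -
  interpret q: cstar_seminormed q by fact
  define h where "h = star x * x"
  have h: "h \<in> C" "star h = h" using x by (auto simp: h_def closed star_mult)
  have "q h \<le> t" if t: "p h < t" for t
  proof -
    have "t > 0" using t nonneg[of h] by linarith
    then have "q ((1/t) *\<^sub>C h) \<le> 1"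
      using t h by (intro selfadjoint_contractive q) (auto simp: closed norm_divide)
    then show ?thesis using \<open>t > 0\<close> by (simp add: norm_divide divide_simps)
  qed
  then have "q h \<le> p h" by (rule dense_ge)
  then show ?thesis
    unfolding h_def cstar q.cstar by (simp add: power2_le_iff_abs_le)
qed

end

lemma (in cstar_algebra) cstar_complete_emb:
  "cstar_complete (\<lambda>f. vnorm A (proj A f)) (emb A ` carrier A)"
proof -
  interpret cstar_seminormed "\<lambda>f. vnorm A (proj A f)"
    by (rule seminormed_proj[OF norm_cstar_seminorm])
  show ?thesis
  proof
    fix \<sigma> :: "nat \<Rightarrow> _" assume \<sigma>: "\<And>n. \<sigma> n \<in> emb A ` carrier A"
      and c: "\<And>e. e > 0 \<Longrightarrow> \<exists>N. \<forall>m\<ge>N. \<forall>n\<ge>N. vnorm A (proj A (\<sigma> m - \<sigma> n)) < e"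
    have "(\<lambda>n. proj A (\<sigma> n)) \<in> cauchy_seqs A (vnorm A)"
      unfolding cauchy_seqs_def using c by simp
    then obtain x where "x \<in> carrier A" "(\<lambda>n. vnorm A (vminus A (proj A (\<sigma> n)) x)) \<longlonglongrightarrow> 0"
      using norm_complete by blast
    then show "\<exists>x\<in>emb A ` carrier A. (\<lambda>n. vnorm A (proj A (\<sigma> n - x))) \<longlonglongrightarrow> 0"
      by (intro bexI[of _ "emb A x"]) auto
  qed (use norm_definite in \<open>auto simp flip: emb_hom simp: closed\<close>)
qed

lemma (in cstar_algebra) cstar_seminorm_le:
  assumes "cstar_seminorm A q" "x \<in> carrier A"
  shows "q x \<le> vnorm A x"
  using cstar_complete.contractive[OF cstar_complete_emb seminormed_proj[OF assms(1)], of "emb A x"] assms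
  by simp

section \<open>Separated completions\<close>

context cstar_seminormed
begin

definition cauchy :: "(nat \<Rightarrow> 'r) \<Rightarrow> bool" where
  "cauchy \<sigma> \<longleftrightarrow> (\<forall>e>0. \<exists>N. \<forall>m\<ge>N. \<forall>n\<ge>N. p (\<sigma> m - \<sigma> n) < e)"

definition null :: "(nat \<Rightarrow> 'r) \<Rightarrow> bool" where
  "null \<sigma> \<longleftrightarrow> (\<lambda>n. p (\<sigma> n)) \<longlonglongrightarrow> 0"

lemma cauchy_const: "cauchy (\<lambda>_. x)"
  by (simp add: cauchy_def)

lemma cauchy_norm: "cauchy \<sigma> \<Longrightarrow> convergent (\<lambda>n. p (\<sigma> n))"
  unfolding cauchy_def
  by (intro Cauchy_convergent CauchyI) (metis abs_diff_le le_less_trans real_norm_def)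

lemma cauchy_bounded: "cauchy \<sigma> \<Longrightarrow> \<exists>B>0. \<forall>n. p (\<sigma> n) \<le> B"
  using convergent_imp_Bseq[OF cauchy_norm[of \<sigma>]] by (auto simp: Bseq_def)

lemma cauchyI:
  assumes "cauchy \<sigma>" "cauchy \<tau>" "B \<ge> 0"
    and "\<And>m n. p (\<rho> m - \<rho> n) \<le> B * p (\<sigma> m - \<sigma> n) + B * p (\<tau> m - \<tau> n)"
  shows "cauchy \<rho>"
  unfolding cauchy_def
proof (intro allI impI)
  fix e :: real assume "e > 0"
  then have e: "e / (2 * B + 1) > 0" using assms by simp
  obtain M N where M: "\<forall>m\<ge>M. \<forall>n\<ge>M. p (\<sigma> m - \<sigma> n) < e / (2 * B + 1)"
    and N: "\<forall>m\<ge>N. \<forall>n\<ge>N. p (\<tau> m - \<tau> n) < e / (2 * B + 1)"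
    using assms(1,2) e unfolding cauchy_def by meson
  have "p (\<rho> m - \<rho> n) < e" if "m \<ge> max M N" "n \<ge> max M N" for m n
  proof -
    have "p (\<rho> m - \<rho> n) \<le> B * (e / (2 * B + 1)) + B * (e / (2 * B + 1))"
      using assms(4)[of m n] M N that assms(3)
      by (smt (verit) max.boundedE mult_left_mono)
    also have "\<dots> < (2 * B + 1) * (e / (2 * B + 1))"
      unfolding distrib_right using e by simp
    also have "\<dots> = e" using assms(3) by simp
    finally show ?thesis .
  qed
  then show "\<exists>N. \<forall>m\<ge>N. \<forall>n\<ge>N. p (\<rho> m - \<rho> n) < e" by blast
qed

lemma cauchy_add:
  assumes "cauchy \<sigma>" "cauchy \<tau>"
  shows "cauchy (\<lambda>n. \<sigma> n + \<tau> n)"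
  using assms
  by (rule cauchyI[where B = 1]) (auto simp: add_diff_add intro: triangle)

lemma cauchy_scaleC: "cauchy \<sigma> \<Longrightarrow> cauchy (\<lambda>n. z *\<^sub>C \<sigma> n)"
  by (rule cauchyI[where B = "cmod z" and \<sigma> = \<sigma> and \<tau> = \<sigma>])
    (simp_all flip: scaleC_diff_right)

lemma cauchy_star: "cauchy \<sigma> \<Longrightarrow> cauchy (\<lambda>n. star (\<sigma> n))"
  by (simp add: cauchy_def flip: star_diff)

lemma mult_diff_le: "p (x * y - x' * y') \<le> p y * p (x - x') + p x' * p (y - y')"
proof -
  have "x * y - x' * y' = (x - x') * y + x' * (y - y')" by (simp add: algebra_simps)
  then show ?thesis
    using triangle[of "(x - x') * y" "x' * (y - y')"] submult[of "x - x'" y] submult[of x' "y - y'"]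
    by (simp add: mult.commute)
qed

lemma cauchy_mult:
  assumes "cauchy \<sigma>" "cauchy \<tau>"
  shows "cauchy (\<lambda>n. \<sigma> n * \<tau> n)"
proof -
  obtain B B' where B: "B > 0" "\<forall>n. p (\<sigma> n) \<le> B" and B': "B' > 0" "\<forall>n. p (\<tau> n) \<le> B'"
    using assms cauchy_bounded by meson
  show ?thesis
    using assms
  proof (rule cauchyI[where B = "max B B'"])
    fix m n
    show "p (\<sigma> m * \<tau> m - \<sigma> n * \<tau> n) \<le> max B B' * p (\<sigma> m - \<sigma> n) + max B B' * p (\<tau> m - \<tau> n)"
      using B B' by (intro order_trans[OF mult_diff_le] add_mono mult_right_mono)
        (auto intro: le_max_iff_disj[THEN iffD2])
  qed (use B in auto)
qed

lemma null_add: "null \<sigma> \<Longrightarrow> null \<tau> \<Longrightarrow> null (\<lambda>n. \<sigma> n + \<tau> n)"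
  unfolding null_def
  by (rule null_limit[OF triangle], simp) (rule tendsto_add_zero)

lemma null_zero: "null (\<lambda>_. 0)"
  by (simp add: null_def)

lemma null_sym: "null (\<lambda>n. \<sigma> n - \<tau> n) \<Longrightarrow> null (\<lambda>n. \<tau> n - \<sigma> n)"
  by (simp add: null_def diff_commute)

lemma null_scaleC: "null \<sigma> \<Longrightarrow> null (\<lambda>n. z *\<^sub>C \<sigma> n)"
  unfolding null_def by (simp add: tendsto_mult_right_zero)

lemma null_star: "null \<sigma> \<Longrightarrow> null (\<lambda>n. star (\<sigma> n))"
  by (simp add: null_def)

lemma null_mult_diff:
  assumes "cauchy \<tau>" "cauchy \<sigma>'" "null (\<lambda>n. \<sigma> n - \<sigma>' n)" "null (\<lambda>n. \<tau> n - \<tau>' n)"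
  shows "null (\<lambda>n. \<sigma> n * \<tau> n - \<sigma>' n * \<tau>' n)"
proof -
  obtain B B' where B: "B > 0" "\<forall>n. p (\<tau> n) \<le> B" and B': "B' > 0" "\<forall>n. p (\<sigma>' n) \<le> B'"
    using assms cauchy_bounded by meson
  show ?thesis
    unfolding null_def
  proof (rule null_limit)
    show "(\<lambda>n. B * p (\<sigma> n - \<sigma>' n) + B' * p (\<tau> n - \<tau>' n)) \<longlonglongrightarrow> 0"
      using assms(3,4) unfolding null_def
      by (intro tendsto_add_zero tendsto_mult_right_zero)
    show "p (\<sigma> n * \<tau> n - \<sigma>' n * \<tau>' n) \<le> B * p (\<sigma> n - \<sigma>' n) + B' * p (\<tau> n - \<tau>' n)" for n
      using B B' by (intro order_trans[OF mult_diff_le] add_mono mult_right_mono) auto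
  qed simp
qed

lemma null_cauchy:
  assumes "null \<sigma>"
  shows "cauchy \<sigma>"
  unfolding cauchy_def
proof (intro allI impI)
  fix e :: real assume "e > 0"
  then obtain N where N: "\<forall>n\<ge>N. p (\<sigma> n) < e / 2"
    using assms unfolding null_def LIMSEQ_def
    by (metis dist_0_norm dist_commute half_gt_zero real_norm_def abs_of_nonneg nonneg)
  have "p (\<sigma> m - \<sigma> n) < e" if "m \<ge> N" "n \<ge> N" for m n
    using diff_le[of "\<sigma> m" "\<sigma> n"] N that by (smt (verit) field_sum_of_halves)
  then show "\<exists>N. \<forall>m\<ge>N. \<forall>n\<ge>N. p (\<sigma> m - \<sigma> n) < e" by blast
qed

lemma cauchy_null:
  assumes "cauchy \<sigma>" "null (\<lambda>n. \<sigma> n - \<tau> n)"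
  shows "cauchy \<tau>"
  using cauchy_add[OF assms(1) cauchy_scaleC[OF null_cauchy[OF assms(2)], of "-1"]] by simp

lemma null_norm:
  assumes "null (\<lambda>n. \<sigma> n - \<tau> n)" "(\<lambda>n. p (\<sigma> n)) \<longlonglongrightarrow> r"
  shows "(\<lambda>n. p (\<tau> n)) \<longlonglongrightarrow> r"
proof -
  have "(\<lambda>n. \<bar>p (\<sigma> n) - p (\<tau> n)\<bar>) \<longlonglongrightarrow> 0"
    using assms(1) unfolding null_def by (rule null_limit[OF abs_diff_le, rotated]) simp
  then have "(\<lambda>n. p (\<sigma> n) - p (\<tau> n)) \<longlonglongrightarrow> 0" by (simp add: tendsto_rabs_zero_iff)
  from tendsto_diff[OF assms(2) this] show ?thesis by simp
qed

end

locale seminormed_star_algebra = star_algebra X for X :: "('a, 'm) star_alg_scheme" +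
  fixes p :: "'a \<Rightarrow> real"
  assumes cstar_seminorm: "cstar_seminorm X p"
begin

sublocale P: cstar_seminormed "\<lambda>f. p (proj X f)"
  by (rule seminormed_proj[OF cstar_seminorm])

abbreviation "Cs \<equiv> cauchy_seqs X p"
abbreviation "K \<equiv> cstar_completion X p"

definition cls :: "(nat \<Rightarrow> 'a) \<Rightarrow> (nat \<Rightarrow> 'a) set" where
  "cls \<sigma> = null_rel X p `` {\<sigma>}"

lemma Cs_iff: "\<sigma> \<in> Cs \<longleftrightarrow> (\<forall>n. \<sigma> n \<in> carrier X) \<and> P.cauchy (\<lambda>n. emb X (\<sigma> n))"
  by (auto simp: cauchy_seqs_def P.cauchy_def)

lemma Cs_mem [simp]: "\<sigma> \<in> Cs \<Longrightarrow> \<sigma> n \<in> carrier X"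
  by (simp add: Cs_iff)

lemma null_rel_iff:
  "(\<sigma>, \<tau>) \<in> null_rel X p \<longleftrightarrow> \<sigma> \<in> Cs \<and> \<tau> \<in> Cs \<and> P.null (\<lambda>n. emb X (\<sigma> n) - emb X (\<tau> n))"
  by (auto simp: null_rel_def P.null_def Cs_iff)

lemma equiv_null_rel: "equiv Cs (null_rel X p)"
proof (rule equivI)
  show "refl_on Cs (null_rel X p)"
    by (auto simp: refl_on_def null_rel_iff P.null_zero)
  show "null_rel X p \<subseteq> Cs \<times> Cs"
    by (auto simp: null_rel_iff)
  show "sym (null_rel X p)"
    by (auto simp: sym_def null_rel_iff intro: P.null_sym)
  show "trans (null_rel X p)"
    using P.null_add[of "\<lambda>n. emb X (x n) - emb X (y n)" "\<lambda>n. emb X (y n) - emb X (z n)" for x y z]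
    by (auto simp: trans_def null_rel_iff)
qed

lemma cls_eq_iff: "\<sigma> \<in> Cs \<Longrightarrow> \<tau> \<in> Cs \<Longrightarrow> cls \<sigma> = cls \<tau> \<longleftrightarrow> (\<sigma>, \<tau>) \<in> null_rel X p"
  unfolding cls_def using eq_equiv_class_iff[OF equiv_null_rel] .

lemma mem_cls: "\<tau> \<in> cls \<sigma> \<longleftrightarrow> (\<sigma>, \<tau>) \<in> null_rel X p"
  by (simp add: cls_def)

lemma mem_cls_self [simp]: "\<sigma> \<in> Cs \<Longrightarrow> \<sigma> \<in> cls \<sigma>"
  by (simp add: mem_cls null_rel_iff P.null_zero)

lemma cls_null: "\<tau> \<in> cls \<sigma> \<Longrightarrow> P.null (\<lambda>n. emb X (\<tau> n) - emb X (\<sigma> n))"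
  and cls_Cs: "\<tau> \<in> cls \<sigma> \<Longrightarrow> \<tau> \<in> Cs"
  by (auto simp: mem_cls null_rel_iff intro: P.null_sym)

lemma carrier_K: "carrier K = cls ` Cs"
  by (auto simp: cstar_completion_def quotient_def cls_def)

lemma cls_in_K [simp]: "\<sigma> \<in> Cs \<Longrightarrow> cls \<sigma> \<in> carrier K"
  by (simp add: carrier_K)

lemma Cs_closed [simp]:
  "x \<in> carrier X \<Longrightarrow> (\<lambda>_. x) \<in> Cs"
  "\<sigma> \<in> Cs \<Longrightarrow> \<tau> \<in> Cs \<Longrightarrow> (\<lambda>n. vplus X (\<sigma> n) (\<tau> n)) \<in> Cs"
  "\<sigma> \<in> Cs \<Longrightarrow> (\<lambda>n. vscale X z (\<sigma> n)) \<in> Cs"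
  "\<sigma> \<in> Cs \<Longrightarrow> \<tau> \<in> Cs \<Longrightarrow> (\<lambda>n. vtimes X (\<sigma> n) (\<tau> n)) \<in> Cs"
  "\<sigma> \<in> Cs \<Longrightarrow> (\<lambda>n. adj X (\<sigma> n)) \<in> Cs"
  by (auto simp: Cs_iff emb_hom closed P.cauchy_const P.cauchy_add P.cauchy_scaleC P.cauchy_mult
      P.cauchy_star)

lemma UN_const_eq: "A \<noteq> {} \<Longrightarrow> (\<And>a. a \<in> A \<Longrightarrow> f a = c) \<Longrightarrow> (\<Union>a\<in>A. f a) = c"
  by auto

text \<open>On classes the operations are unions over all representatives. Independence of the
  representatives makes all members of such a union equal, so that it collapses to a single
  class.\<close>

lemma K_ops:
  "vzero K = cls (\<lambda>_. vzero X)"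
  "\<sigma> \<in> Cs \<Longrightarrow> \<tau> \<in> Cs \<Longrightarrow> vplus K (cls \<sigma>) (cls \<tau>) = cls (\<lambda>n. vplus X (\<sigma> n) (\<tau> n))"
  "\<sigma> \<in> Cs \<Longrightarrow> vscale K z (cls \<sigma>) = cls (\<lambda>n. vscale X z (\<sigma> n))"
  "\<sigma> \<in> Cs \<Longrightarrow> \<tau> \<in> Cs \<Longrightarrow> vtimes K (cls \<sigma>) (cls \<tau>) = cls (\<lambda>n. vtimes X (\<sigma> n) (\<tau> n))"
  "\<sigma> \<in> Cs \<Longrightarrow> adj K (cls \<sigma>) = cls (\<lambda>n. adj X (\<sigma> n))"
proof -
  show "vzero K = cls (\<lambda>_. vzero X)"
    by (simp add: cstar_completion_def cls_def)
  assume \<sigma>: "\<sigma> \<in> Cs"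
  show "vscale K z (cls \<sigma>) = cls (\<lambda>n. vscale X z (\<sigma> n))"
    unfolding cstar_completion_def using \<sigma>
  proof (simp flip: cls_def, intro UN_const_eq)
    fix \<tau> assume "\<tau> \<in> cls \<sigma>"
    then have "\<tau> \<in> Cs" "P.null (\<lambda>n. emb X (\<tau> n) - emb X (\<sigma> n))"
      using cls_null cls_Cs by auto
    then show "cls (\<lambda>n. vscale X z (\<tau> n)) = cls (\<lambda>n. vscale X z (\<sigma> n))"
      using \<sigma> P.null_scaleC[of _ z] by (simp add: cls_eq_iff null_rel_iff emb_hom flip: scaleC_diff_right)
  qed (use \<sigma> mem_cls_self in blast)
  show "adj K (cls \<sigma>) = cls (\<lambda>n. adj X (\<sigma> n))"
    unfolding cstar_completion_def using \<sigma>
  proof (simp flip: cls_def, intro UN_const_eq)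
    fix \<tau> assume "\<tau> \<in> cls \<sigma>"
    then have "\<tau> \<in> Cs" "P.null (\<lambda>n. emb X (\<tau> n) - emb X (\<sigma> n))"
      using cls_null cls_Cs by auto
    then show "cls (\<lambda>n. adj X (\<tau> n)) = cls (\<lambda>n. adj X (\<sigma> n))"
      using \<sigma> P.null_star by (simp add: cls_eq_iff null_rel_iff emb_hom flip: star_diff)
  qed (use \<sigma> mem_cls_self in blast)
  assume \<tau>: "\<tau> \<in> Cs"
  show "vplus K (cls \<sigma>) (cls \<tau>) = cls (\<lambda>n. vplus X (\<sigma> n) (\<tau> n))"
    unfolding cstar_completion_def using \<sigma> \<tau>
  proof (simp flip: cls_def, intro UN_const_eq)
    fix \<sigma>' \<tau>' assume "\<sigma>' \<in> cls \<sigma>" "\<tau>' \<in> cls \<tau>"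
    then have "\<sigma>' \<in> Cs" "P.null (\<lambda>n. emb X (\<sigma>' n) - emb X (\<sigma> n))"
      "\<tau>' \<in> Cs" "P.null (\<lambda>n. emb X (\<tau>' n) - emb X (\<tau> n))"
      using cls_null cls_Cs by auto
    then show "cls (\<lambda>n. vplus X (\<sigma>' n) (\<tau>' n)) = cls (\<lambda>n. vplus X (\<sigma> n) (\<tau> n))"
      using \<sigma> \<tau> P.null_add by (simp add: cls_eq_iff null_rel_iff emb_hom add_diff_add)
  qed (use \<sigma> \<tau> mem_cls_self in blast)+
  show "vtimes K (cls \<sigma>) (cls \<tau>) = cls (\<lambda>n. vtimes X (\<sigma> n) (\<tau> n))"
    unfolding cstar_completion_def using \<sigma> \<tau>
  proof (simp flip: cls_def, intro UN_const_eq)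
    fix \<sigma>' \<tau>' assume "\<sigma>' \<in> cls \<sigma>" "\<tau>' \<in> cls \<tau>"
    then have *: "\<sigma>' \<in> Cs" "P.null (\<lambda>n. emb X (\<sigma>' n) - emb X (\<sigma> n))"
      "\<tau>' \<in> Cs" "P.null (\<lambda>n. emb X (\<tau>' n) - emb X (\<tau> n))"
      using cls_null cls_Cs by auto
    then have "P.cauchy (\<lambda>n. emb X (\<tau>' n))" "P.cauchy (\<lambda>n. emb X (\<sigma> n))"
      using \<sigma> by (auto simp: Cs_iff)
    from P.null_mult_diff[OF this *(2,4)]
    show "cls (\<lambda>n. vtimes X (\<sigma>' n) (\<tau>' n)) = cls (\<lambda>n. vtimes X (\<sigma> n) (\<tau> n))"
      using * \<sigma> \<tau> by (simp add: cls_eq_iff null_rel_iff emb_hom)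
  qed (use \<sigma> \<tau> mem_cls_self in blast)+
qed

lemma vminus_K: "\<sigma> \<in> Cs \<Longrightarrow> \<tau> \<in> Cs \<Longrightarrow> vminus K (cls \<sigma>) (cls \<tau>) = cls (\<lambda>n. vminus X (\<sigma> n) (\<tau> n))"
  by (simp add: vminus_def K_ops)

lemma norm_K:
  assumes \<sigma>: "\<sigma> \<in> Cs"
  shows "(\<lambda>n. p (\<sigma> n)) \<longlonglongrightarrow> vnorm K (cls \<sigma>)"
proof -
  have "convergent (\<lambda>n. p (\<sigma> n))"
    using P.cauchy_norm[of "\<lambda>n. emb X (\<sigma> n)"] \<sigma> by (simp add: Cs_iff)
  then obtain r where r: "(\<lambda>n. p (\<sigma> n)) \<longlonglongrightarrow> r" by (auto simp: convergent_def)
  have all: "(\<lambda>n. p (\<tau> n)) \<longlonglongrightarrow> r" if "\<tau> \<in> cls \<sigma>" for \<tau>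
    using P.null_norm[of "\<lambda>n. emb X (\<sigma> n)" "\<lambda>n. emb X (\<tau> n)" r] that \<sigma> r
    by (simp add: mem_cls null_rel_iff)
  have "(THE r. \<forall>\<tau>\<in>cls \<sigma>. (\<lambda>n. p (\<tau> n)) \<longlonglongrightarrow> r) = r"
    using all LIMSEQ_unique \<sigma> mem_cls_self by (intro the_equality) blast+
  then show ?thesis using r by (simp add: cstar_completion_def)
qed

lemma norm_K_eqI: "\<sigma> \<in> Cs \<Longrightarrow> (\<lambda>n. p (\<sigma> n)) \<longlonglongrightarrow> r \<Longrightarrow> vnorm K (cls \<sigma>) = r"
  using norm_K LIMSEQ_unique by blast

lemma star_algebra_K: "star_algebra K"
proof
  fix S assume "S \<in> carrier K"
  then obtain \<sigma> where S: "S = cls \<sigma>" and \<sigma>: "\<sigma> \<in> Cs" by (auto simp: carrier_K)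
  note [simp] = S \<sigma> K_ops closed
  fix z w
  show "vscale K z S \<in> carrier K" "adj K S \<in> carrier K" by simp_all
  show "vplus K S (vzero K) = S" by (simp add: plus_zero)
  show "vminus K S S = vzero K" using minus_self by (simp add: vminus_def)
  show "vscale K 1 S = S" by (simp add: scale_one)
  show "vscale K z (vscale K w S) = vscale K (z * w) S" by (simp add: scale_scale)
  show "vscale K (z + w) S = vplus K (vscale K z S) (vscale K w S)" by (simp add: scale_add_left)
  show "adj K (adj K S) = S" by (simp add: adj_adj)
  show "adj K (vscale K z S) = vscale K (cnj z) (adj K S)" by (simp add: adj_scale)
  fix T assume "T \<in> carrier K"
  then obtain \<tau> where T: "T = cls \<tau>" and \<tau>: "\<tau> \<in> Cs" by (auto simp: carrier_K)
  note [simp] = T \<tau>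
  show "vplus K S T \<in> carrier K" "vtimes K S T \<in> carrier K" by simp_all
  show "vplus K S T = vplus K T S" using plus_commute[of "\<sigma> n" "\<tau> n" for n] by simp
  show "vscale K z (vplus K S T) = vplus K (vscale K z S) (vscale K z T)"
    by (simp add: scale_add_right)
  show "vtimes K (vscale K z S) T = vscale K z (vtimes K S T)" by (simp add: times_scale_left)
  show "vtimes K S (vscale K z T) = vscale K z (vtimes K S T)" by (simp add: times_scale_right)
  show "adj K (vplus K S T) = vplus K (adj K S) (adj K T)" by (simp add: adj_plus)
  show "adj K (vtimes K S T) = vtimes K (adj K T) (adj K S)" by (simp add: adj_times)
  fix U assume "U \<in> carrier K"
  then obtain \<upsilon> where U: "U = cls \<upsilon>" and \<upsilon>: "\<upsilon> \<in> Cs" by (auto simp: carrier_K)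
  note [simp] = U \<upsilon>
  show "vplus K (vplus K S T) U = vplus K S (vplus K T U)" by (simp add: plus_assoc)
  show "vtimes K (vtimes K S T) U = vtimes K S (vtimes K T U)" by (simp add: times_assoc)
  show "vtimes K (vplus K S T) U = vplus K (vtimes K S U) (vtimes K T U)"
    by (simp add: times_add_left)
  show "vtimes K S (vplus K T U) = vplus K (vtimes K S T) (vtimes K S U)"
    by (simp add: times_add_right)
qed (simp add: K_ops closed)

sublocale K: star_algebra K
  by (rule star_algebra_K)

lemma seminorm_rules:
  "x \<in> carrier X \<Longrightarrow> y \<in> carrier X \<Longrightarrow> p (vplus X x y) \<le> p x + p y"
  "x \<in> carrier X \<Longrightarrow> p (vscale X z x) = cmod z * p x"
  "x \<in> carrier X \<Longrightarrow> y \<in> carrier X \<Longrightarrow> p (vtimes X x y) \<le> p x * p y"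
  "x \<in> carrier X \<Longrightarrow> p (vtimes X (adj X x) x) = (p x)\<^sup>2"
  using cstar_seminorm unfolding cstar_seminorm_def by auto

lemma cstar_seminorm_K: "cstar_seminorm K (vnorm K)"
proof (rule K.cstar_seminormI)
  fix S assume "S \<in> carrier K"
  then obtain \<sigma> where S: "S = cls \<sigma>" and \<sigma>: "\<sigma> \<in> Cs" by (auto simp: carrier_K)
  note [simp] = S \<sigma> K_ops closed
  note lim_S = norm_K[OF \<sigma>]
  show "vnorm K (vscale K z S) = cmod z * vnorm K S" for z
    using tendsto_mult_left[OF lim_S, of "cmod z"] by (simp add: norm_K_eqI seminorm_rules)
  show "vnorm K (vtimes K (adj K S) S) = (vnorm K S)\<^sup>2"
    using tendsto_power[OF lim_S, of 2] by (simp add: norm_K_eqI seminorm_rules)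
  fix T assume "T \<in> carrier K"
  then obtain \<tau> where T: "T = cls \<tau>" and \<tau>: "\<tau> \<in> Cs" by (auto simp: carrier_K)
  note [simp] = T \<tau>
  note lim_T = norm_K[OF \<tau>]
  show "vnorm K (vplus K S T) \<le> vnorm K S + vnorm K T"
    using LIMSEQ_le[OF norm_K tendsto_add[OF lim_S lim_T], of "\<lambda>n. vplus X (\<sigma> n) (\<tau> n)"]
    by (simp add: seminorm_rules)
  show "vnorm K (vtimes K S T) \<le> vnorm K S * vnorm K T"
    using LIMSEQ_le[OF norm_K tendsto_mult[OF lim_S lim_T], of "\<lambda>n. vtimes X (\<sigma> n) (\<tau> n)"]
    by (simp add: seminorm_rules)
qed

sublocale KP: cstar_seminormed "\<lambda>f. vnorm K (proj K f)"
  by (rule K.seminormed_proj[OF cstar_seminorm_K])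

abbreviation "inc \<equiv> to_completion X p"

lemma inc_cls: "inc x = cls (\<lambda>_. x)"
  by (simp add: to_completion_def cls_def)

lemma inc_closed [simp]: "x \<in> carrier X \<Longrightarrow> inc x \<in> carrier K"
  by (simp add: inc_cls)

lemma inc_hom:
  "inc (vzero X) = vzero K"
  "x \<in> carrier X \<Longrightarrow> y \<in> carrier X \<Longrightarrow> inc (vplus X x y) = vplus K (inc x) (inc y)"
  "x \<in> carrier X \<Longrightarrow> y \<in> carrier X \<Longrightarrow> inc (vminus X x y) = vminus K (inc x) (inc y)"
  "x \<in> carrier X \<Longrightarrow> inc (vscale X z x) = vscale K z (inc x)"
  "x \<in> carrier X \<Longrightarrow> y \<in> carrier X \<Longrightarrow> inc (vtimes X x y) = vtimes K (inc x) (inc y)"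
  "x \<in> carrier X \<Longrightarrow> inc (adj X x) = adj K (inc x)"
  by (simp_all add: inc_cls K_ops vminus_K)

lemma inc_star_hom: "inc \<in> star_hom X K"
  by (simp add: star_hom_def inc_hom)

lemma norm_inc: "x \<in> carrier X \<Longrightarrow> vnorm K (inc x) = p x"
  by (simp add: inc_cls norm_K_eqI)

lemma norm_diff_inc_limit:
  assumes \<sigma>: "\<sigma> \<in> Cs" and e: "e > 0"
  shows "\<exists>N. \<forall>n\<ge>N. vnorm K (vminus K (cls \<sigma>) (inc (\<sigma> n))) < e"
proof -
  obtain N where N: "\<forall>m\<ge>N. \<forall>n\<ge>N. p (vminus X (\<sigma> m) (\<sigma> n)) < e / 2"
    using \<sigma> e half_gt_zero[OF e] unfolding cauchy_seqs_def by blast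
  have "vnorm K (vminus K (cls \<sigma>) (inc (\<sigma> n))) < e" if "n \<ge> N" for n
  proof -
    have mem: "(\<lambda>m. vminus X (\<sigma> m) (\<sigma> n)) \<in> Cs"
      using \<sigma> by (simp add: vminus_def)
    have "vnorm K (cls (\<lambda>m. vminus X (\<sigma> m) (\<sigma> n))) \<le> e / 2"
      using norm_K[OF mem] N that by (intro LIMSEQ_le_const2) (auto intro: less_imp_le)
    then show ?thesis using \<sigma> e by (simp add: inc_cls vminus_K)
  qed
  then show ?thesis by blast
qed

lemma dense:
  assumes "S \<in> carrier K" "e > 0"
  shows "\<exists>x\<in>carrier X. vnorm K (vminus K S (inc x)) < e"
  using assms norm_diff_inc_limit by (auto simp: carrier_K) (meson Cs_mem order_refl)

lemma cstar_algebra_K: "cstar_algebra K"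
proof
  show "cstar_seminorm K (vnorm K)" by (rule cstar_seminorm_K)
next
  fix S assume "S \<in> carrier K" "vnorm K S = 0"
  then obtain \<sigma> where S: "S = cls \<sigma>" and \<sigma>: "\<sigma> \<in> Cs" by (auto simp: carrier_K)
  then have "(\<lambda>n. p (\<sigma> n)) \<longlonglongrightarrow> 0" using norm_K[OF \<sigma>] \<open>vnorm K S = 0\<close> by simp
  then have "(\<sigma>, \<lambda>_. vzero X) \<in> null_rel X p"
    using \<sigma> by (simp add: null_rel_iff P.null_def closed emb_hom)
  then show "S = vzero K" using \<sigma> by (simp add: S K_ops cls_eq_iff closed)
next
  fix \<Sigma> assume \<Sigma>: "\<Sigma> \<in> cauchy_seqs K (vnorm K)"
  have mem: "\<Sigma> n \<in> carrier K" for n using \<Sigma> by (simp add: cauchy_seqs_def)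
  \<comment> \<open>Approximate the n-th class by an element of \<open>X\<close> to within
    \<open>1 / (n + 1)\<close>. These elements form a Cauchy sequence, and its class is the
    limit.\<close>
  have "\<forall>n. \<exists>x\<in>carrier X. vnorm K (vminus K (\<Sigma> n) (inc x)) < 1 / real (Suc n)"
    using dense[OF mem] by simp
  then obtain x where x: "\<And>n. x n \<in> carrier X"
    and near: "\<And>n. vnorm K (vminus K (\<Sigma> n) (inc (x n))) < 1 / real (Suc n)"
    by metis
  define S where "S n = emb K (\<Sigma> n)" for n
  define T where "T n = emb K (inc (x n))" for n
  have near': "vnorm K (proj K (S n - T n)) < 1 / real (Suc n)" for n
    using near[of n] mem x by (simp add: S_def T_def)
  have null: "KP.null (\<lambda>n. S n - T n)"
    unfolding KP.null_def
    by (rule null_limit[OF less_imp_le[OF near']], rule KP.nonneg)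
      (rule LIMSEQ_Suc[OF lim_inverse_n'])
  have "KP.cauchy S"
    using \<Sigma> mem unfolding cauchy_seqs_def KP.cauchy_def S_def by simp
  then have "KP.cauchy T" using null by (rule KP.cauchy_null)
  moreover have "p (vminus X (x m) (x n)) = vnorm K (proj K (T m - T n))" for m n
    using x by (simp add: T_def flip: norm_inc inc_hom add: closed)
  ultimately have "x \<in> Cs"
    unfolding cauchy_seqs_def KP.cauchy_def using x by simp
  have "KP.null (\<lambda>n. T n - emb K (cls x))"
    unfolding KP.null_def
  proof (rule LIMSEQ_I)
    fix e :: real assume "e > 0"
    from norm_diff_inc_limit[OF \<open>x \<in> Cs\<close> this]
    obtain N where N: "\<forall>n\<ge>N. vnorm K (vminus K (cls x) (inc (x n))) < e" ..
    have "vnorm K (proj K (T n - emb K (cls x))) = vnorm K (vminus K (cls x) (inc (x n)))" for n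
      using KP.diff_commute[of "T n" "emb K (cls x)"] x \<open>x \<in> Cs\<close> by (simp only: proj_hom T_def K.proj_hom K.proj_emb inc_closed cls_in_K)
    then show "\<exists>N. \<forall>n\<ge>N. norm (vnorm K (proj K (T n - emb K (cls x))) - 0) < e"
      using N KP.nonneg by (metis abs_of_nonneg diff_0_right real_norm_def)
  qed
  from KP.null_add[OF null this]
  have "(\<lambda>n. vnorm K (vminus K (\<Sigma> n) (cls x))) \<longlonglongrightarrow> 0"
    using mem \<open>x \<in> Cs\<close> by (simp add: KP.null_def S_def)
  then show "\<exists>x\<in>carrier K. (\<lambda>n. vnorm K (vminus K (\<Sigma> n) x)) \<longlonglongrightarrow> 0"
    using \<open>x \<in> Cs\<close> cls_in_K by blast
qed

end

section \<open>Star homomorphisms and their extension to completions\<close>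

lemma star_homD:
  assumes "\<Phi> \<in> star_hom A B"
  shows "x \<in> carrier A \<Longrightarrow> \<Phi> x \<in> carrier B"
    and "x \<in> carrier A \<Longrightarrow> y \<in> carrier A \<Longrightarrow> \<Phi> (vplus A x y) = vplus B (\<Phi> x) (\<Phi> y)"
    and "x \<in> carrier A \<Longrightarrow> \<Phi> (vscale A z x) = vscale B z (\<Phi> x)"
    and "x \<in> carrier A \<Longrightarrow> y \<in> carrier A \<Longrightarrow> \<Phi> (vtimes A x y) = vtimes B (\<Phi> x) (\<Phi> y)"
    and "x \<in> carrier A \<Longrightarrow> \<Phi> (adj A x) = adj B (\<Phi> x)"
  using assms by (auto simp: star_hom_def)

lemma star_hom_minus:
  assumes "\<Phi> \<in> star_hom A B" "star_algebra A" "x \<in> carrier A" "y \<in> carrier A"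
  shows "\<Phi> (vminus A x y) = vminus B (\<Phi> x) (\<Phi> y)"
  using assms by (simp add: vminus_def star_homD star_algebra.closed)

lemma star_hom_zero:
  assumes "\<Phi> \<in> star_hom A B" "star_algebra A" "star_algebra B"
  shows "\<Phi> (vzero A) = vzero B"
  using star_hom_minus[OF assms(1,2), of "vzero A" "vzero A"] star_homD(1)[OF assms(1)] assms
  by (simp add: star_algebra.zero_closed star_algebra.minus_self)

lemma star_hom_comp:
  assumes "\<Phi> \<in> star_hom A B" "\<Psi> \<in> star_hom B C"
  shows "(\<lambda>x. \<Psi> (\<Phi> x)) \<in> star_hom A C"
  using assms by (simp add: star_hom_def)

lemma cstar_seminorm_pullback:
  assumes "star_algebra A" "\<Phi> \<in> star_hom A B" "cstar_seminorm B q"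
  shows "cstar_seminorm A (\<lambda>x. q (\<Phi> x))"
  using assms star_algebra.adj_closed[OF assms(1)] by (simp add: cstar_seminorm_def star_hom_def)

lemma star_hom_contractive:
  assumes "\<Phi> \<in> star_hom A B" "cstar_algebra A" "cstar_algebra B" "x \<in> carrier A"
  shows "vnorm B (\<Phi> x) \<le> vnorm A x"
  using cstar_algebra.cstar_seminorm_le[OF assms(2) cstar_seminorm_pullback[OF _ assms(1)]]
    cstar_algebra.norm_cstar_seminorm[OF assms(3)] cstar_algebra.axioms(1)[OF assms(2)] assms(4) by blast

lemma (in star_algebra) minus_eq_zero_iff:
  "x \<in> carrier A \<Longrightarrow> y \<in> carrier A \<Longrightarrow> vminus A x y = vzero A \<longleftrightarrow> x = y"
  by (metis emb_eq_iff emb_hom(1,3) minus_closed zero_closed right_minus_eq)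

text \<open>Termwise application of \<open>\<theta>\<close>, written as a union over representatives
  as in \<open>cstar_completion\<close>; it is a single class as soon as \<open>\<theta>\<close> is
  contractive.\<close>

definition complete_hom where
  "complete_hom Y q \<theta> S = (\<Union>\<sigma>\<in>S. null_rel Y q `` {\<lambda>n. \<theta> (\<sigma> n)})"

locale contractive_hom =
  X: seminormed_star_algebra X p + Y: seminormed_star_algebra Y q
  for X :: "('a, 'm) star_alg_scheme" and p
    and Y :: "('b, 'n) star_alg_scheme" and q +
  fixes \<theta>
  assumes hom: "\<theta> \<in> star_hom X Y"
    and contractive: "x \<in> carrier X \<Longrightarrow> q (\<theta> x) \<le> p x"
begin

abbreviation "\<Theta> \<equiv> complete_hom Y q \<theta>"

lemmas \<theta>_hom = star_homD[OF hom] star_hom_minus[OF hom X.star_algebra_axioms]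

lemma Cs_image [simp]:
  assumes "\<sigma> \<in> X.Cs"
  shows "(\<lambda>n. \<theta> (\<sigma> n)) \<in> Y.Cs"
proof -
  have le: "q (vminus Y (\<theta> (\<sigma> m)) (\<theta> (\<sigma> n))) \<le> p (vminus X (\<sigma> m) (\<sigma> n))" for m n
    using contractive[of "vminus X (\<sigma> m) (\<sigma> n)"] assms by (simp add: \<theta>_hom X.closed)
  have "\<exists>N. \<forall>m\<ge>N. \<forall>n\<ge>N. q (vminus Y (\<theta> (\<sigma> m)) (\<theta> (\<sigma> n))) < e" if "e > 0" for e
  proof -
    obtain N where N: "\<forall>m\<ge>N. \<forall>n\<ge>N. p (vminus X (\<sigma> m) (\<sigma> n)) < e"
      using assms \<open>e > 0\<close> unfolding cauchy_seqs_def by auto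
    then show ?thesis using le_less_trans[OF le] by (intro exI[of _ N]) simp
  qed
  then show ?thesis
    unfolding cauchy_seqs_def[of Y] mem_Collect_eq using \<theta>_hom(1)[OF X.Cs_mem[OF assms]] by metis
qed

lemma complete_hom_cls:
  assumes \<sigma>: "\<sigma> \<in> X.Cs"
  shows "\<Theta> (X.cls \<sigma>) = Y.cls (\<lambda>n. \<theta> (\<sigma> n))"
  unfolding complete_hom_def Y.cls_def[symmetric]
proof (rule Y.UN_const_eq)
  fix \<tau> assume \<tau>: "\<tau> \<in> X.cls \<sigma>"
  then have "\<tau> \<in> X.Cs" and 0: "(\<lambda>n. p (vminus X (\<tau> n) (\<sigma> n))) \<longlonglongrightarrow> 0"
    using X.cls_null[OF \<tau>] X.cls_Cs[OF \<tau>] \<sigma> by (auto simp: X.P.null_def)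
  then have "(\<lambda>n. q (vminus Y (\<theta> (\<tau> n)) (\<theta> (\<sigma> n)))) \<longlonglongrightarrow> 0"
    using contractive[of "vminus X (\<tau> n) (\<sigma> n)" for n] \<sigma> Y.P.nonneg[of "emb Y (\<theta> (\<tau> n)) - emb Y (\<theta> (\<sigma> n))" for n]
    by (intro null_limit[OF _ _ 0]) (simp_all add: \<theta>_hom X.closed)
  then show "Y.cls (\<lambda>n. \<theta> (\<tau> n)) = Y.cls (\<lambda>n. \<theta> (\<sigma> n))"
    using \<open>\<tau> \<in> X.Cs\<close> \<sigma> by (simp add: Y.cls_eq_iff Y.null_rel_iff Y.P.null_def \<theta>_hom)
qed (use \<sigma> X.mem_cls_self in blast)

lemma complete_hom_hom: "\<Theta> \<in> star_hom X.K Y.K"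
  by (auto simp: star_hom_def X.carrier_K X.K_ops Y.K_ops complete_hom_cls \<theta>_hom)

lemma complete_hom_inc: "x \<in> carrier X \<Longrightarrow> \<Theta> (X.inc x) = Y.inc (\<theta> x)"
  by (simp add: X.inc_cls Y.inc_cls complete_hom_cls)

lemma complete_hom_isometric:
  assumes "\<And>x. x \<in> carrier X \<Longrightarrow> q (\<theta> x) = p x" "S \<in> carrier X.K"
  shows "vnorm Y.K (\<Theta> S) = vnorm X.K S"
proof -
  obtain \<sigma> where S: "S = X.cls \<sigma>" and \<sigma>: "\<sigma> \<in> X.Cs" using assms by (auto simp: X.carrier_K)
  show ?thesis
    using X.norm_K[OF \<sigma>] \<sigma> assms(1) by (simp add: S complete_hom_cls Y.norm_K_eqI)
qed

text \<open>Isometry serves twice: it makes the map injective, and it makes approximate preimages of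
  a Cauchy sequence Cauchy again, so that the image is everything and not only dense.\<close>

lemma complete_hom_iso:
  assumes isometric: "\<And>x. x \<in> carrier X \<Longrightarrow> q (\<theta> x) = p x"
    and dense: "\<And>y e. y \<in> carrier Y \<Longrightarrow> e > 0 \<Longrightarrow> \<exists>x\<in>carrier X. q (vminus Y y (\<theta> x)) < e"
  shows "\<Theta> \<in> star_iso X.K Y.K"
proof -
  have "inj_on \<Theta> (carrier X.K)"
  proof (rule inj_onI)
    fix S T assume ST: "S \<in> carrier X.K" "T \<in> carrier X.K" "\<Theta> S = \<Theta> T"
    then have "\<Theta> (vminus X.K S T) = vzero Y.K"
      using complete_hom_hom Y.K.minus_self
      by (simp add: star_hom_minus X.star_algebra_K star_homD)
    then have "vnorm X.K (vminus X.K S T) = 0"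
      using complete_hom_isometric[of "vminus X.K S T"] isometric ST Y.KP.zero
      by (simp add: X.K.closed)
    then show "S = T"
      using cstar_algebra.norm_definite[OF X.cstar_algebra_K, of "vminus X.K S T"] ST
      by (simp add: X.K.closed X.K.minus_eq_zero_iff)
  qed
  moreover have "T \<in> \<Theta> ` carrier X.K" if "T \<in> carrier Y.K" for T
  proof -
    obtain \<tau> where T: "T = Y.cls \<tau>" and \<tau>: "\<tau> \<in> Y.Cs" using \<open>T \<in> carrier Y.K\<close> by (auto simp: Y.carrier_K)
    have "\<forall>n. \<exists>x\<in>carrier X. q (vminus Y (\<tau> n) (\<theta> x)) < 1 / real (Suc n)"
      using dense \<tau> by simp
    then obtain x where x: "\<And>n. x n \<in> carrier X"
      and near: "\<And>n. q (vminus Y (\<tau> n) (\<theta> (x n))) < 1 / real (Suc n)" by metis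
    have null: "Y.P.null (\<lambda>n. emb Y (\<tau> n) - emb Y (\<theta> (x n)))"
      unfolding Y.P.null_def
    proof (rule null_limit)
      show "(\<lambda>n. 1 / real (Suc n)) \<longlonglongrightarrow> 0" by (rule LIMSEQ_Suc[OF lim_inverse_n'])
      show "q (proj Y (emb Y (\<tau> n) - emb Y (\<theta> (x n)))) \<le> 1 / real (Suc n)" for n
        using near[of n] x \<tau> by (simp add: \<theta>_hom)
    qed (rule Y.P.nonneg)
    have "Y.P.cauchy (\<lambda>n. emb Y (\<theta> (x n)))"
      using Y.P.cauchy_null[OF _ null] \<tau> by (simp add: Y.Cs_iff)
    moreover have "p (vminus X (x m) (x n)) = q (proj Y (emb Y (\<theta> (x m)) - emb Y (\<theta> (x n))))" for m n
      using x isometric[of "vminus X (x m) (x n)"] by (simp add: \<theta>_hom X.closed)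
    ultimately have "x \<in> X.Cs"
      using x unfolding cauchy_seqs_def Y.P.cauchy_def by simp
    moreover have "\<Theta> (X.cls x) = T"
      using \<open>x \<in> X.Cs\<close> \<tau> null Y.P.null_sym by (simp add: complete_hom_cls T Y.cls_eq_iff Y.null_rel_iff)
    ultimately show ?thesis by (metis X.cls_in_K imageI)
  qed
  ultimately show ?thesis
    using complete_hom_hom by (auto simp: star_iso_def bij_betw_def star_homD)
qed

end

text \<open>Homomorphisms between C*-algebras are contractive, hence continuous, so agreement on the
  dense image of \<open>X\<close> is enough.\<close>

lemma (in seminormed_star_algebra) hom_eqI:
  assumes F: "F \<in> star_hom K B" and G: "G \<in> star_hom K B" and B: "cstar_algebra B"
    and eq: "\<And>x. x \<in> carrier X \<Longrightarrow> F (inc x) = G (inc x)"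
    and S: "S \<in> carrier K"
  shows "F S = G S"
proof -
  interpret B: cstar_algebra B by fact
  interpret N: cstar_seminormed "\<lambda>f. vnorm B (proj B f)"
    by (rule B.seminormed_proj[OF B.norm_cstar_seminorm])
  have FG [simp]: "F S \<in> carrier B" "G S \<in> carrier B" using F G S by (auto simp: star_homD)
  have "vnorm B (vminus B (F S) (G S)) \<le> 0 + e" if "e > 0" for e
  proof -
    obtain x where x: "x \<in> carrier X" "vnorm K (vminus K S (inc x)) < e / 2"
      using dense[OF S, of "e / 2"] \<open>e > 0\<close> by auto
    define d where "d = vminus K S (inc x)"
    have d: "d \<in> carrier K" using x S by (simp add: d_def K.closed)
    have *: "F d \<in> carrier B" "G d \<in> carrier B" "F (inc x) \<in> carrier B"
      using F G d x by (auto simp: star_homD)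
    have "emb B (F d) = emb B (F S) - emb B (F (inc x))" "emb B (G d) = emb B (G S) - emb B (F (inc x))"
      using F G x S * eq[of x] by (simp_all add: d_def star_hom_minus star_algebra_K B.emb_hom)
    then have "emb B (F d) - emb B (G d) = emb B (vminus B (F S) (G S))"
      by (simp add: B.emb_hom)
    then have "vnorm B (vminus B (F S) (G S)) = vnorm B (proj B (emb B (F d) - emb B (G d)))"
      by (simp only: B.proj_emb B.closed FG)
    also have "\<dots> \<le> vnorm B (F d) + vnorm B (G d)"
      using N.diff_le[of "emb B (F d)" "emb B (G d)"] * by simp
    also have "\<dots> \<le> vnorm K d + vnorm K d"
      by (intro add_mono star_hom_contractive F G cstar_algebra_K B d)
    finally show ?thesis using x by (simp add: d_def)
  qed
  from field_le_epsilon[OF this]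
  have "vnorm B (vminus B (F S) (G S)) \<le> 0" .
  then have "vnorm B (vminus B (F S) (G S)) = 0"
    using N.nonneg[of "emb B (F S) - emb B (G S)"] by simp
  then show ?thesis
    using B.norm_definite[of "vminus B (F S) (G S)"] by (simp add: B.closed B.minus_eq_zero_iff)
qed

section \<open>GNS seminorms\<close>

lemma nonneg_complex_add:
  "x \<in> \<real> \<and> 0 \<le> Re x \<Longrightarrow> y \<in> \<real> \<and> 0 \<le> Re y \<Longrightarrow> x + y \<in> \<real> \<and> 0 \<le> Re (x + y)"
  by (simp add: Reals_add)

locale positive_functional =
  fixes \<omega> :: "'r::star_ring \<Rightarrow> complex"
  assumes add: "\<omega> (x + y) = \<omega> x + \<omega> y"
    and scale [simp]: "\<omega> (z *\<^sub>C x) = z * \<omega> x"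
    and positive: "\<omega> (star x * x) \<in> \<real> \<and> 0 \<le> Re (\<omega> (star x * x))"
begin

lemma zero [simp]: "\<omega> 0 = 0"
  using scale[of 0 0] by simp

lemma minus [simp]: "\<omega> (- x) = - \<omega> x"
  using scale[of "-1" x] by simp

lemma diff: "\<omega> (x - y) = \<omega> x - \<omega> y"
  using add[of x "- y"] by simp

lemma sum: "\<omega> (sum f I) = (\<Sum>i\<in>I. \<omega> (f i))"
  by (induct I rule: infinite_finite_induct) (simp_all add: add)

definition norm2 :: "'r \<Rightarrow> real" where
  "norm2 x = Re (\<omega> (star x * x))"

lemma norm2_nonneg [simp]: "0 \<le> norm2 x"
  using positive by (simp add: norm2_def)

lemma of_real_norm2: "\<omega> (star x * x) = of_real (norm2 x)"
  using positive[of x] by (auto simp: norm2_def Reals_def)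

lemma norm2_scale [simp]: "norm2 (z *\<^sub>C x) = (cmod z)\<^sup>2 * norm2 x"
proof -
  have "\<omega> (star (z *\<^sub>C x) * (z *\<^sub>C x)) = of_real ((cmod z)\<^sup>2 * norm2 x)"
    using complex_norm_square[of z] of_real_norm2[of x] by (simp add: ac_simps)
  then show ?thesis by (simp add: norm2_def)
qed

text \<open>Polarisation: the values at \<open>x + y\<close> and at \<open>x + i y\<close> are real,
  which relates the imaginary and the real parts of the two cross terms.\<close>

lemma hermitian: "\<omega> (star y * x) = cnj (\<omega> (star x * y))"
proof -
  have "Im (\<omega> (star (x + y) * (x + y))) = 0" "Im (\<omega> (star (x + \<i> *\<^sub>C y) * (x + \<i> *\<^sub>C y))) = 0"
    unfolding of_real_norm2 by simp_all
  then have "Im (\<omega> (star x * y) + \<omega> (star y * x)) = 0"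
    "Im (\<i> * \<omega> (star x * y) - \<i> * \<omega> (star y * x)) = 0"
    by (simp_all add: algebra_simps star_ring_simps add diff of_real_norm2)
  then show ?thesis by (simp add: complex_eq_iff)
qed

lemma norm2_diff_scale:
  "norm2 (x - t *\<^sub>C y) = norm2 x - 2 * Re (t * \<omega> (star x * y)) + (cmod t)\<^sup>2 * norm2 y"
proof -
  have "\<omega> (star (x - t *\<^sub>C y) * (x - t *\<^sub>C y)) = of_real (norm2 x) - t * \<omega> (star x * y)
      - cnj t * cnj (\<omega> (star x * y)) + t * cnj t * of_real (norm2 y)"
    by (simp add: algebra_simps star_ring_simps diff add of_real_norm2 hermitian[of y x])
  then show ?thesis by (simp add: norm2_def[of "x - _"] flip: complex_norm_square)
qed

lemma cauchy_schwarz: "(cmod (\<omega> (star x * y)))\<^sup>2 \<le> norm2 x * norm2 y"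
proof -
  define h where "h = \<omega> (star x * y)"
  have *: "0 \<le> norm2 x - 2 * s * (cmod h)\<^sup>2 + s\<^sup>2 * (cmod h)\<^sup>2 * norm2 y" for s
    using norm2_nonneg[of "x - (of_real s * cnj h) *\<^sub>C y"]
    unfolding norm2_diff_scale h_def[symmetric]
    by (simp add: norm_mult power_mult_distrib cmod_power2) (simp add: algebra_simps power2_eq_square)
  show ?thesis
  proof (cases "norm2 y = 0")
    case True
    have "h = 0"
    proof (rule ccontr)
      assume "h \<noteq> 0"
      \<comment> \<open>For \<open>norm2 y = 0\<close> the bound is linear in \<open>s\<close>, and
        this value makes its right side negative.\<close>
      then show False using *[of "(norm2 x + 1) / (cmod h)\<^sup>2"] True norm2_nonneg[of x] by simp
    qed
    then show ?thesis by (simp add: h_def[symmetric])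
  next
    case False
    then have "norm2 y > 0" by (simp add: less_le)
    then show ?thesis using *[of "1 / norm2 y"]
      unfolding h_def[symmetric] by (simp add: power2_eq_square field_simps)
  qed
qed

lemma cauchy_schwarz': "cmod (\<omega> (star x * y)) \<le> sqrt (norm2 x) * sqrt (norm2 y)"
  using real_sqrt_le_mono[OF cauchy_schwarz[of x y]] by (simp add: real_sqrt_mult)

lemma norm2_triangle: "sqrt (norm2 (x + y)) \<le> sqrt (norm2 x) + sqrt (norm2 y)"
proof -
  have "norm2 (x + y) = norm2 x + 2 * Re (\<omega> (star x * y)) + norm2 y"
    using norm2_diff_scale[of x "-1" y] by simp
  also have "\<dots> \<le> norm2 x + 2 * (sqrt (norm2 x) * sqrt (norm2 y)) + norm2 y"
    using cauchy_schwarz'[of x y] complex_Re_le_cmod[of "\<omega> (star x * y)"] by linarith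
  also have "\<dots> = (sqrt (norm2 x) + sqrt (norm2 y))\<^sup>2"
    by (simp add: power2_sum)
  finally show ?thesis using real_sqrt_le_mono by fastforce
qed

end

text \<open>For each \<open>x\<close> one constant serves all functionals and all vectors, so left
  multiplication by \<open>x\<close> is bounded on the direct sum of the GNS spaces.\<close>

locale bounded_functionals =
  fixes \<Omega> :: "('r::star_ring \<Rightarrow> complex) set"
  assumes functional: "\<omega> \<in> \<Omega> \<Longrightarrow> positive_functional \<omega>"
    and nonempty: "\<Omega> \<noteq> {}"
    and bounded: "\<exists>C. \<forall>\<omega>\<in>\<Omega>. \<forall>y. Re (\<omega> (star (x * y) * (x * y))) \<le> C * Re (\<omega> (star y * y))"
begin

abbreviation nrm :: "('r \<Rightarrow> complex) \<Rightarrow> 'r \<Rightarrow> real" where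
  "nrm \<omega> x \<equiv> sqrt (Re (\<omega> (star x * x)))"

definition gns_set :: "'r \<Rightarrow> real set" where
  "gns_set x = {nrm \<omega> (x * y) |\<omega> y. \<omega> \<in> \<Omega> \<and> Re (\<omega> (star y * y)) \<le> 1}"

text \<open>The operator norm of \<open>x\<close> in the direct sum of the GNS representations, read
  off from the functionals without forming quotients or completions.\<close>

definition gns :: "'r \<Rightarrow> real" where
  "gns x = Sup (gns_set x)"

lemma gns_set_nonempty: "gns_set x \<noteq> {}"
proof -
  obtain \<omega> where \<omega>: "\<omega> \<in> \<Omega>" using nonempty by blast
  then interpret positive_functional \<omega> by (rule functional)
  have "nrm \<omega> (x * 0) \<in> gns_set x" unfolding gns_set_def
    by (intro CollectI exI[of _ \<omega>] exI[of _ 0]) (simp add: \<omega>)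
  then show ?thesis by blast
qed

lemma gns_set_le:
  assumes "\<And>\<omega> y. \<omega> \<in> \<Omega> \<Longrightarrow> Re (\<omega> (star (x * y) * (x * y))) \<le> C * Re (\<omega> (star y * y))"
    and "C \<ge> 0" and "r \<in> gns_set x"
  shows "r \<le> sqrt C"
proof -
  obtain \<omega> y where *: "\<omega> \<in> \<Omega>" "Re (\<omega> (star y * y)) \<le> 1" "r = nrm \<omega> (x * y)"
    using assms(3) unfolding gns_set_def by auto
  have "C * Re (\<omega> (star y * y)) \<le> C * 1" using * assms(2) by (intro mult_left_mono) auto
  then show ?thesis using assms(1)[of \<omega> y] * by simp
qed

lemma bdd_gns_set: "bdd_above (gns_set x)"
proof -
  obtain C where C: "\<forall>\<omega>\<in>\<Omega>. \<forall>y. Re (\<omega> (star (x * y) * (x * y))) \<le> C * Re (\<omega> (star y * y))"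
    using bounded by blast
  have "Re (\<omega> (star (x * y) * (x * y))) \<le> \<bar>C\<bar> * Re (\<omega> (star y * y))" if \<omega>: "\<omega> \<in> \<Omega>" for \<omega> y
  proof -
    have "C * Re (\<omega> (star y * y)) \<le> \<bar>C\<bar> * Re (\<omega> (star y * y))"
      using positive_functional.positive[OF functional[OF \<omega>], of y] by (intro mult_right_mono) auto
    then show ?thesis using C[rule_format, OF \<omega>, of y] by (rule order_trans[rotated])
  qed
  from gns_set_le[OF this abs_ge_zero] show ?thesis by (rule bdd_aboveI)
qed

lemma gns_le:
  assumes "\<And>\<omega> y. \<omega> \<in> \<Omega> \<Longrightarrow> Re (\<omega> (star (x * y) * (x * y))) \<le> C * Re (\<omega> (star y * y))"
    and "C \<ge> 0"
  shows "gns x \<le> sqrt C"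
  unfolding gns_def using gns_set_nonempty gns_set_le[OF assms] by (intro cSup_least) auto

lemma nrm_le_gns:
  assumes \<omega>: "\<omega> \<in> \<Omega>"
  shows "nrm \<omega> (x * y) \<le> gns x * nrm \<omega> y"
proof -
  interpret positive_functional \<omega> by (rule functional[OF \<omega>])
  note [simp] = norm2_def[symmetric]
  show ?thesis
  proof (cases "norm2 y = 0")
    case True
    obtain C where "\<forall>\<omega>\<in>\<Omega>. \<forall>y. Re (\<omega> (star (x * y) * (x * y))) \<le> C * Re (\<omega> (star y * y))"
      using bounded[of x] by blast
    then have "norm2 (x * y) \<le> C * norm2 y" using \<omega> unfolding norm2_def by blast
    then show ?thesis using True norm2_nonneg[of "x * y"] by simp
  next
    case False
    define t where "t = sqrt (norm2 y)"
    have t: "t > 0" "norm2 y = t\<^sup>2" using False by (simp_all add: t_def less_le)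
    define y' where "y' = of_real (1 / t) *\<^sub>C y"
    have "norm2 y' = 1" using t by (simp add: y'_def norm_divide power_divide)
    then have "nrm \<omega> (x * y') \<in> gns_set x"
      using \<omega> unfolding gns_set_def by (intro CollectI exI[of _ \<omega>] exI[of _ y']) simp
    then have "nrm \<omega> (x * y') \<le> gns x"
      unfolding gns_def using bdd_gns_set by (rule cSup_upper)
    then show ?thesis using t
      by (simp add: y'_def norm_divide power_divide real_sqrt_mult real_sqrt_divide field_simps)
  qed
qed

lemma gns_nonneg: "0 \<le> gns x"
proof -
  obtain r where r: "r \<in> gns_set x" using gns_set_nonempty by blast
  then have "0 \<le> r"
    using functional positive_functional.positive unfolding gns_set_def by fastforce
  then show ?thesis unfolding gns_def using bdd_gns_set r by (meson cSup_upper order_trans)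
qed

lemma gns_leI:
  assumes "\<And>\<omega> y. \<omega> \<in> \<Omega> \<Longrightarrow> nrm \<omega> (x * y) \<le> C * nrm \<omega> y" "C \<ge> 0"
  shows "gns x \<le> C"
proof -
  have "Re (\<omega> (star (x * y) * (x * y))) \<le> C\<^sup>2 * Re (\<omega> (star y * y))" if "\<omega> \<in> \<Omega>" for \<omega> y
    using power_mono[OF assms(1)[OF that, of y], of 2]
      positive_functional.positive[OF functional[OF that]] by (simp add: power_mult_distrib)
  then show ?thesis using gns_le[of x "C\<^sup>2"] assms(2) by simp
qed

text \<open>The C*-identity is that of operators: \<open>norm2 (x * y)\<close> equals
  \<open>\<omega> (star y * (star x * x * y))\<close>, which Cauchy-Schwarz bounds by
  \<open>gns (star x * x) * norm2 y\<close>. Together with submultiplicativity this also yields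
  isometry of the involution.\<close>

lemma gns_cstar_seminormed: "cstar_seminormed gns"
proof -
  have scale_le: "gns (z *\<^sub>C x) \<le> cmod z * gns x" for z x
  proof (rule gns_leI)
    fix \<omega> y assume \<omega>: "\<omega> \<in> \<Omega>"
    interpret positive_functional \<omega> by (rule functional[OF \<omega>])
    have "nrm \<omega> (z *\<^sub>C x * y) = cmod z * nrm \<omega> (x * y)"
      unfolding norm2_def[symmetric] by (simp add: real_sqrt_mult)
    then show "nrm \<omega> (z *\<^sub>C x * y) \<le> cmod z * gns x * nrm \<omega> y"
      using mult_left_mono[OF nrm_le_gns[OF \<omega>, of x y], of "cmod z"] by (simp add: mult.assoc)
  qed (simp add: gns_nonneg)
  have submult: "gns (x * y) \<le> gns x * gns y" for x y
  proof (rule gns_leI)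
    fix \<omega> v assume \<omega>: "\<omega> \<in> \<Omega>"
    have "nrm \<omega> (x * y * v) \<le> gns x * nrm \<omega> (y * v)" using nrm_le_gns[OF \<omega>, of x "y * v"] by (simp add: mult.assoc)
    also have "\<dots> \<le> gns x * (gns y * nrm \<omega> v)" by (intro mult_left_mono nrm_le_gns \<omega> gns_nonneg)
    finally show "nrm \<omega> (x * y * v) \<le> gns x * gns y * nrm \<omega> v" by (simp add: mult.assoc)
  qed (simp add: gns_nonneg)
  have square_le: "(gns x)\<^sup>2 \<le> gns (star x * x)" for x
  proof -
    have "gns x \<le> sqrt (gns (star x * x))"
    proof (rule gns_leI)
      fix \<omega> y assume \<omega>: "\<omega> \<in> \<Omega>"
      interpret positive_functional \<omega> by (rule functional[OF \<omega>])
      have "norm2 (x * y) \<le> cmod (\<omega> (star y * (star x * x * y)))"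
        using complex_Re_le_cmod by (simp add: norm2_def star_mult mult.assoc)
      also have "\<dots> \<le> sqrt (norm2 y) * sqrt (norm2 (star x * x * y))" by (rule cauchy_schwarz')
      also have "\<dots> \<le> sqrt (norm2 y) * (gns (star x * x) * sqrt (norm2 y))"
        using nrm_le_gns[OF \<omega>, of "star x * x" y] norm2_nonneg[of y]
        by (intro mult_left_mono) (simp_all add: norm2_def)
      also have "\<dots> = gns (star x * x) * (sqrt (norm2 y))\<^sup>2"
        by (simp only: power2_eq_square ac_simps)
      finally have "norm2 (x * y) \<le> gns (star x * x) * norm2 y" by simp
      then show "nrm \<omega> (x * y) \<le> sqrt (gns (star x * x)) * nrm \<omega> y"
        using real_sqrt_le_mono by (fastforce simp: norm2_def real_sqrt_mult)
    qed (simp add: gns_nonneg)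
    then have "(gns x)\<^sup>2 \<le> (sqrt (gns (star x * x)))\<^sup>2" using gns_nonneg by (intro power_mono) auto
    then show ?thesis using gns_nonneg by simp
  qed
  have star_le: "gns x \<le> gns (star x)" for x
  proof (cases "gns x = 0")
    case False
    then show ?thesis using square_le[of x] submult[of "star x" x] gns_nonneg[of x]
      by (simp add: power2_eq_square) (metis less_le mult_le_cancel_right_pos order_trans)
  qed (simp add: gns_nonneg)
  show ?thesis
  proof
    fix x y :: 'r and z
    show "gns (x + y) \<le> gns x + gns y"
    proof (rule gns_leI)
      fix \<omega> v assume \<omega>: "\<omega> \<in> \<Omega>"
      interpret positive_functional \<omega> by (rule functional[OF \<omega>])
      show "nrm \<omega> ((x + y) * v) \<le> (gns x + gns y) * nrm \<omega> v"
        using norm2_triangle[of "x * v" "y * v"] nrm_le_gns[OF \<omega>, of x v] nrm_le_gns[OF \<omega>, of y v]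
        by (simp add: norm2_def distrib_right)
    qed (simp add: gns_nonneg)
    show "gns (z *\<^sub>C x) = cmod z * gns x"
    proof (cases "z = 0")
      case True
      then show ?thesis using scale_le[of 0 x] gns_nonneg[of 0] by simp
    next
      case False
      then have "gns x \<le> cmod (1 / z) * gns (z *\<^sub>C x)" using scale_le[of "1 / z" "z *\<^sub>C x"] by simp
      then show ?thesis using scale_le[of z x] False by (simp add: norm_divide field_simps)
    qed
    show "gns (x * y) \<le> gns x * gns y" by (rule submult)
    show "gns (star x * x) = (gns x)\<^sup>2"
      using square_le[of x] submult[of "star x" x] star_le[of x] star_le[of "star x"]
      by (simp add: power2_eq_square)
  qed
qed

end

lemma (in star_algebra) cstar_seminorm_emb:
  assumes "cstar_seminormed p"
  shows "cstar_seminorm A (\<lambda>x. p (emb A x))"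
proof -
  interpret cstar_seminormed p by fact
  show ?thesis
    by (rule cstar_seminormI) (simp_all add: emb_hom triangle submult cstar closed)
qed

text \<open>By orthogonalisation of the \<open>a k\<close>.\<close>

lemma gram_schur_positive:
  fixes \<phi> :: "'r::star_ring \<Rightarrow> complex" and \<psi> :: "'s::star_ring \<Rightarrow> complex"
  assumes "positive_functional \<phi>" "positive_functional \<psi>" "finite I"
  shows "(\<Sum>k\<in>I. \<Sum>l\<in>I. \<phi> (star (a k) * a l) * \<psi> (star (b k) * b l)) \<in> \<real> \<and>
    0 \<le> Re (\<Sum>k\<in>I. \<Sum>l\<in>I. \<phi> (star (a k) * a l) * \<psi> (star (b k) * b l))"
  using assms(3)
proof (induct I arbitrary: a rule: finite_induct)
  case (insert n I)
  interpret \<phi>: positive_functional \<phi> by fact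
  interpret \<psi>: positive_functional \<psi> by fact
  define m where "m = \<phi>.norm2 (a n)"
  \<comment> \<open>The coefficient of \<open>a k\<close> along \<open>a n\<close>. If
    \<open>m = 0\<close>, division by zero gives \<open>0\<close>, which is right because
    \<open>a n\<close> is then a null vector.\<close>
  define t where "t k = \<phi> (star (a n) * a k) / m" for k
  define a' where "a' k = a k - t k *\<^sub>C a n" for k
  define N where "N k l = \<psi> (star (b k) * b l)" for k l
  have nn: "\<phi> (star (a n) * a n) = m" by (simp add: m_def \<phi>.of_real_norm2)
  have null: "\<phi> (star (a n) * x) = 0" if "m = 0" for x
    using \<phi>.cauchy_schwarz[of "a n" x] that by (simp add: m_def)
  have nk: "\<phi> (star (a n) * a k) = t k * m" for k
    using null[of "a k"] by (simp add: t_def)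
  have kn: "\<phi> (star (a k) * a n) = cnj (t k) * m" for k
    using \<phi>.hermitian[of "a k" "a n"] by (simp add: nk)
  have gram: "\<phi> (star (a' k) * a' l) = \<phi> (star (a k) * a l) - cnj (t k) * t l * m" for k l
    by (simp add: a'_def algebra_simps star_ring_simps \<phi>.add \<phi>.diff nn nk[of l] kn[of k])
  have gram_n: "\<phi> (star (a' n) * x) = 0" "\<phi> (star x * a' n) = 0" for x
  proof -
    have "\<phi> (star (a' n) * a' n) = 0"
      unfolding gram nn by (cases "m = 0") (simp_all add: t_def nn)
    then have "\<phi>.norm2 (a' n) = 0" by (simp add: \<phi>.norm2_def)
    then show "\<phi> (star (a' n) * x) = 0" "\<phi> (star x * a' n) = 0"
      using \<phi>.cauchy_schwarz[of "a' n" x] \<phi>.cauchy_schwarz[of x "a' n"] by simp_all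
  qed
  \<comment> \<open>The Gram matrix of the \<open>a k\<close> is that of the \<open>a' k\<close>,
    whose row and column \<open>n\<close> vanish, plus a matrix of rank one. The first part falls to
    the induction hypothesis, and the second contributes \<open>m\<close> times the value of
    \<open>\<psi>\<close> at a square.\<close>
  have "(\<Sum>k\<in>insert n I. \<Sum>l\<in>insert n I. \<phi> (star (a k) * a l) * N k l)
      = (\<Sum>k\<in>insert n I. \<Sum>l\<in>insert n I. \<phi> (star (a' k) * a' l) * N k l)
        + (\<Sum>k\<in>insert n I. \<Sum>l\<in>insert n I. m * (cnj (t k) * (t l * N k l)))"
    unfolding sum.distrib[symmetric] by (intro sum.cong refl) (simp add: gram algebra_simps)
  also have "(\<Sum>k\<in>insert n I. \<Sum>l\<in>insert n I. \<phi> (star (a' k) * a' l) * N k l)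
      = (\<Sum>k\<in>I. \<Sum>l\<in>I. \<phi> (star (a' k) * a' l) * N k l)"
    using insert.hyps by (simp add: gram_n)
  also have "(\<Sum>k\<in>insert n I. \<Sum>l\<in>insert n I. m * (cnj (t k) * (t l * N k l)))
      = m * \<psi> (star (\<Sum>k\<in>insert n I. t k *\<^sub>C b k) * (\<Sum>k\<in>insert n I. t k *\<^sub>C b k))"
    unfolding star_sum sum_distrib_left sum_distrib_right \<psi>.sum N_def star_scaleC
    by (subst sum.swap) (simp add: ac_simps del: sum.insert)
  also have "\<dots> = of_real (m * \<psi>.norm2 (\<Sum>k\<in>insert n I. t k *\<^sub>C b k))"
    by (simp only: \<psi>.of_real_norm2 of_real_mult)
  finally have eq: "(\<Sum>k\<in>insert n I. \<Sum>l\<in>insert n I. \<phi> (star (a k) * a l) * N k l)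
      = (\<Sum>k\<in>I. \<Sum>l\<in>I. \<phi> (star (a' k) * a' l) * N k l)
      + of_real (m * \<psi>.norm2 (\<Sum>k\<in>insert n I. t k *\<^sub>C b k))" .
  show ?case
    using insert.hyps(3)[of a'] unfolding N_def[symmetric] eq
    by (intro nonneg_complex_add conjI) (auto simp: m_def)
qed simp

section \<open>Universal C*-algebras\<close>

lemma poly_mapping_keys_induct [consumes 1, case_names zero add]:
  fixes f :: "'k \<Rightarrow>\<^sub>0 'b::ab_group_add"
  assumes "Poly_Mapping.keys f \<subseteq> Q"
    and zero: "P 0"
    and add: "\<And>f w c. P f \<Longrightarrow> Poly_Mapping.keys f \<subseteq> Q \<Longrightarrow> w \<in> Q \<Longrightarrow> P (f + Poly_Mapping.single w c)"
  shows "P f"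
  using assms(1)
proof (induct "card (Poly_Mapping.keys f)" arbitrary: f)
  case 0
  then have "f = 0" by simp
  then show ?case using zero by simp
next
  case (Suc n)
  then obtain w where w: "w \<in> Poly_Mapping.keys f" by force
  define g where "g = f - Poly_Mapping.single w (Poly_Mapping.lookup f w)"
  have "Poly_Mapping.keys g = Poly_Mapping.keys f - {w}"
    by (auto simp: g_def in_keys_iff lookup_minus lookup_single when_def split: if_splits)
  then have "P g" "Poly_Mapping.keys g \<subseteq> Q"
    using Suc w by (auto intro!: Suc(1))
  then have "P (g + Poly_Mapping.single w (Poly_Mapping.lookup f w))"
    using w Suc(3) by (intro add) auto
  then show ?case by (simp add: g_def)
qed

section \<open>The free *-algebra and its evaluation in a *-ring\<close>

type_synonym 'g free = "('g \<times> bool) list \<Rightarrow>\<^sub>0 complex"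

definition words :: "'g set \<Rightarrow> ('g \<times> bool) list set" where
  "words S = {w. w \<noteq> [] \<and> fst ` set w \<subseteq> S}"

abbreviation flip_word :: "('g \<times> bool) list \<Rightarrow> ('g \<times> bool) list" where
  "flip_word w \<equiv> rev (map (apsnd Not) w)"

lemma flip_flip [simp]: "flip_word (flip_word w) = w"
  by (simp add: rev_map comp_def apsnd_def map_prod_def case_prod_unfold)

lemma flip_in_words [simp]: "flip_word w \<in> words S \<longleftrightarrow> w \<in> words S"
proof -
  have "fst ` set (flip_word w) = fst ` set w" by (simp add: image_image)
  then show ?thesis by (simp only: words_def mem_Collect_eq rev_is_Nil_conv map_is_Nil_conv)
qed

lemma append_in_words [simp]: "v \<in> words S \<Longrightarrow> w \<in> words S \<Longrightarrow> v + w \<in> words S"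
  by (auto simp: words_def plus_list_def)

lemma Nil_notin_words [simp]: "[] \<notin> words S"
  by (simp add: words_def)

lemma free_simps [simp]:
  "f \<in> carrier (free_star_alg S) \<longleftrightarrow> Poly_Mapping.keys f \<subseteq> words S"
  "vzero (free_star_alg S) = 0"
  "vplus (free_star_alg S) = (+)"
  "vtimes (free_star_alg S) = (*)"
  by (auto simp: free_star_alg_def words_def)

lemma lookup_free_scale:
  "Poly_Mapping.lookup (vscale (free_star_alg S) z f) w = z * Poly_Mapping.lookup f w"
  by (simp add: free_star_alg_def Poly_Mapping.map.rep_eq when_def)

lemma free_scale_single:
  "vscale (free_star_alg S) z (Poly_Mapping.single w c) = Poly_Mapping.single w (z * c)"
  by (rule poly_mapping_eqI) (simp add: lookup_free_scale lookup_single when_def)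

lemma free_minus [simp]: "vminus (free_star_alg S) f g = f - g"
  by (rule poly_mapping_eqI) (simp add: vminus_def lookup_free_scale lookup_add lookup_minus)

lemma lookup_free_adj:
  "Poly_Mapping.lookup (adj (free_star_alg S) f) w = cnj (Poly_Mapping.lookup f (flip_word w))"
proof -
  have eq: "flip_word v = w \<longleftrightarrow> v = flip_word w" for v by (metis flip_flip)
  have "Poly_Mapping.lookup (adj (free_star_alg S) f) w =
      (\<Sum>v\<in>Poly_Mapping.keys f. if v = flip_word w then cnj (Poly_Mapping.lookup f v) else 0)"
    by (simp add: free_star_alg_def lookup_sum lookup_single when_def eq)
  also have "\<dots> = cnj (Poly_Mapping.lookup f (flip_word w))"
    by (simp add: sum.delta' in_keys_iff)
  finally show ?thesis .
qed

lemma free_adj_single: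
  "adj (free_star_alg S) (Poly_Mapping.single w c) = Poly_Mapping.single (flip_word w) (cnj c)"
proof -
  have eq: "w = flip_word v \<longleftrightarrow> flip_word w = v" for v by (metis flip_flip)
  show ?thesis
    by (rule poly_mapping_eqI) (simp add: lookup_free_adj lookup_single when_def eq)
qed

lemma free_adj_add:
  "adj (free_star_alg S) (f + g) = adj (free_star_alg S) f + adj (free_star_alg S) g"
  by (rule poly_mapping_eqI) (simp add: lookup_free_adj lookup_add)

lemma free_adj_mult:
  "adj (free_star_alg S) (f * g) = adj (free_star_alg S) g * adj (free_star_alg S) (f :: 'g free)"
proof (rule poly_mapping_keys_induct[of f UNIV])
  show "adj (free_star_alg S) (0 * g) = adj (free_star_alg S) g * adj (free_star_alg S) 0"
    by (simp add: free_star_alg_def)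
next
  fix f :: "'g free" and v c
  assume f: "adj (free_star_alg S) (f * g) = adj (free_star_alg S) g * adj (free_star_alg S) f"
  have "adj (free_star_alg S) (Poly_Mapping.single v c * g) =
      adj (free_star_alg S) g * Poly_Mapping.single (flip_word v) (cnj c)"
  proof (rule poly_mapping_keys_induct[of g UNIV])
    show "adj (free_star_alg S) (Poly_Mapping.single v c * 0) =
      adj (free_star_alg S) 0 * Poly_Mapping.single (flip_word v) (cnj c)"
      by (simp add: free_star_alg_def)
  next
    fix g :: "'g free" and w d
    assume "adj (free_star_alg S) (Poly_Mapping.single v c * g) =
      adj (free_star_alg S) g * Poly_Mapping.single (flip_word v) (cnj c)"
    then show "adj (free_star_alg S) (Poly_Mapping.single v c * (g + Poly_Mapping.single w d)) =
      adj (free_star_alg S) (g + Poly_Mapping.single w d) * Poly_Mapping.single (flip_word v) (cnj c)"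
      by (simp add: distrib_left distrib_right free_adj_add mult_single free_adj_single plus_list_def mult.commute)
  qed simp
  then show "adj (free_star_alg S) ((f + Poly_Mapping.single v c) * g) =
      adj (free_star_alg S) g * adj (free_star_alg S) (f + Poly_Mapping.single v c)"
    by (simp add: distrib_left distrib_right free_adj_add f free_adj_single)
qed simp

lemma scale_as_mult: "vscale (free_star_alg S) z f = Poly_Mapping.single 0 z * f"
proof (rule poly_mapping_keys_induct[of f UNIV])
  fix f :: "'a free" and v c
  assume "vscale (free_star_alg S) z f = Poly_Mapping.single 0 z * f"
  moreover have "vscale (free_star_alg S) z (f + Poly_Mapping.single v c) =
      vscale (free_star_alg S) z f + vscale (free_star_alg S) z (Poly_Mapping.single v c)"
    by (rule poly_mapping_eqI) (simp add: lookup_free_scale lookup_add algebra_simps)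
  ultimately show "vscale (free_star_alg S) z (f + Poly_Mapping.single v c) =
      Poly_Mapping.single 0 z * (f + Poly_Mapping.single v c)"
    by (simp add: distrib_left mult_single free_scale_single)
next
  show "vscale (free_star_alg S) z 0 = Poly_Mapping.single 0 z * 0"
    by (rule poly_mapping_eqI) (simp add: lookup_free_scale)
qed simp

lemma mult_scale_right: "g * (Poly_Mapping.single 0 z * f) = Poly_Mapping.single 0 z * (g * (f :: 'g free))"
proof -
  have "g * Poly_Mapping.single 0 z = Poly_Mapping.single 0 z * g"
    by (rule poly_mapping_keys_induct[of g UNIV])
      (simp_all add: distrib_left distrib_right mult_single mult.commute)
  then show ?thesis by (simp flip: mult.assoc)
qed

lemma star_algebra_free: "star_algebra (free_star_alg S)"
proof
  fix f g h :: "'a free" and z w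
  assume f: "f \<in> carrier (free_star_alg S)"
  then show "vscale (free_star_alg S) z f \<in> carrier (free_star_alg S)"
    by (auto simp: in_keys_iff lookup_free_scale)
  show "adj (free_star_alg S) f \<in> carrier (free_star_alg S)"
    using f unfolding free_simps by (metis (no_types, lifting) complex_cnj_zero flip_in_words in_keys_iff lookup_free_adj subset_iff)
  show "adj (free_star_alg S) (adj (free_star_alg S) f) = f"
    by (rule poly_mapping_eqI) (simp only: lookup_free_adj flip_flip complex_cnj_cnj)
  show "adj (free_star_alg S) (vscale (free_star_alg S) z f) =
      vscale (free_star_alg S) (cnj z) (adj (free_star_alg S) f)"
    by (rule poly_mapping_eqI) (simp add: lookup_free_adj lookup_free_scale)
  assume g: "g \<in> carrier (free_star_alg S)"
  show "vplus (free_star_alg S) f g \<in> carrier (free_star_alg S)"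
    using f g keys_add[of f g] by auto
  show "vtimes (free_star_alg S) f g \<in> carrier (free_star_alg S)"
    using f g keys_mult[of f g] by fastforce
  show "vtimes (free_star_alg S) f (vscale (free_star_alg S) z g) =
      vscale (free_star_alg S) z (vtimes (free_star_alg S) f g)"
    by (simp add: scale_as_mult mult_scale_right)
next
  fix f :: "'a free" and z w
  have "Poly_Mapping.single 0 z * (Poly_Mapping.single 0 w * f) = Poly_Mapping.single 0 (z * w) * f"
    by (simp add: mult_single flip: mult.assoc)
  then show "vscale (free_star_alg S) z (vscale (free_star_alg S) w f) = vscale (free_star_alg S) (z * w) f"
    by (simp add: scale_as_mult)
qed (simp_all add: scale_as_mult mult.assoc distrib_left distrib_right single_add free_adj_add
    free_adj_mult add.assoc add.commute)

global_interpretation free: star_algebra "free_star_alg S" for S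
  by (rule star_algebra_free)

text \<open>There is no unit to assign to the empty word. The default \<open>0\<close> breaks
  multiplicativity at that word only, and it lies outside \<open>words S\<close>.\<close>

fun word_value :: "('g \<Rightarrow> 'r::star_ring) \<Rightarrow> ('g \<times> bool) list \<Rightarrow> 'r" where
  "word_value g [] = 0"
| "word_value g [(x, b)] = (if b then star (g x) else g x)"
| "word_value g ((x, b) # y # w) = (if b then star (g x) else g x) * word_value g (y # w)"

lemma word_value_append:
  "v \<noteq> [] \<Longrightarrow> w \<noteq> [] \<Longrightarrow> word_value g (v @ w) = word_value g v * word_value g w"
proof (induct g v rule: word_value.induct)
  case (2 g x b)
  then show ?case by (cases w) auto
qed (simp_all add: mult.assoc)

lemma word_value_flip: "word_value g (flip_word w) = star (word_value g w)"
proof (induct g w rule: word_value.induct)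
  case (3 g x b y w)
  then show ?case
    using word_value_append[of "flip_word (y # w)" "[(x, \<not> b)]" g] by (simp add: star_mult)
qed simp_all

definition free_value :: "('g \<Rightarrow> 'r::star_ring) \<Rightarrow> 'g free \<Rightarrow> 'r" where
  "free_value g f = (\<Sum>w\<in>Poly_Mapping.keys f. Poly_Mapping.lookup f w *\<^sub>C word_value g w)"

lemma free_value_zero [simp]: "free_value g 0 = 0"
  by (simp add: free_value_def)

lemma free_value_add: "free_value g (f + f') = free_value g f + free_value g f'"
  unfolding free_value_def by (rule setsum_keys_plus_distrib) (simp_all add: scaleC_add_left)

lemma free_value_single [simp]: "free_value g (Poly_Mapping.single w c) = c *\<^sub>C word_value g w"
  by (simp add: free_value_def)

lemma free_value_gen [simp]: "free_value g (free_gen x) = g x"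
  by (simp add: free_gen_def)

lemma free_value_scale: "free_value g (vscale (free_star_alg S) z f) = z *\<^sub>C free_value g f"
  by (rule poly_mapping_keys_induct[of f UNIV])
    (simp_all add: scale_as_mult distrib_left free_value_add mult_single scaleC_add_right)

lemma free_value_adj: "free_value g (adj (free_star_alg S) f) = star (free_value g f)"
  by (rule poly_mapping_keys_induct[of f UNIV])
    (simp_all add: free_adj_add free_value_add free_adj_single word_value_flip star_add free.adj_zero[simplified])

lemma free_value_mult:
  assumes "Poly_Mapping.keys f \<subseteq> words S" "Poly_Mapping.keys f' \<subseteq> words S"
  shows "free_value g (f * f') = free_value g f * free_value g f'"
  using assms(1)
proof (induct f rule: poly_mapping_keys_induct)
  case (add f v c)
  have "free_value g (Poly_Mapping.single v c * f') = free_value g (Poly_Mapping.single v c) * free_value g f'"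
    using assms(2)
  proof (induct f' rule: poly_mapping_keys_induct)
    case (add f' w d)
    then show ?case using \<open>v \<in> words S\<close>
      by (simp add: distrib_left free_value_add mult_single plus_list_def word_value_append words_def mult.commute[of c])
  qed simp
  then show ?case using add by (simp add: distrib_right free_value_add)
qed simp

definition free_hom :: "('a, 'm) star_alg_scheme \<Rightarrow> ('g \<Rightarrow> 'a) \<Rightarrow> 'g free \<Rightarrow> 'a" where
  "free_hom A g f = proj A (free_value (\<lambda>x. emb A (g x)) f)"

lemma free_gen_in_free [simp]: "Poly_Mapping.keys (free_gen x) \<subseteq> words S \<longleftrightarrow> x \<in> S"
  by (simp add: free_gen_def words_def)

context star_algebra
begin

lemma free_hom: "free_hom A g \<in> star_hom (free_star_alg S) A"
  unfolding free_hom_def star_hom_def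
  by (auto simp: free_value_add free_value_scale free_value_adj free_value_mult)

lemma free_hom_gen: "g x \<in> carrier A \<Longrightarrow> free_hom A g (free_gen x) = g x"
  by (simp add: free_hom_def)

lemma free_hom_unique:
  assumes F: "F \<in> star_hom (free_star_alg S) A" and G: "G \<in> star_hom (free_star_alg S) A"
    and eq: "\<And>x. x \<in> S \<Longrightarrow> F (free_gen x) = G (free_gen x)"
    and f: "f \<in> carrier (free_star_alg S)"
  shows "F f = G f"
proof -
  have keys1: "Poly_Mapping.keys (Poly_Mapping.single w (1::complex)) \<subseteq> words S \<longleftrightarrow> w \<in> words S" for w
    by simp
  have letter: "F (Poly_Mapping.single [l] 1) = G (Poly_Mapping.single [l] 1)" if "[l] \<in> words S" for l
  proof (cases l)
    case (Pair x b)
    have "Poly_Mapping.single [(x, True)] 1 = adj (free_star_alg S) (free_gen x)"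
      by (simp add: free_gen_def free_adj_single)
    moreover have "x \<in> S" using that Pair by (simp add: words_def)
    ultimately show ?thesis
      using Pair eq[of x] star_homD(5)[OF F, of "free_gen x"] star_homD(5)[OF G, of "free_gen x"]
      by (cases b) (simp_all flip: free_gen_def)
  qed
  have word: "F (Poly_Mapping.single w 1) = G (Poly_Mapping.single w 1)" if "w \<in> words S" for w
    using that
  proof (induct w)
    case (Cons l w)
    show ?case
    proof (cases "w = []")
      case True
      then show ?thesis using letter Cons by simp
    next
      case False
      then have w: "w \<in> words S" "[l] \<in> words S" using Cons(2) by (auto simp: words_def)
      have "Poly_Mapping.single (l # w) (1::complex) = Poly_Mapping.single [l] 1 * Poly_Mapping.single w 1"
        by (simp add: mult_single plus_list_def)
      then show ?thesis
        using star_homD(4)[OF F, of "Poly_Mapping.single [l] 1" "Poly_Mapping.single w 1"]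
          star_homD(4)[OF G, of "Poly_Mapping.single [l] 1" "Poly_Mapping.single w 1"] w Cons(1) letter
        by simp
    qed
  qed simp
  have "Poly_Mapping.keys f \<subseteq> words S" using f by simp
  then show ?thesis
  proof (induct f rule: poly_mapping_keys_induct)
    case zero
    then show ?case
      using star_hom_zero[OF F star_algebra_free star_algebra_axioms]
        star_hom_zero[OF G star_algebra_free star_algebra_axioms] by simp
  next
    case (add f w c)
    have "Poly_Mapping.single w c = vscale (free_star_alg S) c (Poly_Mapping.single w 1)"
      by (simp add: free_scale_single)
    then have "F (Poly_Mapping.single w c) = G (Poly_Mapping.single w c)"
      using word[OF add(3)] add(3) star_homD(3)[OF F] star_homD(3)[OF G] by simp
    then show ?case
      using add star_homD(2)[OF F, of f "Poly_Mapping.single w c"]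
        star_homD(2)[OF G, of f "Poly_Mapping.single w c"] by simp
  qed
qed

text \<open>The C*-identity survives because squaring is an order isomorphism of the nonnegative
  reals and so commutes with suprema.\<close>

lemma sup_cstar_seminorm:
  assumes "Ps \<noteq> {}" and Ps: "\<And>p. p \<in> Ps \<Longrightarrow> cstar_seminorm A p"
    and bdd: "\<And>x. x \<in> carrier A \<Longrightarrow> bdd_above ((\<lambda>p. p x) ` Ps)"
  shows "cstar_seminorm A (\<lambda>x. Sup ((\<lambda>p. p x) ` Ps))"
proof -
  define N where "N x = Sup ((\<lambda>p. p x) ` Ps)" for x
  have le: "p x \<le> N x" if "p \<in> Ps" "x \<in> carrier A" for p x
    unfolding N_def using that bdd by (intro cSUP_upper)
  have leI: "N x \<le> c" if "\<And>p. p \<in> Ps \<Longrightarrow> p x \<le> c" for x c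
    unfolding N_def using that assms(1) by (intro cSUP_least)
  have nonneg: "0 \<le> p x" if "p \<in> Ps" "x \<in> carrier A" for p x
    using cstar_seminormed.nonneg[OF seminormed_proj[OF Ps[OF that(1)]], of "emb A x"] that by simp
  have N_nonneg: "0 \<le> N x" if "x \<in> carrier A" for x
    using assms(1) le nonneg that by (meson ex_in_conv order_trans)
  note rules = Ps[unfolded cstar_seminorm_def]
  have scale_le: "N (vscale A z x) \<le> cmod z * N x" if "x \<in> carrier A" for x z
  proof (rule leI)
    fix p assume p: "p \<in> Ps"
    show "p (vscale A z x) \<le> cmod z * N x"
      using rules[OF p] that mult_left_mono[OF le[OF p that], of "cmod z"] by simp
  qed
  show ?thesis
    unfolding N_def[symmetric]
  proof (rule cstar_seminormI)
    fix x y z assume x: "x \<in> carrier A"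
    show "N (vscale A z x) = cmod z * N x"
    proof (cases "z = 0")
      case True
      then show ?thesis using scale_le[OF x, of 0] N_nonneg[of "vscale A 0 x"] x by (simp add: closed)
    next
      case False
      then have "N x \<le> cmod (1 / z) * N (vscale A z x)"
        using scale_le[of "vscale A z x" "1 / z"] x by (simp add: closed scale_scale scale_one)
      then show ?thesis using scale_le[OF x, of z] False by (simp add: norm_divide field_simps)
    qed
    show "N (vtimes A (adj A x) x) = (N x)\<^sup>2"
    proof (rule antisym)
      show "N (vtimes A (adj A x) x) \<le> (N x)\<^sup>2"
      proof (rule leI)
        fix p assume p: "p \<in> Ps"
        show "p (vtimes A (adj A x) x) \<le> (N x)\<^sup>2"
          using rules[OF p] x power_mono[OF le[OF p x] nonneg[OF p x], of 2] by simp
      qed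
      have "N x \<le> sqrt (N (vtimes A (adj A x) x))"
      proof (rule leI)
        fix p assume p: "p \<in> Ps"
        have "(p x)\<^sup>2 \<le> N (vtimes A (adj A x) x)"
          using le[OF p, of "vtimes A (adj A x) x"] rules[OF p] x by (simp add: closed)
        then show "p x \<le> sqrt (N (vtimes A (adj A x) x))" by (rule real_le_rsqrt)
      qed
      then show "(N x)\<^sup>2 \<le> N (vtimes A (adj A x) x)"
        using N_nonneg x power_mono[of "N x" "sqrt (N (vtimes A (adj A x) x))" 2] by (simp add: closed)
    qed
    assume y: "y \<in> carrier A"
    show "N (vplus A x y) \<le> N x + N y"
    proof (rule leI)
      fix p assume "p \<in> Ps"
      then show "p (vplus A x y) \<le> N x + N y"
        using rules[of p] le[of p x] le[of p y] x y by (smt (verit))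
    qed
    show "N (vtimes A x y) \<le> N x * N y"
    proof (rule leI)
      fix p assume p: "p \<in> Ps"
      have "p x * p y \<le> N x * N y" using p x y le nonneg N_nonneg by (intro mult_mono) auto
      then show "p (vtimes A x y) \<le> N x * N y" using rules[OF p] x y by (meson order_trans)
    qed
  qed
qed

end

text \<open>The bound on the generators keeps the supremum in the universal seminorm finite. The
  constant is \<open>1\<close> because the generators of a graph algebra are partial
  isometries.\<close>

locale presentation =
  fixes S :: "'g set" and R :: "'g free set"
  assumes relators: "R \<subseteq> carrier (free_star_alg S)"
    and bounded: "\<lbrakk>cstar_seminorm (free_star_alg S) p; \<And>r. r \<in> R \<Longrightarrow> p r = 0; x \<in> S\<rbrakk> \<Longrightarrow> p (free_gen x) \<le> 1"
begin

abbreviation "FS \<equiv> free_star_alg S"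
abbreviation "U \<equiv> universal_seminorm S R"
abbreviation "gen \<equiv> universal_gen S R"

definition Ps where "Ps = {p. cstar_seminorm FS p \<and> (\<forall>r\<in>R. p r = 0)}"

lemma U_eq: "U x = Sup ((\<lambda>p. p x) ` Ps)"
  unfolding universal_seminorm_def Ps_def by (rule arg_cong[where f = Sup]) auto

text \<open>Every nonempty word is a product of letters of seminorm at most \<open>1\<close>, so the
  sum of the moduli of the coefficients bounds all admissible seminorms at once.\<close>

lemma Ps_bounded:
  assumes "x \<in> carrier FS"
  shows "bdd_above ((\<lambda>p. p x) ` Ps)"
proof -
  have "Poly_Mapping.keys x \<subseteq> words S" using assms by simp
  then have "\<exists>B. \<forall>p\<in>Ps. p x \<le> B"
  proof (induct x rule: poly_mapping_keys_induct)
    case zero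
    have "p 0 \<le> 0" if "p \<in> Ps" for p
      using cstar_seminormed.zero[OF free.seminormed_proj[of S p]] that by (simp add: Ps_def)
    then show ?case by blast
  next
    case (add f w c)
    then obtain B where B: "\<forall>p\<in>Ps. p f \<le> B" by blast
    have "p (f + Poly_Mapping.single w c) \<le> B + cmod c" if p: "p \<in> Ps" for p
    proof -
      interpret p: cstar_seminormed "\<lambda>f. p (proj FS f)"
        using p by (intro free.seminormed_proj) (simp add: Ps_def)
      have letter: "p (proj FS (word_value (\<lambda>x. emb FS (free_gen x)) w)) \<le> 1" if "w \<in> words S" for w
        using that
      proof (induct "\<lambda>x. emb FS (free_gen x :: 'g free)" w rule: word_value.induct)
        case (2 x b)
        then have "x \<in> S" by (simp add: words_def)
        then show ?case using p bounded[of p x] p.star_eq[of "emb FS (free_gen x)"]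
          by (simp add: Ps_def del: free.proj_hom)
      next
        case (3 x b y w)
        then have "p (free_gen x) \<le> 1" "x \<in> S" using p bounded[of p x] by (auto simp: Ps_def words_def)
        then have "p (proj FS (if b then star (emb FS (free_gen x)) else emb FS (free_gen x))) \<le> 1"
          using p.star_eq[of "emb FS (free_gen x)"] by (simp del: free.proj_hom)
        moreover have "y # w \<in> words S" using 3 by (auto simp: words_def)
        ultimately show ?case unfolding word_value.simps using 3(1) by (intro p.mult_le_one)
      qed simp
      have eq: "proj FS (free_value (\<lambda>x. emb FS (free_gen x)) g) = g" if "g \<in> carrier FS" for g
        using free.free_hom_unique[OF free.free_hom[of S free_gen S], of "\<lambda>x. x" g] that
          free.closed by (simp add: free_hom_def star_hom_def)
      have "p (f + Poly_Mapping.single w c) \<le> p f + p (Poly_Mapping.single w c)"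
        using p add by (simp add: Ps_def cstar_seminorm_def)
      also have "p (Poly_Mapping.single w c) = cmod c * p (proj FS (word_value (\<lambda>x. emb FS (free_gen x)) w))"
        using eq[of "Poly_Mapping.single w c"] add(3)
          p.scale[of c "word_value (\<lambda>x. emb FS (free_gen x)) w"] by (simp del: free.proj_hom)
      also have "\<dots> \<le> cmod c * 1" using letter[OF add(3)] by (intro mult_left_mono) auto
      finally show ?thesis using B p by force
    qed
    then show ?case by blast
  qed
  then show ?thesis by (auto intro: bdd_aboveI2)
qed

lemma U_seminorm: "cstar_seminorm FS U"
proof -
  \<comment> \<open>The zero seminorm keeps the index set of the supremum nonempty.\<close>
  have "(\<lambda>_. 0) \<in> Ps" by (simp add: Ps_def cstar_seminorm_def)
  then have "cstar_seminorm FS (\<lambda>x. Sup ((\<lambda>p. p x) ` Ps))"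
    using Ps_bounded by (intro free.sup_cstar_seminorm) (auto simp: Ps_def)
  then show ?thesis unfolding U_eq[symmetric] by simp
qed

sublocale seminormed_star_algebra FS U
  by unfold_locales (rule U_seminorm)

lemma universal:
  assumes "cstar_seminorm FS p" "\<And>r. r \<in> R \<Longrightarrow> p r = 0" "x \<in> carrier FS"
  shows "p x \<le> U x"
  unfolding U_eq using assms by (intro cSUP_upper Ps_bounded) (auto simp: Ps_def)

lemma U_relator: "r \<in> R \<Longrightarrow> U r = 0"
proof -
  assume r: "r \<in> R"
  have "(\<lambda>_. 0) \<in> Ps" by (simp add: Ps_def cstar_seminorm_def)
  then have "(\<lambda>p. p r) ` Ps = {0}" using r by (auto simp: Ps_def)
  then show ?thesis by (simp add: U_eq)
qed

lemma gen_eq: "gen x = inc (free_gen x)"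
  by (simp add: universal_gen_def)

lemma gen_closed [simp]: "x \<in> S \<Longrightarrow> gen x \<in> carrier K"
  by (simp add: gen_eq)

lemma inc_relator: "r \<in> R \<Longrightarrow> inc r = vzero K"
  using cstar_algebra.norm_definite[OF cstar_algebra_K, of "inc r"] norm_inc[of r] U_relator[of r] relators
  by (auto simp del: free_simps)

lemma hom_gen_eqI:
  assumes G: "G \<in> star_hom K B" and H: "H \<in> star_hom K B" and B: "cstar_algebra B"
    and eq: "\<And>x. x \<in> S \<Longrightarrow> G (gen x) = H (gen x)" and x: "x \<in> carrier K"
  shows "G x = H x"
proof -
  interpret B: cstar_algebra B by fact
  have "G (inc f) = H (inc f)" if "f \<in> carrier FS" for f
    using B.free_hom_unique[OF star_hom_comp[OF inc_star_hom G] star_hom_comp[OF inc_star_hom H], of f]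
      that eq by (simp add: gen_eq)
  then show ?thesis using hom_eqI[OF G H B] x by blast
qed

end

section \<open>The graded tensor product\<close>

declare add_bit_eq_xor [simp del] mult_bit_eq_and [simp del]

lemma bit_cases: "i = 0 \<or> i = (1::bit)"
  by (cases i) auto

lemma bit_sign_simps [simp]: "bit_sign 0 = 1" "bit_sign 1 = -1"
  by (simp_all add: bit_sign_def)

lemma bit_sign_add: "bit_sign (i + j) = bit_sign i * bit_sign j"
  using bit_cases[of i] bit_cases[of j] by auto

lemma bit_sign_square [simp]: "bit_sign i * bit_sign i = 1" "bit_sign i * (bit_sign i * z) = z"
  using bit_cases[of i] by auto

lemma cnj_bit_sign [simp]: "cnj (bit_sign i) = bit_sign i"
  using bit_cases[of i] by auto

lemma norm_bit_sign [simp]: "cmod (bit_sign i) = 1"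
  using bit_cases[of i] by auto

definition homogeneous :: "('a, 'm) star_alg_scheme \<Rightarrow> ('a \<Rightarrow> 'a) \<Rightarrow> bit \<Rightarrow> 'a \<Rightarrow> bool" where
  "homogeneous A \<alpha> i a \<longleftrightarrow> a \<in> carrier A \<and> \<alpha> a = vscale A (bit_sign i) a"

locale graded_algebra = star_algebra A for A :: "('a, 'm) star_alg_scheme" +
  fixes \<alpha> :: "'a \<Rightarrow> 'a"
  assumes grading: "grading A \<alpha>"
begin

lemma hom_\<alpha>: "\<alpha> \<in> star_hom A A"
  using grading by (simp add: grading_def star_iso_def)

lemmas \<alpha>_hom = star_homD[OF hom_\<alpha>]

lemma \<alpha>_\<alpha>: "x \<in> carrier A \<Longrightarrow> \<alpha> (\<alpha> x) = x"
  using grading by (simp add: grading_def)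

abbreviation "part \<equiv> hom_part A \<alpha>"
abbreviation "hmg \<equiv> homogeneous A \<alpha>"

lemma part_closed [simp]: "x \<in> carrier A \<Longrightarrow> part i x \<in> carrier A"
  by (simp add: hom_part_def closed \<alpha>_hom)

lemma emb_part: "x \<in> carrier A \<Longrightarrow> emb A (part i x) = (1/2) *\<^sub>C (emb A x + bit_sign i *\<^sub>C emb A (\<alpha> x))"
  by (simp add: hom_part_def closed \<alpha>_hom emb_hom)

lemma part_plus:
  assumes "x \<in> carrier A" "y \<in> carrier A"
  shows "part i (vplus A x y) = vplus A (part i x) (part i y)"
proof -
  have "emb A (part i (vplus A x y)) = emb A (vplus A (part i x) (part i y))"
    using assms by (simp add: emb_part emb_hom closed \<alpha>_hom algebra_simps scaleC_add_right)
  then show ?thesis using assms by (simp add: emb_eq_iff closed)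
qed

lemma part_scale:
  assumes "x \<in> carrier A"
  shows "part i (vscale A z x) = vscale A z (part i x)"
proof -
  have "emb A (part i (vscale A z x)) = emb A (vscale A z (part i x))"
    using assms by (simp add: emb_part emb_hom closed \<alpha>_hom algebra_simps scaleC_add_right)
  then show ?thesis using assms by (simp add: emb_eq_iff closed)
qed

lemma homogeneous_part: "x \<in> carrier A \<Longrightarrow> hmg i (part i x)"
proof -
  assume x: "x \<in> carrier A"
  have "emb A (\<alpha> (part i x)) = emb A (vscale A (bit_sign i) (part i x))"
    using x by (simp add: emb_part emb_hom hom_part_def closed \<alpha>_hom \<alpha>_\<alpha> algebra_simps scaleC_add_right)
  then show ?thesis using x by (simp add: homogeneous_def emb_eq_iff closed \<alpha>_hom)
qed

lemma part_sum: "x \<in> carrier A \<Longrightarrow> vplus A (part 0 x) (part 1 x) = x"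
proof -
  assume x: "x \<in> carrier A"
  have "emb A (vplus A (part 0 x) (part 1 x)) = emb A x"
    using x by (simp add: emb_part emb_hom algebra_simps scaleC_add_right scaleC_diff_right
        flip: scaleC_add_left)
  then show ?thesis using x by (simp add: emb_eq_iff closed)
qed

lemma part_homogeneous: "hmg j x \<Longrightarrow> part i x = (if i = j then x else vzero A)"
proof -
  assume x: "hmg j x"
  then have "emb A (part i x) = (1/2) *\<^sub>C (emb A x + (bit_sign i * bit_sign j) *\<^sub>C emb A x)"
    by (simp add: emb_part emb_hom homogeneous_def)
  also have "\<dots> = (if i = j then emb A x else 0)"
    using bit_cases[of i] bit_cases[of j] by (auto simp: scaleC_two[symmetric])
  finally show ?thesis
    using x by (simp add: homogeneous_def emb_eq_iff closed flip: emb_hom split: if_splits)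
qed

lemma homogeneous_closed [simp]: "hmg i x \<Longrightarrow> x \<in> carrier A"
  by (simp add: homogeneous_def)

lemma homogeneous_scale: "hmg i x \<Longrightarrow> hmg i (vscale A z x)"
  by (simp add: homogeneous_def closed \<alpha>_hom scale_scale mult.commute)

lemma homogeneous_times: "hmg i x \<Longrightarrow> hmg j y \<Longrightarrow> hmg (i + j) (vtimes A x y)"
proof -
  assume x: "hmg i x" and y: "hmg j y"
  then have xy: "x \<in> carrier A" "y \<in> carrier A" by simp_all
  have "\<alpha> (vtimes A x y) = vtimes A (vscale A (bit_sign i) x) (vscale A (bit_sign j) y)"
    using x y by (simp add: \<alpha>_hom(4) homogeneous_def)
  also have "\<dots> = vscale A (bit_sign (i + j)) (vtimes A x y)"
    unfolding bit_sign_add using xy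
    by (simp add: times_scale_left times_scale_right scale_scale scale_closed times_closed mult.commute[of "bit_sign j"])
  finally show ?thesis using xy by (simp add: homogeneous_def times_closed)
qed

lemma homogeneous_adj: "hmg i x \<Longrightarrow> hmg i (adj A x)"
  by (simp add: homogeneous_def closed \<alpha>_hom adj_scale)

end

section \<open>The algebraic graded tensor product as a *-algebra\<close>

lemma sum_list_swap:
  "(\<Sum>x\<leftarrow>xs. \<Sum>y\<leftarrow>ys. f x y) = (\<Sum>y\<leftarrow>ys. \<Sum>x\<leftarrow>xs. f x y :: 'a::comm_monoid_add)"
  by (induct xs) (simp_all add: sum_list_addf)

lemma sum_list_concat_map:
  "(\<Sum>z\<leftarrow>concat (map (\<lambda>x. map (g x) ys) xs). f z) = (\<Sum>x\<leftarrow>xs. \<Sum>y\<leftarrow>ys. f (g x y) :: 'a::comm_monoid_add)"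
  by (induct xs) (simp_all add: comp_def)

lemma set_concat_map_map: "z \<in> set (concat (map (\<lambda>x. map (g x) ys) xs)) \<longleftrightarrow> (\<exists>x\<in>set xs. \<exists>y\<in>set ys. z = g x y)"
  by auto

locale graded_pair = A: graded_algebra A \<alpha> + B: graded_algebra B \<beta>
  for A :: "('a, 'm) star_alg_scheme" and \<alpha> and B :: "('b, 'n) star_alg_scheme" and \<beta>
begin

abbreviation "X \<equiv> alg_gtensor A \<alpha> B \<beta>"
abbreviation "BF \<equiv> bilinear_forms A B"

lemma BF_simps:
  assumes "f \<in> BF"
  shows "\<lbrakk>x \<in> carrier A; y \<in> carrier A; b \<in> carrier B\<rbrakk> \<Longrightarrow> f (vplus A x y) b = f x b + f y b"
    and "\<lbrakk>x \<in> carrier A; b \<in> carrier B\<rbrakk> \<Longrightarrow> f (vscale A z x) b = z * f x b"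
    and "\<lbrakk>a \<in> carrier A; x' \<in> carrier B; y' \<in> carrier B\<rbrakk> \<Longrightarrow> f a (vplus B x' y') = f a x' + f a y'"
    and "\<lbrakk>a \<in> carrier A; x' \<in> carrier B\<rbrakk> \<Longrightarrow> f a (vscale B z x') = z * f a x'"
  using assms by (simp_all add: bilinear_forms_def)

lemma BF_zero:
  assumes "f \<in> BF"
  shows "b \<in> carrier B \<Longrightarrow> f (vzero A) b = 0" "a \<in> carrier A \<Longrightarrow> f a (vzero B) = 0"
  using BF_simps(2)[OF assms, of "vzero A" b 0] BF_simps(4)[OF assms, of a "vzero B" 0]
  by (simp_all add: A.scale_zero_right B.scale_zero_right A.zero_closed B.zero_closed)

text \<open>A quadruple \<open>(i, a, j, b)\<close> stands for \<open>a \<otimes> b\<close> with \<open>a\<close> and \<open>b\<close> homogeneous of degrees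
  \<open>i\<close> and \<open>j\<close>; every element of the algebraic tensor product is given by a list of such.\<close>

definition quads :: "(bit \<times> 'a \<times> bit \<times> 'b) set" where
  "quads = {(i, a, j, b). A.hmg i a \<and> B.hmg j b}"

definition val :: "('a \<Rightarrow> 'b \<Rightarrow> complex) \<Rightarrow> bit \<times> 'a \<times> bit \<times> 'b \<Rightarrow> complex" where
  "val f = (\<lambda>(i, a, j, b). f a b)"

definition tens :: "(bit \<times> 'a \<times> bit \<times> 'b) list \<Rightarrow> ('a \<Rightarrow> 'b \<Rightarrow> complex) \<Rightarrow> complex" where
  "tens xs = (\<lambda>f. if f \<in> BF then \<Sum>x\<leftarrow>xs. val f x else 0)"

lemma tens_Nil: "tens [] = (\<lambda>_. 0)"
  by (auto simp: tens_def)

lemma tens_append: "tens (xs @ ys) = (\<lambda>f. tens xs f + tens ys f)"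
  by (auto simp: tens_def)

lemma tens_Cons: "tens (x # xs) = (\<lambda>f. tens [x] f + tens xs f)"
  by (auto simp: tens_def)

lemma elem_tensor_tens:
  assumes "a \<in> carrier A" "b \<in> carrier B"
  shows "elem_tensor A B a b = tens [(0, A.part 0 a, 0, B.part 0 b), (0, A.part 0 a, 1, B.part 1 b),
    (1, A.part 1 a, 0, B.part 0 b), (1, A.part 1 a, 1, B.part 1 b)]"
proof
  fix f
  show "elem_tensor A B a b f = tens [(0, A.part 0 a, 0, B.part 0 b), (0, A.part 0 a, 1, B.part 1 b),
    (1, A.part 1 a, 0, B.part 0 b), (1, A.part 1 a, 1, B.part 1 b)] f"
  proof (cases "f \<in> BF")
    case True
    have "f a b = f (vplus A (A.part 0 a) (A.part 1 a)) (vplus B (B.part 0 b) (B.part 1 b))"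
      using assms by (simp add: A.part_sum B.part_sum)
    also have "\<dots> = tens [(0, A.part 0 a, 0, B.part 0 b), (0, A.part 0 a, 1, B.part 1 b),
      (1, A.part 1 a, 0, B.part 0 b), (1, A.part 1 a, 1, B.part 1 b)] f"
      using True assms by (simp add: BF_simps tens_def val_def A.closed B.closed)
    finally show ?thesis using True by (simp add: elem_tensor_def)
  qed (simp add: elem_tensor_def tens_def)
qed

definition qscale where
  "qscale z = (\<lambda>(i, a, j, b). (i, vscale A z a, j, b))"

lemma scale_tens:
  assumes "set xs \<subseteq> quads"
  shows "(\<lambda>f. z * tens xs f) = tens (map (qscale z) xs)"
    "set (map (qscale z) xs) \<subseteq> quads"
proof -
  have "z * (\<Sum>x\<leftarrow>xs. val f x) = (\<Sum>x\<leftarrow>xs. val f (qscale z x))"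
    if "f \<in> BF" for f
    using assms that by (induct xs) (auto simp: val_def quads_def qscale_def BF_simps algebra_simps)
  then show "(\<lambda>f. z * tens xs f) = tens (map (qscale z) xs)"
    by (auto simp: tens_def comp_def)
  show "set (map (qscale z) xs) \<subseteq> quads"
    using assms by (auto simp: quads_def qscale_def A.homogeneous_scale)
qed

lemma carrier_X: "T \<in> carrier X \<longleftrightarrow> (\<exists>xs. set xs \<subseteq> quads \<and> T = tens xs)"
proof
  assume "T \<in> carrier X"
  then obtain F z where F: "finite F" "F \<subseteq> carrier A \<times> carrier B"
    and T: "T = (\<lambda>f. \<Sum>(a, b)\<in>F. z (a, b) * elem_tensor A B a b f)"
    by (auto simp: alg_gtensor_def)
  have "\<exists>xs. set xs \<subseteq> quads \<and> (\<lambda>f. \<Sum>(a, b)\<in>F. z (a, b) * elem_tensor A B a b f) = tens xs"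
    using F
  proof (induct F rule: finite_induct)
    case (insert p F)
    obtain a b where p: "p = (a, b)" "a \<in> carrier A" "b \<in> carrier B" using insert by auto
    obtain xs where xs: "set xs \<subseteq> quads"
      "(\<lambda>f. \<Sum>(a, b)\<in>F. z (a, b) * elem_tensor A B a b f) = tens xs" using insert by auto
    define ys :: "(bit \<times> 'a \<times> bit \<times> 'b) list" where "ys = [(0, A.part 0 a, 0, B.part 0 b), (0, A.part 0 a, 1, B.part 1 b),
      (1, A.part 1 a, 0, B.part 0 b), (1, A.part 1 a, 1, B.part 1 b)]"
    have ys: "set ys \<subseteq> quads" "elem_tensor A B a b = tens ys"
      using p by (auto simp: ys_def quads_def A.homogeneous_part B.homogeneous_part elem_tensor_tens)
    show ?case
      using scale_tens[OF ys(1), of "z p"] insert(1,2) xs ys fun_cong[OF xs(2)] p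
      by (intro exI[of _ "map (qscale (z p)) ys @ xs"])
        (auto simp: tens_append fun_eq_iff)
  qed (auto simp: tens_Nil intro: exI[of _ "[]"])
  then show "\<exists>xs. set xs \<subseteq> quads \<and> T = tens xs" by (simp add: T)
next
  assume "\<exists>xs. set xs \<subseteq> quads \<and> T = tens xs"
  then obtain xs where xs: "set xs \<subseteq> quads" and T: "T = tens xs" by blast
  have "\<exists>F z. tens xs = (\<lambda>f. \<Sum>p\<in>F. z p * elem_tensor A B (fst p) (snd p) f) \<and>
      finite F \<and> F \<subseteq> carrier A \<times> carrier B"
    using xs
  proof (induct xs)
    case Nil
    show ?case by (intro exI[of _ "{}"]) (simp add: tens_Nil)
  next
    case (Cons x xs)
    obtain i a j b where x: "x = (i, a, j, b)" "a \<in> carrier A" "b \<in> carrier B"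
      using Cons(2) by (auto simp: quads_def)
    obtain F z where F: "tens xs = (\<lambda>f. \<Sum>p\<in>F. z p * elem_tensor A B (fst p) (snd p) f)"
      "finite F" "F \<subseteq> carrier A \<times> carrier B" using Cons by auto
    \<comment> \<open>The pair \<open>(a, b)\<close> may already occur in \<open>F\<close>; its
      coefficient is then raised by \<open>1\<close>, and otherwise it starts from
      \<open>0\<close>.\<close>
    define z' where "z' p = (if p \<in> F then z p else 0) + (if p = (a, b) then 1 else 0)" for p
    have "tens (x # xs) f = (\<Sum>p\<in>insert (a, b) F. z' p * elem_tensor A B (fst p) (snd p) f)" for f
    proof -
      have "(\<Sum>p\<in>insert (a, b) F. z' p * elem_tensor A B (fst p) (snd p) f) =
          (\<Sum>p\<in>insert (a, b) F. if p \<in> F then z p * elem_tensor A B (fst p) (snd p) f else 0) +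
          (\<Sum>p\<in>insert (a, b) F. if p = (a, b) then elem_tensor A B a b f else 0)"
        unfolding sum.distrib[symmetric] by (intro sum.cong) (auto simp: z'_def algebra_simps)
      also have "(\<Sum>p\<in>insert (a, b) F. if p \<in> F then z p * elem_tensor A B (fst p) (snd p) f else 0)
          = tens xs f"
        unfolding F(1) using F(2) by (intro sum.mono_neutral_cong_right) auto
      finally show ?thesis
        using F(2) tens_Cons[of x xs] by (simp add: tens_def[of "[(i, a, j, b)]"] x val_def elem_tensor_def del: sum.insert)
    qed
    then show ?case using F x by (intro exI[of _ "insert (a, b) F"] exI[of _ z']) auto
  qed
  then show "T \<in> carrier X" by (fastforce simp: T alg_gtensor_def case_prod_unfold)
qed

lemma tens_in_X [simp]: "set xs \<subseteq> quads \<Longrightarrow> tens xs \<in> carrier X"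
  by (auto simp: carrier_X)

lemma elem_tensor_in_X: "a \<in> carrier A \<Longrightarrow> b \<in> carrier B \<Longrightarrow> elem_tensor A B a b \<in> carrier X"
  by (simp add: elem_tensor_tens quads_def A.homogeneous_part B.homogeneous_part)

lemma tens_apply:
  assumes "set xs \<subseteq> quads" "g \<in> BF" "\<And>x. x \<in> set xs \<Longrightarrow> val g x = h x"
  shows "tens xs g = (\<Sum>x\<leftarrow>xs. h x)"
  using assms by (simp add: tens_def cong: map_cong)

text \<open>The sign of moving \<open>b\<close> past \<open>a'\<close> is stored as a scalar in the
  first leg, so that a product of two quadruples is again one quadruple.\<close>

definition qtimes where
  "qtimes = (\<lambda>(i, a, j, b) (i', a', j', b').
     (i + i', vscale A (bit_sign (i' * j)) (vtimes A a a'), j + j', vtimes B b b'))"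

definition qadj where
  "qadj = (\<lambda>(i, a, j, b). (i, vscale A (bit_sign (i * j)) (adj A a), j, adj B b))"

abbreviation "ltimes xs ys \<equiv> concat (map (\<lambda>x. map (qtimes x) ys) xs)"

lemma qtimes_quads: "x \<in> quads \<Longrightarrow> y \<in> quads \<Longrightarrow> qtimes x y \<in> quads"
proof -
  assume "x \<in> quads" "y \<in> quads"
  then obtain i a j b i' a' j' b' where xy: "x = (i, a, j, b)" "y = (i', a', j', b')"
    and hom: "A.hmg i a" "B.hmg j b" "A.hmg i' a'" "B.hmg j' b'"
    by (auto simp: quads_def)
  show ?thesis
    unfolding xy quads_def qtimes_def prod.case mem_Collect_eq
    by (intro conjI A.homogeneous_scale A.homogeneous_times B.homogeneous_times hom)
qed

lemma qadj_quads: "x \<in> quads \<Longrightarrow> qadj x \<in> quads"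
  by (auto simp: quads_def qadj_def A.homogeneous_adj B.homogeneous_adj A.homogeneous_scale)

lemma ltimes_quads: "set xs \<subseteq> quads \<Longrightarrow> set ys \<subseteq> quads \<Longrightarrow> set (ltimes xs ys) \<subseteq> quads"
proof
  fix z assume *: "set xs \<subseteq> quads" "set ys \<subseteq> quads" and "z \<in> set (ltimes xs ys)"
  then obtain x y where "x \<in> set xs" "y \<in> set ys" "z = qtimes x y"
    unfolding set_concat_map_map by blast
  then show "z \<in> quads" using * qtimes_quads[of x y] by (simp add: subsetD)
qed

lemma X_simps [simp]:
  "vzero X = (\<lambda>f. 0)" "vplus X T U = (\<lambda>f. T f + U f)" "vscale X z T = (\<lambda>f. z * T f)"
  by (simp_all add: alg_gtensor_def fun_eq_iff)

text \<open>The product of \<open>alg_gtensor\<close> evaluates one functional inside the other, and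
  functionals are \<open>0\<close> off the bilinear forms. So the inner expressions must first be
  shown to be bilinear (\<open>m2\<close> and \<open>m1\<close>); after that, homogeneity leaves one
  of the four summands.\<close>

lemma times_tens:
  assumes xs: "set xs \<subseteq> quads" and ys: "set ys \<subseteq> quads"
  shows "vtimes X (tens xs) (tens ys) = tens (ltimes xs ys)"
proof
  fix f
  show "vtimes X (tens xs) (tens ys) f = tens (ltimes xs ys) f"
  proof (cases "f \<in> BF")
    case f: True
    note [simp] = BF_simps[OF f] BF_zero[OF f]
    define m where "m a b a' b' = (\<Sum>i\<in>{0, 1}. \<Sum>j\<in>{0, 1}.
      bit_sign (i * j) * f (vtimes A a (A.part i a')) (vtimes B (B.part j b) b'))" for a b a' b'
    note [simp] = A.closed B.closed A.part_plus B.part_plus A.part_scale B.part_scale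
      A.times_add_left A.times_add_right B.times_add_left B.times_add_right
      A.times_scale_left A.times_scale_right B.times_scale_left B.times_scale_right
    have m2: "(\<lambda>a' b'. m a b a' b') \<in> BF" if "a \<in> carrier A" "b \<in> carrier B" for a b
      using that by (simp add: bilinear_forms_def m_def algebra_simps)
    have U: "tens ys (m a b) = (\<Sum>y\<leftarrow>ys. val (m a b) y)" if "a \<in> carrier A" "b \<in> carrier B" for a b
      using m2[OF that] by (simp add: tens_def)
    have y_closed: "\<And>i a j b. (i, a, j, b) \<in> set ys \<Longrightarrow> a \<in> carrier A \<and> b \<in> carrier B"
      using ys by (auto simp: quads_def)
    have "(\<Sum>y\<leftarrow>ys. val (m (vplus A x y') b) y) = (\<Sum>y\<leftarrow>ys. val (m x b) y) + (\<Sum>y\<leftarrow>ys. val (m y' b) y)"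
      if "x \<in> carrier A" "y' \<in> carrier A" "b \<in> carrier B" for x y' b
      unfolding sum_list_addf[symmetric] using that y_closed
      by (intro arg_cong[where f = sum_list] map_cong) (auto simp: m_def val_def algebra_simps)
    moreover have "(\<Sum>y\<leftarrow>ys. val (m x (vplus B b b')) y) = (\<Sum>y\<leftarrow>ys. val (m x b) y) + (\<Sum>y\<leftarrow>ys. val (m x b') y)"
      if "x \<in> carrier A" "b \<in> carrier B" "b' \<in> carrier B" for x b b'
      unfolding sum_list_addf[symmetric] using that y_closed
      by (intro arg_cong[where f = sum_list] map_cong) (auto simp: m_def val_def algebra_simps)
    moreover have "(\<Sum>y\<leftarrow>ys. val (m (vscale A z x) b) y) = z * (\<Sum>y\<leftarrow>ys. val (m x b) y)"
      "(\<Sum>y\<leftarrow>ys. val (m x (vscale B z b)) y) = z * (\<Sum>y\<leftarrow>ys. val (m x b) y)"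
      if "x \<in> carrier A" "b \<in> carrier B" for x b z
      unfolding sum_list_const_mult[symmetric] using that y_closed
      by (intro arg_cong[where f = sum_list] map_cong; auto simp: m_def val_def algebra_simps)+
    ultimately have m1: "(\<lambda>a b. tens ys (m a b)) \<in> BF"
      unfolding bilinear_forms_def by (simp add: U)
    have "vtimes X (tens xs) (tens ys) f = tens xs (\<lambda>a b. tens ys (m a b))"
      using f by (simp add: alg_gtensor_def m_def[abs_def])
    also have "\<dots> = (\<Sum>x\<leftarrow>xs. \<Sum>y\<leftarrow>ys. val f (qtimes x y))"
    proof (rule tens_apply[OF xs m1])
      fix x assume "x \<in> set xs"
      then obtain i a j b where x: "x = (i, a, j, b)" "A.hmg i a" "B.hmg j b"
        using xs by (auto simp: quads_def)
      have "val (m a b) y = val f (qtimes x y)" if y_in: "y \<in> set ys" for y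
      proof -
        obtain i' a' j' b' where y: "y = (i', a', j', b')" "A.hmg i' a'" "B.hmg j' b'"
          using y_in ys by (auto simp: quads_def)
        show ?thesis
          using x y bit_cases[of i'] bit_cases[of j]
          by (auto simp: val_def m_def qtimes_def A.part_homogeneous B.part_homogeneous
              A.times_zero B.zero_times)
      qed
      then show "val (\<lambda>a b. tens ys (m a b)) x = (\<Sum>y\<leftarrow>ys. val f (qtimes x y))"
        using x U by (simp add: val_def[of "\<lambda>a b. tens ys (m a b)"] cong: map_cong)
    qed
    also have "\<dots> = tens (ltimes xs ys) f"
      using f by (simp add: tens_def sum_list_concat_map)
    finally show ?thesis .
  qed (simp add: alg_gtensor_def tens_def)
qed

lemma adj_tens:
  assumes xs: "set xs \<subseteq> quads"
  shows "adj X (tens xs) = tens (map qadj xs)"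
proof
  fix f
  show "adj X (tens xs) f = tens (map qadj xs) f"
  proof (cases "f \<in> BF")
    case f: True
    note [simp] = BF_simps[OF f] BF_zero[OF f]
    define n where "n a b = (\<Sum>i\<in>{0, 1}. \<Sum>j\<in>{0, 1}.
      bit_sign (i * j) * f (adj A (A.part i a)) (adj B (B.part j b)))" for a b
    note [simp] = A.closed B.closed A.part_plus B.part_plus A.part_scale B.part_scale
      A.adj_plus B.adj_plus A.adj_scale B.adj_scale
    have n: "(\<lambda>a b. cnj (n a b)) \<in> BF"
      by (simp add: bilinear_forms_def n_def algebra_simps)
    have "adj X (tens xs) f = cnj (tens xs (\<lambda>a b. cnj (n a b)))"
      using f by (simp add: alg_gtensor_def n_def)
    also have "tens xs (\<lambda>a b. cnj (n a b)) = (\<Sum>x\<leftarrow>xs. cnj (val f (qadj x)))"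
    proof (rule tens_apply[OF xs n])
      fix x assume "x \<in> set xs"
      then obtain i a j b where x: "x = (i, a, j, b)" "A.hmg i a" "B.hmg j b"
        using xs by (auto simp: quads_def)
      then show "val (\<lambda>a b. cnj (n a b)) x = cnj (val f (qadj x))"
        using bit_cases[of i] bit_cases[of j]
        by (auto simp: val_def n_def qadj_def A.part_homogeneous B.part_homogeneous
            A.adj_zero B.adj_zero)
    qed
    also have "cnj (\<Sum>x\<leftarrow>xs. cnj (val f (qadj x))) = (\<Sum>x\<leftarrow>xs. val f (qadj x))"
      by (induct xs) simp_all
    finally show ?thesis using f by (simp add: tens_def comp_def)
  qed (simp add: alg_gtensor_def tens_def)
qed

lemma tens_eqI:
  assumes "\<And>f. f \<in> BF \<Longrightarrow> (\<Sum>x\<leftarrow>xs. val f x) = (\<Sum>y\<leftarrow>ys. val f y)"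
  shows "tens xs = tens ys"
  using assms by (auto simp: tens_def)

text \<open>The sign is biadditive in the degrees: both bracketings give the exponent
  \<open>i' * j + i'' * j + i'' * j'\<close>.\<close>

lemma val_assoc:
  assumes "x \<in> quads" "y \<in> quads" "z \<in> quads" "f \<in> BF"
  shows "val f (qtimes (qtimes x y) z) = val f (qtimes x (qtimes y z))"
  using assms
  by (auto simp: quads_def qtimes_def val_def BF_simps A.closed B.closed A.times_scale_left
      A.times_scale_right A.times_assoc B.times_assoc A.scale_scale distrib_left distrib_right
      bit_sign_add ac_simps)

lemma val_adj_times:
  assumes "x \<in> quads" "y \<in> quads" "f \<in> BF"
  shows "val f (qadj (qtimes x y)) = val f (qtimes (qadj y) (qadj x))"
proof -
  obtain i a j b i' a' j' b' where "x = (i, a, j, b)" "y = (i', a', j', b')"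
    "A.hmg i a" "B.hmg j b" "A.hmg i' a'" "B.hmg j' b'"
    using assms by (auto simp: quads_def)
  then show ?thesis
    using assms(3) bit_cases[of i] bit_cases[of j] bit_cases[of i'] bit_cases[of j']
    by (auto simp: qtimes_def qadj_def val_def BF_simps A.closed B.closed A.times_scale_left
        A.times_scale_right A.adj_times B.adj_times A.adj_scale A.scale_scale)
qed

lemma val_adj_adj: "x \<in> quads \<Longrightarrow> f \<in> BF \<Longrightarrow> val f (qadj (qadj x)) = val f x"
  by (auto simp: quads_def qadj_def val_def BF_simps A.closed B.closed A.adj_scale A.adj_adj
      B.adj_adj A.scale_scale)

lemma X_obtain:
  assumes "T \<in> carrier X"
  obtains xs where "T = tens xs" "set xs \<subseteq> quads"
  using assms by (auto simp: carrier_X)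

lemma star_algebra_X: "star_algebra X"
proof
  show "vzero X \<in> carrier X" by (auto simp: carrier_X tens_Nil intro: exI[of _ "[]"])
next
  fix T assume T: "T \<in> carrier X"
  then obtain xs where T_eq: "T = tens xs" and xs: "set xs \<subseteq> quads" by (rule X_obtain)
  have xs': "set (map qadj xs) \<subseteq> quads" using xs qadj_quads by auto
  show "vscale X z T \<in> carrier X" for z
    using scale_tens[OF xs, of z] by (simp add: T_eq)
  show "adj X T \<in> carrier X"
    using xs' by (simp add: T_eq adj_tens xs)
  show "vplus X T (vzero X) = T" by simp
  show "vminus X T T = vzero X" by (simp add: vminus_def)
  show "adj X (vscale X z T) = vscale X (cnj z) (adj X T)" for z
    by (simp add: alg_gtensor_def fun_eq_iff)
  have "adj X (adj X T) = tens (map qadj (map qadj xs))"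
    by (simp only: T_eq adj_tens xs xs')
  also have "\<dots> = T"
    unfolding T_eq using xs
    by (intro tens_eqI) (auto simp: comp_def val_adj_adj intro!: arg_cong[where f = sum_list] map_cong)
  finally show "adj X (adj X T) = T" .
  fix U assume U: "U \<in> carrier X"
  then obtain ys where U_eq: "U = tens ys" and ys: "set ys \<subseteq> quads" by (rule X_obtain)
  have ys': "set (map qadj ys) \<subseteq> quads" using ys qadj_quads by auto
  show "vplus X T U \<in> carrier X"
    using xs ys tens_in_X[of "xs @ ys"] by (simp add: T_eq U_eq tens_append)
  show "vtimes X T U \<in> carrier X"
    using ltimes_quads[OF xs ys] by (simp only: T_eq U_eq times_tens xs ys tens_in_X)
  show "vplus X T U = vplus X U T" by (simp add: add.commute)
  show "adj X (vplus X T U) = vplus X (adj X T) (adj X U)"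
    by (simp add: alg_gtensor_def fun_eq_iff)
  show "vtimes X (vscale X z T) U = vscale X z (vtimes X T U)" for z
    by (simp add: alg_gtensor_def fun_eq_iff)
  show "vtimes X T (vscale X z U) = vscale X z (vtimes X T U)" for z
  proof
    fix f
    show "vtimes X T (vscale X z U) f = vscale X z (vtimes X T U) f"
    proof (cases "f \<in> BF")
      case True
      have *: "val f (qtimes x (qscale z y)) = z * val f (qtimes x y)"
        if "x \<in> quads" "y \<in> quads" for x y
        using that True by (auto simp: quads_def qtimes_def qscale_def val_def BF_simps A.closed B.closed
            A.times_scale_right)
      have "(\<Sum>x\<leftarrow>xs. \<Sum>y\<leftarrow>ys. val f (qtimes x (qscale z y)))
          = (\<Sum>x\<leftarrow>xs. \<Sum>y\<leftarrow>ys. z * val f (qtimes x y))"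
        using xs ys by (auto simp: comp_def * subset_iff intro!: arg_cong[where f = sum_list] map_cong)
      then show ?thesis
        using True xs ys scale_tens[OF ys, of z] unfolding T_eq U_eq X_simps
        by (simp add: times_tens) (simp add: tens_def sum_list_concat_map sum_list_const_mult)
    qed (simp add: alg_gtensor_def)
  qed
  have "adj X (vtimes X T U) = tens (map qadj (ltimes xs ys))"
    using ltimes_quads[OF xs ys] by (simp only: T_eq U_eq times_tens adj_tens xs ys)
  also have "\<dots> = tens (ltimes (map qadj ys) (map qadj xs))"
  proof (rule tens_eqI)
    fix f assume f: "f \<in> BF"
    have "(\<Sum>x\<leftarrow>map qadj (ltimes xs ys). val f x) = (\<Sum>x\<leftarrow>xs. \<Sum>y\<leftarrow>ys. val f (qadj (qtimes x y)))"
      using sum_list_concat_map[where f = "\<lambda>x. val f (qadj x)" and g = qtimes] by (simp add: comp_def)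
    also have "\<dots> = (\<Sum>x\<leftarrow>xs. \<Sum>y\<leftarrow>ys. val f (qtimes (qadj y) (qadj x)))"
      using xs ys by (auto simp: val_adj_times f subset_iff intro!: arg_cong[where f = sum_list] map_cong)
    also have "\<dots> = (\<Sum>x\<leftarrow>ltimes (map qadj ys) (map qadj xs). val f x)"
      unfolding sum_list_concat_map by (subst sum_list_swap) (simp add: comp_def)
    finally show "(\<Sum>x\<leftarrow>map qadj (ltimes xs ys). val f x) = (\<Sum>x\<leftarrow>ltimes (map qadj ys) (map qadj xs). val f x)" .
  qed
  also have "\<dots> = vtimes X (adj X U) (adj X T)"
    by (simp only: T_eq U_eq times_tens adj_tens xs ys xs' ys')
  finally show "adj X (vtimes X T U) = vtimes X (adj X U) (adj X T)" .
  fix V assume V: "V \<in> carrier X"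
  then obtain zs where V_eq: "V = tens zs" and zs: "set zs \<subseteq> quads" by (rule X_obtain)
  show "vplus X (vplus X T U) V = vplus X T (vplus X U V)" by (simp add: add.assoc)
  show "vtimes X (vplus X T U) V = vplus X (vtimes X T V) (vtimes X U V)"
    by (simp add: alg_gtensor_def fun_eq_iff)
  have "vtimes X T (vplus X U V) = tens (ltimes xs (ys @ zs))"
    using xs ys zs times_tens[of xs "ys @ zs"] by (simp add: T_eq U_eq V_eq flip: tens_append)
  also have "\<dots> = (\<lambda>f. tens (ltimes xs ys) f + tens (ltimes xs zs) f)"
  proof
    fix f
    have "(\<Sum>x\<leftarrow>ltimes xs (ys @ zs). val f x) = (\<Sum>x\<leftarrow>ltimes xs ys. val f x) + (\<Sum>x\<leftarrow>ltimes xs zs. val f x)"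
      unfolding sum_list_concat_map by (simp add: sum_list_addf)
    then show "tens (ltimes xs (ys @ zs)) f = tens (ltimes xs ys) f + tens (ltimes xs zs) f"
      unfolding tens_def by (simp del: map_append)
  qed
  also have "\<dots> = vplus X (vtimes X T U) (vtimes X T V)"
    by (simp add: T_eq U_eq V_eq times_tens xs ys zs)
  finally show "vtimes X T (vplus X U V) = vplus X (vtimes X T U) (vtimes X T V)" .
  have "vtimes X (vtimes X T U) V = tens (ltimes (ltimes xs ys) zs)"
    using ltimes_quads[OF xs ys] by (simp only: T_eq U_eq V_eq times_tens xs ys zs)
  also have "\<dots> = tens (ltimes xs (ltimes ys zs))"
  proof (rule tens_eqI)
    fix f assume f: "f \<in> BF"
    have "(\<Sum>x\<leftarrow>ltimes (ltimes xs ys) zs. val f x) =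
        (\<Sum>x\<leftarrow>xs. \<Sum>y\<leftarrow>ys. \<Sum>z\<leftarrow>zs. val f (qtimes (qtimes x y) z))"
      by (simp only: sum_list_concat_map)
    also have "\<dots> = (\<Sum>x\<leftarrow>xs. \<Sum>y\<leftarrow>ys. \<Sum>z\<leftarrow>zs. val f (qtimes x (qtimes y z)))"
      using xs ys zs by (auto simp: val_assoc f subset_iff intro!: arg_cong[where f = sum_list] map_cong)
    also have "\<dots> = (\<Sum>x\<leftarrow>ltimes xs (ltimes ys zs). val f x)"
      by (simp only: sum_list_concat_map)
    finally show "(\<Sum>x\<leftarrow>ltimes (ltimes xs ys) zs. val f x) = (\<Sum>x\<leftarrow>ltimes xs (ltimes ys zs). val f x)" .
  qed
  also have "\<dots> = vtimes X T (vtimes X U V)"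
    using ltimes_quads[OF ys zs] by (simp only: T_eq U_eq V_eq times_tens xs ys zs)
  finally show "vtimes X (vtimes X T U) V = vtimes X T (vtimes X U V)" .
qed (simp_all add: fun_eq_iff algebra_simps)

sublocale X: star_algebra X
  by (rule star_algebra_X)

end

section \<open>Product functionals and the minimal norm\<close>

lemma (in star_algebra) positive_functional_proj:
  assumes "even_positive_functional A \<alpha> \<phi>"
  shows "positive_functional (\<lambda>f. \<phi> (proj A f))"
  using assms unfolding even_positive_functional_def by unfold_locales auto

lemma (in graded_algebra) even_functional_zero:
  assumes "even_positive_functional A \<alpha> \<phi>" "hmg 1 x"
  shows "\<phi> x = 0"
proof -
  have "\<phi> x = \<phi> (\<alpha> x)" using assms by (simp add: even_positive_functional_def)
  also have "\<dots> = - \<phi> x" using assms by (simp add: homogeneous_def even_positive_functional_def)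
  finally show ?thesis by simp
qed

text \<open>The defect \<open>1 - a* a\<close> of a strict contraction is the square of a selfadjoint element.\<close>

lemma (in cstar_complete) contraction_defect:
  assumes \<phi>: "positive_functional \<phi>" and a: "a \<in> C" "p a < 1"
  obtains b where "\<And>x y. \<phi> (star x * y) = \<phi> (star (x - b * x) * (y - b * y)) + \<phi> (star (a * x) * (a * y))"
proof -
  interpret positive_functional \<phi> by fact
  have "p (star a * a) < 1"
    using a power_less_one_iff[of "p a" 2] by (simp add: cstar)
  then obtain b where b: "star b = b" "b + b = star a * a + b * b"
    using square_root[of "star a * a"] a by (metis mult_closed star_closed star_mult star_star)
  show ?thesis
  proof (rule that)
    fix x y
    have "star (x - b * x) * (y - b * y) = star x * y - star x * (b + b) * y + star x * (b * b) * y"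
      by (simp add: algebra_simps star_ring_simps b(1))
    also have "\<dots> = star x * y - star (a * x) * (a * y)"
      unfolding b(2) by (simp add: algebra_simps star_ring_simps)
    finally show "\<phi> (star x * y) = \<phi> (star (x - b * x) * (y - b * y)) + \<phi> (star (a * x) * (a * y))"
      by (simp add: diff)
  qed
qed

locale graded_cstar_pair = graded_pair A \<alpha> B \<beta> + A: cstar_algebra A + B: cstar_algebra B
  for A :: "('a, 'm) normed_star_alg_scheme" and \<alpha> and B :: "('b, 'n) normed_star_alg_scheme" and \<beta>
begin

abbreviation "even_A \<equiv> even_positive_functional A \<alpha>"
abbreviation "even_B \<equiv> even_positive_functional B \<beta>"

lemma BF_product: "even_A \<phi> \<Longrightarrow> even_B \<psi> \<Longrightarrow> (\<lambda>a b. \<phi> a * \<psi> b) \<in> BF"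
  by (simp add: even_positive_functional_def bilinear_forms_def algebra_simps)

text \<open>The signs disappear: for \<open>i = i'\<close> they cancel, and for
  \<open>i \<noteq> i'\<close> the product of \<open>adj A a\<close> and \<open>a'\<close> is odd,
  hence killed by the even functional \<open>\<phi>\<close>. What remains are entries of the
  entrywise product of two Gram matrices.\<close>

lemma val_gram:
  assumes "even_A \<phi>" "even_B \<psi>" "x = (i, a, j, b)" "y = (i', a', j', b')" "x \<in> quads" "y \<in> quads"
  shows "val (\<lambda>a b. \<phi> a * \<psi> b) (qtimes (qadj x) y) =
    \<phi> (vtimes A (adj A a) a') * \<psi> (vtimes B (adj B b) b')"
proof -
  have hom: "A.hmg i a" "B.hmg j b" "A.hmg i' a'" "B.hmg j' b'" using assms by (auto simp: quads_def)
  have linear: "\<phi> (vscale A z (vtimes A (adj A a) a')) = z * \<phi> (vtimes A (adj A a) a')" for z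
    using assms(1) hom by (simp add: even_positive_functional_def A.closed)
  have "bit_sign (i' * j) * (bit_sign (i * j) * \<phi> (vtimes A (adj A a) a')) = \<phi> (vtimes A (adj A a) a')"
  proof (cases "i = i'")
    case False
    then have "i + i' = 1" using bit_cases[of i] bit_cases[of i'] by auto
    then have "\<phi> (vtimes A (adj A a) a') = 0"
      using A.homogeneous_times[OF A.homogeneous_adj[OF hom(1)] hom(3)] A.even_functional_zero[OF assms(1)]
      by simp
    then show ?thesis by simp
  qed simp
  then show ?thesis
    using hom by (auto simp: assms(3,4) val_def qtimes_def qadj_def A.times_scale_left A.scale_scale
        A.closed linear mult.assoc)
qed

definition qa where "qa xs k = emb A (fst (snd (xs ! k)))"
definition qb where "qb xs k = emb B (snd (snd (snd (xs ! k))))"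

definition gram where
  "gram \<phi> \<psi> (n::nat) a b = (\<Sum>k<n. \<Sum>l<n. \<phi> (proj A (star (a k) * a l)) * \<psi> (proj B (star (b k) * b l)))"

lemma gram_positive:
  assumes "even_A \<phi>" "even_B \<psi>"
  shows "gram \<phi> \<psi> n a b \<in> \<real> \<and> 0 \<le> Re (gram \<phi> \<psi> n a b)"
  unfolding gram_def using assms
  by (intro gram_schur_positive A.positive_functional_proj B.positive_functional_proj) auto

lemma functional_square:
  assumes "even_A \<phi>" "even_B \<psi>" and xs: "set xs \<subseteq> quads"
  shows "vtimes X (adj X (tens xs)) (tens xs) (\<lambda>a b. \<phi> a * \<psi> b)
    = gram \<phi> \<psi> (length xs) (qa xs) (qb xs)"
proof -
  have xs': "set (map qadj xs) \<subseteq> quads" using xs qadj_quads by auto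
  let ?v = "val (\<lambda>a b. \<phi> a * \<psi> b)"
  have "vtimes X (adj X (tens xs)) (tens xs) (\<lambda>a b. \<phi> a * \<psi> b)
      = (\<Sum>x\<leftarrow>map qadj xs. \<Sum>y\<leftarrow>xs. ?v (qtimes x y))"
    unfolding adj_tens[OF xs] times_tens[OF xs' xs] unfolding tens_def
    by (simp only: BF_product[OF assms(1,2)] sum_list_concat_map if_True)
  also have "\<dots> = (\<Sum>k<length xs. \<Sum>l<length xs. ?v (qtimes (qadj (xs ! k)) (xs ! l)))"
    by (simp add: sum_list_sum_nth atLeast0LessThan)
  also have "\<dots> = gram \<phi> \<psi> (length xs) (qa xs) (qb xs)"
    unfolding gram_def
  proof (intro sum.cong refl)
    fix k l assume "k \<in> {..<length xs}" "l \<in> {..<length xs}"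
    then have kl: "xs ! k \<in> quads" "xs ! l \<in> quads" using xs by auto
    obtain i a j b i' a' j' b' where x: "xs ! k = (i, a, j, b)" "xs ! l = (i', a', j', b')"
      by (metis prod_cases4)
    show "?v (qtimes (qadj (xs ! k)) (xs ! l)) =
      \<phi> (proj A (star (qa xs k) * qa xs l)) * \<psi> (proj B (star (qb xs k) * qb xs l))"
      using val_gram[OF assms(1,2) x kl] kl by (auto simp: qa_def qb_def x quads_def)
  qed
  finally show ?thesis .
qed

definition \<omega> where "\<omega> \<phi> \<psi> f = proj X f (\<lambda>a b. \<phi> a * \<psi> b)"

definition \<Omega> where "\<Omega> = {\<omega> \<phi> \<psi> |\<phi> \<psi>. even_A \<phi> \<and> even_B \<psi>}"

lemma \<omega>_positive:
  assumes "even_A \<phi>" "even_B \<psi>"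
  shows "positive_functional (\<omega> \<phi> \<psi>)"
proof
  fix x y z
  show "\<omega> \<phi> \<psi> (x + y) = \<omega> \<phi> \<psi> x + \<omega> \<phi> \<psi> y" "\<omega> \<phi> \<psi> (z *\<^sub>C x) = z * \<omega> \<phi> \<psi> x"
    by (simp_all add: \<omega>_def)
  obtain xs where "proj X x = tens xs" "set xs \<subseteq> quads" using X_obtain[of "proj X x"] X.proj_closed by blast
  then show "\<omega> \<phi> \<psi> (star x * x) \<in> \<real> \<and> 0 \<le> Re (\<omega> \<phi> \<psi> (star x * x))"
    using functional_square[OF assms] gram_positive[OF assms] by (simp add: \<omega>_def)
qed

text \<open>Multiplication by \<open>a \<otimes> b\<close> replaces the vectors in the two Gram
  matrices by their multiples under \<open>a\<close> and \<open>b\<close>. The loss corresponds to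
  \<open>(1 - star a * a) \<otimes> 1 + star a * a \<otimes> (1 - star b * b)\<close>, and by
  \<open>contraction_defect\<close> each summand is again a positive product of Gram
  matrices.\<close>

lemma quad_contraction:
  assumes "even_A \<phi>" "even_B \<psi>" and x: "x = (i, a, j, b)" "x \<in> quads" "vnorm A a < 1" "vnorm B b < 1"
  shows "Re (\<omega> \<phi> \<psi> (star (emb X (tens [x]) * f) * (emb X (tens [x]) * f))) \<le> Re (\<omega> \<phi> \<psi> (star f * f))"
proof -
  obtain ys where ys: "proj X f = tens ys" "set ys \<subseteq> quads" using X_obtain[of "proj X f"] X.proj_closed by blast
  have a: "a \<in> carrier A" "b \<in> carrier B" using x by (auto simp: quads_def)
  interpret \<phi>: positive_functional "\<lambda>f. \<phi> (proj A f)" by (rule A.positive_functional_proj[OF assms(1)])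
  interpret \<psi>: positive_functional "\<lambda>f. \<psi> (proj B f)" by (rule B.positive_functional_proj[OF assms(2)])
  obtain d where d: "\<And>u v. \<phi> (proj A (star u * v)) = \<phi> (proj A (star (u - d * u) * (v - d * v)))
      + \<phi> (proj A (star (emb A a * u) * (emb A a * v)))"
    using cstar_complete.contraction_defect[OF A.cstar_complete_emb \<phi>.positive_functional_axioms, of "emb A a"]
      a x by auto
  obtain e where e: "\<And>u v. \<psi> (proj B (star u * v)) = \<psi> (proj B (star (u - e * u) * (v - e * v)))
      + \<psi> (proj B (star (emb B b * u) * (emb B b * v)))"
    using cstar_complete.contraction_defect[OF B.cstar_complete_emb \<psi>.positive_functional_axioms, of "emb B b"]
      a x by auto
  define zs where "zs = map (qtimes x) ys"
  have zs: "set zs \<subseteq> quads" using x ys qtimes_quads by (auto simp: zs_def)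
  have "vtimes X (tens [x]) (tens ys) = tens zs"
    using times_tens[of "[x]" ys] x ys by (simp add: zs_def)
  then have "\<omega> \<phi> \<psi> (star (emb X (tens [x]) * f) * (emb X (tens [x]) * f)) =
      gram \<phi> \<psi> (length zs) (qa zs) (qb zs)"
    using functional_square[OF assms(1,2) zs] x by (simp add: \<omega>_def ys)
  also have "\<dots> = gram \<phi> \<psi> (length ys) (\<lambda>k. emb A a * qa ys k) (\<lambda>k. emb B b * qb ys k)"
    unfolding gram_def
  proof (intro sum.cong refl)
    show "{..<length zs} = {..<length ys}" "{..<length zs} = {..<length ys}" by (simp_all add: zs_def)
    fix k l assume "k \<in> {..<length ys}" "l \<in> {..<length ys}"
    then have kl: "k < length ys" "l < length ys" "ys ! k \<in> quads" "ys ! l \<in> quads" using ys by auto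
    obtain i1 a1 j1 b1 i2 a2 j2 b2 where y: "ys ! k = (i1, a1, j1, b1)" "ys ! l = (i2, a2, j2, b2)"
      by (metis prod_cases4)
    have hom: "A.hmg i1 a1" "B.hmg j1 b1" "A.hmg i2 a2" "B.hmg j2 b2" "A.hmg i a"
      using kl y x by (auto simp: quads_def)
    \<comment> \<open>Moving \<open>b\<close> past \<open>a1\<close> and past \<open>a2\<close>
      gives the same sign if their degrees agree; otherwise the entry is the value of the even
      \<open>\<phi>\<close> at an odd element.\<close>
    have "bit_sign (i1 * j) * (bit_sign (i2 * j) * \<phi> (proj A (star (emb A a * emb A a1) * (emb A a * emb A a2))))
       = \<phi> (proj A (star (emb A a * emb A a1) * (emb A a * emb A a2)))"
    proof (cases "i1 = i2")
      case False
      then have "i + i1 + (i + i2) = 1" using bit_cases[of i] bit_cases[of i1] bit_cases[of i2] by auto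
      then have "\<phi> (vtimes A (adj A (vtimes A a a1)) (vtimes A a a2)) = 0"
        using A.homogeneous_times[OF A.homogeneous_adj[OF A.homogeneous_times[OF hom(5,1)]] A.homogeneous_times[OF hom(5,3)]]
        by (intro A.even_functional_zero[OF assms(1)]) simp
      then show ?thesis using hom by simp
    qed simp
    then show "\<phi> (proj A (star (qa zs k) * qa zs l)) * \<psi> (proj B (star (qb zs k) * qb zs l)) =
        \<phi> (proj A (star (emb A a * qa ys k) * (emb A a * qa ys l))) *
        \<psi> (proj B (star (emb B b * qb ys k) * (emb B b * qb ys l)))"
      using kl hom a \<phi>.scale by (auto simp add: zs_def qa_def qb_def y x qtimes_def A.emb_hom B.emb_hom A.closed
          B.closed mult.assoc mult.commute[of "bit_sign (i2 * j)"] simp del: A.proj_hom B.proj_hom)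
  qed
  finally have 1: "\<omega> \<phi> \<psi> (star (emb X (tens [x]) * f) * (emb X (tens [x]) * f)) =
      gram \<phi> \<psi> (length ys) (\<lambda>k. emb A a * qa ys k) (\<lambda>k. emb B b * qb ys k)" .
  have "\<omega> \<phi> \<psi> (star f * f) = gram \<phi> \<psi> (length ys) (qa ys) (qb ys)"
    using functional_square[OF assms(1,2) ys(2)] by (simp add: \<omega>_def ys)
  also have "\<dots> = gram \<phi> \<psi> (length ys) (\<lambda>k. qa ys k - d * qa ys k) (qb ys)
      + gram \<phi> \<psi> (length ys) (\<lambda>k. emb A a * qa ys k) (qb ys)"
    unfolding gram_def sum.distrib[symmetric] d[of "qa ys _"] by (simp only: distrib_right)
  also have "gram \<phi> \<psi> (length ys) (\<lambda>k. emb A a * qa ys k) (qb ys)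
    = gram \<phi> \<psi> (length ys) (\<lambda>k. emb A a * qa ys k) (\<lambda>k. qb ys k - e * qb ys k)
      + gram \<phi> \<psi> (length ys) (\<lambda>k. emb A a * qa ys k) (\<lambda>k. emb B b * qb ys k)"
    unfolding gram_def sum.distrib[symmetric] e[of "qb ys _"] by (simp only: distrib_left)
  finally show ?thesis
    unfolding 1 using gram_positive[OF assms(1,2), of "length ys" "\<lambda>k. qa ys k - d * qa ys k" "qb ys"]
      gram_positive[OF assms(1,2), of "length ys" "\<lambda>k. emb A a * qa ys k" "\<lambda>k. qb ys k - e * qb ys k"]
    by simp
qed

text \<open>Scaling by \<open>1 / s\<close> and \<open>1 / t\<close> produces strict contractions;
  strictness is what the square root behind \<open>contraction_defect\<close> requires.\<close>

lemma quad_bound: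
  assumes "even_A \<phi>" "even_B \<psi>" and x: "x = (i, a, j, b)" "x \<in> quads"
    and st: "vnorm A a < s" "vnorm B b < t"
  shows "sqrt (Re (\<omega> \<phi> \<psi> (star (emb X (tens [x]) * f) * (emb X (tens [x]) * f))))
    \<le> s * t * sqrt (Re (\<omega> \<phi> \<psi> (star f * f)))"
proof -
  have ab: "A.hmg i a" "B.hmg j b" "a \<in> carrier A" "b \<in> carrier B" using x by (auto simp: quads_def)
  interpret NA: cstar_seminormed "\<lambda>f. vnorm A (proj A f)"
    by (rule A.seminormed_proj[OF A.norm_cstar_seminorm])
  interpret NB: cstar_seminormed "\<lambda>f. vnorm B (proj B f)"
    by (rule B.seminormed_proj[OF B.norm_cstar_seminorm])
  have "s > 0" "t > 0"
    using st NA.nonneg[of "emb A a"] NB.nonneg[of "emb B b"] ab by simp_all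
  define y where "y = (i, vscale A (1 / s) a, j, vscale B (1 / t) b)"
  have y: "y \<in> quads" using ab by (simp add: y_def quads_def A.homogeneous_scale B.homogeneous_scale)
  have "vnorm A (vscale A (1 / s) a) < 1" "vnorm B (vscale B (1 / t) b) < 1"
    using NA.scale[of "1 / s" "emb A a"] NB.scale[of "1 / t" "emb B b"] ab st \<open>s > 0\<close> \<open>t > 0\<close>
    by (simp_all add: norm_divide)
  note le = quad_contraction[OF assms(1,2) y_def y this, of f]
  have "tens [x] = vscale X (s * t) (tens [y])"
    using ab \<open>s > 0\<close> \<open>t > 0\<close> by (auto simp: fun_eq_iff tens_def val_def y_def x BF_simps A.closed)
  then have eq: "emb X (tens [x]) = of_real (s * t) *\<^sub>C emb X (tens [y])"
    using y by (simp only: X.emb_hom tens_in_X list.set insert_subset empty_subsetI simp_thms of_real_mult)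
  interpret positive_functional "\<omega> \<phi> \<psi>" by (rule \<omega>_positive[OF assms(1,2)])
  from eq have "norm2 (emb X (tens [x]) * f) = (s * t)\<^sup>2 * norm2 (emb X (tens [y]) * f)"
    by (simp only: mult_scaleC_left norm2_scale norm_of_real power2_abs)
  also have "\<dots> \<le> (s * t)\<^sup>2 * norm2 f"
    using le by (intro mult_left_mono) (simp_all add: norm2_def)
  finally have "sqrt (norm2 (emb X (tens [x]) * f)) \<le> sqrt ((s * t)\<^sup>2 * norm2 f)" by simp
  then show ?thesis
    using \<open>s > 0\<close> \<open>t > 0\<close> by (simp add: real_sqrt_mult norm2_def)
qed

text \<open>Every element is a finite sum of quadruples, and \<open>quad_bound\<close> gives each of
  them a constant that depends neither on the functionals nor on the vector.\<close>

lemma \<Omega>_bounded: "bounded_functionals \<Omega>"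
proof (rule bounded_functionals.intro)
  show "positive_functional w" if "w \<in> \<Omega>" for w using that \<omega>_positive by (auto simp: \<Omega>_def)
  have "even_A (\<lambda>_. 0)" "even_B (\<lambda>_. 0)" by (simp_all add: even_positive_functional_def)
  then show "\<Omega> \<noteq> {}" by (auto simp: \<Omega>_def)
  fix g
  obtain xs where xs: "proj X g = tens xs" "set xs \<subseteq> quads" using X_obtain[of "proj X g"] X.proj_closed by blast
  have "\<exists>C\<ge>0. \<forall>w\<in>\<Omega>. \<forall>f. sqrt (Re (w (star (emb X (tens xs) * f) * (emb X (tens xs) * f)))) \<le> C * sqrt (Re (w (star f * f)))"
    using xs(2)
  proof (induct xs)
    case Nil
    have "emb X (tens []) = 0" using X.emb_hom(1) by (simp add: tens_Nil)
    then show ?case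
      using positive_functional.zero[OF \<omega>_positive] by (intro exI[of _ 0]) (auto simp: \<Omega>_def)
  next
    case (Cons x xs)
    then obtain C where C: "C \<ge> 0" "\<forall>w\<in>\<Omega>. \<forall>f. sqrt (Re (w (star (emb X (tens xs) * f) * (emb X (tens xs) * f)))) \<le> C * sqrt (Re (w (star f * f)))"
      by auto
    obtain i a j b where x: "x = (i, a, j, b)" "x \<in> quads" using Cons(2) by (cases x) auto
    \<comment> \<open>Adding \<open>1\<close> provides the strict upper bounds that
      \<open>quad_bound\<close> asks for.\<close>
    define D where "D = (\<bar>vnorm A a\<bar> + 1) * (\<bar>vnorm B b\<bar> + 1)"
    have "sqrt (Re (w (star (emb X (tens (x # xs)) * f) * (emb X (tens (x # xs)) * f)))) \<le> (D + C) * sqrt (Re (w (star f * f)))"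
      if w: "w \<in> \<Omega>" for w f
    proof -
      obtain \<phi> \<psi> where w_eq: "w = \<omega> \<phi> \<psi>" "even_A \<phi>" "even_B \<psi>" using w by (auto simp: \<Omega>_def)
      interpret positive_functional w unfolding w_eq by (rule \<omega>_positive) fact+
      have "emb X (tens (x # xs)) = emb X (tens [x]) + emb X (tens xs)"
        using X.emb_hom(2)[of "tens [x]" "tens xs"] Cons(2) tens_Cons[of x xs] by simp
      then have "sqrt (norm2 (emb X (tens (x # xs)) * f)) \<le> sqrt (norm2 (emb X (tens [x]) * f)) + sqrt (norm2 (emb X (tens xs) * f))"
        using norm2_triangle by (simp add: distrib_right)
      also have "\<dots> \<le> D * sqrt (norm2 f) + C * sqrt (norm2 f)"
      proof (rule add_mono)
        show "sqrt (norm2 (emb X (tens [x]) * f)) \<le> D * sqrt (norm2 f)"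
          using quad_bound[OF w_eq(2,3) x, of "\<bar>vnorm A a\<bar> + 1" "\<bar>vnorm B b\<bar> + 1" f]
          by (simp add: norm2_def D_def flip: w_eq(1))
        show "sqrt (norm2 (emb X (tens xs) * f)) \<le> C * sqrt (norm2 f)"
          using C(2) w by (simp add: norm2_def)
      qed
      finally show ?thesis by (simp add: norm2_def distrib_right)
    qed
    then show ?case using C(1) by (intro exI[of _ "D + C"]) (auto simp: D_def)
  qed
  then obtain C where C: "C \<ge> 0" "\<And>w f. w \<in> \<Omega> \<Longrightarrow>
    sqrt (Re (w (star (emb X (tens xs) * f) * (emb X (tens xs) * f)))) \<le> C * sqrt (Re (w (star f * f)))"
    by blast
  have "Re (w (star (g * f) * (g * f))) \<le> C\<^sup>2 * Re (w (star f * f))" if "w \<in> \<Omega>" for w f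
  proof -
    obtain \<phi> \<psi> where w: "w = \<omega> \<phi> \<psi>" "even_A \<phi>" "even_B \<psi>" using \<open>w \<in> \<Omega>\<close> by (auto simp: \<Omega>_def)
    interpret positive_functional w unfolding w by (rule \<omega>_positive) fact+
    have eq: "w (star (g * f) * (g * f)) = w (star (emb X (tens xs) * f) * (emb X (tens xs) * f))"
      using xs by (simp add: w \<omega>_def)
    have "(sqrt (norm2 (emb X (tens xs) * f)))\<^sup>2 \<le> (C * sqrt (norm2 f))\<^sup>2"
      using C(2)[OF \<open>w \<in> \<Omega>\<close>] by (intro power_mono) (simp_all add: norm2_def[symmetric])
    then show ?thesis unfolding eq by (simp add: power_mult_distrib norm2_def[symmetric])
  qed
  then show "\<exists>C. \<forall>\<omega>\<in>\<Omega>. \<forall>y. Re (\<omega> (star (g * y) * (g * y))) \<le> C * Re (\<omega> (star y * y))" by blast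
qed

sublocale G: bounded_functionals \<Omega>
  by (rule \<Omega>_bounded)

abbreviation "N \<equiv> min_norm A \<alpha> B \<beta>"

text \<open>The two suprema run over the same set of reals, so \<open>min_norm\<close> inherits all
  properties of the GNS seminorm.\<close>

lemma min_norm_gns: "T \<in> carrier X \<Longrightarrow> N T = G.gns (emb X T)"
proof -
  assume T: "T \<in> carrier X"
  have "G.gns_set (emb X T) = {sqrt (Re (vtimes X (adj X (vtimes X T y)) (vtimes X T y) (\<lambda>a b. \<phi> a * \<psi> b))) |\<phi> \<psi> y.
        even_A \<phi> \<and> even_B \<psi> \<and> y \<in> carrier X \<and> Re (vtimes X (adj X y) y (\<lambda>a b. \<phi> a * \<psi> b)) \<le> 1}"
    (is "?L = ?R")
  proof
    show "?L \<subseteq> ?R"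
    proof
      fix r assume "r \<in> ?L"
      then obtain w f where "w \<in> \<Omega>" and wf: "Re (w (star f * f)) \<le> 1" "r = G.nrm w (emb X T * f)"
        by (auto simp: G.gns_set_def)
      then obtain \<phi> \<psi> where "w = \<omega> \<phi> \<psi>" "even_A \<phi>" "even_B \<psi>" by (auto simp: \<Omega>_def)
      note this wf
      then show "r \<in> ?R"
        using T by (intro CollectI exI[of _ \<phi>] exI[of _ \<psi>] exI[of _ "proj X f"]) (simp add: \<omega>_def)
    qed
    show "?R \<subseteq> ?L"
    proof
      fix r assume "r \<in> ?R"
      then obtain \<phi> \<psi> y where "even_A \<phi>" "even_B \<psi>" "y \<in> carrier X" "Re (vtimes X (adj X y) y (\<lambda>a b. \<phi> a * \<psi> b)) \<le> 1"
        "r = sqrt (Re (vtimes X (adj X (vtimes X T y)) (vtimes X T y) (\<lambda>a b. \<phi> a * \<psi> b)))" by blast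
      then show "r \<in> ?L"
        unfolding G.gns_set_def using T
        by (intro CollectI exI[of _ "\<omega> \<phi> \<psi>"] exI[of _ "emb X y"]) (auto simp: \<omega>_def \<Omega>_def)
    qed
  qed
  then show ?thesis by (simp add: min_norm_def G.gns_def Let_def)
qed

lemma min_norm_seminorm: "cstar_seminorm X N"
  using X.cstar_seminorm_emb[OF G.gns_cstar_seminormed]
  unfolding cstar_seminorm_def by (simp add: min_norm_gns X.closed del: X_simps)

sublocale T: seminormed_star_algebra X N
  by unfold_locales (rule min_norm_seminorm)

lemma min_norm_quad:
  assumes "A.hmg i a" "B.hmg j b"
  shows "N (elem_tensor A B a b) \<le> vnorm A a * vnorm B b"
proof -
  have eq: "elem_tensor A B a b = tens [(i, a, j, b)]" by (auto simp: elem_tensor_def tens_def val_def)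
  have q: "(i, a, j, b) \<in> quads" using assms by (simp add: quads_def)
  have NA: "vnorm A a \<ge> 0" "vnorm B b \<ge> 0"
    using cstar_seminormed.nonneg[OF A.seminormed_proj[OF A.norm_cstar_seminorm], of "emb A a"]
      cstar_seminormed.nonneg[OF B.seminormed_proj[OF B.norm_cstar_seminorm], of "emb B b"] assms by simp_all
  have le: "N (elem_tensor A B a b) \<le> s * t" if "vnorm A a < s" "vnorm B b < t" for s t
  proof -
    have "G.gns (emb X (tens [(i, a, j, b)])) \<le> s * t"
      using quad_bound[OF _ _ refl q that] NA that by (intro G.gns_leI) (auto simp: \<Omega>_def)
    then show ?thesis using q by (simp add: eq min_norm_gns)
  qed
  \<comment> \<open>Only strict upper bounds of the two norms can be inserted into
    \<open>le\<close>, so the norms are approached from above.\<close>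
  have lim: "(\<lambda>n. (vnorm A a + 1 / real (Suc n)) * (vnorm B b + 1 / real (Suc n))) \<longlonglongrightarrow>
      (vnorm A a + 0) * (vnorm B b + 0)"
    by (intro tendsto_intros LIMSEQ_Suc[OF lim_inverse_n'])
  have "N (elem_tensor A B a b) \<le> (vnorm A a + 0) * (vnorm B b + 0)"
    by (rule LIMSEQ_le_const[OF lim]) (auto intro!: le)
  then show ?thesis by simp
qed

lemma elem_tensor_linear:
  "\<lbrakk>a \<in> carrier A; a' \<in> carrier A; b \<in> carrier B\<rbrakk> \<Longrightarrow>
    elem_tensor A B (vplus A a a') b = vplus X (elem_tensor A B a b) (elem_tensor A B a' b)"
  "\<lbrakk>a \<in> carrier A; b \<in> carrier B; b' \<in> carrier B\<rbrakk> \<Longrightarrow>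
    elem_tensor A B a (vplus B b b') = vplus X (elem_tensor A B a b) (elem_tensor A B a b')"
  "\<lbrakk>a \<in> carrier A; a' \<in> carrier A; b \<in> carrier B\<rbrakk> \<Longrightarrow>
    elem_tensor A B (vminus A a a') b = vminus X (elem_tensor A B a b) (elem_tensor A B a' b)"
  "\<lbrakk>a \<in> carrier A; b \<in> carrier B; b' \<in> carrier B\<rbrakk> \<Longrightarrow>
    elem_tensor A B a (vminus B b b') = vminus X (elem_tensor A B a b) (elem_tensor A B a b')"
  "\<lbrakk>a \<in> carrier A; b \<in> carrier B\<rbrakk> \<Longrightarrow>
    elem_tensor A B (vscale A z a) b = vscale X z (elem_tensor A B a b)"
  "\<lbrakk>a \<in> carrier A; b \<in> carrier B\<rbrakk> \<Longrightarrow>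
    elem_tensor A B a (vscale B z b) = vscale X z (elem_tensor A B a b)"
  by (auto simp: elem_tensor_def BF_simps vminus_def A.closed B.closed)

lemma norm_part_le:
  assumes "a \<in> carrier A"
  shows "vnorm A (A.part i a) \<le> vnorm A a"
proof -
  interpret NA: cstar_seminormed "\<lambda>f. vnorm A (proj A f)"
    by (rule A.seminormed_proj[OF A.norm_cstar_seminorm])
  have "vnorm A (\<alpha> a) \<le> vnorm A a"
    by (rule star_hom_contractive[OF A.hom_\<alpha>]) (unfold_locales, fact)
  then show ?thesis
    using NA.scale[of "1/2" "emb A a + bit_sign i *\<^sub>C emb A (\<alpha> a)"] NA.triangle[of "emb A a" "bit_sign i *\<^sub>C emb A (\<alpha> a)"]
      NA.scale[of "bit_sign i" "emb A (\<alpha> a)"] assms by (simp add: hom_part_def A.\<alpha>_hom)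
qed

end

context graded_cstar_pair
begin

lemma swap_norm_part_le:
  assumes "b \<in> carrier B"
  shows "vnorm B (B.part i b) \<le> vnorm B b"
proof -
  interpret NB: cstar_seminormed "\<lambda>f. vnorm B (proj B f)"
    by (rule B.seminormed_proj[OF B.norm_cstar_seminorm])
  have "vnorm B (\<beta> b) \<le> vnorm B b"
    by (rule star_hom_contractive[OF B.hom_\<alpha>]) (unfold_locales, fact)
  then show ?thesis
    using NB.scale[of "1/2" "emb B b + bit_sign i *\<^sub>C emb B (\<beta> b)"] NB.triangle[of "emb B b" "bit_sign i *\<^sub>C emb B (\<beta> b)"]
      NB.scale[of "bit_sign i" "emb B (\<beta> b)"] assms by (simp add: hom_part_def B.\<alpha>_hom)
qed

text \<open>The constant \<open>4\<close> counts the pairs of homogeneous components; a crude bound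
  is enough for density.\<close>

lemma min_norm_elem:
  assumes a: "a \<in> carrier A" and b: "b \<in> carrier B"
  shows "N (elem_tensor A B a b) \<le> 4 * (vnorm A a * vnorm B b)"
proof -
  have le: "N (elem_tensor A B (A.part i a) (B.part j b)) \<le> vnorm A a * vnorm B b" for i j
  proof -
    have "N (elem_tensor A B (A.part i a) (B.part j b)) \<le> vnorm A (A.part i a) * vnorm B (B.part j b)"
      by (rule min_norm_quad[OF A.homogeneous_part[OF a] B.homogeneous_part[OF b]])
    also have "\<dots> \<le> vnorm A a * vnorm B b"
      using norm_part_le[OF a] swap_norm_part_le[OF b] a b
        cstar_seminormed.nonneg[OF A.seminormed_proj[OF A.norm_cstar_seminorm], of "emb A a"]
        cstar_seminormed.nonneg[OF B.seminormed_proj[OF B.norm_cstar_seminorm], of "emb B (B.part j b)"]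
      by (intro mult_mono) simp_all
    finally show ?thesis .
  qed
  have "elem_tensor A B a b = elem_tensor A B (vplus A (A.part 0 a) (A.part 1 a)) (vplus B (B.part 0 b) (B.part 1 b))"
    using a b by (simp add: A.part_sum B.part_sum)
  also have "\<dots> = vplus X (vplus X (elem_tensor A B (A.part 0 a) (B.part 0 b)) (elem_tensor A B (A.part 0 a) (B.part 1 b)))
      (vplus X (elem_tensor A B (A.part 1 a) (B.part 0 b)) (elem_tensor A B (A.part 1 a) (B.part 1 b)))"
    using a b by (simp add: elem_tensor_linear A.closed B.closed fun_eq_iff add.assoc add.left_commute)
  finally have eq: "elem_tensor A B a b = \<dots>" .
  have mem: "elem_tensor A B (A.part i a) (B.part j b) \<in> carrier X" for i j
    using a b by (simp add: elem_tensor_in_X)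
  show ?thesis
    unfolding eq
    using T.seminorm_rules(1)[OF X.plus_closed[OF mem mem] X.plus_closed[OF mem mem], of 0 0 0 1 1 0 1 1]
      T.seminorm_rules(1)[OF mem mem, of 0 0 0 1] T.seminorm_rules(1)[OF mem mem, of 1 0 1 1]
      le[of 0 0] le[of 0 1] le[of 1 0] le[of 1 1] by linarith
qed

end

section \<open>Tensor products of automorphisms and the grading of the tensor product\<close>

lemma gradingI:
  assumes "\<Gamma> \<in> star_hom A A" "\<And>x. x \<in> carrier A \<Longrightarrow> \<Gamma> (\<Gamma> x) = x"
  shows "grading A \<Gamma>"
  using assms unfolding grading_def star_iso_def
  by (auto simp: star_homD intro!: bij_betw_byWitness[where f' = \<Gamma>])

lemma (in star_algebra) star_hom_restrict:
  "\<Gamma> \<in> star_hom A B \<Longrightarrow> restrict \<Gamma> (carrier A) \<in> star_hom A B"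
  by (simp add: star_hom_def closed)

lemma (in star_algebra) grading_restrict:
  assumes "\<Gamma> \<in> star_hom A A" "\<And>x. x \<in> carrier A \<Longrightarrow> \<Gamma> (\<Gamma> x) = x"
  shows "grading A (restrict \<Gamma> (carrier A))"
  using assms by (intro gradingI star_hom_restrict) (auto simp: star_homD)

lemma grading_star_hom: "grading A \<Gamma> \<Longrightarrow> \<Gamma> \<in> star_hom A A"
  by (simp add: grading_def star_iso_def)

context graded_pair
begin

text \<open>The map \<open>\<mu> \<otimes> \<nu>\<close>: tensors are functionals on bilinear forms,
  so it acts by pulling the form back.\<close>

definition tmap :: "('a \<Rightarrow> 'a) \<Rightarrow> ('b \<Rightarrow> 'b) \<Rightarrow> (('a \<Rightarrow> 'b \<Rightarrow> complex) \<Rightarrow> complex) \<Rightarrow> ('a \<Rightarrow> 'b \<Rightarrow> complex) \<Rightarrow> complex"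
  where "tmap \<mu> \<nu> T = (\<lambda>f. if f \<in> BF then T (\<lambda>a b. f (\<mu> a) (\<nu> b)) else 0)"

definition equivariant :: "('a \<Rightarrow> 'a) \<Rightarrow> ('b \<Rightarrow> 'b) \<Rightarrow> bool" where
  "equivariant \<mu> \<nu> \<longleftrightarrow> \<mu> \<in> star_hom A A \<and> \<nu> \<in> star_hom B B \<and>
     (\<forall>a\<in>carrier A. \<mu> (\<alpha> a) = \<alpha> (\<mu> a)) \<and> (\<forall>b\<in>carrier B. \<nu> (\<beta> b) = \<beta> (\<nu> b))"

abbreviation qmap :: "('a \<Rightarrow> 'a) \<Rightarrow> ('b \<Rightarrow> 'b) \<Rightarrow> bit \<times> 'a \<times> bit \<times> 'b \<Rightarrow> bit \<times> 'a \<times> bit \<times> 'b" where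
  "qmap \<mu> \<nu> \<equiv> \<lambda>(i, a, j, b). (i, \<mu> a, j, \<nu> b)"

context
  fixes \<mu> \<nu> assumes eqv: "equivariant \<mu> \<nu>"
begin

lemma \<mu>_hom: "\<mu> \<in> star_hom A A" and \<nu>_hom: "\<nu> \<in> star_hom B B"
  using eqv by (simp_all add: equivariant_def)

lemmas \<mu>_rules = star_homD[OF \<mu>_hom]
lemmas \<nu>_rules = star_homD[OF \<nu>_hom]

lemma BF_map: "f \<in> BF \<Longrightarrow> (\<lambda>a b. f (\<mu> a) (\<nu> b)) \<in> BF"
  unfolding bilinear_forms_def mem_Collect_eq
  by (intro conjI ballI allI) (simp_all add: \<mu>_rules \<nu>_rules)

lemma qmap_quads: "x \<in> quads \<Longrightarrow> qmap \<mu> \<nu> x \<in> quads"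
  using eqv \<mu>_rules(3) \<nu>_rules(3)
  by (auto simp: quads_def homogeneous_def equivariant_def \<mu>_rules(1) \<nu>_rules(1))

lemma tmap_tens: "tmap \<mu> \<nu> (tens xs) = tens (map (qmap \<mu> \<nu>) xs)"
  using BF_map by (auto simp: tmap_def tens_def val_def comp_def case_prod_unfold)

lemma tmap_elem: "tmap \<mu> \<nu> (elem_tensor A B a b) = elem_tensor A B (\<mu> a) (\<nu> b)"
  using BF_map by (auto simp: tmap_def elem_tensor_def)

lemma map_quads: "set xs \<subseteq> quads \<Longrightarrow> set (map (qmap \<mu> \<nu>) xs) \<subseteq> quads"
  unfolding set_map by (rule image_subsetI, rule qmap_quads, rule subsetD)

lemma qmap_qtimes: "x \<in> quads \<Longrightarrow> y \<in> quads \<Longrightarrow> qmap \<mu> \<nu> (qtimes x y) = qtimes (qmap \<mu> \<nu> x) (qmap \<mu> \<nu> y)"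
  by (auto simp: quads_def qtimes_def \<mu>_rules \<nu>_rules A.closed B.closed)

lemma qmap_qadj: "x \<in> quads \<Longrightarrow> qmap \<mu> \<nu> (qadj x) = qadj (qmap \<mu> \<nu> x)"
  by (auto simp: quads_def qadj_def \<mu>_rules \<nu>_rules A.closed B.closed)

lemma tmap_hom: "tmap \<mu> \<nu> \<in> star_hom X X"
  unfolding star_hom_def
proof (intro CollectI conjI ballI allI)
  fix T assume "T \<in> carrier X"
  then obtain xs where T: "T = tens xs" and xs: "set xs \<subseteq> quads" by (rule X_obtain)
  have xs': "set (map (qmap \<mu> \<nu>) xs) \<subseteq> quads" using map_quads[OF xs] .
  show "tmap \<mu> \<nu> T \<in> carrier X" using xs' by (simp only: T tmap_tens tens_in_X)
  show "tmap \<mu> \<nu> (vscale X z T) = vscale X z (tmap \<mu> \<nu> T)" for z by (auto simp: tmap_def)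
  have "tmap \<mu> \<nu> (adj X T) = tens (map (qmap \<mu> \<nu>) (map qadj xs))"
    by (simp only: T adj_tens xs tmap_tens)
  also have "map (qmap \<mu> \<nu>) (map qadj xs) = map qadj (map (qmap \<mu> \<nu>) xs)"
    unfolding map_map using xs qmap_qadj by (intro map_cong) auto
  finally show "tmap \<mu> \<nu> (adj X T) = adj X (tmap \<mu> \<nu> T)"
    by (simp only: T tmap_tens adj_tens xs')
  fix U assume "U \<in> carrier X"
  then obtain ys where U: "U = tens ys" and ys: "set ys \<subseteq> quads" by (rule X_obtain)
  have ys': "set (map (qmap \<mu> \<nu>) ys) \<subseteq> quads" using map_quads[OF ys] .
  show "tmap \<mu> \<nu> (vplus X T U) = vplus X (tmap \<mu> \<nu> T) (tmap \<mu> \<nu> U)" by (auto simp: tmap_def)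
  have "map (qmap \<mu> \<nu>) (map (qtimes x) ys) = map (qtimes (qmap \<mu> \<nu> x)) (map (qmap \<mu> \<nu>) ys)"
    if "x \<in> quads" for x
    unfolding map_map by (intro map_cong refl) (simp only: comp_apply qmap_qtimes[OF that] subsetD[OF ys])
  then have *: "map (map (qmap \<mu> \<nu>)) (map (\<lambda>x. map (qtimes x) ys) xs)
      = map (\<lambda>x. map (qtimes x) (map (qmap \<mu> \<nu>) ys)) (map (qmap \<mu> \<nu>) xs)"
    unfolding map_map comp_def using xs by (intro map_cong) auto
  have "tmap \<mu> \<nu> (vtimes X T U) = tens (map (qmap \<mu> \<nu>) (ltimes xs ys))"
    by (simp only: T U times_tens xs ys tmap_tens)
  also have "map (qmap \<mu> \<nu>) (ltimes xs ys) = ltimes (map (qmap \<mu> \<nu>) xs) (map (qmap \<mu> \<nu>) ys)"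
    unfolding map_concat * ..
  finally show "tmap \<mu> \<nu> (vtimes X T U) = vtimes X (tmap \<mu> \<nu> T) (tmap \<mu> \<nu> U)"
    by (simp only: T U tmap_tens times_tens xs' ys')
qed

end

lemma tmap_inverse:
  assumes "equivariant \<mu> \<nu>" "equivariant \<mu>' \<nu>'"
    and "\<And>a. a \<in> carrier A \<Longrightarrow> \<mu> (\<mu>' a) = a" "\<And>b. b \<in> carrier B \<Longrightarrow> \<nu> (\<nu>' b) = b"
    and "T \<in> carrier X"
  shows "tmap \<mu> \<nu> (tmap \<mu>' \<nu>' T) = T"
proof -
  obtain xs where xs: "T = tens xs" "set xs \<subseteq> quads" using assms(5) by (rule X_obtain)
  have "map (qmap \<mu> \<nu>) (map (qmap \<mu>' \<nu>') xs) = xs"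
    unfolding map_map using xs(2) assms(3,4) by (intro map_idI) (auto simp: quads_def)
  then show ?thesis by (simp only: xs tmap_tens assms(1,2))
qed

lemma elem_tensor_hom_eqI:
  assumes F: "F \<in> star_hom X Y" and G: "G \<in> star_hom X Y" and Y: "star_algebra Y"
    and eq: "\<And>a b. a \<in> carrier A \<Longrightarrow> b \<in> carrier B \<Longrightarrow> F (elem_tensor A B a b) = G (elem_tensor A B a b)"
    and T: "T \<in> carrier X"
  shows "F T = G T"
proof -
  obtain xs where xs: "T = tens xs" "set xs \<subseteq> quads" using T by (rule X_obtain)
  have "F (tens xs) = G (tens xs)"
    using xs(2)
  proof (induct xs)
    case Nil
    then show ?case
      using star_hom_zero[OF F star_algebra_X Y] star_hom_zero[OF G star_algebra_X Y] by (simp add: tens_Nil)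
  next
    case (Cons x xs)
    obtain i a j b where x: "x = (i, a, j, b)" "a \<in> carrier A" "b \<in> carrier B"
      using Cons(2) by (auto simp: quads_def)
    have "tens [x] = elem_tensor A B a b" by (auto simp: tens_def val_def elem_tensor_def x)
    moreover have "tens (x # xs) = vplus X (tens [x]) (tens xs)" using tens_Cons[of x xs] by simp
    ultimately show ?case
      using Cons x eq by (simp add: star_homD(2)[OF F] star_homD(2)[OF G] elem_tensor_in_X del: X_simps)
  qed
  then show ?thesis by (simp add: xs)
qed

end

context graded_cstar_pair
begin

lemma even_comp:
  assumes "equivariant \<mu> \<nu>"
  shows "even_A \<phi> \<Longrightarrow> even_A (\<lambda>a. \<phi> (\<mu> a))" "even_B \<psi> \<Longrightarrow> even_B (\<lambda>b. \<psi> (\<nu> b))"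
proof -
  note [simp] = A.closed B.closed \<mu>_rules[OF assms] \<nu>_rules[OF assms]
  have *: "a \<in> carrier A \<Longrightarrow> \<mu> (\<alpha> a) = \<alpha> (\<mu> a)" "b \<in> carrier B \<Longrightarrow> \<nu> (\<beta> b) = \<beta> (\<nu> b)" for a b
    using assms by (simp_all add: equivariant_def)
  show "even_A \<phi> \<Longrightarrow> even_A (\<lambda>a. \<phi> (\<mu> a))" "even_B \<psi> \<Longrightarrow> even_B (\<lambda>b. \<psi> (\<nu> b))"
    unfolding even_positive_functional_def by (simp_all add: *)
qed

text \<open>Pulling \<open>\<phi>\<close> and \<open>\<psi>\<close> back along \<open>\<mu>\<close>
  and \<open>\<nu>\<close> gives even positive functionals again, and the right inverses exhibit
  every test vector as an image under \<open>tmap \<mu> \<nu>\<close>. So each quotient in the one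
  GNS supremum occurs in the other.\<close>

lemma tmap_contractive:
  assumes eqv: "equivariant \<mu> \<nu>" "equivariant \<mu>' \<nu>'"
    and inv: "\<And>a. a \<in> carrier A \<Longrightarrow> \<mu> (\<mu>' a) = a" "\<And>b. b \<in> carrier B \<Longrightarrow> \<nu> (\<nu>' b) = b"
    and T: "T \<in> carrier X"
  shows "N (tmap \<mu> \<nu> T) \<le> N T"
proof -
  note hom = tmap_hom[OF eqv(1)]
  note rules = star_homD[OF hom]
  have "G.gns (emb X (tmap \<mu> \<nu> T)) \<le> G.gns (emb X T)"
  proof (rule G.gns_leI)
    fix w f assume "w \<in> \<Omega>"
    then obtain \<phi> \<psi> where w: "w = \<omega> \<phi> \<psi>" "even_A \<phi>" "even_B \<psi>" by (auto simp: \<Omega>_def)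
    define w' where "w' = \<omega> (\<lambda>a. \<phi> (\<mu> a)) (\<lambda>b. \<psi> (\<nu> b))"
    have w': "w' \<in> \<Omega>" using even_comp[OF eqv(1)] w by (auto simp: w'_def \<Omega>_def)
    define y where "y = tmap \<mu>' \<nu>' (proj X f)"
    have y: "y \<in> carrier X" "tmap \<mu> \<nu> y = proj X f"
      using star_homD(1)[OF tmap_hom[OF eqv(2)]] by (auto simp: y_def tmap_inverse[OF eqv inv])
    have w_tmap: "tmap \<mu> \<nu> U (\<lambda>a b. \<phi> a * \<psi> b) = w' (emb X U)" if "U \<in> carrier X" for U
      using that BF_product w by (simp add: tmap_def w'_def \<omega>_def)
    have "w (star (emb X (tmap \<mu> \<nu> T) * f) * (emb X (tmap \<mu> \<nu> T) * f))
        = tmap \<mu> \<nu> (vtimes X (adj X (vtimes X T y)) (vtimes X T y)) (\<lambda>a b. \<phi> a * \<psi> b)"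
      using T y rules by (simp add: w \<omega>_def X.closed flip: y(2) del: X_simps)
    also have "\<dots> = w' (star (emb X T * emb X y) * (emb X T * emb X y))"
      using T y by (simp add: w_tmap X.closed X.emb_hom del: X_simps)
    finally have 1: "w (star (emb X (tmap \<mu> \<nu> T) * f) * (emb X (tmap \<mu> \<nu> T) * f))
        = w' (star (emb X T * emb X y) * (emb X T * emb X y))" .
    have "w (star f * f) = tmap \<mu> \<nu> (vtimes X (adj X y) y) (\<lambda>a b. \<phi> a * \<psi> b)"
      using y rules by (simp add: w \<omega>_def X.closed flip: y(2) del: X_simps)
    also have "\<dots> = w' (star (emb X y) * emb X y)"
      using y by (simp add: w_tmap X.closed X.emb_hom del: X_simps)
    finally show "G.nrm w (emb X (tmap \<mu> \<nu> T) * f) \<le> G.gns (emb X T) * G.nrm w f"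
      unfolding 1 using G.nrm_le_gns[OF w'] by simp
  qed (rule G.gns_nonneg)
  then show ?thesis using T rules(1) by (simp add: min_norm_gns)
qed

abbreviation "D \<equiv> gtensor A \<alpha> B \<beta>"
abbreviation "telem \<equiv> gtensor_elem A \<alpha> B \<beta>"

lemma D_eq: "D = T.K"
  by (simp add: gtensor_def)

lemma telem_eq: "telem a b = T.inc (elem_tensor A B a b)"
  by (simp add: gtensor_elem_def)

lemma cstar_algebra_D: "cstar_algebra D"
  unfolding D_eq by (rule T.cstar_algebra_K)

lemma D_hom_eqI:
  assumes F: "F \<in> star_hom D C" and G: "G \<in> star_hom D C" and C: "cstar_algebra C"
    and eq: "\<And>a b. a \<in> carrier A \<Longrightarrow> b \<in> carrier B \<Longrightarrow> F (telem a b) = G (telem a b)"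
    and S: "S \<in> carrier D"
  shows "F S = G S"
proof (rule T.hom_eqI[OF F[unfolded D_eq] G[unfolded D_eq] C _ S[unfolded D_eq]])
  interpret C: cstar_algebra C by fact
  fix T assume T: "T \<in> carrier X"
  show "F (T.inc T) = G (T.inc T)"
    by (rule elem_tensor_hom_eqI[OF star_hom_comp[OF T.inc_star_hom F[unfolded D_eq]]
          star_hom_comp[OF T.inc_star_hom G[unfolded D_eq]] C.star_algebra_axioms _ T])
      (simp add: eq flip: telem_eq)
qed

lemma equivariant_grading: "equivariant \<alpha> \<beta>"
  using A.hom_\<alpha> B.hom_\<alpha> by (simp add: equivariant_def)

text \<open>The definite description denotes: \<open>tmap \<alpha> \<beta>\<close> extends to the
  completion, and a homomorphism on the completion is determined by its values at elementary
  tensors.\<close>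

lemma gtensor_grading:
  "grading D (gtensor_grading A \<alpha> B \<beta>)"
  "a \<in> carrier A \<Longrightarrow> b \<in> carrier B \<Longrightarrow> gtensor_grading A \<alpha> B \<beta> (telem a b) = telem (\<alpha> a) (\<beta> b)"
proof -
  let ?P = "\<lambda>\<gamma>. \<gamma> \<in> extensional (carrier D) \<and> grading D \<gamma> \<and>
        (\<forall>a\<in>carrier A. \<forall>b\<in>carrier B. \<gamma> (telem a b) = telem (\<alpha> a) (\<beta> b))"
  interpret C: contractive_hom X N X N "tmap \<alpha> \<beta>"
    by unfold_locales
      (rule tmap_hom[OF equivariant_grading],
        rule tmap_contractive[OF equivariant_grading equivariant_grading A.\<alpha>_\<alpha> B.\<alpha>_\<alpha>])
  have elem: "C.\<Theta> (telem a b) = telem (\<alpha> a) (\<beta> b)" if "a \<in> carrier A" "b \<in> carrier B" for a b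
    using that by (simp add: telem_eq C.complete_hom_inc elem_tensor_in_X tmap_elem equivariant_grading)
  have hom: "C.\<Theta> \<in> star_hom D D" using C.complete_hom_hom by (simp add: D_eq)
  have inv: "C.\<Theta> (C.\<Theta> S) = S" if "S \<in> carrier D" for S
    by (rule D_hom_eqI[OF star_hom_comp[OF hom hom] _ cstar_algebra_D _ that])
      (simp_all add: elem A.\<alpha>_hom B.\<alpha>_hom A.\<alpha>_\<alpha> B.\<alpha>_\<alpha> star_hom_def)
  have t_closed: "telem a b \<in> carrier D" if "a \<in> carrier A" "b \<in> carrier B" for a b
    using that by (simp add: telem_eq D_eq elem_tensor_in_X)
  have "?P (restrict C.\<Theta> (carrier D))"
    using T.K.grading_restrict[of C.\<Theta>] hom inv by (auto simp: elem t_closed D_eq[symmetric])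
  moreover have "\<gamma> = \<gamma>'" if "?P \<gamma>" "?P \<gamma>'" for \<gamma> \<gamma>'
  proof (rule extensionalityI[of _ "carrier D"])
    have "\<gamma> \<in> star_hom D D" "\<gamma>' \<in> star_hom D D" using that grading_star_hom by metis+
    note eq = D_hom_eqI[OF this cstar_algebra_D]
    fix S assume "S \<in> carrier D"
    then show "\<gamma> S = \<gamma>' S"
      by (rule eq[rotated]) (simp add: that)
  qed (use that in auto)
  ultimately have "\<exists>!\<gamma>. ?P \<gamma>" by blast
  from theI'[OF this] show "grading D (gtensor_grading A \<alpha> B \<beta>)"
    "a \<in> carrier A \<Longrightarrow> b \<in> carrier B \<Longrightarrow> gtensor_grading A \<alpha> B \<beta> (telem a b) = telem (\<alpha> a) (\<beta> b)"
    by (simp_all add: gtensor_grading_def Let_def)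
qed

end

section \<open>Twisted algebras of P-graphs\<close>

lemma ex1_eq: "\<exists>!x. Q x \<Longrightarrow> Q a \<Longrightarrow> Q b \<Longrightarrow> a = b"
  by blast

context P_graph
begin

lemma vertices_arr: "v \<in> vertices P \<Lambda> \<Longrightarrow> v \<in> arr \<Lambda>"
  by (simp add: vertices_def level_def)

lemma src_vertex: "x \<in> arr \<Lambda> \<Longrightarrow> src \<Lambda> x \<in> vertices P \<Lambda>"
  and rng_vertex: "x \<in> arr \<Lambda> \<Longrightarrow> rng \<Lambda> x \<in> vertices P \<Lambda>"
  by (simp_all add: vertices_def level_def src_closed rng_closed deg_ident)

lemma factor_unique:
  assumes "y \<in> arr \<Lambda>" "u \<in> arr \<Lambda>" "src \<Lambda> y = rng \<Lambda> u"
    and "y' \<in> arr \<Lambda>" "u' \<in> arr \<Lambda>" "src \<Lambda> y' = rng \<Lambda> u'"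
    and "cmp \<Lambda> y u = cmp \<Lambda> y' u'" "degr \<Lambda> y = degr \<Lambda> y'" "degr \<Lambda> u = degr \<Lambda> u'"
  shows "y = y' \<and> u = u'"
proof -
  let ?Q = "\<lambda>(v, w). v \<in> arr \<Lambda> \<and> w \<in> arr \<Lambda> \<and> src \<Lambda> v = rng \<Lambda> w \<and>
      degr \<Lambda> v = degr \<Lambda> y \<and> degr \<Lambda> w = degr \<Lambda> u \<and> cmp \<Lambda> y u = cmp \<Lambda> v w"
  have "\<exists>!z. ?Q z"
    by (rule factorisation[OF comp_closed[OF assms(1-3)] deg_closed[OF assms(1)] deg_closed[OF assms(2)]
          deg_comp[OF assms(1-3)]])
  moreover have "?Q (y, u)" "?Q (y', u')" using assms by simp_all
  ultimately have "(y, u) = (y', u')" by (rule ex1_eq)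
  then show ?thesis by simp
qed

lemma factorE:
  assumes "x \<in> arr \<Lambda>" "p \<in> carrier P" "q \<in> carrier P" "degr \<Lambda> x = p \<otimes>\<^bsub>P\<^esub> q"
  obtains y u where "y \<in> arr \<Lambda>" "u \<in> arr \<Lambda>" "src \<Lambda> y = rng \<Lambda> u" "degr \<Lambda> y = p" "degr \<Lambda> u = q"
    "x = cmp \<Lambda> y u"
  using factorisation[OF assms] by auto

lemma level_at_arr: "x \<in> level_at \<Lambda> v p \<Longrightarrow> x \<in> arr \<Lambda>"
  by (simp add: level_at_def level_def)

end

locale twisted_graph = P_graph P \<Lambda> + comm_monoid P
  for P :: "('p, 'm) monoid_scheme" and \<Lambda> :: "('a, 'p) deg_category" +
  fixes c :: "'a \<Rightarrow> 'a \<Rightarrow> complex"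
  assumes rowfin: "row_finite P \<Lambda>"
    and c_unit: "\<lbrakk>x \<in> arr \<Lambda>; y \<in> arr \<Lambda>; src \<Lambda> x = rng \<Lambda> y\<rbrakk> \<Longrightarrow> cmod (c x y) = 1"
    and c_rng: "x \<in> arr \<Lambda> \<Longrightarrow> c (rng \<Lambda> x) x = 1"
    and c_src: "x \<in> arr \<Lambda> \<Longrightarrow> c x (src \<Lambda> x) = 1"
begin

text \<open>Composing \<open>v\<close> with its range on the left or with its source on the right
  gives \<open>v\<close> both times. These are two factorisations with equal degrees, so they
  coincide.\<close>

lemma vertex_ident: "v \<in> vertices P \<Lambda> \<Longrightarrow> src \<Lambda> v = v" "v \<in> vertices P \<Lambda> \<Longrightarrow> rng \<Lambda> v = v"
proof -
  assume v: "v \<in> vertices P \<Lambda>"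
  then have "v \<in> arr \<Lambda>" "degr \<Lambda> v = \<one>\<^bsub>P\<^esub>" by (auto simp: vertices_def level_def)
  then have "rng \<Lambda> v = v \<and> v = src \<Lambda> v"
    using factor_unique[of "rng \<Lambda> v" v v "src \<Lambda> v"]
    by (simp add: rng_closed src_closed rng_ident src_ident comp_rng comp_src deg_ident)
  then show "src \<Lambda> v = v" "rng \<Lambda> v = v" by simp_all
qed

lemma finite_level_at: "v \<in> vertices P \<Lambda> \<Longrightarrow> p \<in> carrier P \<Longrightarrow> finite (level_at \<Lambda> v p)"
  using rowfin by (simp add: row_finite_def)

abbreviation "R \<equiv> twisted_relators P \<Lambda> c"

lemma relator_intros:
  "v \<in> vertices P \<Lambda> \<Longrightarrow> adj (free_star_alg (arr \<Lambda>)) (free_gen v) - free_gen v \<in> R"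
  "v \<in> vertices P \<Lambda> \<Longrightarrow> free_gen v * free_gen v - free_gen v \<in> R"
  "\<lbrakk>v \<in> vertices P \<Lambda>; w \<in> vertices P \<Lambda>; v \<noteq> w\<rbrakk> \<Longrightarrow> free_gen v * free_gen w \<in> R"
  "\<lbrakk>x \<in> arr \<Lambda>; y \<in> arr \<Lambda>; src \<Lambda> x = rng \<Lambda> y\<rbrakk> \<Longrightarrow>
    free_gen x * free_gen y - vscale (free_star_alg (arr \<Lambda>)) (c x y) (free_gen (cmp \<Lambda> x y)) \<in> R"
  "x \<in> arr \<Lambda> \<Longrightarrow> adj (free_star_alg (arr \<Lambda>)) (free_gen x) * free_gen x - free_gen (src \<Lambda> x) \<in> R"
  "\<lbrakk>v \<in> vertices P \<Lambda>; p \<in> carrier P\<rbrakk> \<Longrightarrow>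
    free_gen v - (\<Sum>x\<in>level_at \<Lambda> v p. free_gen x * adj (free_star_alg (arr \<Lambda>)) (free_gen x)) \<in> R"
  unfolding twisted_relators_def Let_def by blast+

lemma relator_cases:
  assumes "r \<in> R"
    and "\<And>v. v \<in> vertices P \<Lambda> \<Longrightarrow> Q (adj (free_star_alg (arr \<Lambda>)) (free_gen v) - free_gen v)"
    and "\<And>v. v \<in> vertices P \<Lambda> \<Longrightarrow> Q (free_gen v * free_gen v - free_gen v)"
    and "\<And>v w. \<lbrakk>v \<in> vertices P \<Lambda>; w \<in> vertices P \<Lambda>; v \<noteq> w\<rbrakk> \<Longrightarrow> Q (free_gen v * free_gen w)"
    and "\<And>x y. \<lbrakk>x \<in> arr \<Lambda>; y \<in> arr \<Lambda>; src \<Lambda> x = rng \<Lambda> y\<rbrakk> \<Longrightarrow>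
      Q (free_gen x * free_gen y - vscale (free_star_alg (arr \<Lambda>)) (c x y) (free_gen (cmp \<Lambda> x y)))"
    and "\<And>x. x \<in> arr \<Lambda> \<Longrightarrow>
      Q (adj (free_star_alg (arr \<Lambda>)) (free_gen x) * free_gen x - free_gen (src \<Lambda> x))"
    and "\<And>v p. \<lbrakk>v \<in> vertices P \<Lambda>; p \<in> carrier P\<rbrakk> \<Longrightarrow>
      Q (free_gen v - (\<Sum>x\<in>level_at \<Lambda> v p. free_gen x * adj (free_star_alg (arr \<Lambda>)) (free_gen x)))"
  shows "Q r"
  by (insert assms(1), unfold twisted_relators_def Let_def)
    (elim UnE CollectE exE conjE; hypsubst; rule assms(2-7); assumption)

end

lemma free_sum_closed:
  "(\<And>i. i \<in> I \<Longrightarrow> f i \<in> carrier (free_star_alg S)) \<Longrightarrow> sum f I \<in> carrier (free_star_alg S)"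
  using free.closed(2)[of _ S]
  by (induct I rule: infinite_finite_induct) (simp_all del: free_simps(1) add: free.zero_closed[simplified free_simps(2)])

text \<open>The relations are stated in an arbitrary *-ring because they are met in three of them:
  by the universal generators, by the tensors of generators, and by operators on the path
  space.\<close>

locale twisted_family = twisted_graph P \<Lambda> c
  for P :: "('p, 'm) monoid_scheme" and \<Lambda> :: "('a, 'p) deg_category" and c +
  fixes s :: "'a \<Rightarrow> 'r::star_ring"
  assumes star_vertex: "v \<in> vertices P \<Lambda> \<Longrightarrow> star (s v) = s v"
    and vertex_idem: "v \<in> vertices P \<Lambda> \<Longrightarrow> s v * s v = s v"
    and vertex_orth: "\<lbrakk>v \<in> vertices P \<Lambda>; w \<in> vertices P \<Lambda>; v \<noteq> w\<rbrakk> \<Longrightarrow> s v * s w = 0"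
    and s_mult: "\<lbrakk>x \<in> arr \<Lambda>; y \<in> arr \<Lambda>; src \<Lambda> x = rng \<Lambda> y\<rbrakk> \<Longrightarrow> s x * s y = c x y *\<^sub>C s (cmp \<Lambda> x y)"
    and star_s_s: "x \<in> arr \<Lambda> \<Longrightarrow> star (s x) * s x = s (src \<Lambda> x)"
    and vertex_sum: "\<lbrakk>v \<in> vertices P \<Lambda>; p \<in> carrier P\<rbrakk> \<Longrightarrow> s v = (\<Sum>x\<in>level_at \<Lambda> v p. s x * star (s x))"

lemma (in twisted_family) free_value_relator:
  assumes r: "r \<in> R"
  shows "free_value s r = 0"
proof -
  have minus: "free_value s (f - g) = free_value s f - free_value s g" for f g
    using free_value_add[of s "f - g" g] by simp
  have sum: "free_value s (sum f I) = (\<Sum>i\<in>I. free_value s (f i))" for f :: "'b \<Rightarrow> 'a free" and I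
    by (induct I rule: infinite_finite_induct) (simp_all add: free_value_add)
  have keys: "x \<in> arr \<Lambda> \<Longrightarrow> Poly_Mapping.keys (free_gen x) \<subseteq> words (arr \<Lambda>)"
    "x \<in> arr \<Lambda> \<Longrightarrow> Poly_Mapping.keys (adj (free_star_alg (arr \<Lambda>)) (free_gen x)) \<subseteq> words (arr \<Lambda>)" for x
    using free.adj_closed[of "free_gen x" "arr \<Lambda>"] by simp_all
  note [simp] = minus sum keys vertices_arr free_value_mult[of _ "arr \<Lambda>"] free_value_adj free_value_scale
  show ?thesis
    using r
    by (rule relator_cases)
      (simp_all add: star_vertex vertex_idem vertex_orth s_mult star_s_s level_at_arr, rule vertex_sum)
qed

context twisted_graph
begin

abbreviation "FA \<equiv> free_star_alg (arr \<Lambda>)"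

lemma R_closed: "R \<subseteq> carrier FA"
proof
  fix r assume "r \<in> R"
  have gen: "x \<in> arr \<Lambda> \<Longrightarrow> free_gen x \<in> carrier FA" for x by simp
  have closed: "f \<in> carrier FA \<Longrightarrow> g \<in> carrier FA \<Longrightarrow> f - g \<in> carrier FA"
    "f \<in> carrier FA \<Longrightarrow> g \<in> carrier FA \<Longrightarrow> f * g \<in> carrier FA"
    "f \<in> carrier FA \<Longrightarrow> adj FA f \<in> carrier FA" "f \<in> carrier FA \<Longrightarrow> vscale FA z f \<in> carrier FA"
    for f g :: "'a free" and z
    using free.minus_closed[of f "arr \<Lambda>" g] free.times_closed[of f "arr \<Lambda>" g]
      free.adj_closed[of f "arr \<Lambda>"] free.scale_closed[of f "arr \<Lambda>" z] unfolding free_minus free_simps(4)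
    by blast+
  show "r \<in> carrier FA"
    using \<open>r \<in> R\<close>
    by (rule relator_cases)
      (simp_all add: closed gen free_sum_closed vertices_arr src_closed comp_closed level_at_arr
        del: free_simps(1))
qed

text \<open>The relations hold only up to elements of seminorm zero. Up to these a vertex is a
  projection, so its seminorm is \<open>0\<close> or \<open>1\<close>, and the squared seminorm of a
  generator is the seminorm of its source vertex.\<close>

lemma gen_bounded:
  assumes "cstar_seminorm FA p" and 0: "\<And>r. r \<in> R \<Longrightarrow> p r = 0" and x: "x \<in> arr \<Lambda>"
  shows "p (free_gen x) \<le> 1"
proof -
  interpret cstar_seminormed "\<lambda>f. p (proj FA f)" by (rule free.seminormed_proj) fact
  have near: "p (proj FA f) = p (proj FA g)" if "p (proj FA (f - g)) = 0" for f g
    using abs_diff_le[of f g] that by simp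
  have vertex: "p (free_gen v) \<le> 1" if v: "v \<in> vertices P \<Lambda>" for v
  proof -
    define e where "e = emb FA (free_gen v :: 'a free)"
    have e: "proj FA e = free_gen v" using v vertices_arr by (simp add: e_def)
    have "p (proj FA (star e - e)) = 0" "p (proj FA (e * e - e)) = 0"
      using relator_intros(1,2)[OF v] 0 by (simp_all add: e)
    moreover from this(1) have "p (proj FA (star e * e - e * e)) = 0"
      using null_mult(1)[of "star e - e" e] by (simp add: left_diff_distrib del: free.proj_hom)
    ultimately have "(p (proj FA e))\<^sup>2 = p (proj FA e)"
      using near[of "star e * e" "e * e"] near[of "e * e" e] cstar[of e] by (simp del: free.proj_hom)
    then have "p (proj FA e) = 0 \<or> p (proj FA e) = 1" by (simp add: power2_eq_square)
    then show ?thesis by (auto simp: e)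
  qed
  define e where "e = emb FA (free_gen x :: 'a free)"
  define v where "v = emb FA (free_gen (src \<Lambda> x) :: 'a free)"
  have e: "proj FA e = free_gen x" "proj FA v = free_gen (src \<Lambda> x)"
    using x src_closed by (simp_all add: e_def v_def)
  have "p (proj FA (star e * e - v)) = 0"
    using relator_intros(5)[OF x] 0 by (simp add: e)
  then have "(p (proj FA e))\<^sup>2 = p (proj FA v)"
    using near cstar by metis
  also have "\<dots> \<le> 1" using vertex[OF src_vertex[OF x]] by (simp add: e)
  finally show ?thesis using nonneg[of e] by (simp add: e abs_square_le_1)
qed

sublocale presentation "arr \<Lambda>" R
  by unfold_locales (use R_closed gen_bounded in auto)

lemma twisted_cstar_eq: "twisted_cstar P \<Lambda> c = K"
  by (simp add: twisted_cstar_def universal_cstar_def)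

lemma twisted_gen_eq: "twisted_gen P \<Lambda> c = gen"
  by (simp add: twisted_gen_def)

definition sg :: "'a \<Rightarrow> (nat \<Rightarrow> 'a free) set star_prod" where
  "sg x = emb K (gen x)"

lemma sg_family: "twisted_family P \<Lambda> c sg"
proof
  define h where "h f = emb K (inc f)" for f
  have gen: "x \<in> arr \<Lambda> \<Longrightarrow> free_gen x \<in> carrier FA" for x by simp
  have hsg: "h (free_gen x) = sg x" for x by (simp add: h_def sg_def gen_eq)
  have h0: "r \<in> R \<Longrightarrow> h r = 0" for r by (simp add: h_def inc_relator K.emb_hom)
  have adj: "x \<in> arr \<Lambda> \<Longrightarrow> adj FA (free_gen x) \<in> carrier FA" for x by (intro free.adj_closed gen)
  have h_minus: "f \<in> carrier FA \<Longrightarrow> g \<in> carrier FA \<Longrightarrow> h (f - g) = h f - h g" for f g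
    using inc_hom(3)[of f g] by (simp add: h_def K.emb_hom)
  have h_mult: "f \<in> carrier FA \<Longrightarrow> g \<in> carrier FA \<Longrightarrow> h (f * g) = h f * h g" for f g
    using inc_hom(5)[of f g] by (simp add: h_def K.emb_hom)
  have h_adj: "f \<in> carrier FA \<Longrightarrow> h (adj FA f) = star (h f)" for f
    by (simp add: h_def inc_hom K.emb_hom)
  have h_scale: "f \<in> carrier FA \<Longrightarrow> h (vscale FA z f) = z *\<^sub>C h f" for z f
    by (simp add: h_def inc_hom K.emb_hom)
  have h_sum: "h (sum f I) = (\<Sum>i\<in>I. h (f i))" if "\<And>i. i \<in> I \<Longrightarrow> f i \<in> carrier FA" for f :: "'a \<Rightarrow> 'a free" and I
    using that
  proof (induct I rule: infinite_finite_induct)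
    case (insert i I)
    then have "h (f i + sum f I) = h (f i) + h (sum f I)"
      using inc_hom(2)[of "f i" "sum f I"] free_sum_closed[of I f "arr \<Lambda>"]
      by (simp add: h_def K.emb_hom del: free_simps(1))
    then show ?case using insert by simp
  qed (use h0[OF relator_intros(1)] inc_hom(1) in \<open>simp_all add: h_def K.emb_hom\<close>)
  have closed: "f \<in> carrier FA \<Longrightarrow> g \<in> carrier FA \<Longrightarrow> f * g \<in> carrier FA" for f g :: "'a free"
    using free.times_closed[of f "arr \<Lambda>" g] by simp
  have scale_closed: "f \<in> carrier FA \<Longrightarrow> vscale FA z f \<in> carrier FA" for f :: "'a free" and z
    by (rule free.scale_closed)
  note rules = h_minus h_mult h_adj h_scale h_sum hsg gen adj closed scale_closed vertices_arr src_closed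
    comp_closed level_at_arr free_sum_closed
  fix v w x y p
  show "star (sg v) = sg v" if "v \<in> vertices P \<Lambda>"
    using h0[OF relator_intros(1)[OF that]] that by (simp add: rules del: free_simps)
  show "sg v * sg v = sg v" if "v \<in> vertices P \<Lambda>"
    using h0[OF relator_intros(2)[OF that]] that by (simp add: rules del: free_simps)
  show "sg v * sg w = 0" if "v \<in> vertices P \<Lambda>" "w \<in> vertices P \<Lambda>" "v \<noteq> w"
    using h0[OF relator_intros(3)[OF that]] that by (simp add: rules del: free_simps)
  show "sg x * sg y = c x y *\<^sub>C sg (cmp \<Lambda> x y)" if "x \<in> arr \<Lambda>" "y \<in> arr \<Lambda>" "src \<Lambda> x = rng \<Lambda> y"
    using h0[OF relator_intros(4)[OF that]] that by (simp add: rules del: free_simps)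
  show "star (sg x) * sg x = sg (src \<Lambda> x)" if "x \<in> arr \<Lambda>"
    using h0[OF relator_intros(5)[OF that]] that by (simp add: rules del: free_simps)
  show "sg v = (\<Sum>x\<in>level_at \<Lambda> v p. sg x * star (sg x))" if "v \<in> vertices P \<Lambda>" "p \<in> carrier P"
  proof -
    have mem: "free_gen x * adj FA (free_gen x) \<in> carrier FA" if "x \<in> level_at \<Lambda> v p" for x
      using that by (intro closed adj gen level_at_arr)
    have "h (\<Sum>x\<in>level_at \<Lambda> v p. free_gen x * adj FA (free_gen x)) = (\<Sum>x\<in>level_at \<Lambda> v p. sg x * star (sg x))"
      by (subst h_sum[OF mem], assumption, intro sum.cong refl) (simp add: rules del: free_simps)
    moreover have "(\<Sum>x\<in>level_at \<Lambda> v p. free_gen x * adj FA (free_gen x)) \<in> carrier FA"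
      by (rule free_sum_closed[OF mem])
    ultimately show ?thesis
      using h0[OF relator_intros(6)[OF that]] h_minus[OF gen[of v]] that
      by (simp add: hsg vertices_arr)
  qed
qed

end

section \<open>Gauge-invariant uniqueness\<close>

context cstar_seminormed
begin

text \<open>A projection is an extreme point of the unit ball: a selfadjoint \<open>c\<close> with
  \<open>\<parallel>e \<plusminus> c\<parallel> \<le> 1\<close> may be replaced by \<open>3/2 c\<close>, because \<open>e + 3/2 c\<close> is a convex combination of products of the
  contractions \<open>e \<plusminus> c\<close> and \<open>e \<plusminus> i c\<close>.\<close>

lemma extreme_point_step:
  assumes e: "star e = e" "e * e = e" and c: "star c = c" "e * c = c"
    and le: "p (e + c) \<le> 1" "p (e - c) \<le> 1"
  shows "p (e + (3/2) *\<^sub>C c) \<le> 1"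
proof -
  have ce: "c * e = c" using star_mult[of e c] e c by simp
  have ec3: "e * (c * x) = c * x" "c * (e * x) = c * x" "e * (e * x) = e * x" for x
    by (simp_all add: e c ce flip: mult.assoc)
  define u where "u = e + c"
  define v where "v = e - c"
  define w where "w = e + \<i> *\<^sub>C c"
  define w' where "w' = e - \<i> *\<^sub>C c"
  \<comment> \<open>\<open>e + c * c\<close> is the mean of \<open>u * u\<close> and
    \<open>v * v\<close>, hence a contraction; it equals both \<open>star w * w\<close> and
    \<open>star w' * w'\<close>.\<close>
  have "2 *\<^sub>C (e + c * c) = u * u + v * v"
    by (simp add: u_def v_def algebra_simps scaleC_two e c ce)
  from arg_cong[OF this, of p] have "2 * p (e + c * c) = p (u * u + v * v)" by simp
  also have "\<dots> \<le> 1 + 1"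
    using le by (intro order_trans[OF triangle] add_mono mult_le_one) (simp_all add: u_def v_def)
  finally have ecc: "p (e + c * c) \<le> 1" by simp
  have "star w * w = e + c * c" "star w' * w' = e + c * c"
    by (simp_all add: w_def w'_def star_ring_simps algebra_simps e c ce)
  then have "(p w)\<^sup>2 \<le> 1" "(p w')\<^sup>2 \<le> 1" using ecc by (simp_all flip: cstar)
  then have w: "p w \<le> 1" "p w' \<le> 1"
    by (simp_all add: abs_square_le_1)
  \<comment> \<open>The weights \<open>3\<close>, \<open>1\<close>, \<open>1\<close>,
    \<open>3\<close> add up to \<open>8\<close>. They are chosen so that the quadratic and cubic
    terms in \<open>c\<close> cancel while \<open>12 c\<close> remains.\<close>
  have "8 *\<^sub>C (e + (3/2) *\<^sub>C c) = 3 *\<^sub>C (u * u * u) + (w * w * w + w' * w' * w') + 3 *\<^sub>C (u * u * v)"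
  proof -
    have three: "3 *\<^sub>C x = x + x + x" for x :: 'r
      using scaleC_add_left[of 2 1 x] by (simp add: scaleC_two)
    have four: "4 *\<^sub>C x = x + x + (x + x)" for x :: 'r
      using scaleC_add_left[of 2 2 x] by (simp add: scaleC_two)
    have eight: "8 *\<^sub>C x = x + x + (x + x) + (x + x + (x + x))" for x :: 'r
      using scaleC_add_left[of 4 4 x] by (simp add: four)
    have twelve: "12 *\<^sub>C x = 8 *\<^sub>C x + 4 *\<^sub>C x" for x :: 'r
      using scaleC_add_left[of 8 4 x] by simp
    show ?thesis
      by (simp add: u_def v_def w_def w'_def algebra_simps scaleC_add_right scaleC_diff_right e c ce ec3
          three four eight twelve)
  qed
  from arg_cong[OF this, of p] have "8 * p (e + (3/2) *\<^sub>C c) = p (3 *\<^sub>C (u * u * u) + (w * w * w + w' * w' * w') + 3 *\<^sub>C (u * u * v))"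
    by simp
  also have "\<dots> \<le> p (3 *\<^sub>C (u * u * u)) + (p (w * w * w) + p (w' * w' * w')) + p (3 *\<^sub>C (u * u * v))"
    by (meson add_mono order_refl order_trans triangle)
  also have "\<dots> \<le> 3 + (1 + 1) + 3"
  proof -
    have uv: "p u \<le> 1" "p v \<le> 1" using le by (simp_all add: u_def v_def)
    have "p (u * u * u) \<le> 1" "p (w * w * w) \<le> 1" "p (w' * w' * w') \<le> 1" "p (u * u * v) \<le> 1"
      by (intro mult_le_one uv w)+
    then show ?thesis by simp
  qed
  finally show ?thesis by simp
qed

text \<open>Iterating the step keeps \<open>e\<close> plus and minus \<open>(3/2) ^ n\<close> times
  \<open>c\<close> in the unit ball for every \<open>n\<close>, which bounds
  \<open>(3/2) ^ n * p c\<close> and forces \<open>p c = 0\<close>.\<close>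

lemma extreme_point:
  assumes e: "star e = e" "e * e = e" and c: "star c = c" "e * c = c"
    and le: "p (e + c) \<le> 1" "p (e - c) \<le> 1"
  shows "p c = 0"
proof -
  have step: "p (e + ((3/2) ^ n) *\<^sub>C c) \<le> 1 \<and> p (e - ((3/2) ^ n) *\<^sub>C c) \<le> 1" for n
  proof (induct n)
    case (Suc n)
    then show ?case
      using extreme_point_step[of e "((3/2) ^ n) *\<^sub>C c"] extreme_point_step[of e "- (((3/2) ^ n) *\<^sub>C c)"] e c
      by (simp add: mult.commute)
  qed (use le in simp)
  have "(3/2) ^ n * p c \<le> 2" for n
  proof -
    have "p (((3/2) ^ n) *\<^sub>C c) = p ((e + ((3/2) ^ n) *\<^sub>C c) - e)" by simp
    also have "\<dots> \<le> 2" using diff_le[of "e + ((3/2) ^ n) *\<^sub>C c" e] step[of n] projection_le_one[OF e] by linarith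
    finally show ?thesis by (simp add: norm_power)
  qed
  moreover have "\<exists>n. 2 / p c < (3/2) ^ n" using real_arch_pow[of "3/2"] by simp
  ultimately show ?thesis
    using nonneg[of c] by (metis divide_less_eq less_le not_le)
qed

end

text \<open>Definiteness is asked of the elements \<open>star (s x) * s y\<close>, where a seminorm
  estimate has to be turned into an equation. On the whole type-level ring it would fail, since the
  norm of one algebra vanishes at all other places.\<close>

locale normed_twisted_family = twisted_family P \<Lambda> c s + cstar_seminormed p
  for P :: "('p, 'm) monoid_scheme" and \<Lambda> :: "('a, 'p) deg_category" and c
    and s :: "'a \<Rightarrow> 'r::star_ring" and p :: "'r \<Rightarrow> real" +
  assumes orth_definite: "\<lbrakk>x \<in> arr \<Lambda>; y \<in> arr \<Lambda>; p (star (s x) * s y) = 0\<rbrakk> \<Longrightarrow> star (s x) * s y = 0"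
begin

lemma c_cnj: "\<lbrakk>x \<in> arr \<Lambda>; y \<in> arr \<Lambda>; src \<Lambda> x = rng \<Lambda> y\<rbrakk> \<Longrightarrow> cnj (c x y) * c x y = 1"
  using c_unit[of x y] complex_norm_square[of "c x y"] by (simp add: mult.commute)

lemma s_rng: "x \<in> arr \<Lambda> \<Longrightarrow> s (rng \<Lambda> x) * s x = s x"
  by (simp add: s_mult rng_closed rng_ident c_rng comp_rng)

lemma s_src: "x \<in> arr \<Lambda> \<Longrightarrow> s x * s (src \<Lambda> x) = s x"
  by (simp add: s_mult src_closed src_ident c_src comp_src)

lemma star_s_rng: "x \<in> arr \<Lambda> \<Longrightarrow> star (s x) * s (rng \<Lambda> x) = star (s x)"
  using star_mult[of "s (rng \<Lambda> x)" "s x"] by (simp add: s_rng star_vertex rng_vertex)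

lemma s_src_star: "x \<in> arr \<Lambda> \<Longrightarrow> s (src \<Lambda> x) * star (s x) = star (s x)"
  using star_mult[of "s x" "s (src \<Lambda> x)"] by (simp add: s_src star_vertex src_vertex)

lemma s_src_star': "x \<in> arr \<Lambda> \<Longrightarrow> s (src \<Lambda> x) * (star (s x) * y) = star (s x) * y"
  by (simp add: s_src_star flip: mult.assoc)

lemma s_star_s: "x \<in> arr \<Lambda> \<Longrightarrow> s x * (star (s x) * s x) = s x"
  by (simp add: star_s_s s_src)

lemma s_star_s': "x \<in> arr \<Lambda> \<Longrightarrow> s x * (star (s x) * (s x * y)) = s x * y"
  using s_star_s[of x] by (simp flip: mult.assoc)

lemma star_s_s_star': "x \<in> arr \<Lambda> \<Longrightarrow> star (s x) * (s x * (star (s x) * y)) = star (s x) * y"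
  by (simp add: star_s_s s_src_star' flip: mult.assoc) (simp add: mult.assoc s_src_star')

lemma norm_vertex: "v \<in> vertices P \<Lambda> \<Longrightarrow> p (s v) \<le> 1"
  by (intro projection_le_one star_vertex vertex_idem)

lemma star_s_orth_rng:
  assumes "x \<in> arr \<Lambda>" "y \<in> arr \<Lambda>" "rng \<Lambda> x \<noteq> rng \<Lambda> y"
  shows "star (s x) * s y = 0"
proof -
  have "star (s x) * s y = star (s x) * s (rng \<Lambda> x) * (s (rng \<Lambda> y) * s y)"
    using assms by (simp add: star_s_rng s_rng)
  also have "\<dots> = star (s x) * (s (rng \<Lambda> x) * s (rng \<Lambda> y)) * s y" by (simp add: mult.assoc)
  finally show ?thesis using assms by (simp add: vertex_orth rng_vertex)
qed

text \<open>Projections that have a projection as sum are orthogonal. Compressing the sum over the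
  level to the corner of \<open>e = s x * star (s x)\<close> leaves elements \<open>a z\<close> with
  \<open>z \<noteq> x\<close> that add up to \<open>0\<close>. Positivity of the \<open>a z\<close>
  is replaced by the bounds \<open>p (e - a z) \<le> 1\<close>; averaged, they place a multiple of
  \<open>a y\<close> symmetrically around \<open>e\<close> in the unit ball, and
  \<open>extreme_point\<close> makes it vanish.\<close>

lemma range_orth:
  assumes x: "x \<in> arr \<Lambda>" and y: "y \<in> arr \<Lambda>" and deg: "degr \<Lambda> x = degr \<Lambda> y" and "x \<noteq> y"
  shows "star (s x) * s y = 0"
proof (cases "rng \<Lambda> x = rng \<Lambda> y")
  case False
  then show ?thesis using star_s_orth_rng x y by blast
next
  case True
  define I where "I = level_at \<Lambda> (rng \<Lambda> x) (degr \<Lambda> x)"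
  have I: "finite I" "x \<in> I" "y \<in> I" "\<And>z. z \<in> I \<Longrightarrow> z \<in> arr \<Lambda>"
    using x y deg True finite_level_at[OF rng_vertex[OF x] deg_closed[OF x]]
    by (auto simp: I_def level_at_def level_def)
  define e where "e = s x * star (s x)"
  define a where "a z = e * (s z * star (s z)) * e" for z
  have e: "star e = e" "e * e = e"
    using x by (simp_all add: e_def star_mult mult.assoc s_star_s' s_src_star star_s_s_star')
  have pe: "p e \<le> 1" by (rule projection_le_one[OF e])
  have "e * s (rng \<Lambda> x) = e" using x by (simp add: e_def mult.assoc star_s_rng)
  then have "e = e * (\<Sum>z\<in>I. s z * star (s z)) * e"
    using e unfolding I_def vertex_sum[OF rng_vertex[OF x] deg_closed[OF x], symmetric] by simp
  then have "e = (\<Sum>z\<in>I. a z)" by (simp add: a_def sum_distrib_left sum_distrib_right)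
  moreover have "a x = e"
    using x by (simp add: a_def e_def mult.assoc s_star_s' star_s_s_star')
  ultimately have sum0: "(\<Sum>z\<in>I - {x}. a z) = 0"
    using I(1,2) by (simp add: sum.remove)
  have star_a: "star (a z) = a z" for z
    by (simp add: a_def star_mult e mult.assoc)
  have le: "p (e - a z) \<le> 1" if "z \<in> I" for z
  proof -
    define f where "f = s z * star (s z)"
    have f: "star f = f" "f * (f * t) = f * t" for t
      using I(4)[OF that] by (simp_all add: f_def star_mult mult.assoc s_star_s')
    \<comment> \<open>For \<open>d = e - f * e\<close> one has \<open>star d * d = e * d\<close>, so
      \<open>(p d) ^ 2 \<le> p d\<close> and therefore \<open>p d \<le> 1\<close>.\<close>
    have "star (e - f * e) * (e - f * e) = e * (e - f * e)" "e * (e - f * e) = e - a z"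
      using e f by (simp_all add: star_ring_simps algebra_simps a_def flip: f_def)
    then have sq: "(p (e - f * e))\<^sup>2 = p (e * (e - f * e))" and eq: "p (e - a z) = (p (e - f * e))\<^sup>2"
      by (metis cstar)+
    have "p (e * (e - f * e)) \<le> 1 * p (e - f * e)"
      using submult[of e "e - f * e"] mult_right_mono[OF pe, of "p (e - f * e)"] by simp
    then have "p (e - f * e) \<le> 1"
      using sq nonneg[of "e - f * e"] mult_left_le_imp_le[of "p (e - f * e)" "p (e - f * e)" 1]
      by (cases "p (e - f * e) = 0") (auto simp: power2_eq_square less_le)
    then show ?thesis unfolding eq by (simp add: power_le_one)
  qed
  define m where "m = card (I - {x} - {y})"
  have 1: "a y + (\<Sum>z\<in>I - {x} - {y}. a z) = 0"
    using sum0 I \<open>x \<noteq> y\<close> sum.remove[of "I - {x}" y a] by simp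
  have "p (a y) = 0"
  proof (cases "m = 0")
    case True
    then have "I - {x} - {y} = {}" using I(1) by (simp add: m_def)
    then show ?thesis using 1 by (metis add.right_neutral sum.empty zero)
  next
    case False
    \<comment> \<open>The \<open>m\<close> contractions \<open>e - a z\<close> with \<open>z\<close>
      different from \<open>x\<close> and \<open>y\<close> add up to \<open>m e + a y\<close>;
      division by \<open>m\<close> puts \<open>e + t a y\<close> into the unit ball.\<close>
    define t where "t = complex_of_real (1 / real m)"
    have "(\<Sum>z\<in>I - {x} - {y}. a z) = - a y"
      using 1 by (simp add: eq_neg_iff_add_eq_0 add.commute)
    then have "(\<Sum>z\<in>I - {x} - {y}. e - a z) = of_nat m *\<^sub>C e + a y"
      using scaleC_sum_left[of "\<lambda>_. 1" "I - {x} - {y}" e] by (simp add: sum_subtractf m_def)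
    then have "p (of_nat m *\<^sub>C e + a y) \<le> (\<Sum>z\<in>I - {x} - {y}. p (e - a z))"
      using sum_le by metis
    also have "\<dots> \<le> real m" using sum_mono[of "I - {x} - {y}" "\<lambda>z. p (e - a z)" "\<lambda>_. 1"] le by (simp add: m_def)
    finally have "p (t *\<^sub>C (of_nat m *\<^sub>C e + a y)) \<le> 1"
      using False by (simp add: t_def norm_divide divide_simps)
    then have plus: "p (e + t *\<^sub>C a y) \<le> 1"
      using False by (simp add: scaleC_add_right t_def)
    \<comment> \<open>A convex combination of the contractions \<open>e - a y\<close> and
      \<open>e\<close>, because \<open>0 < t \<le> 1\<close>.\<close>
    have "e - t *\<^sub>C a y = t *\<^sub>C (e - a y) + (1 - t) *\<^sub>C e"
      by (simp add: scaleC_diff_right scaleC_diff_left)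
    also have "p \<dots> \<le> cmod t * p (e - a y) + cmod (1 - t) * p e"
      using triangle[of "t *\<^sub>C (e - a y)" "(1 - t) *\<^sub>C e"] by simp
    also have "\<dots> \<le> cmod t * 1 + cmod (1 - t) * 1"
      using le[OF I(3)] pe by (intro add_mono mult_left_mono) auto
    also have "\<dots> = 1"
    proof -
      have "1 - t = complex_of_real (1 - 1 / real m)" by (simp add: t_def)
      then have "cmod (1 - t) = \<bar>1 - 1 / real m\<bar>" by (simp only: norm_of_real)
      then show ?thesis using False by (simp add: t_def norm_divide)
    qed
    finally have minus: "p (e - t *\<^sub>C a y) \<le> 1" .
    have "star (t *\<^sub>C a y) = t *\<^sub>C a y" "e * (t *\<^sub>C a y) = t *\<^sub>C a y"
      using e by (simp_all add: star_a t_def) (simp add: a_def flip: mult.assoc)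
    from extreme_point[OF e this plus minus] show ?thesis using False by (simp add: t_def)
  qed
  moreover have "a y = star (s y * star (s y) * e) * (s y * star (s y) * e)"
    using y e(1) by (simp add: a_def star_mult mult.assoc s_star_s')
  ultimately have "p (s y * star (s y) * e) = 0" using cstar by (metis power_eq_0_iff)
  then have "p (star (s y) * (s y * star (s y) * e) * s x) = 0"
    by (rule null_mult(1)[OF null_mult(2)])
  also have "star (s y) * (s y * star (s y) * e) * s x = star (s y) * s x"
    using x y by (simp add: e_def mult.assoc star_s_s_star' s_star_s)
  finally have "p (star (s x) * s y) = 0"
    using star_eq[of "star (s y) * s x"] by (simp only: star_mult star_star)
  then show ?thesis using orth_definite x y by blast
qed

end

section \<open>Spanning elements and the core\<close>

context normed_twisted_family
begin

abbreviation unit :: "'a \<times> 'a \<Rightarrow> 'r" where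
  "unit z \<equiv> s (fst z) * star (s (snd z))"

text \<open>Coefficients and index set are kept explicit because the elements \<open>unit z\<close>
  need not be linearly independent: averaging acts on such a presentation and not on the element
  that it presents.\<close>

definition lin :: "('a \<times> 'a \<Rightarrow> complex) \<Rightarrow> ('a \<times> 'a) set \<Rightarrow> 'r" where
  "lin k F = (\<Sum>z\<in>F. k z *\<^sub>C unit z)"

definition span :: "('a \<times> 'a) set \<Rightarrow> 'r set" where
  "span C = {lin k F |k F. finite F \<and> F \<subseteq> C}"

definition pairs :: "('a \<times> 'a) set" where
  "pairs = {(x, y). x \<in> arr \<Lambda> \<and> y \<in> arr \<Lambda> \<and> src \<Lambda> x = src \<Lambda> y}"

lemma lin_in_span [intro]: "finite F \<Longrightarrow> F \<subseteq> C \<Longrightarrow> lin k F \<in> span C"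
  by (auto simp: span_def)

lemma span_mono: "C \<subseteq> C' \<Longrightarrow> span C \<subseteq> span C'"
  by (auto simp: span_def)

lemma span_zero [simp]: "0 \<in> span C"
  using lin_in_span[of "{}" C] by (simp add: lin_def)

lemma span_unit: "z \<in> C \<Longrightarrow> t *\<^sub>C unit z \<in> span C"
  using lin_in_span[of "{z}" C "\<lambda>_. t"] by (simp add: lin_def)

lemma lin_extend: "finite G \<Longrightarrow> F \<subseteq> G \<Longrightarrow> lin k F = lin (\<lambda>z. if z \<in> F then k z else 0) G"
  unfolding lin_def by (rule sum.mono_neutral_cong_left) auto

lemma span_add: "a \<in> span C \<Longrightarrow> b \<in> span C \<Longrightarrow> a + b \<in> span C"
proof -
  assume "a \<in> span C" "b \<in> span C"
  then obtain k F k' F' where *: "a = lin k F" "b = lin k' F'" "finite F" "finite F'" "F \<subseteq> C" "F' \<subseteq> C"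
    by (auto simp: span_def)
  have "a + b = lin (\<lambda>z. (if z \<in> F then k z else 0) + (if z \<in> F' then k' z else 0)) (F \<union> F')"
    using lin_extend[of "F \<union> F'" F k] lin_extend[of "F \<union> F'" F' k'] *
    by (simp add: lin_def scaleC_add_left sum.distrib)
  then show ?thesis using * by auto
qed

lemma span_scale: "a \<in> span C \<Longrightarrow> t *\<^sub>C a \<in> span C"
proof -
  assume "a \<in> span C"
  then obtain k F where *: "a = lin k F" "finite F" "F \<subseteq> C" by (auto simp: span_def)
  then have "t *\<^sub>C a = lin (\<lambda>z. t * k z) F" by (simp add: lin_def scaleC_sum_right)
  then show ?thesis using * by auto
qed

lemma span_sum: "(\<And>i. i \<in> I \<Longrightarrow> f i \<in> span C) \<Longrightarrow> sum f I \<in> span C"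
  by (induct I rule: infinite_finite_induct) (auto intro: span_add)

lemma span_star: "a \<in> span C \<Longrightarrow> star a \<in> span (C\<inverse>)"
proof -
  assume "a \<in> span C"
  then obtain k F where *: "a = lin k F" "finite F" "F \<subseteq> C" by (auto simp: span_def)
  have "star a = (\<Sum>z\<in>F. cnj (k z) *\<^sub>C unit (snd z, fst z))"
    by (simp add: *(1) lin_def star_sum star_mult)
  also have "\<dots> \<in> span (C\<inverse>)"
    using *(3) by (intro span_sum span_unit) auto
  finally show ?thesis .
qed

lemma s_cmp:
  assumes "x \<in> arr \<Lambda>" "y \<in> arr \<Lambda>" "src \<Lambda> x = rng \<Lambda> y"
  shows "s (cmp \<Lambda> x y) = cnj (c x y) *\<^sub>C (s x * s y)"
  using assms by (simp add: s_mult c_cnj)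

text \<open>Split \<open>z\<close> into a path \<open>y\<close> of the degree of \<open>x\<close>
  and a path \<open>u\<close>. By \<open>range_orth\<close> either \<open>y = x\<close>, and
  \<open>s x\<close> cancels up to a phase, or the product is \<open>0\<close>, which is recorded as
  \<open>t = 0\<close>.\<close>

lemma star_s_mult_cases:
  assumes x: "x \<in> arr \<Lambda>" and z: "z \<in> arr \<Lambda>" "q \<in> carrier P" "degr \<Lambda> z = degr \<Lambda> x \<otimes>\<^bsub>P\<^esub> q"
  obtains t u where "u \<in> arr \<Lambda>" "src \<Lambda> u = src \<Lambda> z" "degr \<Lambda> u = q" "star (s x) * s z = t *\<^sub>C s u"
    "t \<noteq> 0 \<Longrightarrow> src \<Lambda> x = rng \<Lambda> u \<and> z = cmp \<Lambda> x u"
proof -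
  obtain y u where yu: "y \<in> arr \<Lambda>" "u \<in> arr \<Lambda>" "src \<Lambda> y = rng \<Lambda> u" "degr \<Lambda> y = degr \<Lambda> x" "degr \<Lambda> u = q"
    "z = cmp \<Lambda> y u"
    using factorE[OF z(1) deg_closed[OF x] z(2,3)] by metis
  have u: "src \<Lambda> u = src \<Lambda> z" using yu by (simp add: src_comp)
  have sz: "star (s x) * s z = cnj (c y u) *\<^sub>C (star (s x) * s y * s u)"
    using yu by (simp add: s_cmp mult.assoc)
  show ?thesis
  proof (cases "y = x")
    case True
    then have "star (s x) * s z = cnj (c y u) *\<^sub>C s u"
      using sz x yu s_rng[of u] by (simp add: star_s_s)
    then show ?thesis using that yu u True by blast
  next
    case False
    then have "star (s x) * s z = 0 *\<^sub>C s u"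
      using sz range_orth[OF x yu(1)] yu(4) by simp
    then show ?thesis using that yu u by blast
  qed
qed

text \<open>Insert the range vertex, written as its sum over a level whose degree is a multiple of
  both degrees. Their product serves as this multiple; a least one makes no sense in a torsion
  coordinate, where every degree divides every other.\<close>

lemma star_s_mult:
  assumes x: "x \<in> arr \<Lambda>" and y: "y \<in> arr \<Lambda>"
  shows "star (s x) * s y \<in> span {(u, w). (u, w) \<in> pairs \<and> src \<Lambda> x = rng \<Lambda> u \<and> src \<Lambda> y = rng \<Lambda> w \<and>
    cmp \<Lambda> x u = cmp \<Lambda> y w}" (is "_ \<in> span ?C")
proof (cases "rng \<Lambda> x = rng \<Lambda> y")
  case False
  then show ?thesis using star_s_orth_rng x y by simp
next
  case True
  define d where "d = degr \<Lambda> x \<otimes>\<^bsub>P\<^esub> degr \<Lambda> y"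
  have "star (s x) * s y = star (s x) * s (rng \<Lambda> x) * s y"
    using x by (simp add: star_s_rng)
  also have "\<dots> = (\<Sum>z\<in>level_at \<Lambda> (rng \<Lambda> x) d. (star (s x) * s z) * star (star (s y) * s z))"
    unfolding vertex_sum[OF rng_vertex[OF x], of d, unfolded d_def, OF m_closed[OF deg_closed[OF x] deg_closed[OF y]]] d_def
    by (simp add: sum_distrib_left sum_distrib_right star_mult mult.assoc)
  also have "\<dots> \<in> span ?C"
  proof (rule span_sum)
    fix z assume "z \<in> level_at \<Lambda> (rng \<Lambda> x) d"
    then have z: "z \<in> arr \<Lambda>" "degr \<Lambda> z = degr \<Lambda> x \<otimes>\<^bsub>P\<^esub> degr \<Lambda> y" "degr \<Lambda> z = degr \<Lambda> y \<otimes>\<^bsub>P\<^esub> degr \<Lambda> x"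
      using m_comm[OF deg_closed[OF x] deg_closed[OF y]] by (auto simp: level_at_def level_def d_def)
    obtain t u where tu: "u \<in> arr \<Lambda>" "src \<Lambda> u = src \<Lambda> z" "star (s x) * s z = t *\<^sub>C s u"
      "t \<noteq> 0 \<Longrightarrow> src \<Lambda> x = rng \<Lambda> u \<and> z = cmp \<Lambda> x u"
      using star_s_mult_cases[OF x z(1) deg_closed[OF y] z(2)] by metis
    obtain t' w where tw: "w \<in> arr \<Lambda>" "src \<Lambda> w = src \<Lambda> z" "star (s y) * s z = t' *\<^sub>C s w"
      "t' \<noteq> 0 \<Longrightarrow> src \<Lambda> y = rng \<Lambda> w \<and> z = cmp \<Lambda> y w"
      using star_s_mult_cases[OF y z(1) deg_closed[OF x] z(3)] by metis
    have eq: "star (s x) * s z * star (star (s y) * s z) = (t * cnj t') *\<^sub>C unit (u, w)"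
      by (simp add: tu(3) tw(3) mult.commute)
    show "star (s x) * s z * star (star (s y) * s z) \<in> span ?C"
    proof (cases "t = 0 \<or> t' = 0")
      case True
      then show ?thesis unfolding eq by auto
    next
      case False
      then show ?thesis unfolding eq using tu tw by (intro span_unit) (auto simp: pairs_def)
    qed
  qed
  finally show ?thesis .
qed

text \<open>The index sets are arbitrary because the same computation serves for all pairs, for a
  homogeneous component multiplied by its adjoint, and for elements of bounded degree. In each case
  only the effect on the indices has to be checked.\<close>

lemma span_mult:
  assumes C: "C1 \<subseteq> pairs" "C2 \<subseteq> pairs"
    and closed: "\<And>x y x' y' u w. \<lbrakk>(x, y) \<in> C1; (x', y') \<in> C2; (u, w) \<in> pairs; src \<Lambda> y = rng \<Lambda> u;
      src \<Lambda> x' = rng \<Lambda> w; cmp \<Lambda> y u = cmp \<Lambda> x' w\<rbrakk> \<Longrightarrow> (cmp \<Lambda> x u, cmp \<Lambda> y' w) \<in> C3"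
    and a: "a \<in> span C1" and b: "b \<in> span C2"
  shows "a * b \<in> span C3"
proof -
  have unit: "unit (x, y) * unit (x', y') \<in> span C3" if xy: "(x, y) \<in> C1" "(x', y') \<in> C2" for x y x' y'
  proof -
    have arr: "x \<in> arr \<Lambda>" "y \<in> arr \<Lambda>" "x' \<in> arr \<Lambda>" "y' \<in> arr \<Lambda>" "src \<Lambda> x = src \<Lambda> y" "src \<Lambda> x' = src \<Lambda> y'"
      using xy C by (auto simp: pairs_def)
    obtain k F where F: "star (s y) * s x' = lin k F" "finite F"
      "F \<subseteq> {(u, w). (u, w) \<in> pairs \<and> src \<Lambda> y = rng \<Lambda> u \<and> src \<Lambda> x' = rng \<Lambda> w \<and> cmp \<Lambda> y u = cmp \<Lambda> x' w}"
      using star_s_mult[OF arr(2,3)] unfolding span_def by auto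
    have "unit (x, y) * unit (x', y') = s x * (star (s y) * s x') * star (s y')"
      by (simp add: mult.assoc)
    also have "\<dots> = (\<Sum>z\<in>F. k z *\<^sub>C (s x * s (fst z) * star (s y' * s (snd z))))"
      unfolding F(1) by (simp add: lin_def sum_distrib_left sum_distrib_right star_mult mult.assoc)
    also have "\<dots> \<in> span C3"
    proof (rule span_sum)
      fix z assume "z \<in> F"
      then obtain u w where z: "z = (u, w)" "(u, w) \<in> pairs" "src \<Lambda> y = rng \<Lambda> u" "src \<Lambda> x' = rng \<Lambda> w"
        "cmp \<Lambda> y u = cmp \<Lambda> x' w" using F(3) by auto
      then have uw: "u \<in> arr \<Lambda>" "w \<in> arr \<Lambda>" by (auto simp: pairs_def)
      have "k z *\<^sub>C (s x * s (fst z) * star (s y' * s (snd z)))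
          = (k z * (c x u * cnj (c y' w))) *\<^sub>C unit (cmp \<Lambda> x u, cmp \<Lambda> y' w)"
        using z uw arr by (simp add: s_mult mult.commute)
      then show "k z *\<^sub>C (s x * s (fst z) * star (s y' * s (snd z))) \<in> span C3"
        using closed[OF xy z(2-5)] by (simp only: span_unit)
    qed
    finally show ?thesis .
  qed
  obtain k F k' F' where *: "a = lin k F" "b = lin k' F'" "F \<subseteq> C1" "F' \<subseteq> C2"
    using a b by (auto simp: span_def)
  have "a * b = (\<Sum>z\<in>F. \<Sum>z'\<in>F'. (k z * k' z') *\<^sub>C (unit z * unit z'))"
    by (simp add: * lin_def sum_product mult.assoc mult.commute)
  also have "\<dots> \<in> span C3"
  proof (intro span_sum)
    fix z z' assume "z \<in> F" "z' \<in> F'"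
    then show "(k z * k' z') *\<^sub>C (unit z * unit z') \<in> span C3"
      using unit[of "fst z" "snd z" "fst z'" "snd z'"] * by (intro span_scale) auto
  qed
  finally show ?thesis .
qed

lemma span_pairs_mult: "a \<in> span pairs \<Longrightarrow> b \<in> span pairs \<Longrightarrow> a * b \<in> span pairs"
  by (rule span_mult[of pairs pairs]) (auto simp: pairs_def comp_closed src_comp)

lemma s_in_span: "x \<in> arr \<Lambda> \<Longrightarrow> s x \<in> span pairs"
  using span_unit[of "(x, src \<Lambda> x)" pairs 1] s_src[of x]
  by (simp add: pairs_def src_closed src_ident star_vertex src_vertex)

lemma free_value_in_span:
  assumes "f \<in> carrier (free_star_alg (arr \<Lambda>))"
  shows "free_value s f \<in> span pairs"
proof -
  have star: "star (s x) \<in> span pairs" if "x \<in> arr \<Lambda>" for x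
  proof -
    have "pairs\<inverse> = pairs" by (auto simp: pairs_def)
    then show ?thesis using span_star[OF s_in_span[OF that]] by simp
  qed
  have letter: "(if b then star (s x) else s x) \<in> span pairs" if "x \<in> arr \<Lambda>" for x b
    using star s_in_span that by simp
  have "word_value s w \<in> span pairs" if "w \<in> words (arr \<Lambda>)" for w
    using that
  proof (induct w)
    case (Cons l w)
    note IH = Cons(1)
    obtain x b where l: "l = (x, b)" by (cases l)
    then have x: "x \<in> arr \<Lambda>" using Cons(2) by (simp add: words_def)
    show ?case
    proof (cases w)
      case Nil
      then show ?thesis using letter[OF x, of b] by (simp add: l)
    next
      case (Cons l' w')
      then have "w \<in> words (arr \<Lambda>)" using \<open>l # w \<in> words (arr \<Lambda>)\<close> by (simp add: words_def)
      then have "(if b then star (s x) else s x) * word_value s w \<in> span pairs"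
        using IH letter[OF x] by (intro span_pairs_mult)
      then show ?thesis using Cons by (cases l') (simp add: l)
    qed
  qed simp
  then show ?thesis
    using assms unfolding free_value_def by (intro span_sum span_scale) auto
qed

lemma degree_bound:
  assumes "finite F" "F \<subseteq> arr \<Lambda>"
  shows "\<exists>d\<in>carrier P. \<forall>x\<in>F. \<exists>r\<in>carrier P. d = degr \<Lambda> x \<otimes>\<^bsub>P\<^esub> r"
  using assms
proof (induct F rule: finite_induct)
  case (insert x F)
  then obtain d where d: "d \<in> carrier P" "\<forall>x\<in>F. \<exists>r\<in>carrier P. d = degr \<Lambda> x \<otimes>\<^bsub>P\<^esub> r" by auto
  have x: "degr \<Lambda> x \<in> carrier P" using insert by (simp add: deg_closed)
  have "\<exists>r\<in>carrier P. degr \<Lambda> x \<otimes>\<^bsub>P\<^esub> d = degr \<Lambda> y \<otimes>\<^bsub>P\<^esub> r" if y: "y \<in> F" for y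
  proof -
    obtain r where r: "r \<in> carrier P" "d = degr \<Lambda> y \<otimes>\<^bsub>P\<^esub> r" using d y by auto
    have "degr \<Lambda> y \<in> carrier P" using insert y by (auto simp: deg_closed)
    then have "degr \<Lambda> x \<otimes>\<^bsub>P\<^esub> d = degr \<Lambda> y \<otimes>\<^bsub>P\<^esub> (degr \<Lambda> x \<otimes>\<^bsub>P\<^esub> r)"
      using r x by (simp add: m_lcomm)
    then show ?thesis using r x m_closed by blast
  qed
  then show ?case using d x m_closed by (intro bexI[of _ "degr \<Lambda> x \<otimes>\<^bsub>P\<^esub> d"]) auto
qed auto

definition core_pairs :: "('a \<times> 'a) set" where
  "core_pairs = {(x, y) \<in> pairs. degr \<Lambda> x = degr \<Lambda> y}"

text \<open>An element of the core lies, for a large degree \<open>d\<close>, in a finite matrix algebra whose matrix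
  units are the \<open>s x star (s y)\<close> with \<open>x\<close>, \<open>y\<close> in a finite set of paths of degree \<open>d\<close>.  There two C*-seminorms
  differ at most by a factor, and this factor does not change along powers.\<close>

lemma core_le:
  assumes q: "cstar_seminormed q" and vertex: "\<And>v. v \<in> vertices P \<Lambda> \<Longrightarrow> p (s v) \<le> q (s v)"
    and a: "a \<in> span core_pairs"
  shows "p a \<le> q a"
proof -
  interpret q: cstar_seminormed q by fact
  obtain k F where F: "a = lin k F" "finite F" "F \<subseteq> core_pairs"
    using a by (auto simp: span_def)
  have F_arr: "x \<in> arr \<Lambda>" "y \<in> arr \<Lambda>" "degr \<Lambda> x = degr \<Lambda> y" if "(x, y) \<in> F" for x y
    using that F(3) by (auto simp: core_pairs_def pairs_def)
  have "finite (fst ` F)" "fst ` F \<subseteq> arr \<Lambda>" using F(2) F_arr by auto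
  from degree_bound[OF this] obtain d where d: "d \<in> carrier P"
    "\<forall>z\<in>F. \<exists>r\<in>carrier P. d = degr \<Lambda> (fst z) \<otimes>\<^bsub>P\<^esub> r" by auto
  define V where "V = rng \<Lambda> ` (fst ` F \<union> snd ` F)"
  have V: "finite V" "V \<subseteq> vertices P \<Lambda>" using F(2) F_arr rng_vertex by (auto simp: V_def)
  define J where "J = (\<Union>v\<in>V. level_at \<Lambda> v d)"
  have J: "finite J" "\<And>x. x \<in> J \<Longrightarrow> x \<in> arr \<Lambda> \<and> degr \<Lambda> x = d"
    using V finite_level_at d(1) by (auto simp: J_def level_at_def level_def)
  have orth: "star (s x) * s y = (if x = y then s (src \<Lambda> x) else 0)" if "x \<in> J" "y \<in> J" for x y
    using that J(2) range_orth[of x y] by (auto simp: star_s_s)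
  \<comment> \<open>This element is computed twice: over \<open>J\<close> it is the sum of the
    diagonal matrix units, and over the vertices in \<open>V\<close> it is seen to act as a unit on
    all paths with range in \<open>V\<close>.\<close>
  define e where "e = (\<Sum>x\<in>J. unit (x, x))"
  have "e = (\<Sum>v\<in>V. \<Sum>x\<in>level_at \<Lambda> v d. unit (x, x))"
    unfolding e_def J_def using V finite_level_at d(1)
    by (intro sum.UNION_disjoint) (auto simp: level_at_def)
  also have "\<dots> = (\<Sum>v\<in>V. s v)"
    using V d(1) by (intro sum.cong refl) (auto simp: vertex_sum[of _ d])
  finally have e_V: "e = (\<Sum>v\<in>V. s v)" .
  have e_s: "e * s x = s x" if "x \<in> arr \<Lambda>" "rng \<Lambda> x \<in> V" for x
  proof -
    have "s v * s x = (if v = rng \<Lambda> x then s x else 0)" if "v \<in> V" for v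
    proof -
      have "s v * s x = s v * s (rng \<Lambda> x) * s x" using \<open>x \<in> arr \<Lambda>\<close> by (simp add: mult.assoc s_rng)
      then show ?thesis using that V \<open>x \<in> arr \<Lambda>\<close> by (auto simp: vertex_orth rng_vertex s_rng)
    qed
    then have "e * s x = (\<Sum>v\<in>V. if v = rng \<Lambda> x then s x else 0)"
      unfolding e_V sum_distrib_right by (intro sum.cong) auto
    then show ?thesis using that V(1) by simp
  qed
  have star_e: "star e = e"
    unfolding e_V star_sum using V star_vertex by (intro sum.cong) auto
  have s_e: "star (s x) * e = star (s x)" if "x \<in> arr \<Lambda>" "rng \<Lambda> x \<in> V" for x
    using e_s[OF that] star_mult[of e "s x"] by (simp add: star_e)
  \<comment> \<open>\<open>good y\<close> describes membership in the matrix algebra through the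
    entries \<open>star (s x) * y * s x'\<close> rather than through an expansion. In this form it
    passes to adjoints and products, hence to all powers.\<close>
  define good where "good y \<longleftrightarrow> e * y = y \<and> y * e = y \<and>
    (\<forall>x\<in>J. \<forall>x'\<in>J. \<exists>t. star (s x) * y * s x' = t *\<^sub>C s (src \<Lambda> x))" for y
  have good_star: "good (star y)" if "good y" for y
    unfolding good_def
  proof (intro conjI ballI)
    show "e * star y = star y" "star y * e = star y"
      using \<open>good y\<close> star_mult[of y e] star_mult[of e y] by (simp_all add: good_def star_e)
    fix x x' assume x: "x \<in> J" "x' \<in> J"
    then obtain t where t: "star (s x') * y * s x = t *\<^sub>C s (src \<Lambda> x')" using \<open>good y\<close> by (auto simp: good_def)
    have arr: "x \<in> arr \<Lambda>" "x' \<in> arr \<Lambda>" using x J by auto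
    have "star (s x) * star y * s x' = star (star (s x') * y * s x)" by (simp add: star_mult mult.assoc)
    also have "\<dots> = cnj t *\<^sub>C s (src \<Lambda> x')" using arr by (simp add: t star_vertex src_vertex)
    finally have 1: "star (s x) * star y * s x' = cnj t *\<^sub>C s (src \<Lambda> x')" .
    \<comment> \<open>The entry is a multiple of \<open>s\<close> at the source of \<open>x'\<close>
      and is fixed by \<open>s\<close> at the source of \<open>x\<close>, so it vanishes unless the
      sources agree.\<close>
    have "star (s x) * star y * s x' = s (src \<Lambda> x) * (star (s x) * star y * s x')"
      using arr by (simp add: s_src_star' mult.assoc)
    then have 2: "star (s x) * star y * s x' = cnj t *\<^sub>C (s (src \<Lambda> x) * s (src \<Lambda> x'))" by (simp add: 1)
    show "\<exists>t. star (s x) * star y * s x' = t *\<^sub>C s (src \<Lambda> x)"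
    proof (cases "src \<Lambda> x = src \<Lambda> x'")
      case True
      then show ?thesis using 1 by auto
    next
      case False
      then have "star (s x) * star y * s x' = 0 *\<^sub>C s (src \<Lambda> x)"
        using 2 arr by (simp add: vertex_orth src_vertex)
      then show ?thesis by blast
    qed
  qed
  have good_mult: "good (y * y')" if y: "good y" "good y'" for y y'
    unfolding good_def
  proof (intro conjI ballI)
    show "e * (y * y') = y * y'" "y * y' * e = y * y'"
      using y by (simp_all add: good_def mult.assoc) (simp flip: mult.assoc)
    fix x x' assume x: "x \<in> J" "x' \<in> J"
    obtain T where T: "\<And>z. z \<in> J \<Longrightarrow> star (s x) * y * s z = T z *\<^sub>C s (src \<Lambda> x)"
      using y(1) x unfolding good_def by metis
    obtain T' where T': "\<And>z. z \<in> J \<Longrightarrow> star (s z) * y' * s x' = T' z *\<^sub>C s (src \<Lambda> z)"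
    proof -
      have "\<forall>z\<in>J. \<exists>t. star (s z) * y' * s x' = t *\<^sub>C s (src \<Lambda> z)"
        using y(2) x(2) unfolding good_def by blast
      then show thesis using that by metis
    qed
    have "y * y' = y * e * y'" using y by (simp add: good_def)
    then have "star (s x) * (y * y') * s x' = (\<Sum>z\<in>J. (star (s x) * y * s z) * (star (s z) * y' * s x'))"
      by (simp add: e_def sum_distrib_left sum_distrib_right mult.assoc)
    also have "\<dots> = (\<Sum>z\<in>J. (if src \<Lambda> x = src \<Lambda> z then T z * T' z else 0) *\<^sub>C s (src \<Lambda> x))"
      using x J(2) by (intro sum.cong refl)
        (auto simp: T T' mult.commute vertex_orth vertex_idem src_vertex)
    finally show "\<exists>t. star (s x) * (y * y') * s x' = t *\<^sub>C s (src \<Lambda> x)"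
      unfolding scaleC_sum_left[symmetric] by blast
  qed
  have "good a"
    unfolding good_def
  proof (intro conjI ballI)
    have "e * unit z = unit z" "unit z * e = unit z" if "z \<in> F" for z
      using e_s[of "fst z"] s_e[of "snd z"] that F_arr[of "fst z" "snd z"] 
      by (auto simp: V_def mult.assoc[symmetric]) (auto simp: mult.assoc)
    then show "e * a = a" "a * e = a"
      by (simp_all add: F(1) lin_def sum_distrib_left sum_distrib_right)
    fix x x' assume x: "x \<in> J" "x' \<in> J"
    have "\<exists>t. star (s x) * unit z * s x' = t *\<^sub>C s (src \<Lambda> x)" if z: "z \<in> F" for z
    proof -
      obtain y y' where yy: "z = (y, y')" "y \<in> arr \<Lambda>" "y' \<in> arr \<Lambda>" "degr \<Lambda> y = degr \<Lambda> y'"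
        using F_arr z by (cases z) auto
      obtain r where r: "r \<in> carrier P" "d = degr \<Lambda> y \<otimes>\<^bsub>P\<^esub> r" using d(2) z yy by auto
      obtain t u where tu: "u \<in> arr \<Lambda>" "src \<Lambda> u = src \<Lambda> x" "degr \<Lambda> u = r" "star (s y) * s x = t *\<^sub>C s u"
        using star_s_mult_cases[OF yy(2), of x r] J(2)[OF x(1)] r by metis
      obtain t' u' where tu': "u' \<in> arr \<Lambda>" "degr \<Lambda> u' = r" "star (s y') * s x' = t' *\<^sub>C s u'"
        using star_s_mult_cases[OF yy(3), of x' r] J(2)[OF x(2)] r yy(4) by metis
      have "star (s x) * unit z * s x' = star (star (s y) * s x) * (star (s y') * s x')"
        by (simp add: yy(1) star_mult mult.assoc)
      also have "\<dots> = (cnj t * t') *\<^sub>C (star (s u) * s u')" by (simp add: tu(4) tu'(3) mult.commute)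
      \<comment> \<open>\<open>y\<close> and \<open>y'\<close> have equal degree, so
        \<open>u\<close> and \<open>u'\<close> both have degree \<open>r\<close> and
        \<open>range_orth\<close> applies to them.\<close>
      also have "star (s u) * s u' = (if u = u' then 1 else 0) *\<^sub>C s (src \<Lambda> x)"
        using tu tu' range_orth[of u u'] by (auto simp: star_s_s)
      finally show ?thesis unfolding scaleC_scaleC by blast
    qed
    then obtain T where T: "\<And>z. z \<in> F \<Longrightarrow> star (s x) * unit z * s x' = T z *\<^sub>C s (src \<Lambda> x)" by metis
    have "star (s x) * a * s x' = (\<Sum>z\<in>F. k z *\<^sub>C (star (s x) * unit z * s x'))"
      by (simp add: F(1) lin_def sum_distrib_left sum_distrib_right)
    also have "\<dots> = (\<Sum>z\<in>F. k z * T z) *\<^sub>C s (src \<Lambda> x)"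
      unfolding scaleC_sum_left by (intro sum.cong) (simp_all add: T)
    finally show "\<exists>t. star (s x) * a * s x' = t *\<^sub>C s (src \<Lambda> x)" by blast
  qed
  have bound: "p y \<le> (real (card J))\<^sup>2 * q y" if "good y" for y
  proof -
    have ps: "p (s x) \<le> 1" "q (s x) \<le> 1" if "x \<in> arr \<Lambda>" for x
    proof -
      have "(p (s x))\<^sup>2 \<le> 1" "(q (s x))\<^sup>2 \<le> 1"
        using that by (simp_all add: star_s_s norm_vertex src_vertex q.projection_le_one star_vertex
            vertex_idem flip: cstar q.cstar)
      then show "p (s x) \<le> 1" "q (s x) \<le> 1" by (simp_all add: abs_square_le_1)
    qed
    have "y = e * y * e" using \<open>good y\<close> by (simp add: good_def)
    also have "\<dots> = (\<Sum>x\<in>J. \<Sum>x'\<in>J. s x * (star (s x) * y * s x') * star (s x'))"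
      unfolding e_def by (subst sum.swap) (simp add: sum_distrib_left sum_distrib_right mult.assoc)
    finally have "p y = p (\<Sum>x\<in>J. \<Sum>x'\<in>J. s x * (star (s x) * y * s x') * star (s x'))"
      by (rule arg_cong)
    also have "\<dots> \<le> (\<Sum>x\<in>J. p (\<Sum>x'\<in>J. s x * (star (s x) * y * s x') * star (s x')))"
      by (rule sum_le)
    also have "\<dots> \<le> (\<Sum>x\<in>J. \<Sum>x'\<in>J. p (s x * (star (s x) * y * s x') * star (s x')))"
      by (intro sum_mono sum_le)
    also have "\<dots> \<le> (\<Sum>x\<in>J. \<Sum>x'\<in>J. q y)"
    proof (intro sum_mono)
      fix x x' assume x: "x \<in> J" "x' \<in> J"
      then have arr: "x \<in> arr \<Lambda>" "x' \<in> arr \<Lambda>" using J by auto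
      obtain t where t: "star (s x) * y * s x' = t *\<^sub>C s (src \<Lambda> x)"
        using \<open>good y\<close> x by (auto simp: good_def)
      have "p (s x * (star (s x) * y * s x') * star (s x')) \<le> p (s x) * p (star (s x) * y * s x') * p (star (s x'))"
        by (meson mult_right_mono nonneg order_trans submult)
      also have "\<dots> \<le> 1 * p (star (s x) * y * s x') * 1"
        using ps arr by (intro mult_mono) auto
      also have "\<dots> \<le> q (star (s x) * y * s x')"
        unfolding t using vertex[OF src_vertex[OF arr(1)]] by (simp add: mult_left_mono)
      also have "\<dots> \<le> q (star (s x)) * q y * q (s x')"
        by (meson mult_right_mono q.nonneg order_trans q.submult)
      also have "\<dots> \<le> 1 * q y * 1"
        using ps arr by (intro mult_mono) auto
      finally show "p (s x * (star (s x) * y * s x') * star (s x')) \<le> q y" by simp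
    qed
    finally show ?thesis by (simp add: power2_eq_square)
  qed
  have "good (square_power a n)" for n
    by (induct n) (auto intro: good_mult good_star \<open>good a\<close>)
  then have "p (square_power a n) \<le> (real (card J))\<^sup>2 * 2 ^ n * q (square_power a n)" for n
  proof -
    have "p (square_power a n) \<le> (real (card J))\<^sup>2 * 1 * q (square_power a n)"
      using bound[OF \<open>good (square_power a n)\<close>] by simp
    also have "\<dots> \<le> (real (card J))\<^sup>2 * 2 ^ n * q (square_power a n)"
      by (intro mult_right_mono mult_left_mono) auto
    finally show ?thesis .
  qed
  then show ?thesis using power_trick[OF cstar_seminormed_axioms q] by blast
qed

end

section \<open>Averaging over roots of unity, one degree coordinate at a time\<close>

lemma sum_roots_of_unity_power:
  fixes M :: nat and t :: int
  assumes M: "M > 0"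
  shows "(\<Sum>j<M. (cis (2 * pi / M) ^ j) powi t) = (if int M dvd t then of_nat M else 0)"
proof -
  define \<zeta> where "\<zeta> = cis (2 * pi / M)"
  have pow: "\<zeta> ^ n = cis (2 * pi * n / M)" for n :: nat
    by (simp add: \<zeta>_def DeMoivre mult.commute)
  have nz: "\<zeta> \<noteq> 0" by (simp add: \<zeta>_def)
  have one: "\<zeta> ^ M = 1" using M by (simp add: pow)
  define z where "z = \<zeta> powi t"
  have zj: "(\<zeta> ^ j) powi t = z ^ j" for j :: nat
    unfolding z_def by (simp flip: power_int_of_nat power_int_mult add: mult.commute)
  have zM: "z ^ M = 1" using zj[of M] by (simp add: one)
  have z1: "z = 1 \<longleftrightarrow> int M dvd t"
  proof
    assume "int M dvd t"
    then obtain k where "t = int M * k" by auto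
    then show "z = 1" by (simp add: z_def power_int_mult one)
  next
    assume "z = 1"
    define r where "r = nat (t mod int M)"
    have t: "t = int M * (t div int M) + int r" using M by (simp add: r_def)
    have "z = \<zeta> ^ r"
      unfolding z_def using nz by (subst t) (simp add: power_int_add power_int_mult one)
    then have "cis (2 * pi * r / M) = cis (2 * pi * 0 / M)" using \<open>z = 1\<close> by (simp add: pow)
    moreover have "r < M" using M by (simp add: r_def nat_less_iff)
    ultimately have "r = 0"
      using bij_betw_roots_unity[OF M] M by (auto simp: bij_betw_def inj_on_def)
    then show "int M dvd t" using t by (metis add.right_neutral dvd_triv_left of_nat_0)
  qed
  have "(\<Sum>j<M. z ^ j) = (if int M dvd t then of_nat M else 0)"
  proof (cases "z = 1")
    case False
    then show ?thesis using z1 zM by (simp add: geometric_sum)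
  qed (use z1 in simp)
  then show ?thesis unfolding \<zeta>_def[symmetric] zj .
qed

lemma cong_diff_bound:
  fixes a b :: int
  assumes "[a = b] (mod int M)" "2 * \<bar>a\<bar> < int M" "2 * \<bar>b\<bar> < int M"
  shows "a = b"
proof -
  have "int M dvd a - b" using assms(1) by (simp add: cong_iff_dvd_diff)
  moreover have "\<bar>a - b\<bar> < int M" using assms(2,3) by linarith
  ultimately show ?thesis using dvd_imp_le_int[of "a - b" "int M"] by fastforce
qed

context normed_twisted_family
begin

text \<open>For \<open>m = 0\<close> congruence is equality, so \<open>(h, 0)\<close> is an unreduced coordinate.\<close>

definition coordinate :: "('a \<Rightarrow> int) \<times> nat \<Rightarrow> bool" where
  "coordinate = (\<lambda>(h, m). \<forall>x\<in>arr \<Lambda>. \<forall>y\<in>arr \<Lambda>. src \<Lambda> x = rng \<Lambda> y \<longrightarrow>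
     [h (cmp \<Lambda> x y) = h x + h y] (mod int m))"

text \<open>The parameters \<open>\<omega>\<close> allowed for the coordinate \<open>(h, m)\<close>
  form its dual group: the whole circle for \<open>m = 0\<close>, and the \<open>m\<close>-th roots
  of unity otherwise.\<close>

definition gauge_invariant :: "('r \<Rightarrow> real) \<Rightarrow> ('a \<Rightarrow> int) \<times> nat \<Rightarrow> bool" where
  "gauge_invariant q = (\<lambda>(h, m). \<forall>\<omega> k F. cmod \<omega> = 1 \<longrightarrow> (m \<noteq> 0 \<longrightarrow> \<omega> ^ m = 1) \<longrightarrow> finite F \<longrightarrow> F \<subseteq> pairs \<longrightarrow>
     q (lin (\<lambda>z. \<omega> powi (h (fst z) - h (snd z)) * k z) F) \<le> q (lin k F))"

text \<open>Indices of the fixed-point algebra for the gauge actions of the listed coordinates: all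
  pairs for the empty list, and pairs of the core once the coordinates separate degrees.\<close>

definition agree :: "(('a \<Rightarrow> int) \<times> nat) list \<Rightarrow> ('a \<times> 'a) set" where
  "agree hs = {(x, y) \<in> pairs. \<forall>(h, m)\<in>set hs. [h x = h y] (mod int m)}"

lemma agree_pairs: "agree hs \<subseteq> pairs"
  by (auto simp: agree_def)

lemma agree_sym: "(x, y) \<in> agree hs \<Longrightarrow> (y, x) \<in> agree hs"
  by (auto simp: agree_def pairs_def cong_sym_eq)

lemma coordinate_mult:
  assumes hm: "coordinate (h, m)" and arr: "(x, y) \<in> pairs" "(x', y') \<in> pairs" "(u, w) \<in> pairs"
    and uw: "src \<Lambda> y = rng \<Lambda> u" "src \<Lambda> x' = rng \<Lambda> w" "cmp \<Lambda> y u = cmp \<Lambda> x' w"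
  shows "[h (cmp \<Lambda> x u) - h (cmp \<Lambda> y' w) = (h x - h y) + (h x' - h y')] (mod int m)"
proof -
  have hom: "[h (cmp \<Lambda> a b) = h a + h b] (mod int m)" if "a \<in> arr \<Lambda>" "b \<in> arr \<Lambda>" "src \<Lambda> a = rng \<Lambda> b" for a b
    using hm that by (simp add: coordinate_def)
  have arr': "x \<in> arr \<Lambda>" "y \<in> arr \<Lambda>" "x' \<in> arr \<Lambda>" "y' \<in> arr \<Lambda>" "u \<in> arr \<Lambda>" "w \<in> arr \<Lambda>"
    "src \<Lambda> x = rng \<Lambda> u" "src \<Lambda> y' = rng \<Lambda> w"
    using arr uw by (auto simp: pairs_def)
  have "[h y + h u = h x' + h w] (mod int m)"
    using hom[of y u] hom[of x' w] arr' uw by (metis cong_sym cong_trans)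
  then have "[h x + h u - (h y' + h w) = (h x - h y) + (h x' - h y')] (mod int m)"
    by (simp add: cong_iff_dvd_diff algebra_simps)
  then show ?thesis
    using hom[of x u] hom[of y' w] arr' by (meson cong_diff cong_trans)
qed

lemma agree_mult:
  assumes hs: "\<forall>c\<in>set hs. coordinate c" and "(x, y) \<in> agree hs" "(x', y') \<in> agree hs"
    and uw: "(u, w) \<in> pairs" "src \<Lambda> y = rng \<Lambda> u" "src \<Lambda> x' = rng \<Lambda> w" "cmp \<Lambda> y u = cmp \<Lambda> x' w"
  shows "(cmp \<Lambda> x u, cmp \<Lambda> y' w) \<in> agree hs"
proof -
  have xy: "(x, y) \<in> pairs" "(x', y') \<in> pairs" using assms agree_pairs by auto
  have "[h (cmp \<Lambda> x u) = h (cmp \<Lambda> y' w)] (mod int m)" if hm: "(h, m) \<in> set hs" for h m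
  proof -
    have "[h x = h y] (mod int m)" "[h x' = h y'] (mod int m)" using assms(2,3) hm by (auto simp: agree_def)
    then have "[(h x - h y) + (h x' - h y') = 0] (mod int m)"
      by (simp add: cong_iff_dvd_diff)
    then have "[h (cmp \<Lambda> x u) - h (cmp \<Lambda> y' w) = 0] (mod int m)"
      using coordinate_mult[OF bspec[OF hs hm] xy uw] cong_trans by blast
    then show ?thesis by (simp add: cong_iff_dvd_diff)
  qed
  moreover have "(cmp \<Lambda> x u, cmp \<Lambda> y' w) \<in> pairs"
    using xy uw by (auto simp: pairs_def comp_closed src_comp)
  ultimately show ?thesis by (auto simp: agree_def)
qed

text \<open>Finite Fourier inversion: \<open>\<omega> powi (- n)\<close> times the gauge action of
  \<open>\<omega>\<close>, averaged over the \<open>M\<close>-th roots of unity, leaves the terms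
  with degree difference \<open>n\<close> modulo \<open>M\<close>. If \<open>m \<noteq> 0\<close>,
  only \<open>m\<close>-th roots act, and \<open>M\<close> has to be \<open>m\<close>.\<close>

lemma component_le:
  assumes q: "cstar_seminormed q" and inv: "gauge_invariant q (h, m)"
    and F: "finite F" "F \<subseteq> pairs" and M: "M > 0" "m = 0 \<or> m = M"
  shows "q (lin k {z \<in> F. [h (fst z) - h (snd z) = n] (mod int M)}) \<le> q (lin k F)"
proof -
  interpret q: cstar_seminormed q by fact
  define D where "D z = h (fst z) - h (snd z)" for z
  define \<omega> where "\<omega> j = cis (2 * pi / M) ^ j" for j :: nat
  have "\<omega> j ^ M = cis (2 * pi * real j)" for j
    using M by (simp add: \<omega>_def DeMoivre mult.commute flip: power_mult)
  then have \<omega>: "cmod (\<omega> j) = 1" "\<omega> j \<noteq> 0" "m \<noteq> 0 \<Longrightarrow> \<omega> j ^ m = 1" for j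
    using M(2) by (auto simp: \<omega>_def norm_power)
  have "of_nat M *\<^sub>C lin k {z \<in> F. [D z = n] (mod int M)} =
      (\<Sum>j<M. \<omega> j powi (- n) *\<^sub>C lin (\<lambda>z. \<omega> j powi D z * k z) F)"
  proof -
    have "(\<Sum>j<M. \<omega> j powi (- n) *\<^sub>C lin (\<lambda>z. \<omega> j powi D z * k z) F)
        = (\<Sum>z\<in>F. \<Sum>j<M. (\<omega> j powi (D z - n) * k z) *\<^sub>C unit z)"
      unfolding lin_def scaleC_sum_right
      by (subst sum.swap) (simp add: power_int_diff power_int_minus \<omega>(2) divide_inverse mult.commute mult.left_commute)
    also have "\<dots> = (\<Sum>z\<in>F. if [D z = n] (mod int M) then of_nat M *\<^sub>C k z *\<^sub>C unit z else 0)"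
    proof (intro sum.cong refl)
      fix z
      have "(\<Sum>j<M. (\<omega> j powi (D z - n) * k z) *\<^sub>C unit z) = ((\<Sum>j<M. \<omega> j powi (D z - n)) * k z) *\<^sub>C unit z"
        by (simp add: scaleC_sum_left sum_distrib_right)
      then show "(\<Sum>j<M. (\<omega> j powi (D z - n) * k z) *\<^sub>C unit z) =
          (if [D z = n] (mod int M) then of_nat M *\<^sub>C k z *\<^sub>C unit z else 0)"
        unfolding \<omega>_def sum_roots_of_unity_power[OF M(1)] by (simp add: cong_iff_dvd_diff)
    qed
    also have "\<dots> = of_nat M *\<^sub>C lin k {z \<in> F. [D z = n] (mod int M)}"
      unfolding lin_def scaleC_sum_right using F(1) by (intro sum.mono_neutral_cong_right) auto
    finally show ?thesis ..
  qed
  from arg_cong[OF this, of q]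
  have "M * q (lin k {z \<in> F. [D z = n] (mod int M)}) = q (\<Sum>j<M. \<omega> j powi (- n) *\<^sub>C lin (\<lambda>z. \<omega> j powi D z * k z) F)"
    by simp
  also have "\<dots> \<le> (\<Sum>j<M. q (\<omega> j powi (- n) *\<^sub>C lin (\<lambda>z. \<omega> j powi D z * k z) F))"
    by (rule q.sum_le)
  also have "\<dots> \<le> (\<Sum>j<M. q (lin k F))"
    using inv \<omega> F unfolding gauge_invariant_def D_def by (intro sum_mono) (simp add: norm_power_int)
  finally show ?thesis using M(1) by (simp add: D_def)
qed

lemma component_sum:
  assumes F: "finite F" and M: "M > 0"
  shows "lin k F = (\<Sum>n<M. lin k {z \<in> F. [D z = int n] (mod int M)})"
proof -
  have "(\<Sum>n<M. lin k {z \<in> F. [D z = int n] (mod int M)})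
      = (\<Sum>n<M. \<Sum>z\<in>F. if [D z = int n] (mod int M) then k z *\<^sub>C unit z else 0)"
    unfolding lin_def using F by (intro sum.cong refl sum.mono_neutral_cong_left) auto
  also have "\<dots> = (\<Sum>z\<in>F. \<Sum>n<M. if n = nat (D z mod int M) then k z *\<^sub>C unit z else 0)"
  proof (subst sum.swap, intro sum.cong refl)
    fix z n assume "n \<in> {..<M}"
    then have "[D z = int n] (mod int M) \<longleftrightarrow> n = nat (D z mod int M)"
      using M by (auto simp: cong_def nat_eq_iff)
    then show "(if [D z = int n] (mod int M) then k z *\<^sub>C unit z else 0)
      = (if n = nat (D z mod int M) then k z *\<^sub>C unit z else 0)" by simp
  qed
  also have "\<dots> = lin k F"
    unfolding lin_def using M by (intro sum.cong refl) (simp add: nat_less_iff)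
  finally show ?thesis ..
qed

text \<open>For a homogeneous component \<open>g\<close> the product \<open>star g * g\<close> lies
  in the span where \<open>h\<close> agrees as well, so \<open>IH\<close> reaches \<open>g\<close>
  through the C*-identity. There are \<open>M\<close> components, whence the factor.\<close>

lemma coordinate_bound:
  assumes q: "cstar_seminormed q" and hs: "\<forall>c\<in>set ((h, m) # hs). coordinate c"
    and inv: "gauge_invariant q (h, m)"
    and IH: "\<And>a. a \<in> span (agree ((h, m) # hs)) \<Longrightarrow> p a \<le> q a"
    and F: "finite F" "F \<subseteq> agree hs" and M: "M > 0"
      "m = M \<or> m = 0 \<and> (\<forall>z\<in>F. 2 * \<bar>h (fst z) - h (snd z)\<bar> < int M)"
  shows "p (lin k F) \<le> M * q (lin k F)"
proof -
  interpret q: cstar_seminormed q by fact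
  define D where "D z = h (fst z) - h (snd z)" for z
  define G where "G n = {z \<in> F. [D z = int n] (mod int M)}" for n :: nat
  have pairs: "F \<subseteq> pairs" using F agree_pairs by blast
  have "p (lin k (G n)) \<le> q (lin k F)" for n
  proof -
    have G: "finite (G n)" "G n \<subseteq> F" "G n \<subseteq> pairs" using F pairs by (auto simp: G_def)
    have "star (lin k (G n)) * lin k (G n) \<in> span (agree ((h, m) # hs))"
    proof (rule span_mult[of "(G n)\<inverse>" "G n"])
      show "(G n)\<inverse> \<subseteq> pairs" "G n \<subseteq> pairs" using G by (auto simp: pairs_def)
      show "star (lin k (G n)) \<in> span ((G n)\<inverse>)" "lin k (G n) \<in> span (G n)"
        using G by (auto intro: span_star)
      fix x y x' y' u w
      assume xy: "(x, y) \<in> (G n)\<inverse>" "(x', y') \<in> G n"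
        and uw: "(u, w) \<in> pairs" "src \<Lambda> y = rng \<Lambda> u" "src \<Lambda> x' = rng \<Lambda> w" "cmp \<Lambda> y u = cmp \<Lambda> x' w"
      have F': "(y, x) \<in> F" "(x', y') \<in> F" "[D (y, x) = int n] (mod int M)" "[D (x', y') = int n] (mod int M)"
        using xy by (auto simp: G_def)
      have ag: "(x, y) \<in> agree hs" "(x', y') \<in> agree hs"
        using F F' agree_sym by auto
      have prs: "(x, y) \<in> pairs" "(x', y') \<in> pairs" using ag agree_pairs by auto
      have "[D (x', y') = D (y, x)] (mod int M)" using F'(3,4) cong_sym cong_trans by blast
      \<comment> \<open>For \<open>m = 0\<close> components are separated modulo \<open>M\<close>
        only; the bound on the differences prevents distinct ones from sharing a residue.\<close>
      then have "[D (x', y') = D (y, x)] (mod int m)"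
        using M(2) cong_diff_bound[of "D (x', y')" "D (y, x)" M] F'(1,2) by (fastforce simp: D_def)
      then have "[(h x - h y) + (h x' - h y') = 0] (mod int m)"
        by (simp add: D_def cong_iff_dvd_diff algebra_simps)
      then have "[h (cmp \<Lambda> x u) - h (cmp \<Lambda> y' w) = 0] (mod int m)"
        using hs by (intro cong_trans[OF coordinate_mult[OF _ prs uw]]) simp_all
      then have "[h (cmp \<Lambda> x u) = h (cmp \<Lambda> y' w)] (mod int m)" by (simp add: cong_iff_dvd_diff)
      then show "(cmp \<Lambda> x u, cmp \<Lambda> y' w) \<in> agree ((h, m) # hs)"
        using agree_mult[OF _ ag uw] hs by (auto simp: agree_def)
    qed
    from IH[OF this] have "p (lin k (G n)) \<le> q (lin k (G n))"
      by (simp add: cstar q.cstar)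
    also have "\<dots> \<le> q (lin k F)"
      unfolding G_def D_def using M by (intro component_le[OF q inv F(1) pairs]) auto
    finally show ?thesis .
  qed
  then have "(\<Sum>n<M. p (lin k (G n))) \<le> (\<Sum>n<M. q (lin k F))" by (intro sum_mono)
  moreover have "p (lin k F) \<le> (\<Sum>n<M. p (lin k (G n)))"
    unfolding component_sum[OF F(1) M(1), of k D] G_def by (rule sum_le)
  ultimately show ?thesis by simp
qed

text \<open>Averaging over roots of unity, \<open>q\<close> bounds the homogeneous components of an element.  Along the
  powers \<open>square_power a n\<close> the number of components grows only like \<open>2\<^sup>n\<close>, so that the resulting estimate
  improves itself.\<close>

lemma coordinate_step:
  assumes q: "cstar_seminormed q" and hs: "\<forall>c\<in>set ((h, m) # hs). coordinate c"
    and inv: "gauge_invariant q (h, m)"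
    and IH: "\<And>a. a \<in> span (agree ((h, m) # hs)) \<Longrightarrow> p a \<le> q a"
    and a: "a \<in> span (agree hs)"
  shows "p a \<le> q a"
proof -
  interpret q: cstar_seminormed q by fact
  define bounded where "bounded N = {z \<in> agree hs. m = 0 \<longrightarrow> \<bar>h (fst z) - h (snd z)\<bar> \<le> N}" for N :: int
  have bounded_mult: "a * b \<in> span (bounded (N + N))" if "a \<in> span (bounded N)" "b \<in> span (bounded N)" for a b N
  proof (rule span_mult[OF _ _ _ that])
    show "bounded N \<subseteq> pairs" "bounded N \<subseteq> pairs" using agree_pairs by (auto simp: bounded_def)
    fix x y x' y' u w
    assume xy: "(x, y) \<in> bounded N" "(x', y') \<in> bounded N"
      and uw: "(u, w) \<in> pairs" "src \<Lambda> y = rng \<Lambda> u" "src \<Lambda> x' = rng \<Lambda> w" "cmp \<Lambda> y u = cmp \<Lambda> x' w"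
    have ag: "(x, y) \<in> agree hs" "(x', y') \<in> agree hs" using xy by (auto simp: bounded_def)
    have "[h (cmp \<Lambda> x u) - h (cmp \<Lambda> y' w) = (h x - h y) + (h x' - h y')] (mod int m)"
      using hs by (intro coordinate_mult[OF _ subsetD[OF agree_pairs ag(1)] subsetD[OF agree_pairs ag(2)] uw]) simp
    then have "m = 0 \<longrightarrow> h (cmp \<Lambda> x u) - h (cmp \<Lambda> y' w) = (h x - h y) + (h x' - h y')"
      by (auto simp: cong_def)
    then show "(cmp \<Lambda> x u, cmp \<Lambda> y' w) \<in> bounded (N + N)"
      using agree_mult[OF _ ag uw] hs xy by (auto simp: bounded_def)
  qed
  have bounded_star: "star a \<in> span (bounded N)" if "a \<in> span (bounded N)" for a N
  proof -
    have "(bounded N)\<inverse> \<subseteq> bounded N"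
      by (auto simp: bounded_def agree_def pairs_def abs_minus_commute intro: cong_sym)
    then show ?thesis using span_star[OF that] span_mono by blast
  qed
  obtain k F where F: "a = lin k F" "finite F" "F \<subseteq> agree hs" using a by (auto simp: span_def)
  define B where "B = (\<Sum>z\<in>F. \<bar>h (fst z) - h (snd z)\<bar>)"
  have B: "B \<ge> 0" by (auto simp: B_def intro: sum_nonneg)
  have "F \<subseteq> bounded B"
    using F member_le_sum[of _ F "\<lambda>z. \<bar>h (fst z) - h (snd z)\<bar>"] by (auto simp: bounded_def B_def)
  then have aB: "a \<in> span (bounded B)" using F by auto
  \<comment> \<open>\<open>star a * a\<close> has degree differences up to \<open>2 * B\<close>, and
    every squaring doubles the range.\<close>
  have power: "square_power a n \<in> span (bounded (2 ^ Suc n * B))" for n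
  proof (induct n)
    case 0
    have "B + B = 2 ^ Suc 0 * B" by simp
    then show ?case using bounded_mult[OF bounded_star[OF aB] aB] by (metis square_power.simps(1))
  next
    case (Suc n)
    have "2 ^ Suc n * B + 2 ^ Suc n * B = 2 ^ Suc (Suc n) * B" by simp
    then show ?case using bounded_mult[OF Suc Suc] by (metis square_power.simps(2))
  qed
  have "p (square_power a n) \<le> (if m = 0 then 4 * real_of_int B + 1 else real m) * 2 ^ n * q (square_power a n)" for n
  proof -
    obtain k' F' where F': "square_power a n = lin k' F'" "finite F'" "F' \<subseteq> bounded (2 ^ Suc n * B)"
      using power[of n] by (auto simp: span_def)
    \<comment> \<open>For \<open>m = 0\<close> this is the number of integers of absolute value at
      most \<open>2 ^ Suc n * B\<close>, just enough to keep them apart modulo \<open>M\<close>. It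
      is bounded by \<open>(4 * B + 1) * 2 ^ n\<close>.\<close>
    define M where "M = (if m = 0 then nat (2 * (2 ^ Suc n * B) + 1) else m)"
    have "p (lin k' F') \<le> M * q (lin k' F')"
    proof (rule coordinate_bound[OF q hs inv IH F'(2)])
      show "F' \<subseteq> agree hs" using F' by (auto simp: bounded_def)
      show "M > 0" using B by (auto simp: M_def)
      have "2 * \<bar>h (fst z) - h (snd z)\<bar> < int M" if "m = 0" "z \<in> F'" for z
      proof -
        define X :: int where "X = 2 ^ Suc n * B"
        define d where "d = \<bar>h (fst z) - h (snd z)\<bar>"
        have "\<bar>h (fst z) - h (snd z)\<bar> \<le> X" using F'(3) that by (auto simp: bounded_def X_def)
        then have "d \<le> X" by (simp add: d_def)
        moreover have "int M = 2 * X + 1" using that(1) B by (simp add: M_def X_def)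
        ultimately have "2 * d < int M" by linarith
        then show ?thesis by (simp add: d_def)
      qed
      then show "m = M \<or> m = 0 \<and> (\<forall>z\<in>F'. 2 * \<bar>h (fst z) - h (snd z)\<bar> < int M)"
        by (auto simp: M_def)
    qed
    also have "\<dots> \<le> (if m = 0 then 4 * real_of_int B + 1 else real m) * 2 ^ n * q (lin k' F')"
    proof (rule mult_right_mono)
      have "real_of_int B * 4 * 2 ^ n + 1 \<le> (4 * B + 1) * 2 ^ n"
        using one_le_power[of "2::real" n] by (simp add: ring_distribs)
      moreover have "real m \<le> real m * 2 ^ n" by (simp add: mult_le_cancel_left1)
      ultimately show "real M \<le> (if m = 0 then 4 * real_of_int B + 1 else real m) * 2 ^ n"
        using B by (simp add: M_def mult.commute mult.left_commute)
    qed simp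
    finally show ?thesis by (simp add: F'(1))
  qed
  then show ?thesis by (rule power_trick[OF cstar_seminormed_axioms q])
qed

lemma gauge_invariant_uniqueness:
  assumes q: "cstar_seminormed q" and vertex: "\<And>v. v \<in> vertices P \<Lambda> \<Longrightarrow> p (s v) \<le> q (s v)"
    and hs: "\<forall>c\<in>set hs. coordinate c \<and> gauge_invariant q c"
    and separating: "\<And>x y. \<lbrakk>x \<in> arr \<Lambda>; y \<in> arr \<Lambda>; \<forall>(h, m)\<in>set hs. [h x = h y] (mod int m)\<rbrakk> \<Longrightarrow> degr \<Lambda> x = degr \<Lambda> y"
    and a: "a \<in> span pairs"
  shows "p a \<le> q a"
proof -
  have "agree hs \<subseteq> core_pairs"
    using separating by (auto simp: agree_def core_pairs_def pairs_def)
  then have "p a \<le> q a" if "a \<in> span (agree hs)" for a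
    using core_le[OF q vertex] span_mono that by blast
  then have "p a \<le> q a" if "a \<in> span (agree [])"
    using hs
  proof (induct hs)
    case (Cons c hs)
    obtain h m where c: "c = (h, m)" by (cases c)
    have "p a \<le> q a" if "a \<in> span (agree hs)" for a
      using Cons(2,3) by (intro coordinate_step[OF q _ _ _ that, of h m]) (auto simp: c)
    then show ?case using Cons by auto
  qed (use that in auto)
  moreover have "agree [] = pairs" by (auto simp: agree_def)
  ultimately show ?thesis using a by simp
qed

end

section \<open>Gauge automorphisms and states\<close>

lemma (in star_algebra) proj_free_value_hom:
  "(\<lambda>f. proj A (free_value t f)) \<in> star_hom (free_star_alg S) A"
  by (auto simp: star_hom_def free_value_add free_value_scale free_value_adj free_value_mult)

context twisted_graph
begin

text \<open>A functor to the circle group; it need not factor through the degree map.\<close>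

definition character :: "('a \<Rightarrow> complex) \<Rightarrow> bool" where
  "character \<chi> \<longleftrightarrow> (\<forall>x\<in>arr \<Lambda>. cmod (\<chi> x) = 1) \<and>
     (\<forall>x\<in>arr \<Lambda>. \<forall>y\<in>arr \<Lambda>. src \<Lambda> x = rng \<Lambda> y \<longrightarrow> \<chi> (cmp \<Lambda> x y) = \<chi> x * \<chi> y)"

lemma character_vertex: "character \<chi> \<Longrightarrow> v \<in> vertices P \<Lambda> \<Longrightarrow> \<chi> v = 1"
proof -
  assume \<chi>: "character \<chi>" and v: "v \<in> vertices P \<Lambda>"
  have "v \<in> arr \<Lambda>" "src \<Lambda> v = v" "rng \<Lambda> v = v" using v by (simp_all add: vertices_arr vertex_ident)
  moreover from this have "cmp \<Lambda> v v = v" using comp_src[of v] by simp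
  ultimately have "\<chi> v = \<chi> v * \<chi> v" "cmod (\<chi> v) = 1" using \<chi> unfolding character_def by metis+
  then show ?thesis by auto
qed

lemma character_family:
  assumes "character \<chi>" "twisted_family P \<Lambda> c t"
  shows "twisted_family P \<Lambda> c (\<lambda>x. \<chi> x *\<^sub>C t x)"
proof -
  interpret t: twisted_family P \<Lambda> c t by fact
  note [simp] = character_vertex[OF assms(1)]
  have 1: "cnj (\<chi> x) * \<chi> x = 1" "\<chi> x * cnj (\<chi> x) = 1" if "x \<in> arr \<Lambda>" for x
    using assms(1) that complex_norm_square[of "\<chi> x"] by (simp_all add: character_def mult.commute)
  show ?thesis
  proof
    fix x y assume "x \<in> arr \<Lambda>" "y \<in> arr \<Lambda>" "src \<Lambda> x = rng \<Lambda> y"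
    then show "\<chi> x *\<^sub>C t x * \<chi> y *\<^sub>C t y = c x y *\<^sub>C \<chi> (cmp \<Lambda> x y) *\<^sub>C t (cmp \<Lambda> x y)"
      using assms(1) by (simp add: t.s_mult character_def mult_ac)
  next
    fix v p assume "v \<in> vertices P \<Lambda>" "p \<in> carrier P"
    then show "\<chi> v *\<^sub>C t v = (\<Sum>x\<in>level_at \<Lambda> v p. \<chi> x *\<^sub>C t x * star (\<chi> x *\<^sub>C t x))"
      by (simp add: t.vertex_sum 1 level_at_arr cong: sum.cong)
  qed (simp_all add: t.star_vertex t.vertex_idem t.vertex_orth t.star_s_s 1 src_vertex)
qed

text \<open>The universal property, with a C*-seminorm on the target ring in place of a target
  C*-algebra.\<close>

lemma universal_family:
  assumes q: "cstar_seminormed q" and t: "twisted_family P \<Lambda> c t" and f: "f \<in> carrier FA"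
  shows "q (free_value t f) \<le> U f"
proof (rule universal[OF _ _ f])
  interpret cstar_seminormed q by fact
  show "cstar_seminorm FA (\<lambda>f. q (free_value t f))"
    by (rule free.cstar_seminormI)
      (simp_all add: free_value_add free_value_scale free_value_adj free_value_mult[of _ "arr \<Lambda>"]
        free.adj_closed[simplified free_simps(1)] triangle submult cstar)
  show "q (free_value t r) = 0" if "r \<in> R" for r
    using twisted_family.free_value_relator[OF t that] by simp
qed

definition gauge :: "('a \<Rightarrow> complex) \<Rightarrow> 'a free \<Rightarrow> 'a free" where
  "gauge \<chi> = free_hom FA (\<lambda>x. vscale FA (\<chi> x) (free_gen x))"

lemma gauge_hom: "gauge \<chi> \<in> star_hom FA FA"
  unfolding gauge_def by (rule free.free_hom)

lemma gauge_gen: "x \<in> arr \<Lambda> \<Longrightarrow> gauge \<chi> (free_gen x) = vscale FA (\<chi> x) (free_gen x)"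
  unfolding gauge_def by (rule free.free_hom_gen) (rule free.scale_closed, simp)

lemma inc_free_value:
  assumes "f \<in> carrier FA"
  shows "inc f = proj K (free_value sg f)"
proof (rule K.free_hom_unique[OF inc_star_hom K.proj_free_value_hom _ assms])
  fix x assume "x \<in> arr \<Lambda>"
  then show "inc (free_gen x) = proj K (free_value sg (free_gen x))" by (simp add: sg_def gen_eq)
qed

lemma gauge_contractive:
  assumes \<chi>: "character \<chi>" and f: "f \<in> carrier FA"
  shows "U (gauge \<chi> f) \<le> U f"
proof -
  have "inc (gauge \<chi> f) = proj K (free_value (\<lambda>x. \<chi> x *\<^sub>C sg x) f)"
  proof (rule K.free_hom_unique[OF star_hom_comp[OF gauge_hom inc_star_hom] K.proj_free_value_hom _ f])
    fix x assume "x \<in> arr \<Lambda>"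
    then show "inc (gauge \<chi> (free_gen x)) = proj K (free_value (\<lambda>x. \<chi> x *\<^sub>C sg x) (free_gen x))"
      by (simp add: gauge_gen inc_hom sg_def gen_eq)
  qed
  then show ?thesis
    using universal_family[OF KP.cstar_seminormed_axioms character_family[OF \<chi> sg_family] f]
      norm_inc[OF star_homD(1)[OF gauge_hom[of \<chi>] f]] by simp
qed

lemma gauge_contractive_hom: "character \<chi> \<Longrightarrow> contractive_hom FA U FA U (gauge \<chi>)"
  by unfold_locales (rule gauge_hom, rule gauge_contractive)

definition gauge_aut where "gauge_aut \<chi> = complete_hom FA U (gauge \<chi>)"

lemma gauge_aut_hom: "character \<chi> \<Longrightarrow> gauge_aut \<chi> \<in> star_hom K K"
  unfolding gauge_aut_def by (rule contractive_hom.complete_hom_hom[OF gauge_contractive_hom])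

lemma gauge_aut_inc: "character \<chi> \<Longrightarrow> f \<in> carrier FA \<Longrightarrow> gauge_aut \<chi> (inc f) = inc (gauge \<chi> f)"
  unfolding gauge_aut_def by (rule contractive_hom.complete_hom_inc[OF gauge_contractive_hom])

lemma gauge_aut_gen: "character \<chi> \<Longrightarrow> x \<in> arr \<Lambda> \<Longrightarrow> gauge_aut \<chi> (gen x) = vscale K (\<chi> x) (gen x)"
  by (simp add: gen_eq gauge_aut_inc gauge_gen inc_hom)

lemma gauge_aut_comp:
  assumes "character \<chi>" "character \<chi>'" "character \<chi>''" "\<And>x. x \<in> arr \<Lambda> \<Longrightarrow> \<chi> x * \<chi>' x = \<chi>'' x"
    and S: "S \<in> carrier K"
  shows "gauge_aut \<chi> (gauge_aut \<chi>' S) = gauge_aut \<chi>'' S"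
proof (rule hom_gen_eqI[OF star_hom_comp[OF gauge_aut_hom gauge_aut_hom] gauge_aut_hom cstar_algebra_K _ S])
  fix x assume "x \<in> arr \<Lambda>"
  then show "gauge_aut \<chi> (gauge_aut \<chi>' (gen x)) = gauge_aut \<chi>'' (gen x)"
    using star_homD(3)[OF gauge_aut_hom[OF assms(1)]] assms(1-3)
    by (simp add: gauge_aut_gen K.scale_scale mult.commute flip: assms(4))
qed fact+

lemma gauge_aut_one:
  assumes "character \<chi>" "\<And>x. x \<in> arr \<Lambda> \<Longrightarrow> \<chi> x = 1" "S \<in> carrier K"
  shows "gauge_aut \<chi> S = S"
proof (rule hom_gen_eqI[OF gauge_aut_hom _ cstar_algebra_K _ assms(3)])
  show "(\<lambda>x. x) \<in> star_hom K K" by (simp add: star_hom_def)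
qed (use assms in \<open>simp_all add: gauge_aut_gen K.scale_one\<close>)

context
  fixes \<delta> :: "'a \<Rightarrow> bit"
  assumes \<delta>: "\<And>x y. \<lbrakk>x \<in> arr \<Lambda>; y \<in> arr \<Lambda>; src \<Lambda> x = rng \<Lambda> y\<rbrakk> \<Longrightarrow> \<delta> (cmp \<Lambda> x y) = \<delta> x + \<delta> y"
begin

lemma character_sign: "character (\<lambda>x. bit_sign (\<delta> x))"
  by (simp add: character_def \<delta> bit_sign_add)

text \<open>The definite description denotes: the gauge automorphism of the sign character has the
  required values, and values at the generators determine a homomorphism.\<close>

lemma gen_grading:
  "grading K (gen_grading P \<Lambda> c \<delta>)"
  "x \<in> arr \<Lambda> \<Longrightarrow> gen_grading P \<Lambda> c \<delta> (gen x) = vscale K (bit_sign (\<delta> x)) (gen x)"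
proof -
  let ?P = "\<lambda>\<alpha>. \<alpha> \<in> extensional (carrier K) \<and> grading K \<alpha> \<and>
        (\<forall>x\<in>arr \<Lambda>. \<alpha> (gen x) = vscale K (bit_sign (\<delta> x)) (gen x))"
  define \<Theta> where "\<Theta> = gauge_aut (\<lambda>x. bit_sign (\<delta> x))"
  have one: "character (\<lambda>_. 1)" by (simp add: character_def)
  have inv: "\<Theta> (\<Theta> S) = S" if "S \<in> carrier K" for S
    using gauge_aut_comp[OF character_sign character_sign one _ that] gauge_aut_one[OF one _ that]
    by (simp add: \<Theta>_def)
  have hom: "\<Theta> \<in> star_hom K K" unfolding \<Theta>_def by (rule gauge_aut_hom[OF character_sign])
  have "?P (restrict \<Theta> (carrier K))"
    using K.grading_restrict[OF hom inv] gauge_aut_gen[OF character_sign] by (simp add: \<Theta>_def)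
  moreover have "\<gamma> = \<gamma>'" if "?P \<gamma>" "?P \<gamma>'" for \<gamma> \<gamma>'
  proof (rule extensionalityI[of _ "carrier K"])
    have "\<gamma> \<in> star_hom K K" "\<gamma>' \<in> star_hom K K" using that grading_star_hom by metis+
    note eq = hom_gen_eqI[OF this cstar_algebra_K]
    fix S assume "S \<in> carrier K"
    then show "\<gamma> S = \<gamma>' S" by (rule eq[rotated]) (simp add: that)
  qed (use that in auto)
  ultimately have "\<exists>!\<gamma>. ?P \<gamma>" by blast
  from theI'[OF this] show "grading K (gen_grading P \<Lambda> c \<delta>)"
    "x \<in> arr \<Lambda> \<Longrightarrow> gen_grading P \<Lambda> c \<delta> (gen x) = vscale K (bit_sign (\<delta> x)) (gen x)"
    by (simp_all add: gen_grading_def Let_def twisted_cstar_eq twisted_gen_eq)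
qed

lemma gen_grading_aut:
  "S \<in> carrier K \<Longrightarrow> gen_grading P \<Lambda> c \<delta> S = gauge_aut (\<lambda>x. bit_sign (\<delta> x)) S"
  by (rule hom_gen_eqI[OF grading_star_hom[OF gen_grading(1)] gauge_aut_hom[OF character_sign] cstar_algebra_K])
    (simp_all add: gen_grading(2) gauge_aut_gen[OF character_sign])

end

end

section \<open>From functionals on a concrete family to functionals on the universal algebra\<close>

lemma (in positive_functional) norm2_projection:
  assumes "star e = e" "e * e = e"
  shows "norm2 (e * b) \<le> norm2 b"
proof -
  have "star b * b = star (e * b) * (e * b) + star (b - e * b) * (b - e * b)"
    using assms by (simp add: algebra_simps star_ring_simps) (simp add: assms flip: mult.assoc)
  then have "norm2 b = norm2 (e * b) + norm2 (b - e * b)" by (simp add: norm2_def add)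
  then show ?thesis using norm2_nonneg[of "b - e * b"] by linarith
qed

lemma (in seminormed_star_algebra) extend_functional:
  assumes add: "\<And>x y. x \<in> carrier X \<Longrightarrow> y \<in> carrier X \<Longrightarrow> \<phi> (vplus X x y) = \<phi> x + \<phi> y"
    and scale: "\<And>x z. x \<in> carrier X \<Longrightarrow> \<phi> (vscale X z x) = z * \<phi> x"
    and le: "\<And>x. x \<in> carrier X \<Longrightarrow> cmod (\<phi> x) \<le> p x"
  obtains \<Phi> where "\<And>\<sigma>. \<sigma> \<in> Cs \<Longrightarrow> (\<lambda>n. \<phi> (\<sigma> n)) \<longlonglongrightarrow> \<Phi> (cls \<sigma>)"
proof -
  have minus: "\<phi> (vminus X x y) = \<phi> x - \<phi> y" if "x \<in> carrier X" "y \<in> carrier X" for x y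
    using that by (simp add: vminus_def add scale closed)
  have conv: "convergent (\<lambda>n. \<phi> (\<sigma> n))" if \<sigma>: "\<sigma> \<in> Cs" for \<sigma>
  proof (intro Cauchy_convergent CauchyI)
    fix e :: real assume "e > 0"
    then obtain N where N: "\<forall>m\<ge>N. \<forall>n\<ge>N. p (vminus X (\<sigma> m) (\<sigma> n)) < e"
      using \<sigma> unfolding cauchy_seqs_def by auto
    have "norm (\<phi> (\<sigma> m) - \<phi> (\<sigma> n)) < e" if "m \<ge> N" "n \<ge> N" for m n
      using le[OF minus_closed[OF Cs_mem[OF \<sigma>, of m] Cs_mem[OF \<sigma>, of n]]] N that
        minus[OF Cs_mem[OF \<sigma>, of m] Cs_mem[OF \<sigma>, of n]] by fastforce
    then show "\<exists>M. \<forall>m\<ge>M. \<forall>n\<ge>M. norm (\<phi> (\<sigma> m) - \<phi> (\<sigma> n)) < e" by blast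
  qed
  \<comment> \<open>A representative is picked once for every class; since \<open>p\<close>
    dominates \<open>\<phi>\<close>, every other representative has the same limit.\<close>
  define \<Phi> where "\<Phi> S = lim (\<lambda>n. \<phi> ((SOME \<sigma>. \<sigma> \<in> S) n))" for S
  show thesis
  proof (rule that)
    fix \<sigma> assume \<sigma>: "\<sigma> \<in> Cs"
    define \<tau> where "\<tau> = (SOME \<tau>. \<tau> \<in> cls \<sigma>)"
    have \<tau>: "\<tau> \<in> cls \<sigma>" unfolding \<tau>_def by (rule someI[of "\<lambda>\<tau>. \<tau> \<in> cls \<sigma>"], rule mem_cls_self[OF \<sigma>])
    then have \<tau>C: "\<tau> \<in> Cs" by (rule cls_Cs)
    have "(\<lambda>n. p (vminus X (\<tau> n) (\<sigma> n))) \<longlonglongrightarrow> 0"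
      using cls_null[OF \<tau>] \<tau>C \<sigma> by (simp add: P.null_def)
    then have "(\<lambda>n. cmod (\<phi> (\<tau> n) - \<phi> (\<sigma> n))) \<longlonglongrightarrow> 0"
    proof (rule null_limit[rotated 2])
      fix n
      have mem: "\<tau> n \<in> carrier X" "\<sigma> n \<in> carrier X" using Cs_mem \<tau>C \<sigma> by simp_all
      show "cmod (\<phi> (\<tau> n) - \<phi> (\<sigma> n)) \<le> p (vminus X (\<tau> n) (\<sigma> n))"
        using le[OF minus_closed[OF mem]] by (simp add: minus[OF mem])
    qed simp
    then have 0: "(\<lambda>n. \<phi> (\<tau> n) - \<phi> (\<sigma> n)) \<longlonglongrightarrow> 0" by (simp add: tendsto_norm_zero_iff)
    have "(\<lambda>n. \<phi> (\<tau> n)) \<longlonglongrightarrow> \<Phi> (cls \<sigma>)"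
      using conv[OF \<tau>C] by (simp add: \<Phi>_def \<tau>_def convergent_LIMSEQ_iff)
    from tendsto_diff[OF this 0] show "(\<lambda>n. \<phi> (\<sigma> n)) \<longlonglongrightarrow> \<Phi> (cls \<sigma>)" by simp
  qed
qed

context twisted_family
begin

lemma free_value_proj:
  "free_value s (proj FA (f * g)) = free_value s (proj FA f) * free_value s (proj FA g)"
  "free_value s (proj FA (star f)) = star (free_value s (proj FA f))"
proof -
  have keys: "Poly_Mapping.keys (proj FA f) \<subseteq> words (arr \<Lambda>)" for f
    using free.proj_closed[of "arr \<Lambda>" f] by simp
  show "free_value s (proj FA (f * g)) = free_value s (proj FA f) * free_value s (proj FA g)"
    "free_value s (proj FA (star f)) = star (free_value s (proj FA f))"
    by (simp_all add: free_value_mult[OF keys keys] free_value_adj)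
qed

text \<open>The ring of values carries no norm. Boundedness comes from the relations:
  \<open>star (s x) * s x\<close> and \<open>s x * star (s x)\<close> are projections, so each
  letter contracts the seminorm given by \<open>\<omega>\<close>, and an element is bounded by the
  sum of the moduli of its coefficients.\<close>

lemma gns_bounded:
  assumes \<omega>: "positive_functional \<omega>"
  shows "bounded_functionals {\<lambda>f. \<omega> (free_value s (proj FA f))}"
proof (rule bounded_functionals.intro)
  interpret positive_functional \<omega> by fact
  have keys: "Poly_Mapping.keys (proj FA f) \<subseteq> words (arr \<Lambda>)" for f
    using free.proj_closed[of "arr \<Lambda>" f] by simp
  have vals: "free_value s (proj FA (f * g)) = free_value s (proj FA f) * free_value s (proj FA g)"
    "free_value s (proj FA (star f)) = star (free_value s (proj FA f))" for f g
    by (rule free_value_proj)+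
  show "positive_functional w" if "w \<in> {\<lambda>f. \<omega> (free_value s (proj FA f))}" for w
    using that
  proof (unfold_locales, goal_cases)
    case (1 x y)
    then show ?case by (simp add: free_value_add add)
  next
    case (2 z x)
    then show ?case by (simp add: free_value_scale)
  next
    case (3 x)
    show ?case using positive unfolding 3[simplified] vals by simp
  qed
  have gen: "sqrt (norm2 (s x * b)) \<le> sqrt (norm2 b)" "sqrt (norm2 (star (s x) * b)) \<le> sqrt (norm2 b)"
    if x: "x \<in> arr \<Lambda>" for x b
  proof -
    define e where "e = s (src \<Lambda> x)"
    have e: "star e = e" "e * e = e" "star (s x) * s x = e" using x
      by (simp_all add: e_def star_vertex vertex_idem src_vertex star_s_s)
    have se: "s x * e = s x" using x by (simp add: e_def s_mult src_closed src_ident c_src comp_src)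
    define f where "f = s x * star (s x)"
    have f: "star f = f" "f * f = f" using e se
      by (simp_all add: f_def star_mult) (metis mult.assoc)
    have "norm2 (s x * b) = norm2 (e * b)" "norm2 (star (s x) * b) = norm2 (f * b)"
      unfolding norm2_def using e f by (simp_all add: star_mult mult.assoc) (metis e f f_def mult.assoc)+
    then show "sqrt (norm2 (s x * b)) \<le> sqrt (norm2 b)" "sqrt (norm2 (star (s x) * b)) \<le> sqrt (norm2 b)"
      using norm2_projection[OF e(1,2)] norm2_projection[OF f] by simp_all
  qed
  have letter: "sqrt (norm2 ((if i then star (s x) else s x) * b)) \<le> sqrt (norm2 b)" if "x \<in> arr \<Lambda>" for x i b
    using gen[OF that, of b] by simp
  have word: "sqrt (norm2 (word_value s w * b)) \<le> sqrt (norm2 b)" if "w \<in> words (arr \<Lambda>)" for w b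
    using that
  proof (induct w arbitrary: b)
    case (Cons l w)
    obtain x i where l: "l = (x, i)" by (cases l)
    then have x: "x \<in> arr \<Lambda>" using Cons(2) by (simp add: words_def)
    show ?case
    proof (cases "w = []")
      case True
      then show ?thesis using letter[OF x, of i b] by (simp add: l)
    next
      case False
      then have w: "w \<in> words (arr \<Lambda>)" using Cons(2) by (simp add: words_def)
      have "word_value s (l # w) = (if i then star (s x) else s x) * word_value s w"
        using False by (cases w) (auto simp: l)
      then show ?thesis
        using letter[OF x, of i "word_value s w * b"] Cons(1)[OF w, of b] by (simp add: mult.assoc)
    qed
  qed simp
  have "\<exists>C\<ge>0. \<forall>b. sqrt (norm2 (free_value s f * b)) \<le> C * sqrt (norm2 b)"
    if "Poly_Mapping.keys f \<subseteq> words (arr \<Lambda>)" for f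
    using that
  proof (induct f rule: poly_mapping_keys_induct)
    case zero
    show ?case by (intro exI[of _ 0]) (simp add: norm2_def)
  next
    case (add f w c)
    then obtain C where C: "C \<ge> 0" "\<And>b. sqrt (norm2 (free_value s f * b)) \<le> C * sqrt (norm2 b)" by blast
    have "sqrt (norm2 (free_value s (f + Poly_Mapping.single w c) * b)) \<le> (C + cmod c) * sqrt (norm2 b)" for b
    proof -
      have "sqrt (norm2 (free_value s (f + Poly_Mapping.single w c) * b)) \<le>
          sqrt (norm2 (free_value s f * b)) + cmod c * sqrt (norm2 (word_value s w * b))"
        using norm2_triangle[of "free_value s f * b" "c *\<^sub>C (word_value s w * b)"]
        by (simp add: free_value_add distrib_right real_sqrt_mult)
      also have "\<dots> \<le> C * sqrt (norm2 b) + cmod c * sqrt (norm2 b)"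
        using C(2) word[OF add(3)] by (intro add_mono mult_left_mono) auto
      finally show ?thesis by (simp add: distrib_right)
    qed
    then show ?case using C(1) by (intro exI[of _ "C + cmod c"]) simp
  qed
  then show "\<exists>C. \<forall>w\<in>{\<lambda>f. \<omega> (free_value s (proj FA f))}. \<forall>y. Re (w (star (f * y) * (f * y))) \<le> C * Re (w (star y * y))" for f
  proof -
    obtain C where C: "C \<ge> 0" "\<And>b. sqrt (norm2 (free_value s (proj FA f) * b)) \<le> C * sqrt (norm2 b)"
      using \<open>\<And>f. Poly_Mapping.keys f \<subseteq> words (arr \<Lambda>) \<Longrightarrow> _\<close>[OF keys[of f]] by blast
    have "norm2 (free_value s (proj FA f) * b) \<le> C\<^sup>2 * norm2 b" for b
      using power_mono[OF C(2)[of b], of 2] C(1) by (simp add: power_mult_distrib)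
    then show ?thesis by (intro exI[of _ "C\<^sup>2"]) (auto simp only: vals norm2_def)
  qed
qed simp

text \<open>The GNS seminorm of \<open>\<omega>\<close> kills the relators and is therefore below
  the universal seminorm. Since \<open>s v\<close> acts like a unit for \<open>\<omega>\<close>,
  Cauchy-Schwarz against \<open>s v\<close> bounds the functional itself by that seminorm, so it
  extends to the completion.\<close>

lemma state_extends:
  assumes \<omega>: "positive_functional \<omega>" and v: "v \<in> vertices P \<Lambda>"
    and local: "\<And>b. \<omega> (s v * b) = \<omega> b" "\<And>b. \<omega> (b * s v) = \<omega> b" and one: "\<omega> (s v) = 1"
    and even: "\<And>f. f \<in> carrier FA \<Longrightarrow> \<omega> (free_value s (gauge \<chi> f)) = \<omega> (free_value s f)"
    and \<chi>: "character \<chi>"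
  obtains \<phi> where "even_positive_functional K (gauge_aut \<chi>) \<phi>" "\<phi> (gen v) = 1"
proof -
  interpret positive_functional \<omega> by fact
  interpret G: bounded_functionals "{\<lambda>f. \<omega> (free_value s (proj FA f))}" by (rule gns_bounded[OF \<omega>])
  have keys: "Poly_Mapping.keys (proj FA f) \<subseteq> words (arr \<Lambda>)" for f
    using free.proj_closed[of "arr \<Lambda>" f] by simp
  define \<phi> where "\<phi> f = \<omega> (free_value s f)" for f
  have gns_le: "G.gns (emb FA f) \<le> U f" if f: "f \<in> carrier FA" for f
  proof (rule universal[OF free.cstar_seminorm_emb[OF G.gns_cstar_seminormed] _ f])
    fix r assume r: "r \<in> R"
    then have "r \<in> carrier FA" using R_closed by blast
    have "G.gns (emb FA r) \<le> 0"
    proof (rule G.gns_leI)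
      fix w y assume "w \<in> {\<lambda>f. \<omega> (free_value s (proj FA f))}"
      then have "w (star (emb FA r * y) * (emb FA r * y)) = 0"
        using free_value_relator[OF r] \<open>r \<in> carrier FA\<close>
        by (auto simp only: free_value_proj free.proj_emb mult_zero_left mult_zero_right positive_functional.zero[OF \<omega>])
      then show "G.nrm w (emb FA r * y) \<le> 0 * G.nrm w y" by simp
    qed simp
    then show "G.gns (emb FA r) = 0" using G.gns_nonneg[of "emb FA r"] by simp
  qed
  have le: "cmod (\<phi> f) \<le> U f" if f: "f \<in> carrier FA" for f
  proof -
    have gv: "free_gen v \<in> carrier FA" using v by (simp add: vertices_arr)
    have nv: "norm2 (s v) = 1" by (simp add: norm2_def star_vertex vertex_idem v one)
    have "\<phi> f = \<omega> (star (s v) * (free_value s f * s v))"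
      by (simp add: \<phi>_def star_vertex v local flip: mult.assoc)
    then have "cmod (\<phi> f) \<le> sqrt (norm2 (s v)) * sqrt (norm2 (free_value s f * s v))"
      using cauchy_schwarz' by simp
    also have "\<dots> \<le> G.gns (emb FA f) * sqrt (norm2 (s v))"
      using G.nrm_le_gns[OF singletonI, of "emb FA f" "emb FA (free_gen v)"] f gv
      by (simp add: nv norm2_def[symmetric] free_value_mult[of _ "arr \<Lambda>"] free_value_adj
          free.times_closed[simplified free_simps] free.adj_closed[simplified free_simps])
    finally show ?thesis using gns_le[OF f] by (simp add: nv)
  qed
  have add: "\<phi> (vplus FA f g) = \<phi> f + \<phi> g" "\<phi> (vscale FA z f) = z * \<phi> f" for f g z
    by (simp_all add: \<phi>_def free_value_add free_value_scale positive_functional.add[OF \<omega>])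
  obtain \<Phi> where \<Phi>: "\<And>\<sigma>. \<sigma> \<in> Cs \<Longrightarrow> (\<lambda>n. \<phi> (\<sigma> n)) \<longlonglongrightarrow> \<Phi> (cls \<sigma>)"
    using extend_functional[of \<phi>, OF add le] by blast
  have eqI: "\<Phi> (cls \<sigma>) = z" if "\<sigma> \<in> Cs" "(\<lambda>n. \<phi> (\<sigma> n)) \<longlonglongrightarrow> z" for \<sigma> z
    using LIMSEQ_unique \<Phi> that by blast
  have "even_positive_functional K (gauge_aut \<chi>) \<Phi>"
    unfolding even_positive_functional_def
  proof (intro conjI ballI allI)
    fix S assume "S \<in> carrier K"
    then obtain \<sigma> where S: "S = cls \<sigma>" and \<sigma>: "\<sigma> \<in> Cs" by (auto simp: carrier_K)
    show "\<Phi> (vscale K z S) = z * \<Phi> S" for z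
      using tendsto_mult_left[OF \<Phi>[OF \<sigma>], of z] \<sigma> unfolding S by (simp add: K_ops eqI add)
    have sq: "(\<lambda>n. vtimes FA (adj FA (\<sigma> n)) (\<sigma> n)) \<in> Cs" using \<sigma> by (intro Cs_closed)
    have pos: "\<phi> (vtimes FA (adj FA (\<sigma> n)) (\<sigma> n)) \<in> \<real> \<and> 0 \<le> Re (\<phi> (vtimes FA (adj FA (\<sigma> n)) (\<sigma> n)))" for n
    proof -
      have "free_value s (vtimes FA (adj FA (\<sigma> n)) (\<sigma> n)) = star (free_value s (\<sigma> n)) * free_value s (\<sigma> n)"
        using Cs_mem[OF \<sigma>, of n] free.adj_closed[OF Cs_mem[OF \<sigma>, of n]]
        by (simp add: free_value_mult[of _ "arr \<Lambda>"] free_value_adj)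
      then show ?thesis using positive by (simp add: \<phi>_def)
    qed
    have lim: "(\<lambda>n. \<phi> (vtimes FA (adj FA (\<sigma> n)) (\<sigma> n))) \<longlonglongrightarrow> \<Phi> (vtimes K (adj K S) S)"
      using \<Phi>[OF sq] \<sigma> unfolding S by (simp add: K_ops del: free_simps)
    show "\<Phi> (vtimes K (adj K S) S) \<in> \<real>"
      using LIMSEQ_unique[OF tendsto_Im[OF lim], of 0] pos by (simp add: complex_is_Real_iff)
    show "0 \<le> Re (\<Phi> (vtimes K (adj K S) S))"
      using pos tendsto_Re[OF lim] by (intro LIMSEQ_le_const) auto
    have g\<sigma>: "(\<lambda>n. gauge \<chi> (\<sigma> n)) \<in> Cs"
      by (rule contractive_hom.Cs_image[OF gauge_contractive_hom[OF \<chi>] \<sigma>])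
    have "gauge_aut \<chi> S = cls (\<lambda>n. gauge \<chi> (\<sigma> n))"
      unfolding S gauge_aut_def by (rule contractive_hom.complete_hom_cls[OF gauge_contractive_hom[OF \<chi>] \<sigma>])
    moreover have "\<phi> (gauge \<chi> (\<sigma> n)) = \<phi> (\<sigma> n)" for n
      unfolding \<phi>_def by (rule even[OF Cs_mem[OF \<sigma>]])
    ultimately show "\<Phi> (gauge_aut \<chi> S) = \<Phi> S"
      using \<Phi>[OF \<sigma>] unfolding S by (simp add: eqI[OF g\<sigma>])
    fix T assume "T \<in> carrier K"
    then obtain \<tau> where T: "T = cls \<tau>" and \<tau>: "\<tau> \<in> Cs" by (auto simp: carrier_K)
    have "(\<lambda>n. vplus FA (\<sigma> n) (\<tau> n)) \<in> Cs" using \<sigma> \<tau> by (intro Cs_closed)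
    then show "\<Phi> (vplus K S T) = \<Phi> S + \<Phi> T"
      using tendsto_add[OF \<Phi>[OF \<sigma>] \<Phi>[OF \<tau>]] \<sigma> \<tau> unfolding S T
      by (simp only: K_ops eqI add)
  qed
  moreover have "\<Phi> (gen v) = 1"
    using eqI[of "\<lambda>_. free_gen v" 1] v one by (simp add: gen_eq inc_cls vertices_arr \<phi>_def)
  ultimately show thesis by (rule that)
qed

end

section \<open>The infinite path representation\<close>

text \<open>An inner product space without completion is enough: boundedness of the operators is
  supplied by \<open>gns_bounded\<close>.\<close>

type_synonym 'i vec = "'i \<Rightarrow>\<^sub>0 complex"

definition ip :: "'i vec \<Rightarrow> 'i vec \<Rightarrow> complex" where
  "ip x y = (\<Sum>i\<in>Poly_Mapping.keys x. cnj (Poly_Mapping.lookup x i) * Poly_Mapping.lookup y i)"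

lemma ip_superset:
  assumes "finite A" "Poly_Mapping.keys x \<inter> Poly_Mapping.keys y \<subseteq> A"
  shows "ip x y = (\<Sum>i\<in>A. cnj (Poly_Mapping.lookup x i) * Poly_Mapping.lookup y i)"
  unfolding ip_def
  by (rule sum.mono_neutral_cong) (use assms in \<open>auto simp: in_keys_iff\<close>)

lemma ip_cnj: "cnj (ip x y) = ip y x"
  unfolding ip_superset[of "Poly_Mapping.keys x \<inter> Poly_Mapping.keys y" x y, simplified]
    ip_superset[of "Poly_Mapping.keys x \<inter> Poly_Mapping.keys y" y x, simplified Int_commute, simplified]
  by (simp add: mult.commute Int_commute)

lemma ip_add_right: "ip x (y + y') = ip x y + ip x y'"
  by (simp add: ip_def lookup_add distrib_left sum.distrib)

lemma ip_add_left: "ip (x + x') y = ip x y + ip x' y"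
  using ip_add_right[of y x x'] by (metis ip_cnj complex_cnj_add)

lemma ip_single_left [simp]: "ip (Poly_Mapping.single i c) y = cnj c * Poly_Mapping.lookup y i"
  by (simp add: ip_def lookup_single)

lemma ip_single_right [simp]: "ip y (Poly_Mapping.single i c) = cnj (Poly_Mapping.lookup y i) * c"
  by (subst ip_cnj[symmetric]) (simp add: mult.commute)

lemma ip_self: "ip x x \<in> \<real> \<and> 0 \<le> Re (ip x x)"
proof -
  have "ip x x = complex_of_real (\<Sum>i\<in>Poly_Mapping.keys x. (cmod (Poly_Mapping.lookup x i))\<^sup>2)"
    by (simp add: ip_def complex_norm_square mult.commute del: of_real_power)
  then show ?thesis by (simp add: sum_nonneg)
qed

definition vec_scale :: "complex \<Rightarrow> 'i vec \<Rightarrow> 'i vec" where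
  "vec_scale z = Poly_Mapping.map (\<lambda>c. z * c)"

lemma lookup_vec_scale [simp]: "Poly_Mapping.lookup (vec_scale z x) i = z * Poly_Mapping.lookup x i"
  by (simp add: vec_scale_def Poly_Mapping.map.rep_eq when_def)

lemma ip_vec_scale [simp]: "ip x (vec_scale z y) = z * ip x y" "ip (vec_scale z x) y = cnj z * ip x y"
proof -
  show 1: "ip x (vec_scale z y) = z * ip x y" for x y :: "'a vec"
    by (simp add: ip_def sum_distrib_left mult_ac)
  show "ip (vec_scale z x) y = cnj z * ip x y"
    using arg_cong[OF 1[of y x], of cnj] by (simp add: ip_cnj)
qed

text \<open>Operators on the finitely supported vectors that have an adjoint; linearity is automatic.\<close>

typedef 'i adjointable = "{(T :: 'i vec \<Rightarrow> 'i vec, T' :: 'i vec \<Rightarrow> 'i vec). \<forall>x y. ip (T x) y = ip x (T' y)}"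
  by (rule exI[of _ "(\<lambda>x. x, \<lambda>x. x)"]) simp

definition ap :: "'i adjointable \<Rightarrow> 'i vec \<Rightarrow> 'i vec" where "ap T = fst (Rep_adjointable T)"

definition ap' :: "'i adjointable \<Rightarrow> 'i vec \<Rightarrow> 'i vec" where "ap' T = snd (Rep_adjointable T)"

definition adjointable :: "('i vec \<Rightarrow> 'i vec) \<Rightarrow> ('i vec \<Rightarrow> 'i vec) \<Rightarrow> 'i adjointable" where
  "adjointable T T' = Abs_adjointable (T, T')"

lemma ap_adjointable:
  assumes "\<And>x y. ip (T x) y = ip x (T' y)"
  shows "ap (adjointable T T') x = T x" "ap' (adjointable T T') x = T' x"
  using assms by (simp_all add: ap_def ap'_def adjointable_def Abs_adjointable_inverse)

lemma ip_ap_ap': "ip (ap T x) y = ip x (ap' T y)" "ip (ap' T x) y = ip x (ap T y)"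
proof -
  show 1: "ip (ap T x) y = ip x (ap' T y)" for x y
    using Rep_adjointable[of T] by (auto simp: ap_def ap'_def case_prod_beta)
  show "ip (ap' T x) y = ip x (ap T y)" using 1[of y x] by (metis ip_cnj)
qed

lemma ip_eqI: "(\<And>i. ip (Poly_Mapping.single i 1) x = ip (Poly_Mapping.single i 1) y) \<Longrightarrow> x = y"
  by (rule poly_mapping_eqI) simp

lemma ap_eqI:
  assumes "\<And>x. ap S x = ap T x"
  shows "S = T"
proof -
  have "ap' S y = ap' T y" for y by (rule ip_eqI) (simp only: ip_ap_ap'[symmetric] assms)
  then have "Rep_adjointable S = Rep_adjointable T"
    using assms by (simp add: ap_def ap'_def prod_eq_iff fun_eq_iff)
  then show ?thesis by (simp add: Rep_adjointable_inject)
qed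

instantiation adjointable :: (type) star_ring
begin

definition "0 = adjointable (\<lambda>x. 0 :: 'a vec) (\<lambda>x. 0)"
definition "S + T = adjointable (\<lambda>x. ap S x + ap T x) (\<lambda>x. ap' S x + ap' T x)"
definition "z *\<^sub>C T = adjointable (\<lambda>x. vec_scale z (ap T x)) (\<lambda>x. vec_scale (cnj z) (ap' T x))"
definition "S * T = adjointable (\<lambda>x. ap S (ap T x)) (\<lambda>x. ap' T (ap' S x))"
definition "star T = adjointable (ap' T) (ap T)"
definition "- T = (-1) *\<^sub>C (T :: 'a adjointable)"
definition "S - T = S + - (T :: 'a adjointable)"

lemma ap_simps [simp]:
  "ap 0 x = 0" "ap (S + T) x = ap S x + ap T x" "ap (z *\<^sub>C T) x = vec_scale z (ap T x)"
  "ap (S * T) x = ap S (ap T x)" for S T :: "'a adjointable"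
  by (simp_all add: zero_adjointable_def plus_adjointable_def scaleC_adjointable_def times_adjointable_def
      ap_adjointable ip_ap_ap' ip_add_left ip_add_right, subst ap_adjointable, simp_all add: ip_def)

lemma ap_star: "ap (star T) = ap' T" for T :: "'a adjointable"
  by (rule ext) (simp add: star_adjointable_def ap_adjointable ip_ap_ap')

lemma ip_ap: "ip (ap T x) y = ip x (ap (star T) y)" "ip (ap (star T) x) y = ip x (ap T y)"
  for T :: "'a adjointable"
  by (simp_all add: ap_star ip_ap_ap')

text \<open>The coefficient at \<open>j\<close> is an inner product with the image of the basis
  vector \<open>j\<close> under the adjoint. Hence an operator is determined by its columns.\<close>

lemma lookup_ap: "Poly_Mapping.lookup (ap T x) j =
    (\<Sum>i\<in>Poly_Mapping.keys x. Poly_Mapping.lookup (ap T (Poly_Mapping.single i 1)) j * Poly_Mapping.lookup x i)"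
  for T :: "'a adjointable"
proof -
  have star: "cnj (Poly_Mapping.lookup (ap (star T) (Poly_Mapping.single j 1)) i) =
      Poly_Mapping.lookup (ap T (Poly_Mapping.single i 1)) j" for i
    using ip_ap(1)[of T "Poly_Mapping.single i 1" "Poly_Mapping.single j 1"] by (metis complex_cnj_cnj complex_cnj_one ip_single_left ip_single_right mult.right_neutral mult_1)
  have "cnj (Poly_Mapping.lookup (ap T x) j) = ip x (ap (star T) (Poly_Mapping.single j 1))"
    using ip_ap(1)[of T x "Poly_Mapping.single j 1"] by simp
  then have "Poly_Mapping.lookup (ap T x) j = cnj (ip x (ap (star T) (Poly_Mapping.single j 1)))"
    by (metis complex_cnj_cnj)
  then show ?thesis by (simp add: ip_def star mult.commute)
qed

lemma ap_linear: "ap T (x + y) = ap T x + ap T y" "ap T (vec_scale z x) = vec_scale z (ap T x)"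
  for T :: "'a adjointable"
  by (rule ip_eqI, simp only: ip_ap(2)[symmetric] ip_add_right ip_vec_scale)+

lemma ap_zero: "ap T 0 = 0" for T :: "'a adjointable"
  using ap_linear(1)[of T 0 0] by simp

lemma star_simps:
  "star (S + T) = star S + star T" "star (z *\<^sub>C T) = cnj z *\<^sub>C star T" "star (S * T) = star T * star S"
  "star (star T) = T" for S T :: "'a adjointable"
  by (rule ap_eqI, rule ip_eqI, simp only: ip_ap(1)[symmetric] ap_simps ip_add_left ip_add_right ip_vec_scale complex_cnj_cnj)+
    (simp only: ip_ap(2))

instance
proof
  fix a b c :: "'a adjointable" and z w :: complex
  note [simp] = ap_linear poly_mapping_eqI lookup_add algebra_simps star_simps
  show "a + b + c = a + (b + c)" "a + b = b + a" "0 + a = a" "- a + a = 0" "a - b = a + - b"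
    by (rule ap_eqI, rule poly_mapping_eqI, simp add: uminus_adjointable_def minus_adjointable_def)+
  show "a * b * c = a * (b * c)" "(a + b) * c = a * c + b * c" "a * (b + c) = a * b + a * c"
    by (rule ap_eqI, rule poly_mapping_eqI, simp)+
  show "z *\<^sub>C (a + b) = z *\<^sub>C a + z *\<^sub>C b" "(z + w) *\<^sub>C a = z *\<^sub>C a + w *\<^sub>C a"
    "z *\<^sub>C w *\<^sub>C a = (z * w) *\<^sub>C a" "1 *\<^sub>C a = a" "z *\<^sub>C a * b = z *\<^sub>C (a * b)"
    "a * z *\<^sub>C b = z *\<^sub>C (a * b)"
    by (rule ap_eqI, rule poly_mapping_eqI, simp)+
  show "star (star a) = a" "star (a + b) = star a + star b" "star (z *\<^sub>C a) = cnj z *\<^sub>C star a"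
    "star (a * b) = star b * star a"
    by simp_all
qed

end

lemma adjointable_eqI:
  assumes "\<And>i. ap S (Poly_Mapping.single i 1) = ap T (Poly_Mapping.single i 1)"
  shows "S = T"
  by (rule ap_eqI, rule poly_mapping_eqI) (subst (1 2) lookup_ap, simp add: assms)

lemma ap_sum [simp]: "ap (sum F I) x = (\<Sum>i\<in>I. ap (F i) x)"
  by (induct I rule: infinite_finite_induct) simp_all

lemma vector_functional: "positive_functional (\<lambda>T. ip x (ap T x))"
  by unfold_locales (use ip_self in \<open>simp_all add: ip_add_right flip: ip_ap(1)\<close>)

section \<open>Sign cocycles and infinite paths\<close>

lemma kappa_add:
  "kappa N (\<lambda>i. m i + m' i) n = kappa N m n + kappa N m' n"
  "kappa N m (\<lambda>i. n i + n' i) = kappa N m n + kappa N m n'"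
  by (simp_all add: kappa_def distrib_left distrib_right sum.distrib)

lemma kappa_zero [simp]: "kappa N (\<lambda>i. 0) n = 0" "kappa N m (\<lambda>i. 0) = 0"
  by (simp_all add: kappa_def)

locale sign_graph = P_graph P \<Lambda> + comm_monoid P
  for P :: "('p, 'm) degree_monoid_scheme" and \<Lambda> :: "('a, 'p) deg_category" +
  assumes rowfin: "row_finite P \<Lambda>"
    and red_one: "red P \<one>\<^bsub>P\<^esub> = (\<lambda>i. 0)"
    and red_mult: "\<lbrakk>p \<in> carrier P; q \<in> carrier P\<rbrakk> \<Longrightarrow> red P (p \<otimes>\<^bsub>P\<^esub> q) = (\<lambda>i. red P p i + red P q i)"
begin

sublocale twisted_graph P \<Lambda> "sign_cocycle P \<Lambda>"
  by unfold_locales (simp_all add: rowfin sign_cocycle_def bit_sign_def deg_ident red_one)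

lemma red_comp: "\<lbrakk>x \<in> arr \<Lambda>; y \<in> arr \<Lambda>; src \<Lambda> x = rng \<Lambda> y\<rbrakk> \<Longrightarrow>
    red P (degr \<Lambda> (cmp \<Lambda> x y)) = (\<lambda>i. red P (degr \<Lambda> x) i + red P (degr \<Lambda> y) i)"
  by (simp add: deg_comp red_mult deg_closed)

lemma deg_parity_comp: "\<lbrakk>x \<in> arr \<Lambda>; y \<in> arr \<Lambda>; src \<Lambda> x = rng \<Lambda> y\<rbrakk> \<Longrightarrow>
    deg_parity P \<Lambda> (cmp \<Lambda> x y) = deg_parity P \<Lambda> x + deg_parity P \<Lambda> y"
  by (simp add: deg_parity_def red_comp sum.distrib)

end

text \<open>The powers of \<open>e\<close> are cofinal for divisibility, so appending paths of
  degree \<open>e\<close> forever produces initial segments of every degree. Cancellation makes the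
  segment of a given degree unique.\<close>

locale path_graph = sign_graph P \<Lambda>
  for P :: "('p, 'm) degree_monoid_scheme" and \<Lambda> :: "('a, 'p) deg_category" and e :: 'p +
  assumes nosources: "no_sources P \<Lambda>"
    and cancel: "\<lbrakk>p \<in> carrier P; q \<in> carrier P; r \<in> carrier P; p \<otimes>\<^bsub>P\<^esub> q = p \<otimes>\<^bsub>P\<^esub> r\<rbrakk> \<Longrightarrow> q = r"
    and e_closed: "e \<in> carrier P"
    and cofinal: "p \<in> carrier P \<Longrightarrow> \<exists>n::nat. \<exists>q\<in>carrier P. e [^]\<^bsub>P\<^esub> n = p \<otimes>\<^bsub>P\<^esub> q"
begin

definition prefix :: "'a \<Rightarrow> 'a \<Rightarrow> bool" where
  "prefix x z \<longleftrightarrow> x \<in> arr \<Lambda> \<and> (\<exists>u\<in>arr \<Lambda>. src \<Lambda> x = rng \<Lambda> u \<and> z = cmp \<Lambda> x u)"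

lemma prefixI: "\<lbrakk>x \<in> arr \<Lambda>; u \<in> arr \<Lambda>; src \<Lambda> x = rng \<Lambda> u\<rbrakk> \<Longrightarrow> prefix x (cmp \<Lambda> x u)"
  unfolding prefix_def by blast

lemma prefixE:
  assumes "prefix x z"
  obtains u where "x \<in> arr \<Lambda>" "u \<in> arr \<Lambda>" "src \<Lambda> x = rng \<Lambda> u" "z = cmp \<Lambda> x u" "z \<in> arr \<Lambda>" "rng \<Lambda> z = rng \<Lambda> x"
    "degr \<Lambda> z = degr \<Lambda> x \<otimes>\<^bsub>P\<^esub> degr \<Lambda> u"
  using assms by (auto simp: prefix_def comp_closed rng_comp deg_comp)

lemma prefix_trans:
  assumes "prefix x y" "prefix y z"
  shows "prefix x z"
proof -
  obtain u where u: "x \<in> arr \<Lambda>" "u \<in> arr \<Lambda>" "src \<Lambda> x = rng \<Lambda> u" "y = cmp \<Lambda> x u" by (rule prefixE[OF assms(1)])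
  obtain w where w: "w \<in> arr \<Lambda>" "src \<Lambda> y = rng \<Lambda> w" "z = cmp \<Lambda> y w" by (rule prefixE[OF assms(2)])
  have "src \<Lambda> u = rng \<Lambda> w" using u w by (simp add: src_comp)
  then have "z = cmp \<Lambda> x (cmp \<Lambda> u w)" "cmp \<Lambda> u w \<in> arr \<Lambda>" "src \<Lambda> x = rng \<Lambda> (cmp \<Lambda> u w)"
    using u w by (simp_all add: comp_assoc comp_closed rng_comp)
  then show ?thesis using prefixI[OF u(1)] by simp
qed

lemma prefix_unique:
  assumes "prefix x z" "prefix x' z" "degr \<Lambda> x = degr \<Lambda> x'"
  shows "x = x'"
proof -
  obtain u where u: "x \<in> arr \<Lambda>" "u \<in> arr \<Lambda>" "src \<Lambda> x = rng \<Lambda> u" "z = cmp \<Lambda> x u"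
    "degr \<Lambda> z = degr \<Lambda> x \<otimes>\<^bsub>P\<^esub> degr \<Lambda> u" by (rule prefixE[OF assms(1)])
  obtain u' where u': "x' \<in> arr \<Lambda>" "u' \<in> arr \<Lambda>" "src \<Lambda> x' = rng \<Lambda> u'" "z = cmp \<Lambda> x' u'"
    "degr \<Lambda> z = degr \<Lambda> x' \<otimes>\<^bsub>P\<^esub> degr \<Lambda> u'" by (rule prefixE[OF assms(2)])
  have "degr \<Lambda> u = degr \<Lambda> u'"
    by (rule cancel[of "degr \<Lambda> x"]) (use u u' assms(3) in \<open>simp_all add: deg_closed\<close>)
  then show ?thesis using factor_unique[of x u x' u'] u u' assms(3) by simp
qed

lemma prefix_exists:
  assumes "z \<in> arr \<Lambda>" "degr \<Lambda> z = p \<otimes>\<^bsub>P\<^esub> q" "p \<in> carrier P" "q \<in> carrier P"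
  obtains x where "prefix x z" "degr \<Lambda> x = p"
  by (rule factorE[OF assms(1,3,4,2)]) (use prefixI that in blast)

lemma prefix_compare:
  assumes "prefix x z" "prefix x' z" "degr \<Lambda> x' = degr \<Lambda> x \<otimes>\<^bsub>P\<^esub> r" "r \<in> carrier P"
  shows "prefix x x'"
proof -
  have arr: "x \<in> arr \<Lambda>" "x' \<in> arr \<Lambda>" using assms by (simp_all add: prefix_def)
  obtain w where w: "prefix w x'" "degr \<Lambda> w = degr \<Lambda> x"
    by (rule prefix_exists[OF arr(2) assms(3) deg_closed[OF arr(1)] assms(4)])
  have "w = x" by (rule prefix_unique[OF prefix_trans[OF w(1) assms(2)] assms(1) w(2)])
  then show ?thesis using w by simp
qed

lemma prefix_cmp:
  assumes "prefix y y'" "x \<in> arr \<Lambda>" "src \<Lambda> x = rng \<Lambda> y"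
  shows "prefix (cmp \<Lambda> x y) (cmp \<Lambda> x y')"
proof -
  obtain u where u: "y \<in> arr \<Lambda>" "u \<in> arr \<Lambda>" "src \<Lambda> y = rng \<Lambda> u" "y' = cmp \<Lambda> y u" by (rule prefixE[OF assms(1)])
  then have "cmp \<Lambda> x y' = cmp \<Lambda> (cmp \<Lambda> x y) u" using assms by (simp add: comp_assoc)
  then show ?thesis using u assms by (auto intro!: prefixI simp: comp_closed src_comp)
qed

lemma cmp_cancel:
  assumes "cmp \<Lambda> x y = cmp \<Lambda> x y'" "x \<in> arr \<Lambda>" "y \<in> arr \<Lambda>" "y' \<in> arr \<Lambda>" "src \<Lambda> x = rng \<Lambda> y" "src \<Lambda> x = rng \<Lambda> y'"
  shows "y = y'"
proof -
  have "degr \<Lambda> x \<otimes>\<^bsub>P\<^esub> degr \<Lambda> y = degr \<Lambda> x \<otimes>\<^bsub>P\<^esub> degr \<Lambda> y'"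
    using assms by (simp add: deg_comp[symmetric])
  then have "degr \<Lambda> y = degr \<Lambda> y'" by (rule cancel[rotated 3]) (use assms in \<open>simp_all add: deg_closed\<close>)
  then show ?thesis using factor_unique[of x y x y'] assms by simp
qed

text \<open>An infinite path is given by its initial segments, one of each degree.\<close>

definition paths :: "('p \<Rightarrow> 'a) set" where
  "paths = {y \<in> extensional (carrier P). (\<forall>p\<in>carrier P. degr \<Lambda> (y p) = p) \<and>
     (\<forall>p\<in>carrier P. \<forall>q\<in>carrier P. prefix (y p) (y (p \<otimes>\<^bsub>P\<^esub> q)))}"

lemma pathsD:
  assumes "y \<in> paths" "p \<in> carrier P"
  shows "degr \<Lambda> (y p) = p" "y p \<in> arr \<Lambda>" "q \<in> carrier P \<Longrightarrow> prefix (y p) (y (p \<otimes>\<^bsub>P\<^esub> q))"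
    "rng \<Lambda> (y p) = y \<one>\<^bsub>P\<^esub>"
proof -
  show 1: "degr \<Lambda> (y p) = p" "q \<in> carrier P \<Longrightarrow> prefix (y p) (y (p \<otimes>\<^bsub>P\<^esub> q))" for q
    using assms by (simp_all add: paths_def)
  show "y p \<in> arr \<Lambda>" using 1(2)[OF one_closed] by (simp add: prefix_def)
  have "prefix (y \<one>\<^bsub>P\<^esub>) (y (\<one>\<^bsub>P\<^esub> \<otimes>\<^bsub>P\<^esub> p))"
    using assms(1) one_closed assms(2) unfolding paths_def by blast
  then have "prefix (y \<one>\<^bsub>P\<^esub>) (y p)" using assms by simp
  then have "rng \<Lambda> (y p) = rng \<Lambda> (y \<one>\<^bsub>P\<^esub>)" "y \<one>\<^bsub>P\<^esub> \<in> arr \<Lambda>" by (auto elim: prefixE)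
  moreover have "degr \<Lambda> (y \<one>\<^bsub>P\<^esub>) = \<one>\<^bsub>P\<^esub>" using assms by (simp add: paths_def)
  ultimately show "rng \<Lambda> (y p) = y \<one>\<^bsub>P\<^esub>" by (simp add: vertex_ident vertices_def level_def)
qed

lemma paths_eqI: "\<lbrakk>y \<in> paths; y' \<in> paths; \<And>p. p \<in> carrier P \<Longrightarrow> y p = y' p\<rbrakk> \<Longrightarrow> y = y'"
  by (rule extensionalityI[of _ "carrier P"]) (simp_all add: paths_def)

text \<open>Read as \<open>z = x y\<close> for a finite path \<open>x\<close> and infinite paths
  \<open>z\<close> and \<open>y\<close>. It is a relation because the composite exists only if
  \<open>y\<close> starts at the source of \<open>x\<close>; for fixed \<open>x\<close> each of
  \<open>z\<close> and \<open>y\<close> determines the other.\<close>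

definition shift :: "'a \<Rightarrow> ('p \<Rightarrow> 'a) \<Rightarrow> ('p \<Rightarrow> 'a) \<Rightarrow> bool" where
  "shift x z y \<longleftrightarrow> x \<in> arr \<Lambda> \<and> z \<in> paths \<and> y \<in> paths \<and> y \<one>\<^bsub>P\<^esub> = src \<Lambda> x \<and>
     (\<forall>p\<in>carrier P. z (degr \<Lambda> x \<otimes>\<^bsub>P\<^esub> p) = cmp \<Lambda> x (y p))"

lemma shiftD:
  assumes "shift x z y"
  shows "x \<in> arr \<Lambda>" "z \<in> paths" "y \<in> paths" "y \<one>\<^bsub>P\<^esub> = src \<Lambda> x"
    "p \<in> carrier P \<Longrightarrow> z (degr \<Lambda> x \<otimes>\<^bsub>P\<^esub> p) = cmp \<Lambda> x (y p)" "z (degr \<Lambda> x) = x" "z \<one>\<^bsub>P\<^esub> = rng \<Lambda> x"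
    "p \<in> carrier P \<Longrightarrow> src \<Lambda> x = rng \<Lambda> (y p)"
proof -
  show 1: "x \<in> arr \<Lambda>" "z \<in> paths" "y \<in> paths" "y \<one>\<^bsub>P\<^esub> = src \<Lambda> x"
    "p \<in> carrier P \<Longrightarrow> z (degr \<Lambda> x \<otimes>\<^bsub>P\<^esub> p) = cmp \<Lambda> x (y p)" for p
    using assms by (simp_all add: shift_def)
  show 2: "z (degr \<Lambda> x) = x" using 1(1,4) 1(5)[of "\<one>\<^bsub>P\<^esub>"] by (simp add: deg_closed comp_src)
  show "z \<one>\<^bsub>P\<^esub> = rng \<Lambda> x" using pathsD(4)[OF 1(2) deg_closed[OF 1(1)]] 2 by simp
  show "p \<in> carrier P \<Longrightarrow> src \<Lambda> x = rng \<Lambda> (y p)" using pathsD(4)[OF 1(3)] 1(4) by simp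
qed

lemma shift_right_unique:
  assumes "shift x z y" "shift x z y'"
  shows "y = y'"
proof (rule paths_eqI)
  fix p assume p: "p \<in> carrier P"
  show "y p = y' p"
    by (rule cmp_cancel[of x]) (use shiftD[OF assms(1)] shiftD[OF assms(2)] p pathsD(2) in simp_all)
qed (use shiftD assms in blast)+

text \<open>\<open>z\<close> is prescribed only at multiples of the degree of \<open>x\<close>. But
  \<open>z p\<close> is the initial segment of degree \<open>p\<close> of such a value, and this
  segment is unique.\<close>

lemma shift_left_unique:
  assumes "shift x z y" "shift x z' y"
  shows "z = z'"
proof (rule paths_eqI)
  fix p assume p: "p \<in> carrier P"
  have x: "degr \<Lambda> x \<in> carrier P" using shiftD(1)[OF assms(1)] by (rule deg_closed)
  have "prefix (z p) (cmp \<Lambda> x (y p))" "prefix (z' p) (cmp \<Lambda> x (y p))"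
    using pathsD(3)[OF shiftD(2)[OF assms(1)] p x] pathsD(3)[OF shiftD(2)[OF assms(2)] p x]
      shiftD(5)[OF assms(1) p] shiftD(5)[OF assms(2) p] m_comm[OF p x] by simp_all
  then show "z p = z' p"
    by (rule prefix_unique) (use shiftD(2) assms p in \<open>simp add: pathsD(1)\<close>)
qed (use shiftD assms in blast)+

lemma shift_vertex:
  assumes "v \<in> vertices P \<Lambda>"
  shows "shift v z y \<longleftrightarrow> z = y \<and> y \<in> paths \<and> y \<one>\<^bsub>P\<^esub> = v"
proof -
  have deg: "degr \<Lambda> v = \<one>\<^bsub>P\<^esub>" "v \<in> arr \<Lambda>" using assms by (simp_all add: vertices_def level_def)
  have self: "shift v y y" if "y \<in> paths" "y \<one>\<^bsub>P\<^esub> = v" for y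
    using that deg comp_rng[OF pathsD(2)[OF that(1)]] pathsD(4)[OF that(1)]
    by (simp add: shift_def vertex_ident assms)
  have "z = y" if "shift v z y"
    by (rule shift_left_unique[OF that self]) (use shiftD[OF that] in \<open>simp_all add: vertex_ident assms\<close>)
  then show ?thesis using self shiftD(3,4)[of v z y] vertex_ident[OF assms] by auto
qed

lemma shift_comp:
  assumes "shift x z y" "shift x' y w"
  shows "shift (cmp \<Lambda> x x') z w"
proof -
  note x = shiftD[OF assms(1)] note x' = shiftD[OF assms(2)]
  have eq: "src \<Lambda> x = rng \<Lambda> x'" using x(4) x'(7) by simp
  have "z (degr \<Lambda> (cmp \<Lambda> x x') \<otimes>\<^bsub>P\<^esub> p) = cmp \<Lambda> (cmp \<Lambda> x x') (w p)" if p: "p \<in> carrier P" for p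
  proof -
    have "z (degr \<Lambda> (cmp \<Lambda> x x') \<otimes>\<^bsub>P\<^esub> p) = z (degr \<Lambda> x \<otimes>\<^bsub>P\<^esub> (degr \<Lambda> x' \<otimes>\<^bsub>P\<^esub> p))"
      using p x(1) x'(1) eq by (simp add: deg_comp deg_closed m_assoc)
    also have "\<dots> = cmp \<Lambda> x (cmp \<Lambda> x' (w p))" using p x'(1) by (simp add: x(5) x'(5) deg_closed)
    also have "\<dots> = cmp \<Lambda> (cmp \<Lambda> x x') (w p)"
      using x(1) x'(1) eq pathsD(2)[OF x'(3) p] x'(8)[OF p] by (simp add: comp_assoc)
    finally show ?thesis .
  qed
  then show ?thesis using x x' eq by (simp add: shift_def comp_closed src_comp)
qed

lemma shift_factor:
  assumes z: "z \<in> paths" and m: "m \<in> carrier P"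
  obtains y where "shift (z m) z y"
proof -
  have "\<exists>u\<in>arr \<Lambda>. src \<Lambda> (z m) = rng \<Lambda> u \<and> z (m \<otimes>\<^bsub>P\<^esub> p) = cmp \<Lambda> (z m) u" if "p \<in> carrier P" for p
    using pathsD(3)[OF z m that] unfolding prefix_def by blast
  then obtain u where u: "\<And>p. p \<in> carrier P \<Longrightarrow> u p \<in> arr \<Lambda>" "\<And>p. p \<in> carrier P \<Longrightarrow> src \<Lambda> (z m) = rng \<Lambda> (u p)"
    "\<And>p. p \<in> carrier P \<Longrightarrow> z (m \<otimes>\<^bsub>P\<^esub> p) = cmp \<Lambda> (z m) (u p)" by metis
  note zm = pathsD[OF z m]
  have deg: "degr \<Lambda> (u p) = p" if p: "p \<in> carrier P" for p
  proof (rule cancel[of m])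
    show "m \<otimes>\<^bsub>P\<^esub> degr \<Lambda> (u p) = m \<otimes>\<^bsub>P\<^esub> p"
      using deg_comp[OF zm(2) u(1)[OF p] u(2)[OF p]] u(3)[OF p] pathsD(1)[OF z m_closed[OF m p]] zm(1) by simp
  qed (use p m u deg_closed in simp_all)
  have pre: "prefix (u p) (u (p \<otimes>\<^bsub>P\<^esub> q))" if p: "p \<in> carrier P" and q: "q \<in> carrier P" for p q
  proof -
    have pq: "p \<otimes>\<^bsub>P\<^esub> q \<in> carrier P" using p q by simp
    have "prefix (cmp \<Lambda> (z m) (u p)) (cmp \<Lambda> (z m) (u (p \<otimes>\<^bsub>P\<^esub> q)))"
      using pathsD(3)[OF z m_closed[OF m p] q] u(3)[OF p] u(3)[OF pq] m p q by (simp add: m_assoc)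
    then obtain w where w: "w \<in> arr \<Lambda>" "src \<Lambda> (cmp \<Lambda> (z m) (u p)) = rng \<Lambda> w"
      "cmp \<Lambda> (z m) (u (p \<otimes>\<^bsub>P\<^esub> q)) = cmp \<Lambda> (cmp \<Lambda> (z m) (u p)) w" by (rule prefixE)
    have sw: "src \<Lambda> (u p) = rng \<Lambda> w" using w(2) zm(2) u(1,2)[OF p] by (simp add: src_comp)
    have "u (p \<otimes>\<^bsub>P\<^esub> q) = cmp \<Lambda> (u p) w"
    proof (rule cmp_cancel[of "z m"])
      show "cmp \<Lambda> (z m) (u (p \<otimes>\<^bsub>P\<^esub> q)) = cmp \<Lambda> (z m) (cmp \<Lambda> (u p) w)"
        unfolding w(3) using zm(2) u(1,2)[OF p] w(1) sw by (simp add: comp_assoc)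
    qed (use zm(2) u(1)[OF p] u(1)[OF pq] u(2)[OF p, symmetric] u(2)[OF pq, symmetric] w(1) sw in
        \<open>simp_all add: comp_closed rng_comp\<close>)
    then show ?thesis using prefixI[OF u(1)[OF p] w(1) sw] by simp
  qed
  define y where "y = restrict u (carrier P)"
  have y: "y \<in> paths" using deg pre by (simp add: paths_def y_def)
  have "y \<one>\<^bsub>P\<^esub> = src \<Lambda> (z m)" using pathsD(4)[OF y one_closed] u(2)[OF one_closed] by (simp add: y_def)
  then have "shift (z m) z y" using z y zm u(3) by (simp add: shift_def y_def)
  then show thesis by (rule that)
qed

lemma shift_exists:
  assumes x: "x \<in> arr \<Lambda>" and y: "y \<in> paths" "y \<one>\<^bsub>P\<^esub> = src \<Lambda> x"
  obtains z where "shift x z y"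
proof -
  define m where "m = degr \<Lambda> x"
  have m: "m \<in> carrier P" using x by (simp add: m_def deg_closed)
  have sy: "src \<Lambda> x = rng \<Lambda> (y p)" if "p \<in> carrier P" for p using pathsD(4)[OF y(1) that] y(2) by simp
  have arr: "cmp \<Lambda> x (y p) \<in> arr \<Lambda>" "degr \<Lambda> (cmp \<Lambda> x (y p)) = m \<otimes>\<^bsub>P\<^esub> p" if "p \<in> carrier P" for p
    using x pathsD[OF y(1) that] sy[OF that] that by (simp_all add: comp_closed deg_comp m_def)
  \<comment> \<open>The segment of degree \<open>p\<close> of the composite is cut out of
    \<open>x\<close> followed by \<open>y p\<close>, whose degree is a multiple of
    \<open>p\<close>.\<close>
  have "\<exists>w. prefix w (cmp \<Lambda> x (y p)) \<and> degr \<Lambda> w = p" if p: "p \<in> carrier P" for p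
    using prefix_exists[OF arr(1)[OF p] _ p m] arr(2)[OF p] m_comm[OF m p] by metis
  then obtain w where w: "\<And>p. p \<in> carrier P \<Longrightarrow> prefix (w p) (cmp \<Lambda> x (y p))"
    "\<And>p. p \<in> carrier P \<Longrightarrow> degr \<Lambda> (w p) = p" by metis
  have mono: "prefix (cmp \<Lambda> x (y p)) (cmp \<Lambda> x (y (p \<otimes>\<^bsub>P\<^esub> q)))" if "p \<in> carrier P" "q \<in> carrier P" for p q
    by (rule prefix_cmp[OF pathsD(3)[OF y(1) that] x sy[OF that(1)]])
  have pre: "prefix (w p) (w (p \<otimes>\<^bsub>P\<^esub> q))" if p: "p \<in> carrier P" and q: "q \<in> carrier P" for p q
    by (rule prefix_compare[OF prefix_trans[OF w(1)[OF p] mono[OF p q]] w(1), of q])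
      (use p q w(2) in simp_all)
  define z where "z = restrict w (carrier P)"
  have z: "z \<in> paths" using w(2) pre by (simp add: paths_def z_def)
  have "w (m \<otimes>\<^bsub>P\<^esub> p) = cmp \<Lambda> x (y p)" if p: "p \<in> carrier P" for p
  proof (rule prefix_unique)
    have mp: "m \<otimes>\<^bsub>P\<^esub> p \<in> carrier P" using m p by simp
    show "prefix (w (m \<otimes>\<^bsub>P\<^esub> p)) (cmp \<Lambda> x (y (m \<otimes>\<^bsub>P\<^esub> p)))" by (rule w(1)[OF mp])
    show "prefix (cmp \<Lambda> x (y p)) (cmp \<Lambda> x (y (m \<otimes>\<^bsub>P\<^esub> p)))" using mono[OF p m] m_comm[OF m p] by simp
    show "degr \<Lambda> (w (m \<otimes>\<^bsub>P\<^esub> p)) = degr \<Lambda> (cmp \<Lambda> x (y p))" using w(2)[OF mp] arr(2)[OF p] by simp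
  qed
  then have "shift x z y" using x y z m by (simp add: shift_def z_def flip: m_def)
  then show thesis by (rule that)
qed

lemma path_exists:
  assumes v: "v \<in> vertices P \<Lambda>"
  obtains y where "y \<in> paths" "y \<one>\<^bsub>P\<^esub> = v"
proof -
  have ex: "\<exists>u. u \<in> arr \<Lambda> \<and> degr \<Lambda> u = e \<and> rng \<Lambda> u = src \<Lambda> x" if "x \<in> arr \<Lambda>" for x
    using nosources e_closed src_vertex[OF that] by (fastforce simp: no_sources_def level_at_def level_def)
  define nxt where "nxt x = cmp \<Lambda> x (SOME u. u \<in> arr \<Lambda> \<and> degr \<Lambda> u = e \<and> rng \<Lambda> u = src \<Lambda> x)" for x
  \<comment> \<open>Segments whose degrees are the powers of \<open>e\<close>; the segment of an
    arbitrary degree is later cut out of a sufficiently late member.\<close>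
  define w where "w n = (nxt ^^ n) v" for n
  have nxt: "prefix x (nxt x)" "degr \<Lambda> (nxt x) = degr \<Lambda> x \<otimes>\<^bsub>P\<^esub> e" "nxt x \<in> arr \<Lambda>" if "x \<in> arr \<Lambda>" for x
    using someI_ex[OF ex[OF that]] that unfolding nxt_def by (auto intro!: prefixI simp: deg_comp comp_closed)
  have w: "w n \<in> arr \<Lambda> \<and> degr \<Lambda> (w n) = e [^]\<^bsub>P\<^esub> n" for n
    using v by (induct n) (auto simp: w_def nxt vertices_def level_def)
  have "prefix (w n) (w (n + k))" for n k
  proof (induct k)
    case 0
    show ?case using prefixI[of "w n" "src \<Lambda> (w n)"] w[of n] by (simp add: comp_src src_ident src_closed)
  next
    case (Suc k)
    then show ?case using prefix_trans[OF Suc nxt(1)] w[of "n + k"] by (simp add: w_def)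
  qed
  then have mono: "prefix (w n) (w k)" if "n \<le> k" for n k using that by (metis le_add_diff_inverse)
  have "\<exists>x n. prefix x (w n) \<and> degr \<Lambda> x = p" if p: "p \<in> carrier P" for p
  proof -
    obtain n :: nat and q where "e [^]\<^bsub>P\<^esub> n = p \<otimes>\<^bsub>P\<^esub> q" "q \<in> carrier P" using cofinal[OF p] by blast
    then show ?thesis using prefix_exists[of "w n" p q] w[of n] p by metis
  qed
  then obtain u n where u: "\<And>p. p \<in> carrier P \<Longrightarrow> prefix (u p) (w (n p))" "\<And>p. p \<in> carrier P \<Longrightarrow> degr \<Lambda> (u p) = p"
    by metis
  have pre: "prefix (u p) (u (p \<otimes>\<^bsub>P\<^esub> q))" if p: "p \<in> carrier P" and q: "q \<in> carrier P" for p q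
  proof (rule prefix_compare[where r = q])
    let ?N = "max (n p) (n (p \<otimes>\<^bsub>P\<^esub> q))"
    show "prefix (u p) (w ?N)" "prefix (u (p \<otimes>\<^bsub>P\<^esub> q)) (w ?N)"
      using prefix_trans[OF u(1) mono] p q by (simp_all add: max.coboundedI1 max.coboundedI2)
  qed (use u(2) p q in simp_all)
  define y where "y = restrict u (carrier P)"
  have y: "y \<in> paths" using u(2) pre by (simp add: paths_def y_def)
  moreover have "u \<one>\<^bsub>P\<^esub> = v"
  proof (rule prefix_unique[OF u(1)[OF one_closed]])
    show "prefix v (w (n \<one>\<^bsub>P\<^esub>))" using mono[of 0] by (simp add: w_def)
    show "degr \<Lambda> (u \<one>\<^bsub>P\<^esub>) = degr \<Lambda> v" using u(2)[OF one_closed] v by (simp add: vertices_def level_def)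
  qed
  ultimately show thesis using that by (simp add: y_def)
qed

end

section \<open>Twisted shift operators on the path space and their parity\<close>

lemma ip_sum_left: "ip (sum f I) y = (\<Sum>i\<in>I. ip (f i) y)"
  by (induct I rule: infinite_finite_induct) (simp_all add: ip_add_left, simp_all add: ip_def)

lemma ip_sum_right: "ip y (sum f I) = (\<Sum>i\<in>I. ip y (f i))"
  by (induct I rule: infinite_finite_induct) (simp_all add: ip_add_right, simp_all add: ip_def)

lemma vec_scale_single [simp]: "vec_scale z (Poly_Mapping.single i c) = Poly_Mapping.single i (z * c)"
  by (rule poly_mapping_eqI) (simp add: lookup_single when_def)

lemma vec_scale_simps [simp]: "vec_scale z 0 = 0" "vec_scale 0 x = 0"
  by (rule poly_mapping_eqI, simp)+

text \<open>Unspecified unless \<open>F'\<close> is the conjugate transpose of \<open>F\<close>.\<close>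

definition of_columns :: "('i \<Rightarrow> 'i vec) \<Rightarrow> ('i \<Rightarrow> 'i vec) \<Rightarrow> 'i adjointable" where
  "of_columns F F' =
     adjointable (\<lambda>x. \<Sum>i\<in>Poly_Mapping.keys x. vec_scale (Poly_Mapping.lookup x i) (F i))
       (\<lambda>x. \<Sum>i\<in>Poly_Mapping.keys x. vec_scale (Poly_Mapping.lookup x i) (F' i))"

lemma ap_of_columns:
  assumes "\<And>i j. Poly_Mapping.lookup (F i) j = cnj (Poly_Mapping.lookup (F' j) i)"
  shows "ap (of_columns F F') (Poly_Mapping.single i c) = vec_scale c (F i)"
    "ap (star (of_columns F F')) (Poly_Mapping.single i c) = vec_scale c (F' i)"
proof -
  let ?T = "\<lambda>F x. \<Sum>i\<in>Poly_Mapping.keys x. vec_scale (Poly_Mapping.lookup x i) (F i)"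
  have "ip (?T F x) y = ip x (?T F' y)" for x y
  proof -
    have "ip (?T F x) y = (\<Sum>i\<in>Poly_Mapping.keys x. \<Sum>j\<in>Poly_Mapping.keys y.
        cnj (Poly_Mapping.lookup x i) * (Poly_Mapping.lookup (F' j) i * Poly_Mapping.lookup y j))"
      by (simp add: ip_sum_left ip_superset[of "Poly_Mapping.keys y" _ y] assms sum_distrib_left)
    also have "\<dots> = (\<Sum>j\<in>Poly_Mapping.keys y. \<Sum>i\<in>Poly_Mapping.keys x.
        cnj (Poly_Mapping.lookup x i) * (Poly_Mapping.lookup (F' j) i * Poly_Mapping.lookup y j))"
      by (rule sum.swap)
    also have "\<dots> = ip x (?T F' y)"
      by (simp add: ip_sum_right ip_superset[of "Poly_Mapping.keys x" x] sum_distrib_left mult_ac)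
    finally show ?thesis .
  qed
  then have "ap (of_columns F F') x = ?T F x" "ap (star (of_columns F F')) x = ?T F' x" for x
    by (simp_all add: of_columns_def ap_adjointable ap_star)
  then show "ap (of_columns F F') (Poly_Mapping.single i c) = vec_scale c (F i)"
    "ap (star (of_columns F F')) (Poly_Mapping.single i c) = vec_scale c (F' i)"
    by (cases "c = 0"; simp)+
qed

lemma bit_sign_mult: "bit_sign i * bit_sign j = bit_sign (i + j)"
  by (simp add: bit_sign_add)

lemma bit_cancel: "(\<lambda>i. r i + (r i + g i :: bit)) = g"
  proof
  fix i
  show "r i + (r i + g i) = g i" using bit_cases[of "r i"] bit_cases[of "g i"] by auto
qed

context path_graph
begin

abbreviation "rd x \<equiv> red P (degr \<Lambda> x)"

abbreviation eps :: "'a \<Rightarrow> (nat \<Rightarrow> bit) \<Rightarrow> complex" where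
  "eps x g \<equiv> bit_sign (kappa (coords P) (rd x) g)"

text \<open>The twist acts on a copy of the group algebra of \<open>\<int>\<^sub>2\<^sup>k\<^sup>+\<^sup>a\<close>, tensored with the
  infinite path space.\<close>

definition path_op :: "'a \<Rightarrow> (('p \<Rightarrow> 'a) \<times> (nat \<Rightarrow> bit)) adjointable" where
  "path_op x = of_columns
     (\<lambda>(y, g). if \<exists>z. shift x z y then Poly_Mapping.single (THE z. shift x z y, \<lambda>i. rd x i + g i) (eps x g) else 0)
     (\<lambda>(z, h). if \<exists>y. shift x z y
       then Poly_Mapping.single (THE y. shift x z y, \<lambda>i. rd x i + h i) (eps x (\<lambda>i. rd x i + h i)) else 0)"

lemma path_op_lookup:
  fixes x i j
  defines "F \<equiv> \<lambda>(y, g). if \<exists>z. shift x z y then Poly_Mapping.single (THE z. shift x z y, \<lambda>i. rd x i + g i) (eps x g) else 0"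
    and "F' \<equiv> \<lambda>(z, h). if \<exists>y. shift x z y
       then Poly_Mapping.single (THE y. shift x z y, \<lambda>i. rd x i + h i) (eps x (\<lambda>i. rd x i + h i)) else 0"
  shows "Poly_Mapping.lookup (F i) j = cnj (Poly_Mapping.lookup (F' j) i)"
proof (cases i, cases j)
  fix y g z h assume ij: "i = (y, g)" "j = (z, h)"
  have the: "(THE z. shift x z y) = z" "(THE y. shift x z y) = y" if "shift x z y" for z y
    using that shift_left_unique shift_right_unique by blast+
  \<comment> \<open>Reductions modulo 2 are their own inverses, so the adjoint moves the group
    coordinate by the same amount.\<close>
  have sw: "h = (\<lambda>i. rd x i + g i) \<longleftrightarrow> g = (\<lambda>i. rd x i + h i)" using bit_cancel by metis
  have F: "Poly_Mapping.lookup (F i) j = (if shift x z y \<and> h = (\<lambda>i. rd x i + g i) then eps x g else 0)"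
    by (auto simp: F_def ij lookup_single when_def the)
  have F': "Poly_Mapping.lookup (F' j) i = (if shift x z y \<and> g = (\<lambda>i. rd x i + h i) then eps x g else 0)"
    by (auto simp: F'_def ij lookup_single when_def the)
  show ?thesis unfolding F F' sw by (simp add: bit_sign_def)
qed

lemma path_op_shift:
  assumes "shift x z y"
  shows "ap (path_op x) (Poly_Mapping.single (y, g) c) = Poly_Mapping.single (z, \<lambda>i. rd x i + g i) (c * eps x g)"
    "ap (star (path_op x)) (Poly_Mapping.single (z, h) c) =
       Poly_Mapping.single (y, \<lambda>i. rd x i + h i) (c * eps x (\<lambda>i. rd x i + h i))"
proof -
  have the: "(THE z. shift x z y) = z" "(THE y. shift x z y) = y"
    using assms shift_left_unique shift_right_unique by blast+
  show "ap (path_op x) (Poly_Mapping.single (y, g) c) = Poly_Mapping.single (z, \<lambda>i. rd x i + g i) (c * eps x g)"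
    "ap (star (path_op x)) (Poly_Mapping.single (z, h) c) =
       Poly_Mapping.single (y, \<lambda>i. rd x i + h i) (c * eps x (\<lambda>i. rd x i + h i))"
    using assms the unfolding path_op_def ap_of_columns[OF path_op_lookup] by auto
qed

lemma path_op_zero:
  "(\<And>z. \<not> shift x z y) \<Longrightarrow> ap (path_op x) (Poly_Mapping.single (y, g) c) = 0"
  "(\<And>y. \<not> shift x z y) \<Longrightarrow> ap (star (path_op x)) (Poly_Mapping.single (z, h) c) = 0"
  unfolding path_op_def ap_of_columns[OF path_op_lookup] by auto

lemma path_op_vertex:
  assumes "v \<in> vertices P \<Lambda>"
  shows "ap (path_op v) (Poly_Mapping.single (y, g) c) =
      (if y \<in> paths \<and> y \<one>\<^bsub>P\<^esub> = v then Poly_Mapping.single (y, g) c else 0)"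
    "ap (star (path_op v)) (Poly_Mapping.single (y, g) c) =
      (if y \<in> paths \<and> y \<one>\<^bsub>P\<^esub> = v then Poly_Mapping.single (y, g) c else 0)"
proof -
  have rd: "rd v = (\<lambda>i. 0)" using assms red_one by (simp add: vertices_def level_def)
  note sv = shift_vertex[OF assms]
  show "ap (path_op v) (Poly_Mapping.single (y, g) c) =
      (if y \<in> paths \<and> y \<one>\<^bsub>P\<^esub> = v then Poly_Mapping.single (y, g) c else 0)"
    "ap (star (path_op v)) (Poly_Mapping.single (y, g) c) =
      (if y \<in> paths \<and> y \<one>\<^bsub>P\<^esub> = v then Poly_Mapping.single (y, g) c else 0)"
  proof (atomize(full), cases "y \<in> paths \<and> y \<one>\<^bsub>P\<^esub> = v")
    case True
    then have "shift v y y" by (simp add: sv)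
    from path_op_shift[OF this] True
    show "ap (path_op v) (Poly_Mapping.single (y, g) c) =
        (if y \<in> paths \<and> y \<one>\<^bsub>P\<^esub> = v then Poly_Mapping.single (y, g) c else 0) \<and>
      ap (star (path_op v)) (Poly_Mapping.single (y, g) c) =
        (if y \<in> paths \<and> y \<one>\<^bsub>P\<^esub> = v then Poly_Mapping.single (y, g) c else 0)" by (simp add: rd)
  next
    case False
    then have "\<not> shift v z y" "\<not> shift v y z" for z unfolding sv by auto
    from path_op_zero(1)[of v y, OF this(1)] path_op_zero(2)[of v y, OF this(2)] False
    show "ap (path_op v) (Poly_Mapping.single (y, g) c) =
        (if y \<in> paths \<and> y \<one>\<^bsub>P\<^esub> = v then Poly_Mapping.single (y, g) c else 0) \<and>
      ap (star (path_op v)) (Poly_Mapping.single (y, g) c) =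
        (if y \<in> paths \<and> y \<one>\<^bsub>P\<^esub> = v then Poly_Mapping.single (y, g) c else 0)" by auto
  qed
qed

text \<open>On the group coordinate this is a left regular representation twisted by
  \<open>kappa\<close>. On paths it is the shift, for which the sum relation says that an infinite
  path has exactly one initial segment of each degree.\<close>

lemma path_family: "twisted_family P \<Lambda> (sign_cocycle P \<Lambda>) path_op"
proof
  fix v w x x' p
  show "star (path_op v) = path_op v" if "v \<in> vertices P \<Lambda>"
    by (rule adjointable_eqI) (metis path_op_vertex[OF that] surj_pair)
  show "path_op v * path_op v = path_op v" if "v \<in> vertices P \<Lambda>"
  proof (rule adjointable_eqI)
    fix i :: "('p \<Rightarrow> 'a) \<times> (nat \<Rightarrow> bit)"
    obtain y g where "i = (y, g)" by (cases i)
    then show "ap (path_op v * path_op v) (Poly_Mapping.single i 1) = ap (path_op v) (Poly_Mapping.single i 1)"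
      by (simp add: path_op_vertex[OF that] ap_zero)
  qed
  show "path_op v * path_op w = 0" if "v \<in> vertices P \<Lambda>" "w \<in> vertices P \<Lambda>" "v \<noteq> w"
  proof (rule adjointable_eqI)
    fix i :: "('p \<Rightarrow> 'a) \<times> (nat \<Rightarrow> bit)"
    obtain y g where "i = (y, g)" by (cases i)
    then show "ap (path_op v * path_op w) (Poly_Mapping.single i 1) = ap 0 (Poly_Mapping.single i 1)"
      using that(3) by (simp add: path_op_vertex[OF that(1)] path_op_vertex[OF that(2)] ap_zero)
  qed
  show "path_op x * path_op x' = sign_cocycle P \<Lambda> x x' *\<^sub>C path_op (cmp \<Lambda> x x')"
    if x: "x \<in> arr \<Lambda>" "x' \<in> arr \<Lambda>" "src \<Lambda> x = rng \<Lambda> x'"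
  proof (rule adjointable_eqI)
    fix i :: "('p \<Rightarrow> 'a) \<times> (nat \<Rightarrow> bit)"
    obtain w g where i: "i = (w, g)" by (cases i)
    show "ap (path_op x * path_op x') (Poly_Mapping.single i 1) =
        ap (sign_cocycle P \<Lambda> x x' *\<^sub>C path_op (cmp \<Lambda> x x')) (Poly_Mapping.single i 1)"
    proof (cases "w \<in> paths \<and> w \<one>\<^bsub>P\<^esub> = src \<Lambda> x'")
      case True
      then obtain y where y: "shift x' y w" using shift_exists x by blast
      then obtain z where z: "shift x z y" using shift_exists[OF x(1)] shiftD(2,7)[OF y] x(3) by metis
      \<comment> \<open>Bilinearity of \<open>kappa\<close>: the summand \<open>rd x'\<close> in the
        second argument yields the cocycle, and the rest combines to the sign of the composite
        path.\<close>
      have "eps x' g * eps x (\<lambda>i. rd x' i + g i) = sign_cocycle P \<Lambda> x x' * eps (cmp \<Lambda> x x') g"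
        by (simp add: bit_sign_mult sign_cocycle_def red_comp[OF x] kappa_add add_ac)
      then show ?thesis
        by (simp add: i path_op_shift(1)[OF y] path_op_shift(1)[OF z] path_op_shift(1)[OF shift_comp[OF z y]]
            red_comp[OF x] add.assoc)
    next
      case False
      then have "\<not> shift x' y w" "\<not> shift (cmp \<Lambda> x x') y w" for y
        using shiftD(3,4)[of x' y w] shiftD(3,4)[of "cmp \<Lambda> x x'" y w] src_comp[OF x] by auto
      then show ?thesis by (simp add: i path_op_zero ap_zero)
    qed
  qed
  show "star (path_op x) * path_op x = path_op (src \<Lambda> x)" if x: "x \<in> arr \<Lambda>"
  proof (rule adjointable_eqI)
    fix i :: "('p \<Rightarrow> 'a) \<times> (nat \<Rightarrow> bit)"
    obtain y g where i: "i = (y, g)" by (cases i)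
    show "ap (star (path_op x) * path_op x) (Poly_Mapping.single i 1) = ap (path_op (src \<Lambda> x)) (Poly_Mapping.single i 1)"
    proof (cases "y \<in> paths \<and> y \<one>\<^bsub>P\<^esub> = src \<Lambda> x")
      case True
      then obtain z where z: "shift x z y" using shift_exists x by blast
      show ?thesis using True
        by (simp add: i path_op_vertex[OF src_vertex[OF x]] path_op_shift[OF z] bit_cancel bit_sign_def)
    next
      case False
      then have "\<not> shift x z y" for z using shiftD(3,4)[of x z y] by auto
      then show ?thesis using False by (auto simp: i path_op_vertex[OF src_vertex[OF x]] path_op_zero ap_zero)
    qed
  qed
  show "path_op v = (\<Sum>x\<in>level_at \<Lambda> v p. path_op x * star (path_op x))"
    if v: "v \<in> vertices P \<Lambda>" and p: "p \<in> carrier P"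
  proof (rule adjointable_eqI)
    fix i :: "('p \<Rightarrow> 'a) \<times> (nat \<Rightarrow> bit)"
    obtain z h where i: "i = (z, h)" by (cases i)
    \<comment> \<open>Each summand is the projection onto the basis vectors whose path has
      \<open>x\<close> as its segment of degree \<open>p\<close>.\<close>
    have summand: "ap (path_op x * star (path_op x)) (Poly_Mapping.single i 1) =
        (if z \<in> paths \<and> z p = x then Poly_Mapping.single i 1 else 0)" if x: "x \<in> level_at \<Lambda> v p" for x
    proof (cases "z \<in> paths \<and> z p = x")
      case True
      then obtain y where "shift x z y" using shift_factor p by metis
      from path_op_shift[OF this] show ?thesis
        using True by (simp add: i bit_cancel bit_sign_def)
    next
      case False
      have "\<not> shift x z y" for y
        using False shiftD(2,6)[of x z y] x by (auto simp: level_at_def level_def)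
      then show ?thesis using False by (auto simp: i path_op_zero ap_zero)
    qed
    have "(\<Sum>x\<in>level_at \<Lambda> v p. if z \<in> paths \<and> z p = x then Poly_Mapping.single i 1 else 0) =
        (if z \<in> paths \<and> z p \<in> level_at \<Lambda> v p then Poly_Mapping.single i (1::complex) else 0)"
      using finite_level_at[OF v p] by (cases "z \<in> paths") simp_all
    moreover have "z p \<in> level_at \<Lambda> v p \<longleftrightarrow> z \<one>\<^bsub>P\<^esub> = v" if "z \<in> paths"
      using pathsD[OF that p] by (simp add: level_at_def level_def)
    ultimately show "ap (path_op v) (Poly_Mapping.single i 1) =
        ap (\<Sum>x\<in>level_at \<Lambda> v p. path_op x * star (path_op x)) (Poly_Mapping.single i 1)"
      unfolding ap_sum by (simp only: summand cong: sum.cong) (auto simp: i path_op_vertex[OF v])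
  qed
qed

text \<open>Conjugation by the parity operator implements the grading, so vector states at homogeneous
  vectors are even.\<close>

definition parity_op :: "(('p \<Rightarrow> 'a) \<times> (nat \<Rightarrow> bit)) adjointable" where
  "parity_op = of_columns (\<lambda>(y, g). Poly_Mapping.single (y, g) (bit_sign (\<Sum>i<coords P. g i)))
     (\<lambda>(y, g). Poly_Mapping.single (y, g) (bit_sign (\<Sum>i<coords P. g i)))"

lemma parity_op:
  "ap parity_op (Poly_Mapping.single (y, g) c) = Poly_Mapping.single (y, g) (c * bit_sign (\<Sum>i<coords P. g i))"
  "star parity_op = parity_op"
  "parity_op * (parity_op * T) = T"
proof -
  let ?F = "\<lambda>(y :: 'p \<Rightarrow> 'a, g :: nat \<Rightarrow> bit). Poly_Mapping.single (y, g) (bit_sign (\<Sum>i<coords P. g i))"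
  have sa: "Poly_Mapping.lookup (?F i) j = cnj (Poly_Mapping.lookup (?F j) i)" for i j
    by (cases i; cases j) (auto simp: lookup_single when_def bit_sign_def)
  note ap = ap_of_columns[of ?F ?F, OF sa, folded parity_op_def]
  show 1: "ap parity_op (Poly_Mapping.single (y, g) c) = Poly_Mapping.single (y, g) (c * bit_sign (\<Sum>i<coords P. g i))" for y g c
    using ap(1)[of "(y, g)"] by simp
  show "star parity_op = parity_op" by (rule adjointable_eqI) (simp only: ap)
  then have star: "ap (star parity_op) = ap parity_op" by simp
  have "Poly_Mapping.lookup (ap parity_op x) (y, g) = bit_sign (\<Sum>i<coords P. g i) * Poly_Mapping.lookup x (y, g)"
    for x :: "(('p \<Rightarrow> 'a) \<times> (nat \<Rightarrow> bit)) vec" and y g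
    using ip_ap(2)[of parity_op "Poly_Mapping.single (y, g) 1" x] bit_cases[of "\<Sum>i<coords P. g i"] by (auto simp: star 1)
  then have "ap parity_op (ap parity_op x) = x" for x by (intro poly_mapping_eqI) (simp add: split_paired_all)
  then show "parity_op * (parity_op * T) = T" for T by (intro ap_eqI) simp
qed

lemma parity_op_conjugate:
  assumes x: "x \<in> arr \<Lambda>"
  shows "parity_op * path_op x * parity_op = bit_sign (deg_parity P \<Lambda> x) *\<^sub>C path_op x"
proof (rule adjointable_eqI)
  fix i :: "('p \<Rightarrow> 'a) \<times> (nat \<Rightarrow> bit)"
  obtain y g where i: "i = (y, g)" by (cases i)
  show "ap (parity_op * path_op x * parity_op) (Poly_Mapping.single i 1) =
      ap (bit_sign (deg_parity P \<Lambda> x) *\<^sub>C path_op x) (Poly_Mapping.single i 1)"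
  proof (cases "\<exists>z. shift x z y")
    case True
    then obtain z where z: "shift x z y" by blast
    show ?thesis
      by (simp add: i parity_op(1) path_op_shift(1)[OF z] deg_parity_def sum.distrib bit_sign_add mult_ac)
  next
    case False
    then show ?thesis by (simp add: i parity_op(1) path_op_zero ap_zero)
  qed
qed

end

text \<open>A *-ring type seen as an algebra with a carrier, so that uniqueness of homomorphisms out
  of the free algebra applies to evaluations in it.\<close>

definition type_alg :: "'r::star_ring star_alg" where
  "type_alg = \<lparr>carrier = UNIV, vzero = 0, vplus = (+), vscale = (*\<^sub>C), vtimes = (*), adj = star\<rparr>"

lemma type_alg: "star_algebra type_alg"
  by unfold_locales
    (simp_all add: type_alg_def vminus_def algebra_simps scaleC_add_left star_ring_simps)

context path_graph
begin

text \<open>The vector state at the basis vector of an infinite path from \<open>v\<close> with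
  group coordinate \<open>0\<close>. That vector is fixed by \<open>parity_op\<close>, which makes
  the state even, and by the operator of \<open>v\<close>, which gives the value
  \<open>1\<close>.\<close>

lemma state_exists:
  assumes v: "v \<in> vertices P \<Lambda>"
  obtains \<phi> where "even_positive_functional K (parity_grading P \<Lambda>) \<phi>" "\<phi> (gen v) = 1"
proof -
  interpret T: star_algebra "type_alg :: (('p \<Rightarrow> 'a) \<times> (nat \<Rightarrow> bit)) adjointable star_alg" by (rule type_alg)
  interpret path: twisted_family P \<Lambda> "sign_cocycle P \<Lambda>" path_op by (rule path_family)
  define \<chi> where "\<chi> x = bit_sign (deg_parity P \<Lambda> x)" for x
  note \<chi> = character_sign[of "deg_parity P \<Lambda>", OF deg_parity_comp, folded \<chi>_def]
  obtain y where y: "y \<in> paths" "y \<one>\<^bsub>P\<^esub> = v" by (rule path_exists[OF v])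
  define e where "e = Poly_Mapping.single (y, \<lambda>_::nat. 0::bit) (1::complex)"
  define \<omega> where "\<omega> T = ip e (ap T e)" for T
  have Je: "ap parity_op e = e" by (simp add: e_def parity_op(1))
  have ve: "ap (path_op v) e = e" using y by (simp add: e_def path_op_vertex[OF v])
  have conj: "free_value path_op (gauge \<chi> f) = parity_op * free_value path_op f * parity_op"
    if f: "f \<in> carrier FA" for f
  proof (rule T.free_hom_unique[OF _ _ _ f])
    have fv: "free_value path_op \<in> star_hom FA type_alg"
      by (auto simp: star_hom_def type_alg_def free_value_add free_value_scale free_value_adj free_value_mult[of _ "arr \<Lambda>"])
    show "(\<lambda>f. free_value path_op (gauge \<chi> f)) \<in> star_hom FA type_alg"
      by (rule star_hom_comp[OF gauge_hom fv])
    show "(\<lambda>f. parity_op * free_value path_op f * parity_op) \<in> star_hom FA type_alg"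
      by (auto simp: star_hom_def type_alg_def free_value_add free_value_scale free_value_adj
          free_value_mult[of _ "arr \<Lambda>"] algebra_simps star_mult parity_op)
    fix x assume x: "x \<in> arr \<Lambda>"
    then show "free_value path_op (gauge \<chi> (free_gen x)) = parity_op * free_value path_op (free_gen x) * parity_op"
      by (simp add: gauge_gen free_value_scale parity_op_conjugate \<chi>_def)
  qed
  have pos: "positive_functional \<omega>" unfolding \<omega>_def by (rule vector_functional)
  have left: "\<omega> (path_op v * b) = \<omega> b" for b
    using ip_ap(1)[of "path_op v" e "ap b e"] by (simp add: \<omega>_def path.star_vertex[OF v] ve)
  have right: "\<omega> (b * path_op v) = \<omega> b" for b by (simp add: \<omega>_def ve)
  have one: "\<omega> (path_op v) = 1" by (simp add: \<omega>_def ve) (simp add: e_def)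
  have even: "\<omega> (free_value path_op (gauge \<chi> f)) = \<omega> (free_value path_op f)" if "f \<in> carrier FA" for f
    using ip_ap(1)[of parity_op e "ap (free_value path_op f) e"]
    by (simp add: \<omega>_def conj[OF that] Je parity_op(2))
  obtain \<phi> where \<phi>: "even_positive_functional K (gauge_aut \<chi>) \<phi>" "\<phi> (gen v) = 1"
    by (rule path.state_extends[OF pos v left right one even \<chi>])
  have "even_positive_functional K (parity_grading P \<Lambda>) \<phi>"
  proof -
    have "parity_grading P \<Lambda> S = gauge_aut \<chi> S" if "S \<in> carrier K" for S
      unfolding \<chi>_def by (rule gen_grading_aut[OF deg_parity_comp that])
    then show ?thesis using \<phi>(1) unfolding even_positive_functional_def by metis
  qed
  then show thesis using \<phi>(2) by (rule that)
qed

end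

section \<open>Product graphs\<close>

lemma NZ_simps:
  "carrier (NZ k a) = {(m, x). (\<forall>i\<ge>k. m i = 0) \<and> (\<forall>i\<ge>a. x i = 0)}"
  "(m, x) \<otimes>\<^bsub>NZ k a\<^esub> (m', x') = (\<lambda>i. m i + m' i, \<lambda>i. x i + x' i)"
  "\<one>\<^bsub>NZ k a\<^esub> = (\<lambda>_. 0, \<lambda>_. 0)" "coords (NZ k a) = k + a"
  "red (NZ k a) (m, x) i = (if i < k then of_nat (m i) else x (i - k))"
  by (simp_all add: NZ_def)

lemma comm_monoid_NZ: "comm_monoid (NZ k a)"
  by unfold_locales (auto simp: NZ_simps add_ac fun_eq_iff)

lemma sign_graph_NZ:
  assumes "P_graph (NZ k a) \<Lambda>" "row_finite (NZ k a) \<Lambda>"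
  shows "sign_graph (NZ k a) \<Lambda>"
proof -
  interpret P_graph "NZ k a" \<Lambda> by fact
  interpret comm_monoid "NZ k a" by (rule comm_monoid_NZ)
  show ?thesis
    by unfold_locales (use assms in \<open>auto simp: NZ_simps fun_eq_iff\<close>)
qed

lemma path_graph_NZ:
  assumes "P_graph (NZ k a) \<Lambda>" "row_finite (NZ k a) \<Lambda>" "no_sources (NZ k a) \<Lambda>"
  shows "path_graph (NZ k a) \<Lambda> (\<lambda>i. if i < k then 1 else 0, \<lambda>_. 0)"
proof -
  let ?e = "(\<lambda>i. if i < k then 1 else 0, \<lambda>_. 0) :: (nat \<Rightarrow> nat) \<times> (nat \<Rightarrow> bit)"
  interpret sign_graph "NZ k a" \<Lambda> by (rule sign_graph_NZ) fact+
  have pow: "?e [^]\<^bsub>NZ k a\<^esub> n = (\<lambda>i. if i < k then n else 0, \<lambda>_. 0)" for n :: nat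
    by (induct n) (auto simp: NZ_simps)
  show ?thesis
  proof
    fix p q r :: "(nat \<Rightarrow> nat) \<times> (nat \<Rightarrow> bit)"
    assume p: "p \<in> carrier (NZ k a)"
    obtain m x where mx: "p = (m, x)" by (cases p)
    show "q = r" if "p \<otimes>\<^bsub>NZ k a\<^esub> q = p \<otimes>\<^bsub>NZ k a\<^esub> r"
      using that by (cases q; cases r) (simp add: mx NZ_simps fun_eq_iff)
    \<comment> \<open>Any common bound of the entries \<open>m i\<close> would do. In the torsion
      coordinates \<open>x\<close> is its own inverse, so the complementary degree repeats
      \<open>x\<close>.\<close>
    define n where "n = (\<Sum>i<k. m i)"
    have le: "m i \<le> n" if "i < k" for i unfolding n_def using that by (intro member_le_sum) auto
    have xx: "x i + x i = 0" for i using bit_cases[of "x i"] by auto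
    have "(\<lambda>i. if i < k then n - m i else 0, x) \<in> carrier (NZ k a)" using p by (simp add: mx NZ_simps)
    moreover have "?e [^]\<^bsub>NZ k a\<^esub> n = p \<otimes>\<^bsub>NZ k a\<^esub> (\<lambda>i. if i < k then n - m i else 0, x)"
      using p le by (auto simp: pow mx NZ_simps fun_eq_iff xx)
    ultimately show "\<exists>n::nat. \<exists>q\<in>carrier (NZ k a). ?e [^]\<^bsub>NZ k a\<^esub> n = p \<otimes>\<^bsub>NZ k a\<^esub> q" by blast
  qed (use assms in \<open>simp_all add: NZ_simps\<close>)
qed

text \<open>\<open>kappa\<close> pairs a coordinate of its first argument with the earlier
  coordinates of the second. Across the two blocks this happens only with the first argument in the
  later block, so the cross term is a product of two parities, which is the exponent of the sign for
  exchanging tensor factors.\<close>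

lemma kappa_append:
  "kappa (N + M) (\<lambda>i. if i < N then m i else n (i - N)) (\<lambda>i. if i < N then m' i else n' (i - N)) =
    kappa N m m' + kappa M n n' + (\<Sum>i<M. n i) * (\<Sum>j<N. m' j)"
proof -
  let ?m = "\<lambda>i. if i < N then m i else n (i - N)" and ?m' = "\<lambda>i. if i < N then m' i else n' (i - N)"
  have split: "(\<Sum>i<N + M. f i) = (\<Sum>i<N. f i) + (\<Sum>i<M. f (N + i))" for f :: "nat \<Rightarrow> bit" and M
    by (induct M) (simp_all add: add.assoc)
  have "(\<Sum>i<M. \<Sum>j<N + i. ?m (N + i) * ?m' j) = (\<Sum>i<M. \<Sum>j<N. n i * m' j) + kappa M n n'"
    by (simp add: split kappa_def sum.distrib)
  moreover have "(\<Sum>i<N. \<Sum>j<i. ?m i * ?m' j) = kappa N m m'"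
    unfolding kappa_def by (intro sum.cong refl) auto
  ultimately show ?thesis
    unfolding kappa_def[of "N + M"] split by (simp add: sum_product add_ac)
qed

locale sign_graph_pair = L: sign_graph P \<Lambda> + G: sign_graph Q \<Gamma>
  for P :: "('p, 'm) degree_monoid_scheme" and \<Lambda> :: "('a, 'p) deg_category"
    and Q :: "('q, 'n) degree_monoid_scheme" and \<Gamma> :: "('b, 'q) deg_category"
begin

abbreviation "PQ \<equiv> prod_degree P Q"
abbreviation "LG \<equiv> prod_graph \<Lambda> \<Gamma>"

lemma prod_simps:
  "carrier PQ = carrier P \<times> carrier Q" "(p, q) \<otimes>\<^bsub>PQ\<^esub> (p', q') = (p \<otimes>\<^bsub>P\<^esub> p', q \<otimes>\<^bsub>Q\<^esub> q')"
  "\<one>\<^bsub>PQ\<^esub> = (\<one>\<^bsub>P\<^esub>, \<one>\<^bsub>Q\<^esub>)" "coords PQ = coords P + coords Q"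
  "red PQ (p, q) = (\<lambda>i. if i < coords P then red P p i else red Q q (i - coords P))"
  "arr LG = arr \<Lambda> \<times> arr \<Gamma>" "src LG (x, y) = (src \<Lambda> x, src \<Gamma> y)" "rng LG (x, y) = (rng \<Lambda> x, rng \<Gamma> y)"
  "cmp LG (x, y) (x', y') = (cmp \<Lambda> x x', cmp \<Gamma> y y')" "degr LG (x, y) = (degr \<Lambda> x, degr \<Gamma> y)"
  by (auto simp: prod_degree_def prod_graph_def DirProd_def)

lemma prod_level: "level LG (p, q) = level \<Lambda> p \<times> level \<Gamma> q"
  "vertices PQ LG = vertices P \<Lambda> \<times> vertices Q \<Gamma>"
  "level_at LG (v, w) (p, q) = level_at \<Lambda> v p \<times> level_at \<Gamma> w q"
  by (auto simp: vertices_def level_def level_at_def prod_simps)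

sublocale LG: sign_graph PQ LG
proof
  show "countable (arr LG)" by (simp add: prod_simps L.countable_arr G.countable_arr)
  fix x y u :: "'a \<times> 'b"
  note defs = L.src_closed L.rng_closed G.src_closed G.rng_closed L.src_ident L.rng_ident G.src_ident G.rng_ident
    L.comp_closed G.comp_closed L.src_comp G.src_comp L.rng_comp G.rng_comp L.comp_src G.comp_src L.comp_rng G.comp_rng
    L.deg_closed G.deg_closed L.deg_ident G.deg_ident L.deg_comp G.deg_comp L.comp_assoc G.comp_assoc
  obtain x1 x2 y1 y2 u1 u2 where xyu: "x = (x1, x2)" "y = (y1, y2)" "u = (u1, u2)"
    by (metis surj_pair)
  show "x \<in> arr LG \<Longrightarrow> src LG x \<in> arr LG" "x \<in> arr LG \<Longrightarrow> rng LG x \<in> arr LG"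
    "x \<in> arr LG \<Longrightarrow> src LG (src LG x) = src LG x \<and> rng LG (src LG x) = src LG x"
    "x \<in> arr LG \<Longrightarrow> src LG (rng LG x) = rng LG x \<and> rng LG (rng LG x) = rng LG x"
    "x \<in> arr LG \<Longrightarrow> cmp LG x (src LG x) = x" "x \<in> arr LG \<Longrightarrow> cmp LG (rng LG x) x = x"
    "x \<in> arr LG \<Longrightarrow> degr LG x \<in> carrier PQ"
    "x \<in> arr LG \<Longrightarrow> degr LG (src LG x) = \<one>\<^bsub>PQ\<^esub> \<and> degr LG (rng LG x) = \<one>\<^bsub>PQ\<^esub>"
    by (auto simp: xyu prod_simps defs)
  show "cmp LG x y \<in> arr LG" "src LG (cmp LG x y) = src LG y" "rng LG (cmp LG x y) = rng LG x"
    "degr LG (cmp LG x y) = degr LG x \<otimes>\<^bsub>PQ\<^esub> degr LG y"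
    if "x \<in> arr LG" "y \<in> arr LG" "src LG x = rng LG y"
    using that by (auto simp: xyu prod_simps defs)
  show "cmp LG (cmp LG x y) u = cmp LG x (cmp LG y u)"
    if "x \<in> arr LG" "y \<in> arr LG" "u \<in> arr LG" "src LG x = rng LG y" "src LG y = rng LG u"
    using that by (auto simp: xyu prod_simps defs)
  fix p q
  show "\<exists>!(y, u). y \<in> arr LG \<and> u \<in> arr LG \<and> src LG y = rng LG u \<and> degr LG y = p \<and> degr LG u = q \<and> x = cmp LG y u"
    if "x \<in> arr LG" "p \<in> carrier PQ" "q \<in> carrier PQ" "degr LG x = p \<otimes>\<^bsub>PQ\<^esub> q"
  proof -
    obtain p1 p2 q1 q2 where pq: "p = (p1, p2)" "q = (q1, q2)" by (metis surj_pair)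
    have 1: "x1 \<in> arr \<Lambda>" "x2 \<in> arr \<Gamma>" "p1 \<in> carrier P" "q1 \<in> carrier P" "p2 \<in> carrier Q" "q2 \<in> carrier Q"
      "degr \<Lambda> x1 = p1 \<otimes>\<^bsub>P\<^esub> q1" "degr \<Gamma> x2 = p2 \<otimes>\<^bsub>Q\<^esub> q2"
      using that by (simp_all add: xyu pq prod_simps)
    obtain y1 u1 where yu1: "y1 \<in> arr \<Lambda>" "u1 \<in> arr \<Lambda>" "src \<Lambda> y1 = rng \<Lambda> u1" "degr \<Lambda> y1 = p1" "degr \<Lambda> u1 = q1"
      "x1 = cmp \<Lambda> y1 u1" by (rule L.factorE[OF 1(1,3,4,7)])
    obtain y2 u2 where yu2: "y2 \<in> arr \<Gamma>" "u2 \<in> arr \<Gamma>" "src \<Gamma> y2 = rng \<Gamma> u2" "degr \<Gamma> y2 = p2" "degr \<Gamma> u2 = q2"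
      "x2 = cmp \<Gamma> y2 u2" by (rule G.factorE[OF 1(2,5,6,8)])
    show ?thesis
    proof (rule ex1I[of _ "((y1, y2), (u1, u2))"])
      show "case ((y1, y2), u1, u2) of (y, u) \<Rightarrow> y \<in> arr LG \<and> u \<in> arr LG \<and> src LG y = rng LG u \<and>
          degr LG y = p \<and> degr LG u = q \<and> x = cmp LG y u"
        using yu1 yu2 by (simp add: xyu pq prod_simps)
      fix z assume z: "case z of (y, u) \<Rightarrow> y \<in> arr LG \<and> u \<in> arr LG \<and> src LG y = rng LG u \<and>
          degr LG y = p \<and> degr LG u = q \<and> x = cmp LG y u"
      obtain y1' y2' u1' u2' where z': "z = ((y1', y2'), (u1', u2'))" by (metis surj_pair)
      then show "z = ((y1, y2), (u1, u2))"
        using z yu1 yu2 L.factor_unique[of y1' u1' y1 u1] G.factor_unique[of y2' u2' y2 u2]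
        by (simp add: xyu pq prod_simps)
    qed
  qed
next
  show "row_finite PQ LG"
    using L.finite_level_at G.finite_level_at by (auto simp: row_finite_def prod_level prod_simps)
  show "red PQ \<one>\<^bsub>PQ\<^esub> = (\<lambda>i. 0)" by (auto simp: prod_simps L.red_one G.red_one)
  fix p q assume "p \<in> carrier PQ" "q \<in> carrier PQ"
  then show "red PQ (p \<otimes>\<^bsub>PQ\<^esub> q) = (\<lambda>i. red PQ p i + red PQ q i)"
    by (cases p; cases q) (auto simp: prod_simps L.red_mult G.red_mult)
qed (auto simp: prod_simps L.m_ac G.m_ac)

lemma prod_parity: "deg_parity PQ LG (x, y) = deg_parity P \<Lambda> x + deg_parity Q \<Gamma> y"
proof -
  have split: "(\<Sum>i<N + M. f i) = (\<Sum>i<N. f i) + (\<Sum>i<M. f (N + i))" for f :: "nat \<Rightarrow> bit" and N M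
    by (induct M) (simp_all add: add.assoc)
  show ?thesis by (simp add: deg_parity_def prod_simps split)
qed

lemma prod_cocycle:
  "sign_cocycle PQ LG (x, y) (x', y') =
    bit_sign (deg_parity Q \<Gamma> y * deg_parity P \<Lambda> x') * (sign_cocycle P \<Lambda> x x' * sign_cocycle Q \<Gamma> y y')"
  by (simp add: sign_cocycle_def prod_simps kappa_append deg_parity_def bit_sign_add)

end

section \<open>Tensors of generators as a family for the product graph\<close>

context graded_cstar_pair
begin

text \<open>The elementary tensor on the type-level *-rings, where it is bilinear without side
  conditions and sums over levels can be expanded.\<close>

definition tp :: "'a star_prod \<Rightarrow> 'b star_prod \<Rightarrow> (('a \<Rightarrow> 'b \<Rightarrow> complex) \<Rightarrow> complex) star_prod" where
  "tp a b = emb X (elem_tensor A B (proj A a) (proj B b))"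

lemma proj_tp: "proj X (tp a b) = elem_tensor A B (proj A a) (proj B b)"
  by (simp add: tp_def elem_tensor_in_X)

lemma tp_linear:
  "tp (a + a') b = tp a b + tp a' b" "tp a (b + b') = tp a b + tp a b'"
  "tp (z *\<^sub>C a) b = z *\<^sub>C tp a b" "tp a (z *\<^sub>C b) = z *\<^sub>C tp a b"
  by (simp_all only: tp_def A.proj_hom B.proj_hom A.proj_closed B.proj_closed elem_tensor_linear
      elem_tensor_in_X X.emb_hom)

lemma tp_zero: "tp 0 b = 0" "tp a 0 = 0"
  using tp_linear(3)[of 0 0 b] tp_linear(4)[of a 0 0] by simp_all

lemma tp_sum: "tp (sum f I) b = (\<Sum>i\<in>I. tp (f i) b)" "tp a (sum g J) = (\<Sum>j\<in>J. tp a (g j))"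
  by (induct I rule: infinite_finite_induct; simp add: tp_linear tp_zero)
    (induct J rule: infinite_finite_induct; simp add: tp_linear tp_zero)

lemma elem_quad: "elem_tensor A B a b = tens [(i, a, j, b)]"
  by (auto simp: tens_def val_def elem_tensor_def)

lemma tp_mult:
  assumes "A.hmg i (proj A a)" "B.hmg j (proj B b)" "A.hmg i' (proj A a')" "B.hmg j' (proj B b')"
  shows "tp a b * tp a' b' = bit_sign (i' * j) *\<^sub>C tp (a * a') (b * b')"
proof -
  have q: "(i, proj A a, j, proj B b) \<in> quads" "(i', proj A a', j', proj B b') \<in> quads"
    using assms by (simp_all add: quads_def)
  have "vtimes X (elem_tensor A B (proj A a) (proj B b)) (elem_tensor A B (proj A a') (proj B b')) =
      elem_tensor A B (vscale A (bit_sign (i' * j)) (proj A (a * a'))) (proj B (b * b'))"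
    unfolding elem_quad[of "proj A a" _ i j] elem_quad[of "proj A a'" _ i' j']
    using q by (subst times_tens) (simp_all add: qtimes_def elem_quad[of _ _ "i + i'" "j + j'"])
  also have "\<dots> = vscale X (bit_sign (i' * j)) (elem_tensor A B (proj A (a * a')) (proj B (b * b')))"
    by (simp only: elem_tensor_linear(5)[OF A.proj_closed B.proj_closed])
  finally show ?thesis
    by (simp only: tp_def X.emb_hom[symmetric] elem_tensor_in_X A.proj_closed B.proj_closed)
qed

lemma tp_star:
  assumes "A.hmg i (proj A a)" "B.hmg j (proj B b)"
  shows "star (tp a b) = bit_sign (i * j) *\<^sub>C tp (star a) (star b)"
proof -
  have q: "(i, proj A a, j, proj B b) \<in> quads" using assms by (simp add: quads_def)
  have "adj X (elem_tensor A B (proj A a) (proj B b)) =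
      elem_tensor A B (vscale A (bit_sign (i * j)) (proj A (star a))) (proj B (star b))"
    unfolding elem_quad[of "proj A a" _ i j] using q
    by (subst adj_tens) (simp_all add: qadj_def elem_quad[of _ _ i j])
  also have "\<dots> = vscale X (bit_sign (i * j)) (elem_tensor A B (proj A (star a)) (proj B (star b)))"
    by (simp only: elem_tensor_linear(5)[OF A.proj_closed B.proj_closed])
  finally show ?thesis
    by (simp only: tp_def X.emb_hom[symmetric] elem_tensor_in_X A.proj_closed B.proj_closed)
qed

end

context sign_graph
begin

lemmas parity_grading = gen_grading[of "deg_parity P \<Lambda>", OF deg_parity_comp]

lemma graded_K: "graded_algebra K (parity_grading P \<Lambda>)"
  by unfold_locales (rule parity_grading)

lemma gen_homogeneous:
  assumes "x \<in> arr \<Lambda>"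
  shows "homogeneous K (parity_grading P \<Lambda>) (deg_parity P \<Lambda> x) (proj K (sg x))"
    "homogeneous K (parity_grading P \<Lambda>) (deg_parity P \<Lambda> x) (proj K (star (sg x)))"
proof -
  interpret graded_algebra K "parity_grading P \<Lambda>" by (rule graded_K)
  show 1: "homogeneous K (parity_grading P \<Lambda>) (deg_parity P \<Lambda> x) (proj K (sg x))"
    using assms by (simp add: homogeneous_def sg_def gen_closed parity_grading)
  show "homogeneous K (parity_grading P \<Lambda>) (deg_parity P \<Lambda> x) (proj K (star (sg x)))"
    using homogeneous_adj[OF 1] by simp
qed

lemma parity_vertex: "v \<in> vertices P \<Lambda> \<Longrightarrow> deg_parity P \<Lambda> v = 0"
  using red_one by (simp add: deg_parity_def vertices_def level_def)

end

context sign_graph_pair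
begin

sublocale C: graded_cstar_pair L.K "parity_grading P \<Lambda>" G.K "parity_grading Q \<Gamma>"
proof -
  interpret L': graded_algebra L.K "parity_grading P \<Lambda>" by (rule L.graded_K)
  interpret G': graded_algebra G.K "parity_grading Q \<Gamma>" by (rule G.graded_K)
  interpret L'': cstar_algebra L.K by (rule L.cstar_algebra_K)
  interpret G'': cstar_algebra G.K by (rule G.cstar_algebra_K)
  show "graded_cstar_pair L.K (parity_grading P \<Lambda>) G.K (parity_grading Q \<Gamma>)" by unfold_locales
qed

interpretation L: twisted_family P \<Lambda> "sign_cocycle P \<Lambda>" L.sg by (rule L.sg_family)
interpretation G: twisted_family Q \<Gamma> "sign_cocycle Q \<Gamma>" G.sg by (rule G.sg_family)

definition t where "t = (\<lambda>(x, y). C.tp (L.sg x) (G.sg y))"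

lemma t_star: "x \<in> arr \<Lambda> \<Longrightarrow> y \<in> arr \<Gamma> \<Longrightarrow>
    star (t (x, y)) = bit_sign (deg_parity P \<Lambda> x * deg_parity Q \<Gamma> y) *\<^sub>C C.tp (star (L.sg x)) (star (G.sg y))"
  by (simp add: t_def C.tp_star[OF L.gen_homogeneous(1) G.gen_homogeneous(1)])

lemma t_mult: "\<lbrakk>x \<in> arr \<Lambda>; y \<in> arr \<Gamma>; x' \<in> arr \<Lambda>; y' \<in> arr \<Gamma>\<rbrakk> \<Longrightarrow>
    t (x, y) * t (x', y') = bit_sign (deg_parity P \<Lambda> x' * deg_parity Q \<Gamma> y) *\<^sub>C C.tp (L.sg x * L.sg x') (G.sg y * G.sg y')"
  by (simp add: t_def C.tp_mult[OF L.gen_homogeneous(1) G.gen_homogeneous(1) L.gen_homogeneous(1) G.gen_homogeneous(1)])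

lemma t_mult_star:
  assumes "x \<in> arr \<Lambda>" "y \<in> arr \<Gamma>" "x' \<in> arr \<Lambda>" "y' \<in> arr \<Gamma>"
  shows "t (x, y) * star (t (x', y')) =
    bit_sign (deg_parity P \<Lambda> x' * deg_parity Q \<Gamma> y' + deg_parity P \<Lambda> x' * deg_parity Q \<Gamma> y) *\<^sub>C
      C.tp (L.sg x * star (L.sg x')) (G.sg y * star (G.sg y'))"
  using assms
  by (simp add: t_star) (simp add: t_def bit_sign_add
      C.tp_mult[OF L.gen_homogeneous(1) G.gen_homogeneous(1) L.gen_homogeneous(2) G.gen_homogeneous(2)])

lemma t_family: "twisted_family PQ LG (sign_cocycle PQ LG) t"
proof
  fix z z' :: "'a \<times> 'b" and p
  obtain v w v' w' where z: "z = (v, w)" "z' = (v', w')" by (metis surj_pair)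
  show "star (t z) = t z" if "z \<in> vertices PQ LG"
    using that by (simp add: z prod_level t_star L.vertices_arr G.vertices_arr L.parity_vertex
        L.star_vertex G.star_vertex) (simp add: t_def)
  show "t z * t z = t z" if "z \<in> vertices PQ LG"
    using that by (simp add: z prod_level t_mult L.vertices_arr G.vertices_arr L.parity_vertex
        L.vertex_idem G.vertex_idem) (simp add: t_def)
  show "t z * t z' = 0" if "z \<in> vertices PQ LG" "z' \<in> vertices PQ LG" "z \<noteq> z'"
  proof (cases "v = v'")
    case True
    then show ?thesis using that
      by (simp add: z prod_level t_mult L.vertices_arr G.vertices_arr G.vertex_orth C.tp_zero)
  next
    case False
    then show ?thesis using that
      by (simp add: z prod_level t_mult L.vertices_arr G.vertices_arr L.vertex_orth C.tp_zero)
  qed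
  show "t z * t z' = sign_cocycle PQ LG z z' *\<^sub>C t (cmp LG z z')"
    if "z \<in> arr LG" "z' \<in> arr LG" "src LG z = rng LG z'"
    using that by (simp add: z prod_simps t_mult prod_cocycle L.s_mult G.s_mult C.tp_linear mult.commute)
      (simp add: t_def mult_ac)
  show "star (t z) * t z = t (src LG z)" if "z \<in> arr LG"
  proof -
    have vw: "v \<in> arr \<Lambda>" "w \<in> arr \<Gamma>" using that by (simp_all add: z prod_simps)
    have "star (t z) * t z = C.tp (star (L.sg v) * L.sg v) (star (G.sg w) * G.sg w)"
      using vw by (simp add: z t_star) (simp add: t_def
          C.tp_mult[OF L.gen_homogeneous(2) G.gen_homogeneous(2) L.gen_homogeneous(1) G.gen_homogeneous(1)])
    then show ?thesis using vw by (simp add: z prod_simps t_def L.star_s_s G.star_s_s)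
  qed
  show "t z = (\<Sum>x\<in>level_at LG z p. t x * star (t x))" if "z \<in> vertices PQ LG" "p \<in> carrier PQ"
  proof -
    obtain q r where p: "p = (q, r)" by (cases p)
    have vw: "v \<in> vertices P \<Lambda>" "w \<in> vertices Q \<Gamma>" "q \<in> carrier P" "r \<in> carrier Q"
      using that by (simp_all add: z p prod_simps prod_level)
    \<comment> \<open>On the diagonal the two signs in \<open>t_mult_star\<close> are equal and
      cancel.\<close>
    have "(\<Sum>x\<in>level_at LG z p. t x * star (t x)) =
        (\<Sum>x\<in>level_at \<Lambda> v q. \<Sum>y\<in>level_at \<Gamma> w r. C.tp (L.sg x * star (L.sg x)) (G.sg y * star (G.sg y)))"
      unfolding z p prod_level sum.cartesian_product
      by (intro sum.cong refl) (auto simp: t_mult_star L.level_at_arr G.level_at_arr bit_sign_add)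
    also have "\<dots> = t z"
      by (simp add: z t_def L.vertex_sum[OF vw(1,3)] G.vertex_sum[OF vw(2,4)] C.tp_sum)
    finally show ?thesis ..
  qed
qed

end

section \<open>The universal family with its norm, and inverses of gauge automorphisms\<close>

context twisted_graph
begin

lemma normed_sg: "normed_twisted_family P \<Lambda> c sg (\<lambda>f. vnorm K (proj K f))"
proof -
  interpret twisted_family P \<Lambda> c sg by (rule sg_family)
  interpret C: cstar_algebra K by (rule cstar_algebra_K)
  show ?thesis
  proof
    fix x y
    assume xy: "x \<in> arr \<Lambda>" "y \<in> arr \<Lambda>" "vnorm K (proj K (star (sg x) * sg y)) = 0"
    define S where "S = vtimes K (adj K (gen x)) (gen y)"
    have S: "S \<in> carrier K" using xy by (simp add: S_def K.closed gen_closed)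
    have eq: "star (sg x) * sg y = emb K S"
      using xy by (simp add: S_def sg_def K.emb_hom K.closed gen_closed)
    have "S = vzero K" using C.norm_definite[OF S] xy(3) S by (simp add: eq)
    then show "star (sg x) * sg y = 0" by (simp add: eq K.emb_hom)
  qed
qed

lemma free_value_gauge:
  fixes s :: "'a \<Rightarrow> 'r::star_ring"
  assumes f: "f \<in> carrier FA"
  shows "free_value s (gauge \<chi> f) = free_value (\<lambda>x. \<chi> x *\<^sub>C s x) f"
proof -
  interpret T: star_algebra "type_alg :: 'r::star_ring star_alg" by (rule type_alg)
  have hom: "free_value s \<in> star_hom FA type_alg" for s :: "'a \<Rightarrow> 'r"
    by (auto simp: star_hom_def type_alg_def free_value_add free_value_scale free_value_adj free_value_mult[of _ "arr \<Lambda>"])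
  show ?thesis
    by (rule T.free_hom_unique[OF star_hom_comp[OF gauge_hom hom] hom _ f])
      (simp add: gauge_gen free_value_scale)
qed

text \<open>A lift of presentations as in \<open>lin\<close> to the free algebra, on which
  \<open>gauge\<close> and \<open>\<theta>\<close> are defined.\<close>

definition free_lin :: "('a \<times> 'a \<Rightarrow> complex) \<Rightarrow> ('a \<times> 'a) set \<Rightarrow> 'a free" where
  "free_lin k F = (\<Sum>z\<in>F. vscale FA (k z) (free_gen (fst z) * adj FA (free_gen (snd z))))"

lemma free_lin:
  assumes "F \<subseteq> arr \<Lambda> \<times> arr \<Lambda>"
  shows "free_lin k F \<in> carrier FA"
    "free_value s (free_lin k F) = (\<Sum>z\<in>F. k z *\<^sub>C (s (fst z) * star (s (snd z))))"
proof -
  have gen: "x \<in> arr \<Lambda> \<Longrightarrow> free_gen x \<in> carrier FA" for x by simp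
  have mem: "vscale FA (k z) (free_gen (fst z) * adj FA (free_gen (snd z))) \<in> carrier FA" if "z \<in> F" for z
  proof -
    have "fst z \<in> arr \<Lambda>" "snd z \<in> arr \<Lambda>" using assms that by auto
    then show ?thesis
      using free.times_closed[OF gen[of "fst z"] free.adj_closed[OF gen[of "snd z"]]]
      by (intro free.scale_closed) simp
  qed
  then show "free_lin k F \<in> carrier FA" unfolding free_lin_def by (rule free_sum_closed)
  have sum: "free_value s (sum f I) = (\<Sum>i\<in>I. free_value s (f i))" for f :: "'a \<times> 'a \<Rightarrow> 'a free" and I
    by (induct I rule: infinite_finite_induct) (simp_all add: free_value_add)
  have "free_value s (vscale FA (k z) (free_gen (fst z) * adj FA (free_gen (snd z)))) =
      k z *\<^sub>C (s (fst z) * star (s (snd z)))" if "z \<in> F" for z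
  proof -
    have z: "fst z \<in> arr \<Lambda>" "snd z \<in> arr \<Lambda>" using assms that by auto
    then show ?thesis
      using free.adj_closed[OF gen[OF z(2)]]
      by (simp add: free_value_scale free_value_adj free_value_mult[of _ "arr \<Lambda>"])
  qed
  then show "free_value s (free_lin k F) = (\<Sum>z\<in>F. k z *\<^sub>C (s (fst z) * star (s (snd z))))"
    unfolding free_lin_def sum by (rule sum.cong[OF refl])
qed

lemma character_mult: "character \<chi> \<Longrightarrow> character \<chi>' \<Longrightarrow> character (\<lambda>x. \<chi> x * \<chi>' x)"
  by (simp add: character_def norm_mult mult_ac)

lemma character_cnj: "character \<chi> \<Longrightarrow> character (\<lambda>x. cnj (\<chi> x))"
  by (simp add: character_def)

lemma character_one: "character (\<lambda>_. 1)"
  by (simp add: character_def)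

lemma character_norm: "character \<chi> \<Longrightarrow> x \<in> arr \<Lambda> \<Longrightarrow> \<chi> x * cnj (\<chi> x) = 1"
  using complex_norm_square[of "\<chi> x"] by (simp add: character_def)

lemma gauge_aut_inverse:
  assumes "character \<chi>" "S \<in> carrier K"
  shows "gauge_aut \<chi> (gauge_aut (\<lambda>x. cnj (\<chi> x)) S) = S"
  using gauge_aut_comp[OF assms(1) character_cnj[OF assms(1)] character_one character_norm[OF assms(1)] assms(2)]
    gauge_aut_one[OF character_one refl assms(2)] by simp

end

context sign_graph
begin

text \<open>The grading is itself a gauge automorphism, and pointwise products of characters
  commute.\<close>

lemma gauge_aut_parity:
  assumes \<chi>: "character \<chi>" and S: "S \<in> carrier K"
  shows "gauge_aut \<chi> (parity_grading P \<Lambda> S) = parity_grading P \<Lambda> (gauge_aut \<chi> S)"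
proof -
  define \<sigma> where "\<sigma> x = bit_sign (deg_parity P \<Lambda> x)" for x
  have \<sigma>: "character \<sigma>" unfolding \<sigma>_def by (rule character_sign[OF deg_parity_comp])
  have par: "parity_grading P \<Lambda> S = gauge_aut \<sigma> S" if "S \<in> carrier K" for S
    unfolding \<sigma>_def by (rule gen_grading_aut[OF deg_parity_comp that])
  show ?thesis
    using gauge_aut_comp[OF \<chi> \<sigma> character_mult[OF \<chi> \<sigma>] refl S]
      gauge_aut_comp[OF \<sigma> \<chi> character_mult[OF \<chi> \<sigma>] mult.commute S]
    by (simp add: par S star_homD(1)[OF gauge_aut_hom[OF \<chi>]])
qed

end

section \<open>The isomorphism\<close>

context sign_graph_pair
begin

definition \<theta> where "\<theta> f = proj C.X (free_value t f)"

lemma \<theta>_hom: "\<theta> \<in> star_hom LG.FA C.X"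
  unfolding \<theta>_def[abs_def] by (rule C.X.proj_free_value_hom)

lemma \<theta>_gen:
  assumes "x \<in> arr \<Lambda>" "y \<in> arr \<Gamma>"
  shows "\<theta> (free_gen (x, y)) = elem_tensor L.K G.K (L.gen x) (G.gen y)"
  using assms by (simp add: \<theta>_def t_def C.proj_tp L.sg_def G.sg_def L.gen_closed G.gen_closed)

lemma \<theta>_contractive: "f \<in> carrier LG.FA \<Longrightarrow> C.N (\<theta> f) \<le> LG.U f"
  unfolding \<theta>_def by (rule LG.universal_family[OF C.T.P.cstar_seminormed_axioms t_family])

lemma \<theta>_contractive_hom: "contractive_hom LG.FA LG.U C.X C.N \<theta>"
  by unfold_locales (rule \<theta>_hom, rule \<theta>_contractive)

sublocale M: contractive_hom LG.FA LG.U C.X C.N \<theta>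
  by (rule \<theta>_contractive_hom)

lemma gauge_equivariant:
  assumes "L.character \<chi>" "G.character \<chi>'"
  shows "C.equivariant (L.gauge_aut \<chi>) (G.gauge_aut \<chi>')"
  using assms by (simp add: C.equivariant_def L.gauge_aut_hom G.gauge_aut_hom L.gauge_aut_parity G.gauge_aut_parity)

text \<open>On the tensor side the product character acts as the tensor product of two gauge
  automorphisms, an instance of \<open>tmap\<close>; the conjugate characters supply the inverses
  that \<open>tmap_contractive\<close> asks for.\<close>

lemma \<theta>_gauge:
  assumes \<chi>: "L.character \<chi>" "G.character \<chi>'" and f: "f \<in> carrier LG.FA"
  shows "C.N (\<theta> (LG.gauge (\<lambda>(x, y). \<chi> x * \<chi>' y) f)) \<le> C.N (\<theta> f)"
proof -
  let ?\<tau> = "C.tmap (L.gauge_aut \<chi>) (G.gauge_aut \<chi>')"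
  note eqv = gauge_equivariant[OF \<chi>]
  have eq: "\<theta> (LG.gauge (\<lambda>(x, y). \<chi> x * \<chi>' y) f) = ?\<tau> (\<theta> f)"
  proof (rule C.X.free_hom_unique[OF star_hom_comp[OF LG.gauge_hom \<theta>_hom] star_hom_comp[OF \<theta>_hom C.tmap_hom[OF eqv]] _ f])
    fix z assume z: "z \<in> arr LG"
    obtain x y where xy: "z = (x, y)" by (cases z)
    have arr: "x \<in> arr \<Lambda>" "y \<in> arr \<Gamma>" using z by (simp_all add: xy prod_simps)
    have "\<theta> (LG.gauge (\<lambda>(x, y). \<chi> x * \<chi>' y) (free_gen z)) = vscale C.X (\<chi> x * \<chi>' y) (\<theta> (free_gen z))"
      using LG.gauge_gen[OF z] star_homD(3)[OF \<theta>_hom, of "free_gen z"] z by (simp add: xy del: C.X_simps)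
    also have "\<dots> = ?\<tau> (\<theta> (free_gen z))"
      using arr by (simp add: xy \<theta>_gen C.tmap_elem[OF eqv] L.gauge_aut_gen \<chi> G.gauge_aut_gen
          C.elem_tensor_linear(5,6) L.gen_closed G.gen_closed L.K.scale_closed mult_ac)
    finally show "\<theta> (LG.gauge (\<lambda>(x, y). \<chi> x * \<chi>' y) (free_gen z)) = ?\<tau> (\<theta> (free_gen z))" .
  qed
  show ?thesis unfolding eq
    by (rule C.tmap_contractive[OF eqv gauge_equivariant[OF L.character_cnj[OF \<chi>(1)] G.character_cnj[OF \<chi>(2)]]
          L.gauge_aut_inverse[OF \<chi>(1)] G.gauge_aut_inverse[OF \<chi>(2)] star_homD(1)[OF \<theta>_hom f]])
qed

interpretation E: normed_twisted_family PQ LG "sign_cocycle PQ LG" LG.sg "\<lambda>f. vnorm LG.K (proj LG.K f)"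
  by (rule LG.normed_sg)
interpretation L: normed_twisted_family P \<Lambda> "sign_cocycle P \<Lambda>" L.sg "\<lambda>f. vnorm L.K (proj L.K f)"
  by (rule L.normed_sg)
interpretation G: normed_twisted_family Q \<Gamma> "sign_cocycle Q \<Gamma>" G.sg "\<lambda>f. vnorm G.K (proj G.K f)"
  by (rule G.normed_sg)

text \<open>The norm of the tensor product pulled back to the *-ring in which the family
  \<open>LG.sg\<close> lives, since gauge-invariant uniqueness compares two seminorms on one
  ring.\<close>

definition q where "q f = vnorm C.T.K (M.\<Theta> (proj LG.K f))"

lemma q_seminorm: "cstar_seminormed q"
  unfolding q_def[abs_def]
  by (rule LG.K.seminormed_proj[OF cstar_seminorm_pullback[OF LG.K.star_algebra_axioms M.complete_hom_hom C.T.cstar_seminorm_K]])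

lemma q_value: "f \<in> carrier LG.FA \<Longrightarrow> q (free_value LG.sg f) = C.N (\<theta> f)"
  by (simp add: q_def LG.inc_free_value[symmetric] M.complete_hom_inc C.T.norm_inc star_homD(1)[OF \<theta>_hom])

lemma q_gauge:
  assumes \<chi>: "L.character \<chi>" "G.character \<chi>'" and F: "F \<subseteq> E.pairs"
    and \<psi>: "\<And>x y x' y'. ((x, y), (x', y')) \<in> E.pairs \<Longrightarrow> \<psi> ((x, y), (x', y')) = \<chi> x * \<chi>' y * cnj (\<chi> x' * \<chi>' y')"
  shows "q (E.lin (\<lambda>z. \<psi> z * k z) F) \<le> q (E.lin k F)"
proof -
  let ?f = "LG.free_lin k F"
  have F': "F \<subseteq> arr LG \<times> arr LG" using F by (auto simp: E.pairs_def)
  note f = LG.free_lin[OF F']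
  have "E.lin k F = free_value LG.sg ?f" by (simp add: f(2) E.lin_def)
  then have 1: "q (E.lin k F) = C.N (\<theta> ?f)" using q_value[OF f(1)] by simp
  have "E.lin (\<lambda>z. \<psi> z * k z) F = free_value (\<lambda>z. (case z of (x, y) \<Rightarrow> \<chi> x * \<chi>' y) *\<^sub>C LG.sg z) ?f"
    unfolding f(2) E.lin_def using F \<psi> by (intro sum.cong refl) (auto simp: mult_ac)
  also have "\<dots> = free_value LG.sg (LG.gauge (\<lambda>(x, y). \<chi> x * \<chi>' y) ?f)"
    by (rule LG.free_value_gauge[OF f(1), symmetric])
  finally have "q (E.lin (\<lambda>z. \<psi> z * k z) F) = C.N (\<theta> (LG.gauge (\<lambda>(x, y). \<chi> x * \<chi>' y) ?f))"
    using q_value[OF star_homD(1)[OF LG.gauge_hom f(1)]] by simp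
  then show ?thesis using \<theta>_gauge[OF \<chi> f(1)] 1 by simp
qed

text \<open>The images of the two free algebras are spanned by elements
  \<open>s x * star (s x')\<close>, and a tensor of two of these is, up to sign, the product of
  \<open>t (x, y)\<close> and \<open>star (t (x', y'))\<close>.\<close>

lemma \<theta>_span:
  assumes f: "f \<in> carrier L.FA" and g: "g \<in> carrier G.FA"
  obtains h where "h \<in> carrier LG.FA" "\<theta> h = elem_tensor L.K G.K (L.inc f) (G.inc g)"
proof -
  obtain k F where F: "free_value L.sg f = L.lin k F" "finite F" "F \<subseteq> L.pairs"
    using L.free_value_in_span[OF f] by (auto simp: L.span_def)
  obtain l H where H: "free_value G.sg g = G.lin l H" "finite H" "H \<subseteq> G.pairs"
    using G.free_value_in_span[OF g] by (auto simp: G.span_def)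
  \<comment> \<open>The sign is the one from \<open>t_mult_star\<close>; occurring twice, it
    cancels.\<close>
  define m where "m = (\<lambda>((x, y), (x', y')). bit_sign (deg_parity P \<Lambda> x' * deg_parity Q \<Gamma> y' + deg_parity P \<Lambda> x' * deg_parity Q \<Gamma> y)
     * (k (x, x') * l (y, y')))"
  define J where "J = (\<lambda>((x, x'), (y, y')). ((x, y), (x', y'))) ` (F \<times> H)"
  have J: "J \<subseteq> arr LG \<times> arr LG"
    using F(3) H(3) by (auto simp: J_def L.pairs_def G.pairs_def prod_simps)
  have inj: "inj_on (\<lambda>((x, x'), (y, y')). ((x, y), (x', y'))) (F \<times> H)" by (auto simp: inj_on_def)
  have "free_value t (LG.free_lin m J) = (\<Sum>(u, w)\<in>F \<times> H. (k u * l w) *\<^sub>C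
      C.tp (L.sg (fst u) * star (L.sg (snd u))) (G.sg (fst w) * star (G.sg (snd w))))"
    unfolding LG.free_lin(2)[OF J] unfolding J_def sum.reindex[OF inj]
  proof (intro sum.cong refl)
    fix z assume z: "z \<in> F \<times> H"
    obtain x x' y y' where xy: "z = ((x, x'), (y, y'))" by (metis surj_pair)
    have arr: "x \<in> arr \<Lambda>" "x' \<in> arr \<Lambda>" "y \<in> arr \<Gamma>" "y' \<in> arr \<Gamma>"
      using z F(3) H(3) by (auto simp: xy L.pairs_def G.pairs_def)
    show "((\<lambda>z. m z *\<^sub>C (t (fst z) * star (t (snd z)))) \<circ> (\<lambda>((x, x'), (y, y')). ((x, y), (x', y')))) z =
        (case z of (u, w) \<Rightarrow> (k u * l w) *\<^sub>C
          C.tp (L.sg (fst u) * star (L.sg (snd u))) (G.sg (fst w) * star (G.sg (snd w))))"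
      using arr by (simp add: xy m_def t_mult_star mult_ac)
  qed
  also have "\<dots> = (\<Sum>u\<in>F. \<Sum>w\<in>H. (k u * l w) *\<^sub>C
      C.tp (L.sg (fst u) * star (L.sg (snd u))) (G.sg (fst w) * star (G.sg (snd w))))"
    by (simp add: sum.cartesian_product)
  also have "\<dots> = C.tp (free_value L.sg f) (free_value G.sg g)"
    unfolding F(1) H(1) L.lin_def G.lin_def C.tp_sum(1) by (simp add: C.tp_sum(2) C.tp_linear scaleC_sum_right mult.commute)
  finally have "\<theta> (LG.free_lin m J) = elem_tensor L.K G.K (L.inc f) (G.inc g)"
    by (simp add: \<theta>_def C.proj_tp L.inc_free_value[OF f] G.inc_free_value[OF g])
  then show thesis by (rule that[OF LG.free_lin(1)[OF J]])
qed

lemma \<theta>_dense: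
  assumes "T \<in> carrier C.X" "e > 0"
  shows "\<exists>f\<in>carrier LG.FA. C.N (vminus C.X T (\<theta> f)) < e"
proof -
  obtain xs where xs: "T = C.tens xs" "set xs \<subseteq> C.quads" using assms(1) by (rule C.X_obtain)
  have "\<exists>f\<in>carrier LG.FA. C.N (vminus C.X (C.tens xs) (\<theta> f)) < e" using xs(2) assms(2)
  proof (induct xs arbitrary: e)
    case Nil
    have "\<theta> 0 = vzero C.X" using star_hom_zero[OF \<theta>_hom LG.star_algebra_axioms C.X.star_algebra_axioms] by simp
    moreover have "C.N (vminus C.X (vzero C.X) (vzero C.X)) = 0"
      using C.T.P.zero by (simp only: C.X.minus_self[OF C.X.zero_closed] C.X.proj_hom)
    ultimately show ?case using Nil by (intro bexI[of _ 0]) (simp_all add: C.tens_Nil)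
  next
    case (Cons x xs)
    obtain i a j b where x: "x = (i, a, j, b)" "a \<in> carrier L.K" "b \<in> carrier G.K"
      using Cons(2) by (auto simp: C.quads_def)
    have "e / 2 > 0" using Cons(3) by simp
    then obtain f where f: "f \<in> carrier LG.FA" "C.N (vminus C.X (C.tens xs) (\<theta> f)) < e / 2"
      using Cons(1)[of "e / 2"] Cons(2) by auto
    define A where "A = vnorm L.K a"
    define B where "B = vnorm G.K b"
    have AB: "A \<ge> 0" "B \<ge> 0"
      using L.KP.nonneg[of "emb L.K a"] G.KP.nonneg[of "emb G.K b"] x by (simp_all add: A_def B_def)
    \<comment> \<open>\<open>d \<le> 1\<close> bounds the norm of \<open>L.inc g\<close> by
      \<open>A + 1\<close>. With the factor \<open>4\<close> of \<open>min_norm_elem\<close> the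
      error is at most \<open>4 * (d * (A + B + 1))\<close>; the factor \<open>8\<close> brings it
      down to \<open>e / 2\<close>, and the \<open>2\<close> in the denominator makes the inequality
      strict.\<close>
    define d where "d = min 1 (e / (8 * (A + B + 2)))"
    have d: "0 < d" "d \<le> 1" "4 * (d * (A + B + 1)) < e / 2"
    proof -
      show "0 < d" "d \<le> 1" using AB Cons(3) by (simp_all add: d_def)
      have "d * (A + B + 1) < d * (A + B + 2)" using \<open>0 < d\<close> by simp
      also have "\<dots> \<le> e / (8 * (A + B + 2)) * (A + B + 2)" using AB by (intro mult_right_mono) (auto simp: d_def)
      also have "\<dots> = e / 8" using AB by (simp add: field_simps)
      finally show "4 * (d * (A + B + 1)) < e / 2" by simp
    qed
    obtain g where g: "g \<in> carrier L.FA" "vnorm L.K (vminus L.K a (L.inc g)) < d"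
      using L.dense[OF x(2) d(1)] by blast
    obtain h where h: "h \<in> carrier G.FA" "vnorm G.K (vminus G.K b (G.inc h)) < d"
      using G.dense[OF x(3) d(1)] by blast
    obtain f' where f': "f' \<in> carrier LG.FA" "\<theta> f' = elem_tensor L.K G.K (L.inc g) (G.inc h)"
      by (rule \<theta>_span[OF g(1) h(1)])
    note mem = x(2,3) L.inc_closed[OF g(1)] G.inc_closed[OF h(1)]
    have "vnorm L.K (L.inc g) \<le> A + d"
      using L.KP.triangle[of "emb L.K a" "emb L.K (L.inc g) - emb L.K a"] L.KP.diff_commute[of "emb L.K a" "emb L.K (L.inc g)"]
        mem g(2) by (simp add: A_def)
    then have Ag: "vnorm L.K (L.inc g) \<le> A + 1" using d by simp
    have "C.N (vminus C.X (C.tens [x]) (\<theta> f')) \<le> C.N (elem_tensor L.K G.K (vminus L.K a (L.inc g)) b)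
        + C.N (elem_tensor L.K G.K (L.inc g) (vminus G.K b (G.inc h)))"
    proof -
      have "vminus C.X (C.tens [x]) (\<theta> f') = vplus C.X (elem_tensor L.K G.K (vminus L.K a (L.inc g)) b)
          (elem_tensor L.K G.K (L.inc g) (vminus G.K b (G.inc h)))"
        using mem by (simp add: x(1) f'(2) C.elem_quad[symmetric] C.elem_tensor_linear vminus_def[of C.X] fun_eq_iff)
      then show ?thesis
        using C.T.seminorm_rules(1) mem by (simp add: C.elem_tensor_in_X L.K.closed G.K.closed del: C.X_simps)
    qed
    also have "\<dots> \<le> 4 * (vnorm L.K (vminus L.K a (L.inc g)) * B) + 4 * (vnorm L.K (L.inc g) * vnorm G.K (vminus G.K b (G.inc h)))"
      unfolding B_def using mem by (intro add_mono C.min_norm_elem) (simp_all add: L.K.closed G.K.closed)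
    also have "\<dots> \<le> 4 * (d * B) + 4 * ((A + 1) * d)"
      using g(2) h(2) AB d(1) Ag G.KP.nonneg[of "emb G.K b - emb G.K (G.inc h)"] mem
      by (intro add_mono mult_left_mono mult_mono) simp_all
    also have "\<dots> = 4 * (d * (A + B + 1))" by (simp add: algebra_simps)
    finally have 1: "C.N (vminus C.X (C.tens [x]) (\<theta> f')) < e / 2" using d(3) by simp
    have tx: "C.tens [x] \<in> carrier C.X" "C.tens xs \<in> carrier C.X" using Cons(2) by simp_all
    note \<theta>f = star_homD(1)[OF \<theta>_hom f(1)] star_homD(1)[OF \<theta>_hom f'(1)]
    have sum: "f' + f \<in> carrier LG.FA" "\<theta> (f' + f) = vplus C.X (\<theta> f') (\<theta> f)"
      using free.plus_closed[OF f'(1) f(1)] star_homD(2)[OF \<theta>_hom f'(1) f(1)] by (simp_all del: C.X_simps)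
    have "vminus C.X (C.tens (x # xs)) (\<theta> (f' + f)) =
        vplus C.X (vminus C.X (C.tens [x]) (\<theta> f')) (vminus C.X (C.tens xs) (\<theta> f))"
      using C.tens_Cons[of x xs] by (simp add: sum(2) vminus_def fun_eq_iff)
    then have "C.N (vminus C.X (C.tens (x # xs)) (\<theta> (f' + f))) \<le>
        C.N (vminus C.X (C.tens [x]) (\<theta> f')) + C.N (vminus C.X (C.tens xs) (\<theta> f))"
      using C.T.seminorm_rules(1)[OF C.X.minus_closed[OF tx(1) \<theta>f(2)] C.X.minus_closed[OF tx(2) \<theta>f(1)]] by simp
    then show ?case using 1 f(2) sum(1) by (intro bexI[of _ "f' + f"]) simp_all
  qed
  then show ?thesis by (simp add: xs(1))
qed

end

section \<open>Coordinates of degrees and the isometry\<close>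

locale gauge_graph = path_graph P \<Lambda> e
  for P :: "('p, 'm) degree_monoid_scheme" and \<Lambda> :: "('a, 'p) deg_category" and e +
  fixes hs :: "(('p \<Rightarrow> int) \<times> nat) list"
  assumes coordinate_hom: "\<lbrakk>(h, m) \<in> set hs; p \<in> carrier P; q \<in> carrier P\<rbrakk> \<Longrightarrow>
      [h (p \<otimes>\<^bsub>P\<^esub> q) = h p + h q] (mod int m)"
    and coordinate_separating: "\<lbrakk>p \<in> carrier P; q \<in> carrier P; \<forall>(h, m)\<in>set hs. [h p = h q] (mod int m)\<rbrakk> \<Longrightarrow> p = q"
begin

lemma coordinate_character:
  assumes hm: "(h, m) \<in> set hs" and \<omega>: "cmod \<omega> = 1" "m \<noteq> 0 \<Longrightarrow> \<omega> ^ m = 1"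
  shows "character (\<lambda>x. \<omega> powi h (degr \<Lambda> x))"
  unfolding character_def
proof (intro conjI ballI impI)
  show "cmod (\<omega> powi h (degr \<Lambda> x)) = 1" for x by (simp add: norm_power_int \<omega>(1))
  fix x y assume xy: "x \<in> arr \<Lambda>" "y \<in> arr \<Lambda>" "src \<Lambda> x = rng \<Lambda> y"
  have nz: "\<omega> \<noteq> 0" using \<omega>(1) by auto
  have "int m dvd h (degr \<Lambda> (cmp \<Lambda> x y)) - (h (degr \<Lambda> x) + h (degr \<Lambda> y))"
    using coordinate_hom[OF hm deg_closed[OF xy(1)] deg_closed[OF xy(2)]] xy
    by (simp add: deg_comp cong_iff_dvd_diff)
  then obtain r where r: "h (degr \<Lambda> (cmp \<Lambda> x y)) = h (degr \<Lambda> x) + h (degr \<Lambda> y) + int m * r"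
    by (metis add_diff_cancel_left' diff_add_cancel dvdE add.commute)
  have "\<omega> powi (int m * r) = 1" using \<omega>(2) by (cases "m = 0") (simp_all add: power_int_mult)
  then show "\<omega> powi h (degr \<Lambda> (cmp \<Lambda> x y)) = \<omega> powi h (degr \<Lambda> x) * \<omega> powi h (degr \<Lambda> y)"
    using nz by (simp add: r power_int_add)
qed

end

lemma cnj_powi: "cmod \<omega> = 1 \<Longrightarrow> cnj (\<omega> powi n) = \<omega> powi (- n)"
proof -
  assume \<omega>: "cmod \<omega> = 1"
  then have "inverse \<omega> = cnj \<omega>" using complex_norm_square[of \<omega>] by (intro inverse_unique) simp
  then show ?thesis by (simp add: power_int_minus flip: power_int_inverse)
qed

locale gauge_pair = L: gauge_graph P \<Lambda> e hs + G: gauge_graph Q \<Gamma> e' hs'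
  for P :: "('p, 'm) degree_monoid_scheme" and \<Lambda> :: "('a, 'p) deg_category" and e hs
    and Q :: "('q, 'n) degree_monoid_scheme" and \<Gamma> :: "('b, 'q) deg_category" and e' hs'
begin

sublocale sign_graph_pair P \<Lambda> Q \<Gamma> ..

interpretation E: normed_twisted_family PQ LG "sign_cocycle PQ LG" LG.sg "\<lambda>f. vnorm LG.K (proj LG.K f)"
  by (rule LG.normed_sg)

definition coordinates :: "(('a \<times> 'b \<Rightarrow> int) \<times> nat) list" where
  "coordinates = map (\<lambda>(h, m). (\<lambda>z. h (degr \<Lambda> (fst z)), m)) hs @ map (\<lambda>(h, m). (\<lambda>z. h (degr \<Gamma> (snd z)), m)) hs'"

lemma coordinates_cases:
  assumes "c \<in> set coordinates"
  obtains h m where "(h, m) \<in> set hs" "c = (\<lambda>z. h (degr \<Lambda> (fst z)), m)"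
  | h m where "(h, m) \<in> set hs'" "c = (\<lambda>z. h (degr \<Gamma> (snd z)), m)"
  using assms unfolding coordinates_def by auto

text \<open>A coordinate of one factor is gauged by a character of that factor and the trivial
  character on the other, so \<open>q_gauge\<close> covers all coordinates of the product.\<close>

lemma coordinates: "\<forall>c\<in>set coordinates. E.coordinate c \<and> E.gauge_invariant q c"
proof
  fix c assume "c \<in> set coordinates"
  then show "E.coordinate c \<and> E.gauge_invariant q c"
  proof (cases rule: coordinates_cases)
    case (1 h m)
    have "q (E.lin (\<lambda>z. \<omega> powi (h (degr \<Lambda> (fst (fst z))) - h (degr \<Lambda> (fst (snd z)))) * k z) F) \<le> q (E.lin k F)"
      if \<omega>: "cmod \<omega> = 1" "m \<noteq> 0 \<longrightarrow> \<omega> ^ m = 1" and F: "F \<subseteq> E.pairs" for \<omega> k F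
    proof (rule q_gauge[OF L.coordinate_character[OF 1(1) \<omega>(1)] G.character_one F])
      have "\<omega> \<noteq> 0" using \<omega>(1) by auto
      then show "\<omega> powi (h (degr \<Lambda> (fst (fst ((x, y), x', y')))) - h (degr \<Lambda> (fst (snd ((x, y), x', y'))))) =
          \<omega> powi h (degr \<Lambda> x) * 1 * cnj (\<omega> powi h (degr \<Lambda> x') * 1)" for x :: 'a and y :: 'b and x' y'
        by (simp add: cnj_powi[OF \<omega>(1)] power_int_diff power_int_minus divide_inverse del: complex_cnj_power_int)
    qed (use \<omega> in simp)
    then show ?thesis
      using L.coordinate_hom[OF 1(1)]
      by (auto simp: 1(2) E.coordinate_def E.gauge_invariant_def prod_simps L.deg_comp L.deg_closed)
  next
    case (2 h m)
    have "q (E.lin (\<lambda>z. \<omega> powi (h (degr \<Gamma> (snd (fst z))) - h (degr \<Gamma> (snd (snd z)))) * k z) F) \<le> q (E.lin k F)"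
      if \<omega>: "cmod \<omega> = 1" "m \<noteq> 0 \<longrightarrow> \<omega> ^ m = 1" and F: "F \<subseteq> E.pairs" for \<omega> k F
    proof (rule q_gauge[OF L.character_one G.coordinate_character[OF 2(1) \<omega>(1)] F])
      have "\<omega> \<noteq> 0" using \<omega>(1) by auto
      then show "\<omega> powi (h (degr \<Gamma> (snd (fst ((x, y), x', y')))) - h (degr \<Gamma> (snd (snd ((x, y), x', y'))))) =
          1 * \<omega> powi h (degr \<Gamma> y) * cnj (1 * \<omega> powi h (degr \<Gamma> y'))" for x :: 'a and y :: 'b and x' :: 'a and y'
        by (simp add: cnj_powi[OF \<omega>(1)] power_int_diff power_int_minus divide_inverse del: complex_cnj_power_int)
    qed (use \<omega> in simp)
    then show ?thesis
      using G.coordinate_hom[OF 2(1)]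
      by (auto simp: 2(2) E.coordinate_def E.gauge_invariant_def prod_simps G.deg_comp G.deg_closed)
  qed
qed

lemma coordinates_separating:
  assumes "z \<in> arr LG" "z' \<in> arr LG" "\<forall>(h, m)\<in>set coordinates. [h z = h z'] (mod int m)"
  shows "degr LG z = degr LG z'"
proof -
  obtain x y x' y' where z: "z = (x, y)" "z' = (x', y')" by (metis surj_pair)
  have "degr \<Lambda> x = degr \<Lambda> x'"
  proof (rule L.coordinate_separating)
    have "[h (degr \<Lambda> x) = h (degr \<Lambda> x')] (mod int m)" if "(h, m) \<in> set hs" for h m
      using bspec[OF assms(3), of "(\<lambda>z. h (degr \<Lambda> (fst z)), m)"] that by (force simp: z coordinates_def)
    then show "\<forall>(h, m)\<in>set hs. [h (degr \<Lambda> x) = h (degr \<Lambda> x')] (mod int m)" by blast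
  qed (use assms in \<open>simp_all add: z prod_simps L.deg_closed\<close>)
  moreover have "degr \<Gamma> y = degr \<Gamma> y'"
  proof (rule G.coordinate_separating)
    have "[h (degr \<Gamma> y) = h (degr \<Gamma> y')] (mod int m)" if "(h, m) \<in> set hs'" for h m
      using bspec[OF assms(3), of "(\<lambda>z. h (degr \<Gamma> (snd z)), m)"] that by (force simp: z coordinates_def)
    then show "\<forall>(h, m)\<in>set hs'. [h (degr \<Gamma> y) = h (degr \<Gamma> y')] (mod int m)" by blast
  qed (use assms in \<open>simp_all add: z prod_simps G.deg_closed\<close>)
  ultimately show ?thesis by (simp add: z prod_simps)
qed

text \<open>\<open>t z\<close> is a projection at which the product of the two even functionals has
  the value \<open>1\<close>. So \<open>t z\<close>, as a vector, has norm \<open>1\<close> and is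
  fixed by left multiplication by \<open>t z\<close>, which bounds the operator norm from
  below.\<close>

lemma vertex_nonzero:
  assumes z: "z \<in> vertices PQ LG"
  shows "1 \<le> C.N (\<theta> (free_gen z))"
proof -
  obtain v w where vw: "z = (v, w)" "v \<in> vertices P \<Lambda>" "w \<in> vertices Q \<Gamma>" using z by (auto simp: prod_level)
  obtain \<phi> where \<phi>: "C.even_A \<phi>" "\<phi> (L.gen v) = 1" by (rule L.state_exists[OF vw(2)])
  obtain \<psi> where \<psi>: "C.even_B \<psi>" "\<psi> (G.gen w) = 1" by (rule G.state_exists[OF vw(3)])
  define \<omega> where "\<omega> = C.\<omega> \<phi> \<psi>"
  have \<omega>: "\<omega> \<in> C.\<Omega>" using \<phi> \<psi> by (auto simp: \<omega>_def C.\<Omega>_def)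
  interpret t: twisted_family PQ LG "sign_cocycle PQ LG" t by (rule t_family)
  have arr: "v \<in> arr \<Lambda>" "w \<in> arr \<Gamma>" using vw L.vertices_arr G.vertices_arr by auto
  have \<theta>: "\<theta> (free_gen z) \<in> carrier C.X" using star_homD(1)[OF \<theta>_hom, of "free_gen z"] LG.vertices_arr[OF z] by simp
  have "emb C.X (\<theta> (free_gen z)) = t z"
    using arr by (simp add: vw \<theta>_gen) (simp add: t_def C.tp_def L.sg_def G.sg_def L.gen_closed G.gen_closed)
  then have gns: "C.N (\<theta> (free_gen z)) = C.G.gns (t z)" using C.min_norm_gns[OF \<theta>] by simp
  have "\<omega> (t z) = 1"
    using arr \<phi> \<psi> C.BF_product[OF \<phi>(1) \<psi>(1)]
    by (simp add: \<omega>_def C.\<omega>_def vw t_def C.proj_tp L.sg_def G.sg_def L.gen_closed G.gen_closed elem_tensor_def)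
  then have "sqrt (Re (\<omega> (star (t z) * t z))) = 1" by (simp add: t.star_vertex t.vertex_idem z)
  then show ?thesis using C.G.nrm_le_gns[OF \<omega>, of "t z" "t z"] by (simp add: gns t.vertex_idem z)
qed

text \<open>At vertices the comparison demanded by uniqueness goes through the value
  \<open>1\<close>: the universal norm is at most \<open>1\<close> by \<open>norm_vertex\<close>,
  and the tensor norm at least \<open>1\<close> by \<open>vertex_nonzero\<close>.\<close>

lemma \<theta>_isometric:
  assumes f: "f \<in> carrier LG.FA"
  shows "C.N (\<theta> f) = LG.U f"
proof (rule antisym)
  show "C.N (\<theta> f) \<le> LG.U f" by (rule \<theta>_contractive[OF f])
  have "vnorm LG.K (proj LG.K (free_value LG.sg f)) \<le> q (free_value LG.sg f)"
  proof (rule E.gauge_invariant_uniqueness[OF q_seminorm _ coordinates coordinates_separating E.free_value_in_span[OF f]])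
    fix v assume v: "v \<in> vertices PQ LG"
    have "q (LG.sg v) = C.N (\<theta> (free_gen v))"
      using q_value[of "free_gen v"] LG.vertices_arr[OF v] by simp
    then show "vnorm LG.K (proj LG.K (LG.sg v)) \<le> q (LG.sg v)"
      using E.norm_vertex[OF v] vertex_nonzero[OF v] by simp
  qed
  then show "LG.U f \<le> C.N (\<theta> f)"
    using LG.norm_inc[OF f] LG.inc_free_value[OF f] q_value[OF f] by simp
qed

lemma graded_isomorphism:
  "graded_cstar_isomorphic (sign_cstar PQ LG) (parity_grading PQ LG)
     (gtensor (sign_cstar P \<Lambda>) (parity_grading P \<Lambda>) (sign_cstar Q \<Gamma>) (parity_grading Q \<Gamma>))
     (gtensor_grading (sign_cstar P \<Lambda>) (parity_grading P \<Lambda>) (sign_cstar Q \<Gamma>) (parity_grading Q \<Gamma>))"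
  unfolding graded_cstar_isomorphic_def L.twisted_cstar_eq G.twisted_cstar_eq LG.twisted_cstar_eq
proof (intro conjI bexI ballI)
  show "cstar_algebra LG.K" by (rule LG.cstar_algebra_K)
  show "grading LG.K (parity_grading PQ LG)" by (rule LG.parity_grading)
  show "cstar_algebra C.D" by (rule C.cstar_algebra_D)
  note D = C.gtensor_grading
  show "grading C.D (gtensor_grading L.K (parity_grading P \<Lambda>) G.K (parity_grading Q \<Gamma>))" by (rule D)
  show "M.\<Theta> \<in> star_iso LG.K C.D"
    unfolding C.D_eq by (rule M.complete_hom_iso[OF \<theta>_isometric \<theta>_dense])
  have hom: "M.\<Theta> \<in> star_hom LG.K C.D" using M.complete_hom_hom by (simp add: C.D_eq)
  fix S assume S: "S \<in> carrier LG.K"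
  show "M.\<Theta> (parity_grading PQ LG S) =
      gtensor_grading L.K (parity_grading P \<Lambda>) G.K (parity_grading Q \<Gamma>) (M.\<Theta> S)"
  \<comment> \<open>Both sides are homomorphisms, so they are compared at generators, where the
    parity is the sum of the parities in the two factors.\<close>
  proof (rule LG.hom_gen_eqI[OF star_hom_comp[OF grading_star_hom[OF LG.parity_grading(1)] hom]
        star_hom_comp[OF hom grading_star_hom[OF D(1)]] C.cstar_algebra_D _ S])
    fix z assume z: "z \<in> arr LG"
    obtain x y where xy: "z = (x, y)" by (cases z)
    have arr: "x \<in> arr \<Lambda>" "y \<in> arr \<Gamma>" using z by (simp_all add: xy prod_simps)
    note gen = L.gen_closed[OF arr(1)] G.gen_closed[OF arr(2)]
    have \<Theta>: "M.\<Theta> (LG.gen z) = C.telem (L.gen x) (G.gen y)"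
      using z arr by (simp add: LG.gen_eq M.complete_hom_inc xy \<theta>_gen C.telem_eq)
    have "M.\<Theta> (parity_grading PQ LG (LG.gen z)) =
        vscale C.D (bit_sign (deg_parity P \<Lambda> x + deg_parity Q \<Gamma> y)) (C.telem (L.gen x) (G.gen y))"
      using z star_homD(3)[OF hom LG.gen_closed[OF z]]
      by (simp add: LG.parity_grading \<Theta>[symmetric]) (simp add: xy prod_parity)
    also have "\<dots> = C.telem (vscale L.K (bit_sign (deg_parity P \<Lambda> x)) (L.gen x))
        (vscale G.K (bit_sign (deg_parity Q \<Gamma> y)) (G.gen y))"
    proof -
      have "elem_tensor L.K G.K (vscale L.K (bit_sign (deg_parity P \<Lambda> x)) (L.gen x))
          (vscale G.K (bit_sign (deg_parity Q \<Gamma> y)) (G.gen y)) =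
        vscale C.X (bit_sign (deg_parity P \<Lambda> x + deg_parity Q \<Gamma> y)) (elem_tensor L.K G.K (L.gen x) (G.gen y))"
        using gen by (simp add: C.elem_tensor_linear(5,6) L.K.scale_closed bit_sign_add mult_ac)
      then show ?thesis
        using C.T.inc_hom(4)[OF C.elem_tensor_in_X[OF gen]] by (simp add: C.telem_eq C.D_eq)
    qed
    also have "\<dots> = gtensor_grading L.K (parity_grading P \<Lambda>) G.K (parity_grading Q \<Gamma>) (M.\<Theta> (LG.gen z))"
      using D(2)[OF gen] arr by (simp add: \<Theta> L.parity_grading(2) G.parity_grading(2))
    finally show "M.\<Theta> (parity_grading PQ LG (LG.gen z)) =
        gtensor_grading L.K (parity_grading P \<Lambda>) G.K (parity_grading Q \<Gamma>) (M.\<Theta> (LG.gen z))" .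
  qed
qed

end

text \<open>A coordinate in \<open>\<nat>\<close> has modulus \<open>0\<close> and is gauged by the
  whole circle. One in \<open>\<int>\<^sub>2\<close> has modulus \<open>2\<close>, is lifted to the
  integers \<open>0\<close> and \<open>1\<close>, and is gauged by signs only.\<close>

lemma gauge_graph_NZ:
  assumes "P_graph (NZ k a) \<Lambda>" "row_finite (NZ k a) \<Lambda>" "no_sources (NZ k a) \<Lambda>"
  shows "gauge_graph (NZ k a) \<Lambda> (\<lambda>i. if i < k then 1 else 0, \<lambda>_. 0)
     (map (\<lambda>i. (\<lambda>p. int (fst p i), 0)) [0..<k] @ map (\<lambda>i. (\<lambda>p. if snd p i = 0 then 0 else 1, 2)) [0..<a])"
proof -
  interpret path_graph "NZ k a" \<Lambda> "(\<lambda>i. if i < k then 1 else 0, \<lambda>_. 0)" by (rule path_graph_NZ) fact+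
  show ?thesis
  proof
    fix h :: "(nat \<Rightarrow> nat) \<times> (nat \<Rightarrow> bit) \<Rightarrow> int" and m and p q :: "(nat \<Rightarrow> nat) \<times> (nat \<Rightarrow> bit)"
    obtain u x v y where pq: "p = (u, x)" "q = (v, y)" by (metis surj_pair)
    have bit: "[if x i + y i = 0 then 0 else 1 = (if x i = 0 then 0 else 1) + (if y i = 0 then 0 else 1 :: int)] (mod 2)" for i
      using bit_cases[of "x i"] bit_cases[of "y i"] by (auto simp: cong_def)
    show "[h (p \<otimes>\<^bsub>NZ k a\<^esub> q) = h p + h q] (mod int m)"
      if "(h, m) \<in> set (map (\<lambda>i. (\<lambda>p. int (fst p i), 0)) [0..<k] @ map (\<lambda>i. (\<lambda>p. if snd p i = 0 then 0 else 1, 2)) [0..<a])"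
      using that bit by (auto simp: pq NZ_simps)
    assume carrier: "p \<in> carrier (NZ k a)" "q \<in> carrier (NZ k a)"
      and eq: "\<forall>(h, m)\<in>set (map (\<lambda>i. (\<lambda>p. int (fst p i), 0)) [0..<k] @ map (\<lambda>i. (\<lambda>p. if snd p i = 0 then 0 else 1, 2)) [0..<a]).
        [h p = h q] (mod int m)"
    have "u i = v i" for i
    proof (cases "i < k")
      case True
      then have "[int (u i) = int (v i)] (mod int 0)"
        using bspec[OF eq, of "(\<lambda>p. int (fst p i), 0)"] by (force simp: pq)
      then show ?thesis by simp
    qed (use carrier in \<open>simp add: pq NZ_simps\<close>)
    moreover have "x i = y i" for i
    proof (cases "i < a")
      case True
      then have "[if x i = 0 then 0 else 1 = (if y i = 0 then 0 else 1 :: int)] (mod 2)"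
        using bspec[OF eq, of "(\<lambda>p. if snd p i = 0 then 0 else 1, 2)"] by (force simp: pq)
      then show ?thesis using bit_cases[of "x i"] bit_cases[of "y i"] by (auto simp: cong_def)
    qed (use carrier in \<open>simp add: pq NZ_simps\<close>)
    ultimately show "p = q" by (simp add: pq fun_eq_iff)
  qed
qed

theorem theorem7p1:
  fixes k a l b :: nat
    and \<Lambda> :: "('x, (nat \<Rightarrow> nat) \<times> (nat \<Rightarrow> bit)) deg_category"
    and \<Gamma> :: "('y, (nat \<Rightarrow> nat) \<times> (nat \<Rightarrow> bit)) deg_category"
  assumes "P = NZ k a" and "Q = NZ l b"
    and "P_graph P \<Lambda>" and "row_finite P \<Lambda>" and "no_sources P \<Lambda>"
    and "P_graph Q \<Gamma>" and "row_finite Q \<Gamma>" and "no_sources Q \<Gamma>"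
  shows "graded_cstar_isomorphic
    (sign_cstar (prod_degree P Q) (prod_graph \<Lambda> \<Gamma>))
    (parity_grading (prod_degree P Q) (prod_graph \<Lambda> \<Gamma>))
    (gtensor (sign_cstar P \<Lambda>) (parity_grading P \<Lambda>) (sign_cstar Q \<Gamma>) (parity_grading Q \<Gamma>))
    (gtensor_grading (sign_cstar P \<Lambda>) (parity_grading P \<Lambda>) (sign_cstar Q \<Gamma>) (parity_grading Q \<Gamma>))"
  using assms gauge_pair.graded_isomorphism[OF gauge_pair.intro[OF gauge_graph_NZ gauge_graph_NZ]]
  by blast

end
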